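(* Let $k$ be a field, $n\ge2$, and let $\Lambda$ be the exterior algebra over $k$ on $n$ generators. Then for all $m\ge0$, $$\dim_k HH^m(\Lambda)=\begin{cases}2^n\binom{n+m-1}{n-1},&\text{if }\operatorname{char}k=2;\\ 2^{n-1}+1,&\text{if }m=0,\ n\text{ is odd and }\operatorname{char}k\ne2;\\ 2^{n-1}\binom{n+m-1}{n-1},&\text{otherwise.}\end{cases}$$
   Context: The exterior algebra is the ungraded associative $k$-algebra $\Lambda=k\langle x_1,\dots,x_n\rangle/(x_i^2\ (1\le i\le n),\ x_ix_j+x_jx_i\ (1\le i<j\le n))$. Hochschild cohomology is the usual (ungraded, no super signs) one: $HH^m(\Lambda)=\operatorname{Ext}^m_{\Lambda^e}(\Lambda,\Lambda)$ with $\Lambda^e=\Lambda\otimes_k\Lambda^{op}$. *)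

theory Defs
  imports
    "Jordan_Normal_Form.Missing_VectorSpace"
    "HOL-Algebra.Algebra"
begin

section \<open>Algebras\<close>

text \<open>
  A \<open>k\<close>-algebra, not necessarily commutative, is a record of type \<^typ>\<open>('k, 'a) module\<close>: its ring
  fields give the ring and \<^const>\<open>smult\<close> gives the action of \<open>k\<close>.
\<close>

text \<open>The library's \<^term>\<open>group.ord\<close> is \<open>0\<close> on elements of infinite order.\<close>

definition characteristic :: "('k, 'z) ring_scheme \<Rightarrow> nat"
  where "characteristic k = group.ord (add_monoid k) \<one>\<^bsub>k\<^esub>"

text \<open>Functions of finite support on the monoid \<open>M\<close>, with the convolution product.\<close>

definition monoid_algebra ::
    "('k, 'z) ring_scheme \<Rightarrow> ('w, 'y) monoid_scheme \<Rightarrow> ('k, 'w \<Rightarrow> 'k) module"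
  where "monoid_algebra k M =
    \<lparr>carrier = {f. range f \<subseteq> carrier k \<and> finite {w. f w \<noteq> \<zero>\<^bsub>k\<^esub>} \<and> {w. f w \<noteq> \<zero>\<^bsub>k\<^esub>} \<subseteq> carrier M},
     monoid.mult = (\<lambda>f g w. \<Oplus>\<^bsub>k\<^esub>p\<in>{(u, v). f u \<noteq> \<zero>\<^bsub>k\<^esub> \<and> g v \<noteq> \<zero>\<^bsub>k\<^esub> \<and> u \<otimes>\<^bsub>M\<^esub> v = w}. f (fst p) \<otimes>\<^bsub>k\<^esub> g (snd p)),
     monoid.one = (\<lambda>w. if w = \<one>\<^bsub>M\<^esub> then \<one>\<^bsub>k\<^esub> else \<zero>\<^bsub>k\<^esub>),
     ring.zero = (\<lambda>_. \<zero>\<^bsub>k\<^esub>),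
     ring.add = (\<lambda>f g w. f w \<oplus>\<^bsub>k\<^esub> g w),
     smult = (\<lambda>c f w. c \<otimes>\<^bsub>k\<^esub> f w)\<rparr>"

definition basis_elt :: "('k, 'z) ring_scheme \<Rightarrow> 'w \<Rightarrow> 'w \<Rightarrow> 'k"
  where "basis_elt k u = (\<lambda>w. if w = u then \<one>\<^bsub>k\<^esub> else \<zero>\<^bsub>k\<^esub>)"

text \<open>
  The ring \<^term>\<open>A Quot I\<close> together with the induced scalar multiplication. The same construction
  is used for the quotient of a module by a submodule; there \<^const>\<open>monoid.mult\<close> and \<^const>\<open>monoid.one\<close>
  are meaningless.
\<close>

definition quotient :: "('s, 'a) module \<Rightarrow> 'a set \<Rightarrow> ('s, 'a set) module"
  where "quotient A I =
    \<lparr>carrier = carrier (A Quot I), monoid.mult = monoid.mult (A Quot I), monoid.one = monoid.one (A Quot I),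
     ring.zero = ring.zero (A Quot I), ring.add = ring.add (A Quot I),
     smult = (\<lambda>c C. \<Union>x\<in>C. I +>\<^bsub>A\<^esub> (c \<odot>\<^bsub>A\<^esub> x))\<rparr>"

definition word_monoid :: "'x set \<Rightarrow> 'x list monoid"
  where "word_monoid S = \<lparr>carrier = lists S, monoid.mult = (@), monoid.one = []\<rparr>"

definition free_algebra :: "('k, 'z) ring_scheme \<Rightarrow> nat \<Rightarrow> ('k, nat list \<Rightarrow> 'k) module"
  where "free_algebra k n = monoid_algebra k (word_monoid {1..n})"

definition exterior_relations :: "('k, 'z) ring_scheme \<Rightarrow> nat \<Rightarrow> (nat list \<Rightarrow> 'k) set"
  where "exterior_relations k n =
    (let F = free_algebra k n; x = (\<lambda>i. basis_elt k [i]) in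
      {x i \<otimes>\<^bsub>F\<^esub> x i | i. 1 \<le> i \<and> i \<le> n} \<union>
      {x i \<otimes>\<^bsub>F\<^esub> x j \<oplus>\<^bsub>F\<^esub> x j \<otimes>\<^bsub>F\<^esub> x i | i j. 1 \<le> i \<and> i < j \<and> j \<le> n})"

definition exterior_algebra :: "('k, 'z) ring_scheme \<Rightarrow> nat \<Rightarrow> ('k, (nat list \<Rightarrow> 'k) set) module"
  where "exterior_algebra k n =
    quotient (free_algebra k n) (Idl\<^bsub>free_algebra k n\<^esub> (exterior_relations k n))"

definition opposite :: "('k, 'a) module \<Rightarrow> ('k, 'a) module"
  where "opposite A = A\<lparr>monoid.mult := (\<lambda>x y. y \<otimes>\<^bsub>A\<^esub> x)\<rparr>"

text \<open>
  \<open>A \<otimes>\<^sub>k B\<close> is the free \<open>k\<close>-module on \<open>A \<times> B\<close> modulo the span of the bilinearity relations.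
  With the product inherited from \<open>A \<times> B\<close> the free module is a monoid algebra. A pure tensor times
  a relation is again a relation, so the span equals the two-sided ideal used below.
\<close>

definition bilinear_relations ::
    "('k, 'z) ring_scheme \<Rightarrow> ('k, 'a) module \<Rightarrow> ('k, 'b) module \<Rightarrow> ('a \<times> 'b \<Rightarrow> 'k) set"
  where "bilinear_relations k A B =
    (let F = monoid_algebra k (A \<times>\<times> B); e = (\<lambda>a b. basis_elt k (a, b)) in
      {e (a \<oplus>\<^bsub>A\<^esub> a') b \<ominus>\<^bsub>F\<^esub> (e a b \<oplus>\<^bsub>F\<^esub> e a' b) | a a' b.
         a \<in> carrier A \<and> a' \<in> carrier A \<and> b \<in> carrier B} \<union>
      {e a (b \<oplus>\<^bsub>B\<^esub> b') \<ominus>\<^bsub>F\<^esub> (e a b \<oplus>\<^bsub>F\<^esub> e a b') | a b b'.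
         a \<in> carrier A \<and> b \<in> carrier B \<and> b' \<in> carrier B} \<union>
      {e (c \<odot>\<^bsub>A\<^esub> a) b \<ominus>\<^bsub>F\<^esub> c \<odot>\<^bsub>F\<^esub> e a b | c a b.
         c \<in> carrier k \<and> a \<in> carrier A \<and> b \<in> carrier B} \<union>
      {e a (c \<odot>\<^bsub>B\<^esub> b) \<ominus>\<^bsub>F\<^esub> c \<odot>\<^bsub>F\<^esub> e a b | c a b.
         c \<in> carrier k \<and> a \<in> carrier A \<and> b \<in> carrier B})"

definition tensor_algebra ::
    "('k, 'z) ring_scheme \<Rightarrow> ('k, 'a) module \<Rightarrow> ('k, 'b) module \<Rightarrow> ('k, ('a \<times> 'b \<Rightarrow> 'k) set) module"
  where "tensor_algebra k A B =
    (let F = monoid_algebra k (A \<times>\<times> B) in quotient F (Idl\<^bsub>F\<^esub> (bilinear_relations k A B)))"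

definition enveloping_algebra ::
    "('k, 'z) ring_scheme \<Rightarrow> ('k, 'a) module \<Rightarrow> ('k, ('a \<times> 'a \<Rightarrow> 'k) set) module"
  where "enveloping_algebra k A = tensor_algebra k A (opposite A)"

text \<open>
  \<open>A\<close> as a left module over its enveloping algebra, \<open>(a \<otimes> b) x = a x b\<close>. An element of the
  enveloping algebra is a coset \<open>T\<close>, all of whose representatives \<open>f\<close> act on \<open>x\<close> in the same way.
\<close>

definition regular_bimodule ::
    "('k, 'z) ring_scheme \<Rightarrow> ('k, 'a) module \<Rightarrow> (('a \<times> 'a \<Rightarrow> 'k) set, 'a) module"
  where "regular_bimodule k A =
    \<lparr>carrier = carrier A, monoid.mult = monoid.mult A, monoid.one = monoid.one A, ring.zero = ring.zero A, ring.add = ring.add A,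
     smult = (\<lambda>T x. the_elem ((\<lambda>f. \<Oplus>\<^bsub>A\<^esub>p\<in>{p. f p \<noteq> \<zero>\<^bsub>k\<^esub>}. f p \<odot>\<^bsub>A\<^esub> (fst p \<otimes>\<^bsub>A\<^esub> x \<otimes>\<^bsub>A\<^esub> snd p)) ` T))\<rparr>"


section \<open>Modules over noncommutative rings and Ext\<close>

text \<open>The library locale \<^locale>\<open>module\<close> requires the ring of scalars to be commutative.\<close>

locale left_module = R?: ring R + M?: abelian_group M
    for R :: "('r, 'z) ring_scheme" (structure) and M :: "('r, 'm, 'y) module_scheme" (structure) +
  assumes smult_closed: "\<lbrakk>a \<in> carrier R; x \<in> carrier M\<rbrakk> \<Longrightarrow> a \<odot>\<^bsub>M\<^esub> x \<in> carrier M"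
    and smult_l_distr: "\<lbrakk>a \<in> carrier R; b \<in> carrier R; x \<in> carrier M\<rbrakk> \<Longrightarrow>
      (a \<oplus>\<^bsub>R\<^esub> b) \<odot>\<^bsub>M\<^esub> x = a \<odot>\<^bsub>M\<^esub> x \<oplus>\<^bsub>M\<^esub> b \<odot>\<^bsub>M\<^esub> x"
    and smult_r_distr: "\<lbrakk>a \<in> carrier R; x \<in> carrier M; y \<in> carrier M\<rbrakk> \<Longrightarrow>
      a \<odot>\<^bsub>M\<^esub> (x \<oplus>\<^bsub>M\<^esub> y) = a \<odot>\<^bsub>M\<^esub> x \<oplus>\<^bsub>M\<^esub> a \<odot>\<^bsub>M\<^esub> y"
    and smult_assoc: "\<lbrakk>a \<in> carrier R; b \<in> carrier R; x \<in> carrier M\<rbrakk> \<Longrightarrow>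
      (a \<otimes>\<^bsub>R\<^esub> b) \<odot>\<^bsub>M\<^esub> x = a \<odot>\<^bsub>M\<^esub> (b \<odot>\<^bsub>M\<^esub> x)"
    and smult_one: "x \<in> carrier M \<Longrightarrow> \<one>\<^bsub>R\<^esub> \<odot>\<^bsub>M\<^esub> x = x"

definition free_basis :: "('r, 'z) ring_scheme \<Rightarrow> ('r, 'p) module \<Rightarrow> 'p set \<Rightarrow> bool"
  where "free_basis R M B \<longleftrightarrow> B \<subseteq> carrier M \<and>
    (\<forall>x\<in>carrier M. \<exists>!c. range c \<subseteq> carrier R \<and> finite {b. c b \<noteq> \<zero>\<^bsub>R\<^esub>} \<and> {b. c b \<noteq> \<zero>\<^bsub>R\<^esub>} \<subseteq> B \<and>
       x = (\<Oplus>\<^bsub>M\<^esub>b\<in>{b. c b \<noteq> \<zero>\<^bsub>R\<^esub>}. c b \<odot>\<^bsub>M\<^esub> b))"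

definition free_module :: "('r, 'z) ring_scheme \<Rightarrow> ('r, 'p) module \<Rightarrow> bool"
  where "free_module R M \<longleftrightarrow> left_module R M \<and> (\<exists>B. free_basis R M B)"

text \<open>An exact sequence \<open>\<dots> \<rightarrow> P 2 \<rightarrow> P 1 \<rightarrow> P 0 \<rightarrow> M \<rightarrow> 0\<close> with \<open>d i : P (i + 1) \<rightarrow> P i\<close>.\<close>

definition free_resolution ::
    "('r, 'z) ring_scheme \<Rightarrow> ('r, 'm) module \<Rightarrow>
     (nat \<Rightarrow> ('r, 'p) module) \<Rightarrow> (nat \<Rightarrow> 'p \<Rightarrow> 'p) \<Rightarrow> ('p \<Rightarrow> 'm) \<Rightarrow> bool"
  where "free_resolution R M P d \<epsilon> \<longleftrightarrow>
    (\<forall>i. free_module R (P i)) \<and>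
    (\<forall>i. d i \<in> LinearCombinations.module_hom R (P (Suc i)) (P i)) \<and>
    \<epsilon> \<in> LinearCombinations.module_hom R (P 0) M \<and>
    \<epsilon> ` carrier (P 0) = carrier M \<and>
    {x \<in> carrier (P 0). \<epsilon> x = \<zero>\<^bsub>M\<^esub>} = d 0 ` carrier (P 1) \<and>
    (\<forall>i. {x \<in> carrier (P (Suc i)). d i x = \<zero>\<^bsub>P i\<^esub>} = d (Suc i) ` carrier (P (Suc (Suc i))))"

text \<open>
  \<open>Hom\<^sub>R(M, N)\<close> for a \<open>k\<close>-algebra \<open>R\<close>, as a \<open>k\<close>-module: \<open>k\<close> acts on \<open>N\<close> through \<open>c \<mapsto> c 1\<^sub>R\<close>. Maps are
  made extensional so that equality of functions is equality of homomorphisms.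
\<close>

definition hom_module ::
    "('k, 'r) module \<Rightarrow> ('r, 'm) module \<Rightarrow> ('r, 'n) module \<Rightarrow> ('k, 'm \<Rightarrow> 'n) module"
  where "hom_module R M N =
    \<lparr>carrier = LinearCombinations.module_hom R M N \<inter> extensional (carrier M),
     monoid.mult = undefined, monoid.one = undefined,
     ring.zero = (\<lambda>x\<in>carrier M. \<zero>\<^bsub>N\<^esub>),
     ring.add = (\<lambda>f g. \<lambda>x\<in>carrier M. f x \<oplus>\<^bsub>N\<^esub> g x),
     smult = (\<lambda>c f. \<lambda>x\<in>carrier M. (c \<odot>\<^bsub>R\<^esub> \<one>\<^bsub>R\<^esub>) \<odot>\<^bsub>N\<^esub> f x)\<rparr>"

definition hom_cocycles ::
    "('k, 'r) module \<Rightarrow> (nat \<Rightarrow> ('r, 'p) module) \<Rightarrow> (nat \<Rightarrow> 'p \<Rightarrow> 'p) \<Rightarrow> ('r, 'n) module \<Rightarrow> nat \<Rightarrow>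
     ('p \<Rightarrow> 'n) set"
  where "hom_cocycles R P d N m =
    {f \<in> carrier (hom_module R (P m) N).
       compose (carrier (P (Suc m))) f (d m) = \<zero>\<^bsub>hom_module R (P (Suc m)) N\<^esub>}"

primrec hom_coboundaries ::
    "('k, 'r) module \<Rightarrow> (nat \<Rightarrow> ('r, 'p) module) \<Rightarrow> (nat \<Rightarrow> 'p \<Rightarrow> 'p) \<Rightarrow> ('r, 'n) module \<Rightarrow> nat \<Rightarrow>
     ('p \<Rightarrow> 'n) set"
  where
    "hom_coboundaries R P d N 0 = {\<zero>\<^bsub>hom_module R (P 0) N\<^esub>}"
  | "hom_coboundaries R P d N (Suc m) =
      (\<lambda>f. compose (carrier (P (Suc m))) f (d m)) ` carrier (hom_module R (P m) N)"

definition hom_cohomology ::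
    "('k, 'r) module \<Rightarrow> (nat \<Rightarrow> ('r, 'p) module) \<Rightarrow> (nat \<Rightarrow> 'p \<Rightarrow> 'p) \<Rightarrow> ('r, 'n) module \<Rightarrow> nat \<Rightarrow>
     ('k, ('p \<Rightarrow> 'n) set) module"
  where "hom_cohomology R P d N m =
    quotient ((hom_module R (P m) N)\<lparr>carrier := hom_cocycles R P d N m\<rparr>) (hom_coboundaries R P d N m)"

text \<open>
  \<open>Ext\<close> is computed from a chosen free resolution; any other choice gives an isomorphic module. The
  modules of the resolution have carriers in the type of functions \<^typ>\<open>('m \<times> 'r) list \<Rightarrow> 'r\<close>, which is
  large enough for every \<open>R\<close> and \<open>M\<close>: with \<open>X = ('m \<times> 'r) list\<close>, the free module on a subset of \<open>X\<close>
  has at most \<open>|X|\<close> elements, so each kernel is generated by a family indexed by a subset of \<open>X\<close>.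
\<close>

definition Ext ::
    "('k, 'r) module \<Rightarrow> ('r, 'm) module \<Rightarrow> ('r, 'n) module \<Rightarrow> nat \<Rightarrow>
     ('k, ((('m \<times> 'r) list \<Rightarrow> 'r) \<Rightarrow> 'n) set) module"
  where "Ext R M N m =
    (let (P, d, \<epsilon>) = (SOME (P, d, \<epsilon>). free_resolution R M P d \<epsilon>) in hom_cohomology R P d N m)"

definition HH ::
    "('k, 'z) ring_scheme \<Rightarrow> ('k, 'a) module \<Rightarrow> nat \<Rightarrow>
     ('k, ((('a \<times> ('a \<times> 'a \<Rightarrow> 'k) set) list \<Rightarrow> ('a \<times> 'a \<Rightarrow> 'k) set) \<Rightarrow> 'a) set) module"
  where "HH k A m = Ext (enveloping_algebra k A) (regular_bimodule k A) (regular_bimodule k A) m"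

end

theory Submission
  imports Defs "HOL-Library.Multiset" "HOL-Library.Countable"
begin

text \<open>
  The \<open>\<Lambda>\<close>-bimodule \<open>\<Lambda>\<close> has a Koszul resolution. Its term of degree \<open>m\<close> is free on the multisets \<open>a\<close>
  of size \<open>m\<close> over \<open>{1..n}\<close>, and its differential sends \<open>e\<^sub>a\<close> to the sum over the distinct elements
  \<open>i\<close> of \<open>a\<close> of \<open>P\<^sub>i e\<^bsub>a - i\<^esub>\<close>, where \<open>P\<^sub>i = x\<^sub>i \<otimes> 1 + (-1)\<^sup>m 1 \<otimes> x\<^sub>i\<close>. Write \<open>P\<^sub>i'\<close> for the same element
  with \<open>m + 1\<close> in place of \<open>m\<close>. The right derivative \<open>D\<^sub>j\<close> in the first tensor factor satisfies
  \<open>D\<^sub>j (r P\<^sub>i) = \<delta>\<^sub>i\<^sub>j r - D\<^sub>j(r) P\<^sub>i'\<close>, and a cycle is therefore contracted one variable \<open>j\<close> at a time.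

  A cochain on the Koszul resolution is an element of \<open>\<Lambda> \<otimes> k[y\<^sub>1, \<dots>, y\<^sub>n]\<close>. Since
  \<open>x\<^sub>i u = \<plusminus> u x\<^sub>i\<close> with the sign given by the degree of \<open>u\<close>, the coboundary is zero on elements of
  even total degree and twice the multiplication by \<open>\<Sum>\<^sub>i x\<^sub>i y\<^sub>i\<close> on those of odd total degree. If
  \<open>2 \<noteq> 0\<close>, only the elements of even total degree survive, together with the class of \<open>x\<^sub>1 \<cdots> x\<^sub>n\<close> in
  degree \<open>0\<close> when \<open>n\<close> is odd.
\<close>

text \<open>\<open>Ext\<close> uses a free resolution picked by \<open>SOME\<close>, about which
  nothing else is known. The Koszul modules must therefore live in the prescribed type of functions
  on lists, so that there is a resolution to pick, and the comparison theorem must carry the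
  computation over to the one picked. No isomorphism of cohomologies is formed: the dimension is
  read off from finitely many coordinate functionals on Koszul cochains, pulled back along a
  comparison map. \<open>\<Lambda>\<close> is a free algebra modulo a generated ideal, so the
  independence of its \<open>2^n\<close> sorted monomials needs proof. It comes from letting words
  act by signed operators on functions of subsets; afterwards identities in \<open>\<Lambda>\<close>
  can be checked on coordinates. The characteristic is arbitrary, so no contraction may divide by a
  degree. Hence both exactness proofs treat one variable at a time, and the differential takes each
  element of a multiset once, whatever its multiplicity: the \<open>e_a\<close> are divided powers,
  dual to the monomials in the \<open>y_i\<close>. The only division is by 2, where
  \<open>2 \<noteq> 0\<close>.\<close>

lemma additive_zero:
  assumes "abelian_group G" "abelian_group H"
    and "h \<in> carrier G \<rightarrow> carrier H"
    and "\<And>x y. \<lbrakk>x \<in> carrier G; y \<in> carrier G\<rbrakk> \<Longrightarrow> h (x \<oplus>\<^bsub>G\<^esub> y) = h x \<oplus>\<^bsub>H\<^esub> h y"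
  shows "h \<zero>\<^bsub>G\<^esub> = \<zero>\<^bsub>H\<^esub>"
proof -
  interpret G: abelian_group G by fact
  interpret H: abelian_group H by fact
  have c: "h \<zero>\<^bsub>G\<^esub> \<in> carrier H" using assms(3) by auto
  have "h \<zero>\<^bsub>G\<^esub> \<oplus>\<^bsub>H\<^esub> h \<zero>\<^bsub>G\<^esub> = h \<zero>\<^bsub>G\<^esub>" using assms(4)[of "\<zero>\<^bsub>G\<^esub>" "\<zero>\<^bsub>G\<^esub>"] by simp
  then show ?thesis using c by (metis H.add.r_cancel_one)
qed

lemma additive_uminus:
  assumes G: "abelian_group G" and H: "abelian_group H"
    and h: "h \<in> carrier G \<rightarrow> carrier H"
    and add: "\<And>x y. \<lbrakk>x \<in> carrier G; y \<in> carrier G\<rbrakk> \<Longrightarrow> h (x \<oplus>\<^bsub>G\<^esub> y) = h x \<oplus>\<^bsub>H\<^esub> h y"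
    and x: "x \<in> carrier G"
  shows "h (\<ominus>\<^bsub>G\<^esub> x) = \<ominus>\<^bsub>H\<^esub> h x"
proof -
  interpret G: abelian_group G by fact
  interpret H: abelian_group H by fact
  have "h (\<ominus>\<^bsub>G\<^esub> x) \<oplus>\<^bsub>H\<^esub> h x = h (\<ominus>\<^bsub>G\<^esub> x \<oplus>\<^bsub>G\<^esub> x)" using add x by simp
  also have "\<dots> = \<zero>\<^bsub>H\<^esub>" using x additive_zero[where h = h and G = G and H = H, OF G H h add] by (simp add: G.l_neg)
  finally show ?thesis using x h by (metis G.a_inv_closed H.minus_equality Pi_mem)
qed

lemma additive_minus:
  assumes G: "abelian_group G" and H: "abelian_group H"
    and h: "h \<in> carrier G \<rightarrow> carrier H"
    and add: "\<And>x y. \<lbrakk>x \<in> carrier G; y \<in> carrier G\<rbrakk> \<Longrightarrow> h (x \<oplus>\<^bsub>G\<^esub> y) = h x \<oplus>\<^bsub>H\<^esub> h y"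
    and x: "x \<in> carrier G" "y \<in> carrier G"
  shows "h (x \<ominus>\<^bsub>G\<^esub> y) = h x \<ominus>\<^bsub>H\<^esub> h y"
proof -
  interpret G: abelian_group G by fact
  interpret H: abelian_group H by fact
  show ?thesis using additive_uminus[where h = h and G = G and H = H, OF G H h add] add x by (simp add: a_minus_def)
qed

text \<open>Holds for every index set: over an infinite one both sums take the default value zero,
  which \<open>h\<close> preserves.\<close>

lemma additive_finsum:
  assumes G: "abelian_group G" and H: "abelian_group H"
    and h: "h \<in> carrier G \<rightarrow> carrier H"
    and add: "\<And>x y. \<lbrakk>x \<in> carrier G; y \<in> carrier G\<rbrakk> \<Longrightarrow> h (x \<oplus>\<^bsub>G\<^esub> y) = h x \<oplus>\<^bsub>H\<^esub> h y"
    and f: "f \<in> A \<rightarrow> carrier G"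
  shows "h (\<Oplus>\<^bsub>G\<^esub>i\<in>A. f i) = (\<Oplus>\<^bsub>H\<^esub>i\<in>A. h (f i))"
proof -
  interpret G: abelian_group G by fact
  interpret H: abelian_group H by fact
  show ?thesis
    using f
  proof (induction A rule: infinite_finite_induct)
    case (infinite A)
    then show ?case by (simp add: additive_zero[where h = h and G = G and H = H, OF G H h add] G.finsum_infinite H.finsum_infinite)
  next
    case empty
    then show ?case by (simp add: additive_zero[where h = h and G = G and H = H, OF G H h add])
  next
    case (insert x F)
    then have "(\<lambda>i. h (f i)) \<in> insert x F \<rightarrow> carrier H" using h by auto
    with insert show ?case by (simp add: G.finsum_insert H.finsum_insert add Pi_def)
  qed
qed

section \<open>Differences and finite sums in abelian groups\<close>

lemma (in abelian_group) minus_eq_zero_iff: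
  assumes "a \<in> carrier G" "b \<in> carrier G"
  shows "a \<ominus> b = \<zero> \<longleftrightarrow> a = b"
  using assms by (metis a_minus_def local.minus_minus minus_equality r_neg a_inv_closed)

text \<open>This is the cancellation behind \<open>d d = 0\<close>. Vanishing on the diagonal is a
  separate hypothesis because antisymmetry does not force it in characteristic 2. Each induction
  step splits off the row and the column of the new index, which cancel against each other.\<close>

lemma (in abelian_group) finsum_finsum_antisym:
  assumes "finite S" and f: "\<And>i j. \<lbrakk>i \<in> S; j \<in> S\<rbrakk> \<Longrightarrow> f i j \<in> carrier G"
    and "\<And>i. i \<in> S \<Longrightarrow> f i i = \<zero>"
    and "\<And>i j. \<lbrakk>i \<in> S; j \<in> S; i \<noteq> j\<rbrakk> \<Longrightarrow> f i j \<oplus> f j i = \<zero>"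
  shows "(\<Oplus>i\<in>S. \<Oplus>j\<in>S. f i j) = \<zero>"
  using assms
proof (induction S)
  case empty
  then show ?case by simp
next
  case (insert x F)
  have F: "(\<lambda>j. f i j) \<in> F \<rightarrow> carrier G" "(\<lambda>j. f j i) \<in> F \<rightarrow> carrier G" if "i \<in> insert x F" for i
    using insert.prems(1) that by auto
  have s: "(\<Oplus>j\<in>insert x F. f i j) = f i x \<oplus> (\<Oplus>j\<in>F. f i j)" if "i \<in> insert x F" for i
    using insert that F by (subst finsum_insert) auto
  have "(\<Oplus>i\<in>insert x F. \<Oplus>j\<in>insert x F. f i j) = (\<Oplus>i\<in>insert x F. f i x \<oplus> (\<Oplus>j\<in>F. f i j))"
    using insert.prems(1) F by (intro finsum_cong') (auto simp: s)
  also have "\<dots> = (f x x \<oplus> (\<Oplus>j\<in>F. f x j)) \<oplus> (\<Oplus>i\<in>F. f i x \<oplus> (\<Oplus>j\<in>F. f i j))"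
    using insert F by (subst finsum_insert) auto
  also have "(\<Oplus>i\<in>F. f i x \<oplus> (\<Oplus>j\<in>F. f i j)) = (\<Oplus>i\<in>F. f i x) \<oplus> (\<Oplus>i\<in>F. \<Oplus>j\<in>F. f i j)"
    using F by (intro finsum_addf) auto
  also have "(\<Oplus>i\<in>F. \<Oplus>j\<in>F. f i j) = \<zero>" using insert by auto
  also have "f x x = \<zero>" using insert by auto
  finally have "(\<Oplus>i\<in>insert x F. \<Oplus>j\<in>insert x F. f i j) = (\<Oplus>j\<in>F. f x j) \<oplus> (\<Oplus>i\<in>F. f i x)"
    using F by simp
  also have "\<dots> = (\<Oplus>j\<in>F. f x j \<oplus> f j x)" using F by (subst finsum_addf) auto
  also have "\<dots> = (\<Oplus>j\<in>F. \<zero>)"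
    using insert.hyps by (intro finsum_cong') (auto intro!: insert.prems(3))
  finally show ?case by simp
qed

lemma (in abelian_group) finsum_fibres:
  assumes "finite P" "F \<in> P \<rightarrow> carrier G"
  shows "(\<Oplus>p\<in>P. F p) = (\<Oplus>w\<in>q ` P. \<Oplus>p\<in>{p \<in> P. q p = w}. F p)"
proof -
  have "P = (\<Union>w\<in>q ` P. {p \<in> P. q p = w})" by auto
  then have "(\<Oplus>p\<in>P. F p) = finsum G F (\<Union>w\<in>q ` P. {p \<in> P. q p = w})" by simp
  also have "\<dots> = (\<Oplus>w\<in>q ` P. \<Oplus>p\<in>{p \<in> P. q p = w}. F p)"
    by (rule add.finprod_UN_disjoint) (use assms in \<open>auto simp: pairwise_def disjnt_def\<close>)
  finally show ?thesis .
qed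

lemma (in abelian_group) finsum_Times:
  assumes "finite U" "finite V" "\<And>u v. \<lbrakk>u \<in> U; v \<in> V\<rbrakk> \<Longrightarrow> F (u, v) \<in> carrier G"
  shows "(\<Oplus>p\<in>U \<times> V. F p) = (\<Oplus>u\<in>U. \<Oplus>v\<in>V. F (u, v))"
proof (cases "V = {}")
  case True
  then show ?thesis by simp
next
  case False
  have "(\<Oplus>p\<in>U \<times> V. F p) = (\<Oplus>u\<in>fst ` (U \<times> V). \<Oplus>p\<in>{p \<in> U \<times> V. fst p = u}. F p)"
    using assms by (intro finsum_fibres) auto
  also have "\<dots> = (\<Oplus>u\<in>U. \<Oplus>v\<in>V. F (u, v))"
  proof (intro finsum_cong')
    fix u assume u: "u \<in> U"
    have "{p \<in> U \<times> V. fst p = u} = Pair u ` V" using u by auto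
    then show "(\<Oplus>p\<in>{p \<in> U \<times> V. fst p = u}. F p) = (\<Oplus>v\<in>V. F (u, v))"
      using assms u by (simp, subst finsum_reindex) (auto simp: inj_on_def)
  qed (use False assms in \<open>auto intro!: finsum_closed\<close>)
  finally show ?thesis .
qed

lemma (in abelian_group) finsum_single:
  assumes "finite A" "f \<in> A \<rightarrow> carrier G" "i \<in> A" "\<And>j. \<lbrakk>j \<in> A; j \<noteq> i\<rbrakk> \<Longrightarrow> f j = \<zero>"
  shows "(\<Oplus>j\<in>A. f j) = f i"
proof -
  have "(\<Oplus>j\<in>A. f j) = (\<Oplus>j\<in>A. if i = j then f j else \<zero>)"
    using assms by (intro finsum_cong') auto
  then show ?thesis using finsum_singleton[OF assms(3,1,2)] by simp
qed

section \<open>Modules and finitely supported linear combinations\<close>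

context left_module
begin

lemma smult_l_zero: "x \<in> carrier M \<Longrightarrow> \<zero> \<odot>\<^bsub>M\<^esub> x = \<zero>\<^bsub>M\<^esub>"
  by (rule additive_zero[OF R.abelian_group_axioms M.abelian_group_axioms, of "\<lambda>a. a \<odot>\<^bsub>M\<^esub> x"])
    (auto simp: smult_closed smult_l_distr)

lemma smult_r_zero: "a \<in> carrier R \<Longrightarrow> a \<odot>\<^bsub>M\<^esub> \<zero>\<^bsub>M\<^esub> = \<zero>\<^bsub>M\<^esub>"
  by (rule additive_zero[OF M.abelian_group_axioms M.abelian_group_axioms, of "\<lambda>x. a \<odot>\<^bsub>M\<^esub> x"])
    (auto simp: smult_closed smult_r_distr)

lemma smult_l_uminus: "\<lbrakk>a \<in> carrier R; x \<in> carrier M\<rbrakk> \<Longrightarrow> (\<ominus> a) \<odot>\<^bsub>M\<^esub> x = \<ominus>\<^bsub>M\<^esub> (a \<odot>\<^bsub>M\<^esub> x)"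
  by (rule additive_uminus[OF R.abelian_group_axioms M.abelian_group_axioms, of "\<lambda>a. a \<odot>\<^bsub>M\<^esub> x"])
    (auto simp: smult_closed smult_l_distr)

lemma smult_r_uminus: "\<lbrakk>a \<in> carrier R; x \<in> carrier M\<rbrakk> \<Longrightarrow> a \<odot>\<^bsub>M\<^esub> (\<ominus>\<^bsub>M\<^esub> x) = \<ominus>\<^bsub>M\<^esub> (a \<odot>\<^bsub>M\<^esub> x)"
  by (rule additive_uminus[OF M.abelian_group_axioms M.abelian_group_axioms, of "\<lambda>x. a \<odot>\<^bsub>M\<^esub> x"])
    (auto simp: smult_closed smult_r_distr)

lemma smult_l_finsum: "\<lbrakk>f \<in> A \<rightarrow> carrier R; x \<in> carrier M\<rbrakk> \<Longrightarrow>
    (\<Oplus>i\<in>A. f i) \<odot>\<^bsub>M\<^esub> x = (\<Oplus>\<^bsub>M\<^esub>i\<in>A. f i \<odot>\<^bsub>M\<^esub> x)"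
  by (rule additive_finsum[OF R.abelian_group_axioms M.abelian_group_axioms, of "\<lambda>a. a \<odot>\<^bsub>M\<^esub> x"])
    (auto simp: smult_closed smult_l_distr)

lemma smult_r_finsum: "\<lbrakk>f \<in> A \<rightarrow> carrier M; a \<in> carrier R\<rbrakk> \<Longrightarrow>
    a \<odot>\<^bsub>M\<^esub> (\<Oplus>\<^bsub>M\<^esub>i\<in>A. f i) = (\<Oplus>\<^bsub>M\<^esub>i\<in>A. a \<odot>\<^bsub>M\<^esub> f i)"
  by (rule additive_finsum[OF M.abelian_group_axioms M.abelian_group_axioms, of "\<lambda>x. a \<odot>\<^bsub>M\<^esub> x"])
    (auto simp: smult_closed smult_r_distr)

end

lemma module_if_left_module: "\<lbrakk>left_module R M; cring R\<rbrakk> \<Longrightarrow> Module.module R M"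
  by (simp add: left_module_def left_module_axioms_def Module.module_def Module.module_axioms_def)

section \<open>Finitely supported functions and linear extension\<close>

definition fsupp :: "('r, 'z) ring_scheme \<Rightarrow> 'w set \<Rightarrow> ('w \<Rightarrow> 'r) set"
  where "fsupp R S = {f. range f \<subseteq> carrier R \<and> finite {w. f w \<noteq> \<zero>\<^bsub>R\<^esub>} \<and> {w. f w \<noteq> \<zero>\<^bsub>R\<^esub>} \<subseteq> S}"

text \<open>The linear extension of \<open>h\<close> to the free module on its arguments. The same
  expression stands, unfolded, in the action on \<open>regular_bimodule\<close> and in
  \<open>free_basis\<close>, so one set of rules serves tensor products, words acting as operators,
  and free modules.\<close>

definition lin :: "('r, 'z) ring_scheme \<Rightarrow> ('r, 'm, 'y) module_scheme \<Rightarrow> ('w \<Rightarrow> 'm) \<Rightarrow> ('w \<Rightarrow> 'r) \<Rightarrow> 'm"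
  where "lin R M h f = (\<Oplus>\<^bsub>M\<^esub>w\<in>{w. f w \<noteq> \<zero>\<^bsub>R\<^esub>}. f w \<odot>\<^bsub>M\<^esub> h w)"

lemma fsuppD:
  assumes "f \<in> fsupp R S"
  shows "f w \<in> carrier R" "finite {w. f w \<noteq> \<zero>\<^bsub>R\<^esub>}" "f w \<noteq> \<zero>\<^bsub>R\<^esub> \<Longrightarrow> w \<in> S"
  using assms by (auto simp: fsupp_def)

lemma fsupp_mono: "\<lbrakk>f \<in> fsupp R S; S \<subseteq> T\<rbrakk> \<Longrightarrow> f \<in> fsupp R T"
  by (auto simp: fsupp_def)

lemma fsuppI:
  assumes "\<And>w. f w \<in> carrier R" "finite T" "\<And>w. f w \<noteq> \<zero>\<^bsub>R\<^esub> \<Longrightarrow> w \<in> T" "T \<subseteq> S"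
  shows "f \<in> fsupp R S"
proof -
  have "{w. f w \<noteq> \<zero>\<^bsub>R\<^esub>} \<subseteq> T" using assms(3) by auto
  with assms show ?thesis by (auto simp: fsupp_def intro: finite_subset)
qed

context ring
begin

lemma fsupp_zero: "(\<lambda>_. \<zero>) \<in> fsupp R S"
  by (rule fsuppI[of _ _ "{}"]) auto

lemma fsupp_add:
  assumes "f \<in> fsupp R S" "g \<in> fsupp R S"
  shows "(\<lambda>w. f w \<oplus> g w) \<in> fsupp R S"
  by (rule fsuppI[of _ _ "{w. f w \<noteq> \<zero>} \<union> {w. g w \<noteq> \<zero>}"])
    (use fsuppD[OF assms(1)] fsuppD[OF assms(2)] in auto)

lemma fsupp_smult:
  assumes "f \<in> fsupp R S" "c \<in> carrier R"
  shows "(\<lambda>w. c \<otimes> f w) \<in> fsupp R S"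
  by (rule fsuppI[of _ _ "{w. f w \<noteq> \<zero>}"]) (use assms(2) fsuppD[OF assms(1)] in auto)

lemma fsupp_uminus:
  assumes "f \<in> fsupp R S"
  shows "(\<lambda>w. \<ominus> f w) \<in> fsupp R S"
  by (rule fsuppI[of _ _ "{w. f w \<noteq> \<zero>}"]) (use fsuppD[OF assms] in auto)

lemma fsupp_basis_elt: "u \<in> S \<Longrightarrow> basis_elt R u \<in> fsupp R S"
  by (rule fsuppI[of _ _ "{u}"]) (auto simp: basis_elt_def split: if_splits)

end

context left_module
begin

text \<open>The support of \<open>f\<close> varies with \<open>f\<close>; sums for different
  functions become comparable only over a common finite set, where the additional terms are
  zero.\<close>

lemma lin_eq_finsum:
  assumes f: "f \<in> fsupp R S" and h: "h \<in> S \<rightarrow> carrier M"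
    and T: "finite T" "{w. f w \<noteq> \<zero>} \<subseteq> T" "T \<subseteq> S"
  shows "lin R M h f = (\<Oplus>\<^bsub>M\<^esub>w\<in>T. f w \<odot>\<^bsub>M\<^esub> h w)"
  unfolding lin_def
proof (rule M.add.finprod_mono_neutral_cong_left)
  show "f i \<odot>\<^bsub>M\<^esub> h i = \<zero>\<^bsub>M\<^esub>" if "i \<in> T - {w. f w \<noteq> \<zero>}" for i
    using that T h by (auto intro!: smult_l_zero)
  show "(\<lambda>w. f w \<odot>\<^bsub>M\<^esub> h w) \<in> T \<rightarrow> carrier M"
    using T h fsuppD(1)[OF f] by (auto intro!: smult_closed)
qed (use T in auto)

lemma lin_closed:
  assumes f: "f \<in> fsupp R S" and h: "h \<in> S \<rightarrow> carrier M"
  shows "lin R M h f \<in> carrier M"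
  unfolding lin_def using fsuppD[OF f] h by (auto intro!: M.finsum_closed smult_closed)

lemma lin_cong:
  assumes f: "f \<in> fsupp R S" and h: "h \<in> S \<rightarrow> carrier M" and eq: "\<And>w. w \<in> S \<Longrightarrow> g w = h w"
  shows "lin R M g f = lin R M h f"
  unfolding lin_def using fsuppD[OF f] h eq by (intro M.finsum_cong') (auto intro!: smult_closed)

lemma lin_zero: "lin R M h (\<lambda>_. \<zero>) = \<zero>\<^bsub>M\<^esub>"
  by (simp add: lin_def)

lemma lin_add:
  assumes f: "f \<in> fsupp R S" and g: "g \<in> fsupp R S" and h: "h \<in> S \<rightarrow> carrier M"
  shows "lin R M h (\<lambda>w. f w \<oplus> g w) = lin R M h f \<oplus>\<^bsub>M\<^esub> lin R M h g"
proof -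
  define T where "T = {w. f w \<noteq> \<zero>} \<union> {w. g w \<noteq> \<zero>}"
  have T: "finite T" "T \<subseteq> S" using fsuppD[OF f] fsuppD[OF g] by (auto simp: T_def)
  have hT: "w \<in> T \<Longrightarrow> h w \<in> carrier M" for w using h T by auto
  have "lin R M h (\<lambda>w. f w \<oplus> g w) = (\<Oplus>\<^bsub>M\<^esub>w\<in>T. (f w \<oplus> g w) \<odot>\<^bsub>M\<^esub> h w)"
    by (rule lin_eq_finsum[OF R.fsupp_add[OF f g] h T(1) _ T(2)]) (auto simp: T_def)
  also have "\<dots> = (\<Oplus>\<^bsub>M\<^esub>w\<in>T. f w \<odot>\<^bsub>M\<^esub> h w \<oplus>\<^bsub>M\<^esub> g w \<odot>\<^bsub>M\<^esub> h w)"
    using fsuppD(1)[OF f] fsuppD(1)[OF g] hT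
    by (intro M.finsum_cong') (auto simp: smult_l_distr smult_closed)
  also have "\<dots> = (\<Oplus>\<^bsub>M\<^esub>w\<in>T. f w \<odot>\<^bsub>M\<^esub> h w) \<oplus>\<^bsub>M\<^esub> (\<Oplus>\<^bsub>M\<^esub>w\<in>T. g w \<odot>\<^bsub>M\<^esub> h w)"
    using fsuppD(1)[OF f] fsuppD(1)[OF g] hT by (intro M.finsum_addf) (auto simp: smult_closed)
  also have "\<dots> = lin R M h f \<oplus>\<^bsub>M\<^esub> lin R M h g"
    using lin_eq_finsum[OF f h T(1) _ T(2)] lin_eq_finsum[OF g h T(1) _ T(2)] by (auto simp: T_def)
  finally show ?thesis .
qed

lemma lin_smult:
  assumes f: "f \<in> fsupp R S" and h: "h \<in> S \<rightarrow> carrier M" and c: "c \<in> carrier R"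
  shows "lin R M h (\<lambda>w. c \<otimes> f w) = c \<odot>\<^bsub>M\<^esub> lin R M h f"
proof -
  define T where "T = {w. f w \<noteq> \<zero>}"
  have T: "finite T" "T \<subseteq> S" using fsuppD[OF f] by (auto simp: T_def)
  have hT: "w \<in> T \<Longrightarrow> h w \<in> carrier M" for w using h T by auto
  have "lin R M h (\<lambda>w. c \<otimes> f w) = (\<Oplus>\<^bsub>M\<^esub>w\<in>T. (c \<otimes> f w) \<odot>\<^bsub>M\<^esub> h w)"
    by (rule lin_eq_finsum[OF R.fsupp_smult[OF f c] h T(1) _ T(2)]) (auto simp: T_def c)
  also have "\<dots> = (\<Oplus>\<^bsub>M\<^esub>w\<in>T. c \<odot>\<^bsub>M\<^esub> (f w \<odot>\<^bsub>M\<^esub> h w))"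
    using fsuppD(1)[OF f] hT c
    by (intro M.finsum_cong') (auto simp: smult_assoc smult_closed)
  also have "\<dots> = c \<odot>\<^bsub>M\<^esub> (\<Oplus>\<^bsub>M\<^esub>w\<in>T. f w \<odot>\<^bsub>M\<^esub> h w)"
    using fsuppD(1)[OF f] hT c by (intro smult_r_finsum[symmetric]) (auto simp: smult_closed)
  finally show ?thesis by (simp add: lin_def T_def)
qed

lemma lin_basis_elt:
  assumes "h u \<in> carrier M"
  shows "lin R M h (basis_elt R u) = h u"
proof -
  have "lin R M h (basis_elt R u) = (\<Oplus>\<^bsub>M\<^esub>w\<in>{u}. basis_elt R u w \<odot>\<^bsub>M\<^esub> h w)"
    using assms by (intro lin_eq_finsum[where S = "{u}"] R.fsupp_basis_elt) (auto simp: basis_elt_def)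
  then show ?thesis using assms by (simp add: basis_elt_def smult_one)
qed

lemma lin_fun_add:
  assumes f: "f \<in> fsupp R S" and h: "h \<in> S \<rightarrow> carrier M" and g: "g \<in> S \<rightarrow> carrier M"
  shows "lin R M (\<lambda>w. h w \<oplus>\<^bsub>M\<^esub> g w) f = lin R M h f \<oplus>\<^bsub>M\<^esub> lin R M g f"
proof -
  have "lin R M (\<lambda>w. h w \<oplus>\<^bsub>M\<^esub> g w) f
      = (\<Oplus>\<^bsub>M\<^esub>w\<in>{w. f w \<noteq> \<zero>}. f w \<odot>\<^bsub>M\<^esub> h w \<oplus>\<^bsub>M\<^esub> f w \<odot>\<^bsub>M\<^esub> g w)"
    unfolding lin_def using fsuppD[OF f] h g
    by (intro M.finsum_cong') (auto simp: smult_r_distr smult_closed Pi_def)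
  also have "\<dots> = lin R M h f \<oplus>\<^bsub>M\<^esub> lin R M g f"
    unfolding lin_def using fsuppD[OF f] h g
    by (intro M.finsum_addf) (auto simp: smult_closed Pi_def)
  finally show ?thesis .
qed

end

lemma lin_hom:
  assumes M: "left_module R M" and N: "left_module R N"
    and \<phi>: "\<phi> \<in> LinearCombinations.module_hom R M N"
    and f: "f \<in> fsupp R S" and h: "h \<in> S \<rightarrow> carrier M"
  shows "\<phi> (lin R M h f) = lin R N (\<lambda>w. \<phi> (h w)) f"
proof -
  interpret M: left_module R M by fact
  interpret N: left_module R N by fact
  have hm: "\<phi> \<in> carrier M \<rightarrow> carrier N" using \<phi> by (simp add: LinearCombinations.module_hom_def)
  have "\<phi> (lin R M h f) = (\<Oplus>\<^bsub>N\<^esub>w\<in>{w. f w \<noteq> \<zero>\<^bsub>R\<^esub>}. \<phi> (f w \<odot>\<^bsub>M\<^esub> h w))"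
    unfolding lin_def using \<phi> fsuppD[OF f] h
    by (intro additive_finsum[OF M.M.abelian_group_axioms N.M.abelian_group_axioms])
      (auto simp: LinearCombinations.module_hom_def M.smult_closed Pi_def)
  also have "\<dots> = lin R N (\<lambda>w. \<phi> (h w)) f"
    unfolding lin_def using \<phi> fsuppD[OF f] h hm
    by (intro N.M.finsum_cong') (auto simp: LinearCombinations.module_hom_def N.smult_closed Pi_def)
  finally show ?thesis .
qed

section \<open>Algebras over a commutative ring\<close>

locale kalgebra = L?: left_module k A + A?: ring A
    for k :: "('k, 'z) ring_scheme" (structure) and A :: "('k, 'a) module" (structure) +
  assumes k_comm: "\<lbrakk>c \<in> carrier k; d \<in> carrier k\<rbrakk> \<Longrightarrow> c \<otimes>\<^bsub>k\<^esub> d = d \<otimes>\<^bsub>k\<^esub> c"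
    and smult_mult_l: "\<lbrakk>c \<in> carrier k; a \<in> carrier A; b \<in> carrier A\<rbrakk> \<Longrightarrow>
      (c \<odot>\<^bsub>A\<^esub> a) \<otimes>\<^bsub>A\<^esub> b = c \<odot>\<^bsub>A\<^esub> (a \<otimes>\<^bsub>A\<^esub> b)"
    and smult_mult_r: "\<lbrakk>c \<in> carrier k; a \<in> carrier A; b \<in> carrier A\<rbrakk> \<Longrightarrow>
      a \<otimes>\<^bsub>A\<^esub> (c \<odot>\<^bsub>A\<^esub> b) = c \<odot>\<^bsub>A\<^esub> (a \<otimes>\<^bsub>A\<^esub> b)"
begin

lemma cring_k: "cring k"
  by unfold_locales (auto intro: k_comm)

end

section \<open>The base ring as a module over itself\<close>

definition self_module :: "('k, 'z) ring_scheme \<Rightarrow> ('k, 'k) module"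
  where "self_module k = \<lparr>carrier = carrier k, monoid.mult = monoid.mult k, monoid.one = monoid.one k,
    ring.zero = ring.zero k, ring.add = ring.add k, smult = monoid.mult k\<rparr>"

lemma self_module_simps [simp]:
  "carrier (self_module k) = carrier k" "monoid.mult (self_module k) = monoid.mult k"
  "\<one>\<^bsub>self_module k\<^esub> = \<one>\<^bsub>k\<^esub>" "\<zero>\<^bsub>self_module k\<^esub> = \<zero>\<^bsub>k\<^esub>"
  "ring.add (self_module k) = ring.add k" "smult (self_module k) = monoid.mult k"
  by (simp_all add: self_module_def)

lemma finsum_self_module [simp]: "finsum (self_module k) f S = finsum k f S"
  by (simp add: finsum_def finprod_def foldD_def)

lemma abelian_group_self_module:
  assumes "abelian_group k"
  shows "abelian_group (self_module k)"
proof -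
  interpret abelian_group k by fact
  show ?thesis
    by (rule abelian_groupI) (auto simp: a_ac intro: l_neg exI bexI[of _ "\<ominus>\<^bsub>k\<^esub> _"])
qed

lemma left_module_self_module:
  assumes "ring k"
  shows "left_module k (self_module k)"
proof -
  interpret ring k by fact
  interpret S: abelian_group "self_module k"
    by (rule abelian_group_self_module) (rule abelian_group_axioms)
  show ?thesis
    by unfold_locales (auto simp: l_distr r_distr m_assoc)
qed

text \<open>Evaluation at \<open>w\<close> is the linear extension of the Kronecker delta at
  \<open>w\<close>. Since a coordinate is thereby a \<open>lin\<close>, every coordinate of a
  product falls under the rules for \<open>lin\<close>.\<close>

lemma fsupp_coordinate:
  assumes "ring k" and f: "f \<in> fsupp k S"
  shows "lin k (self_module k) (basis_elt k w) f = f w"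
proof -
  interpret ring k by fact
  interpret L: left_module k "self_module k" by (rule left_module_self_module) fact
  note fD = fsuppD[OF f]
  have "lin k (self_module k) (basis_elt k w) f
      = (\<Oplus>\<^bsub>self_module k\<^esub>u\<in>insert w {w. f w \<noteq> \<zero>\<^bsub>k\<^esub>}. f u \<odot>\<^bsub>self_module k\<^esub> basis_elt k w u)"
    using f fD(2) by (intro L.lin_eq_finsum[where S = UNIV] fsupp_mono[OF f]) (auto simp: basis_elt_def)
  also have "\<dots> = f w \<otimes>\<^bsub>k\<^esub> basis_elt k w w"
    using fD unfolding finsum_self_module self_module_simps
    by (intro finsum_single) (auto simp: basis_elt_def)
  finally show ?thesis using fD by (simp add: basis_elt_def)
qed

section \<open>Monoid algebras\<close>

lemma monoid_algebra_carrier: "carrier (monoid_algebra k W) = fsupp k (carrier W)"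
  by (simp add: monoid_algebra_def fsupp_def)

lemma monoid_algebra_mult: "monoid.mult (monoid_algebra k W) = (\<lambda>f g w. \<Oplus>\<^bsub>k\<^esub>p\<in>{(u, v).
      f u \<noteq> \<zero>\<^bsub>k\<^esub> \<and> g v \<noteq> \<zero>\<^bsub>k\<^esub> \<and> u \<otimes>\<^bsub>W\<^esub> v = w}. f (fst p) \<otimes>\<^bsub>k\<^esub> g (snd p))"
  by (simp add: monoid_algebra_def)

lemma monoid_algebra_simps:
  "\<one>\<^bsub>monoid_algebra k W\<^esub> = basis_elt k \<one>\<^bsub>W\<^esub>"
  "\<zero>\<^bsub>monoid_algebra k W\<^esub> = (\<lambda>_. \<zero>\<^bsub>k\<^esub>)"
  "f \<oplus>\<^bsub>monoid_algebra k W\<^esub> g = (\<lambda>w. f w \<oplus>\<^bsub>k\<^esub> g w)"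
  "c \<odot>\<^bsub>monoid_algebra k W\<^esub> f = (\<lambda>w. c \<otimes>\<^bsub>k\<^esub> f w)"
  by (auto simp: monoid_algebra_def basis_elt_def)

locale monoid_algebra_loc = K?: cring k + W?: monoid W
  for k :: "('k, 'z) ring_scheme" (structure) and W :: "('w, 'y) monoid_scheme" (structure)
begin

abbreviation "MA \<equiv> monoid_algebra k W"

lemma conv_support:
  assumes f: "f \<in> carrier MA" and g: "g \<in> carrier MA"
  shows "(f \<otimes>\<^bsub>MA\<^esub> g) w \<noteq> \<zero>\<^bsub>k\<^esub> \<Longrightarrow>
    w \<in> (\<lambda>(u, v). u \<otimes>\<^bsub>W\<^esub> v) ` ({u. f u \<noteq> \<zero>\<^bsub>k\<^esub>} \<times> {v. g v \<noteq> \<zero>\<^bsub>k\<^esub>})"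
proof (rule ccontr)
  assume w: "w \<notin> (\<lambda>(u, v). u \<otimes>\<^bsub>W\<^esub> v) ` ({u. f u \<noteq> \<zero>\<^bsub>k\<^esub>} \<times> {v. g v \<noteq> \<zero>\<^bsub>k\<^esub>})"
    and nz: "(f \<otimes>\<^bsub>MA\<^esub> g) w \<noteq> \<zero>\<^bsub>k\<^esub>"
  then have "{(u, v). f u \<noteq> \<zero>\<^bsub>k\<^esub> \<and> g v \<noteq> \<zero>\<^bsub>k\<^esub> \<and> u \<otimes>\<^bsub>W\<^esub> v = w} = {}" by (force simp: image_iff)
  then have "(f \<otimes>\<^bsub>MA\<^esub> g) w = \<zero>\<^bsub>k\<^esub>" by (simp only: monoid_algebra_mult K.finsum_empty)
  with nz show False by simp
qed

lemma conv_closed: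
  assumes f: "f \<in> carrier MA" and g: "g \<in> carrier MA"
  shows "f \<otimes>\<^bsub>MA\<^esub> g \<in> carrier MA"
  unfolding monoid_algebra_carrier
proof (rule fsuppI)
  note fD = fsuppD[OF f[unfolded monoid_algebra_carrier]] and gD = fsuppD[OF g[unfolded monoid_algebra_carrier]]
  show "(f \<otimes>\<^bsub>MA\<^esub> g) w \<in> carrier k" for w
    unfolding monoid_algebra_mult using fD gD by (auto intro!: K.finsum_closed)
  show "finite ((\<lambda>(u, v). u \<otimes>\<^bsub>W\<^esub> v) ` ({u. f u \<noteq> \<zero>\<^bsub>k\<^esub>} \<times> {v. g v \<noteq> \<zero>\<^bsub>k\<^esub>}))"
    using fD gD by auto
  show "(\<lambda>(u, v). u \<otimes>\<^bsub>W\<^esub> v) ` ({u. f u \<noteq> \<zero>\<^bsub>k\<^esub>} \<times> {v. g v \<noteq> \<zero>\<^bsub>k\<^esub>}) \<subseteq> carrier W"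
    using fD gD by auto
qed (rule conv_support[OF f g])

text \<open>The coefficient of a product at \<open>w\<close> sums over the pairs of support elements
  with product \<open>w\<close>. Grouping all pairs by their product (\<open>finsum_fibres\<close>)
  and then summing them factor by factor (\<open>finsum_Times\<close>) gives the iterated extension.
  Applied to coordinate functionals (\<open>conv_apply\<close>), this is the source of the ring laws
  of the monoid algebra; applied to other maps, it shows that kernels of actions are ideals.\<close>

lemma lin_conv:
  assumes N: "left_module k N" and h: "h \<in> carrier W \<rightarrow> carrier N"
    and f: "f \<in> carrier MA" and g: "g \<in> carrier MA"
  shows "lin k N h (f \<otimes>\<^bsub>MA\<^esub> g) = lin k N (\<lambda>u. lin k N (\<lambda>v. h (u \<otimes>\<^bsub>W\<^esub> v)) g) f"
proof -
  interpret N: left_module k N by fact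
  note fD = fsuppD[OF f[unfolded monoid_algebra_carrier]] and gD = fsuppD[OF g[unfolded monoid_algebra_carrier]]
  define U V where "U = {u. f u \<noteq> \<zero>\<^bsub>k\<^esub>}" and "V = {v. g v \<noteq> \<zero>\<^bsub>k\<^esub>}"
  have UV: "finite U" "finite V" "U \<subseteq> carrier W" "V \<subseteq> carrier W" using fD gD by (auto simp: U_def V_def)
  define q where "q = (\<lambda>(u, v). u \<otimes>\<^bsub>W\<^esub> v)"
  define P where "P = U \<times> V"
  have P: "finite P" using UV by (simp add: P_def)
  have qc: "q p \<in> carrier W" if "p \<in> P" for p using that UV by (auto simp: P_def q_def)
  have hq: "h (q p) \<in> carrier N" if "p \<in> P" for p using qc[OF that] h by auto
  have fib: "{(u, v). f u \<noteq> \<zero>\<^bsub>k\<^esub> \<and> g v \<noteq> \<zero>\<^bsub>k\<^esub> \<and> u \<otimes>\<^bsub>W\<^esub> v = w} = {p \<in> P. q p = w}" for w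
    by (auto simp: P_def U_def V_def q_def)
  have sub: "{w. (f \<otimes>\<^bsub>MA\<^esub> g) w \<noteq> \<zero>\<^bsub>k\<^esub>} \<subseteq> q ` P"
    using conv_support[OF f g] unfolding q_def P_def U_def V_def by blast
  have "lin k N h (f \<otimes>\<^bsub>MA\<^esub> g) = (\<Oplus>\<^bsub>N\<^esub>w\<in>q ` P. (f \<otimes>\<^bsub>MA\<^esub> g) w \<odot>\<^bsub>N\<^esub> h w)"
    using conv_closed[OF f g] P qc
    by (intro N.lin_eq_finsum[OF _ h _ sub]) (auto simp: monoid_algebra_carrier)
  also have "\<dots> = (\<Oplus>\<^bsub>N\<^esub>w\<in>q ` P. \<Oplus>\<^bsub>N\<^esub>p\<in>{p \<in> P. q p = w}. (f (fst p) \<otimes>\<^bsub>k\<^esub> g (snd p)) \<odot>\<^bsub>N\<^esub> h (q p))"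
  proof (intro N.M.finsum_cong')
    fix w assume w: "w \<in> q ` P"
    have "(f \<otimes>\<^bsub>MA\<^esub> g) w \<odot>\<^bsub>N\<^esub> h w
        = (\<Oplus>\<^bsub>N\<^esub>p\<in>{p \<in> P. q p = w}. (f (fst p) \<otimes>\<^bsub>k\<^esub> g (snd p)) \<odot>\<^bsub>N\<^esub> h w)"
      unfolding monoid_algebra_mult fib using fD gD w hq by (intro N.smult_l_finsum) auto
    also have "\<dots> = (\<Oplus>\<^bsub>N\<^esub>p\<in>{p \<in> P. q p = w}. (f (fst p) \<otimes>\<^bsub>k\<^esub> g (snd p)) \<odot>\<^bsub>N\<^esub> h (q p))"
      using fD gD w hq by (intro N.M.finsum_cong') (auto simp: N.smult_closed)
    finally show "(f \<otimes>\<^bsub>MA\<^esub> g) w \<odot>\<^bsub>N\<^esub> h w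
        = (\<Oplus>\<^bsub>N\<^esub>p\<in>{p \<in> P. q p = w}. (f (fst p) \<otimes>\<^bsub>k\<^esub> g (snd p)) \<odot>\<^bsub>N\<^esub> h (q p))" .
  qed (use fD gD hq in \<open>auto intro!: N.M.finsum_closed N.smult_closed\<close>)
  also have "\<dots> = (\<Oplus>\<^bsub>N\<^esub>p\<in>P. (f (fst p) \<otimes>\<^bsub>k\<^esub> g (snd p)) \<odot>\<^bsub>N\<^esub> h (q p))"
    using P fD gD hq by (intro N.M.finsum_fibres[symmetric]) (auto simp: N.smult_closed)
  also have "\<dots> = (\<Oplus>\<^bsub>N\<^esub>u\<in>U. \<Oplus>\<^bsub>N\<^esub>v\<in>V. (f u \<otimes>\<^bsub>k\<^esub> g v) \<odot>\<^bsub>N\<^esub> h (u \<otimes>\<^bsub>W\<^esub> v))"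
    unfolding P_def using UV fD gD hq
    by (subst N.M.finsum_Times) (auto simp: N.smult_closed P_def q_def)
  also have "\<dots> = (\<Oplus>\<^bsub>N\<^esub>u\<in>U. f u \<odot>\<^bsub>N\<^esub> (\<Oplus>\<^bsub>N\<^esub>v\<in>V. g v \<odot>\<^bsub>N\<^esub> h (u \<otimes>\<^bsub>W\<^esub> v)))"
  proof (intro N.M.finsum_cong')
    fix u assume u: "u \<in> U"
    have huv: "h (u \<otimes>\<^bsub>W\<^esub> v) \<in> carrier N" if "v \<in> V" for v using hq[of "(u, v)"] u that by (auto simp: P_def q_def)
    then have "f u \<odot>\<^bsub>N\<^esub> (\<Oplus>\<^bsub>N\<^esub>v\<in>V. g v \<odot>\<^bsub>N\<^esub> h (u \<otimes>\<^bsub>W\<^esub> v)) = (\<Oplus>\<^bsub>N\<^esub>v\<in>V. f u \<odot>\<^bsub>N\<^esub> (g v \<odot>\<^bsub>N\<^esub> h (u \<otimes>\<^bsub>W\<^esub> v)))"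
      using fD gD by (intro N.smult_r_finsum) (auto simp: N.smult_closed)
    also have "\<dots> = (\<Oplus>\<^bsub>N\<^esub>v\<in>V. (f u \<otimes>\<^bsub>k\<^esub> g v) \<odot>\<^bsub>N\<^esub> h (u \<otimes>\<^bsub>W\<^esub> v))"
      using fD gD huv by (intro N.M.finsum_cong') (auto simp: N.smult_assoc N.smult_closed)
    finally show "(\<Oplus>\<^bsub>N\<^esub>v\<in>V. (f u \<otimes>\<^bsub>k\<^esub> g v) \<odot>\<^bsub>N\<^esub> h (u \<otimes>\<^bsub>W\<^esub> v))
      = f u \<odot>\<^bsub>N\<^esub> (\<Oplus>\<^bsub>N\<^esub>v\<in>V. g v \<odot>\<^bsub>N\<^esub> h (u \<otimes>\<^bsub>W\<^esub> v))" by simp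
  next
    show "(\<lambda>u. f u \<odot>\<^bsub>N\<^esub> (\<Oplus>\<^bsub>N\<^esub>v\<in>V. g v \<odot>\<^bsub>N\<^esub> h (u \<otimes>\<^bsub>W\<^esub> v))) \<in> U \<rightarrow> carrier N"
      using fD gD hq unfolding P_def q_def by (fastforce intro!: N.M.finsum_closed N.smult_closed)
  qed simp
  finally show ?thesis by (simp add: lin_def U_def V_def)
qed

lemma conv_apply:
  assumes f: "f \<in> carrier MA" and g: "g \<in> carrier MA"
  shows "(f \<otimes>\<^bsub>MA\<^esub> g) w =
    lin k (self_module k) (\<lambda>u. lin k (self_module k) (\<lambda>v. basis_elt k w (u \<otimes>\<^bsub>W\<^esub> v)) g) f"
proof -
  have "(f \<otimes>\<^bsub>MA\<^esub> g) w = lin k (self_module k) (basis_elt k w) (f \<otimes>\<^bsub>MA\<^esub> g)"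
    using conv_closed[OF f g] unfolding monoid_algebra_carrier
    by (intro fsupp_coordinate[symmetric] K.ring_axioms)
  also have "\<dots> = lin k (self_module k) (\<lambda>u. lin k (self_module k) (\<lambda>v. basis_elt k w (u \<otimes>\<^bsub>W\<^esub> v)) g) f"
    by (intro lin_conv left_module_self_module K.ring_axioms f g) (auto simp: basis_elt_def)
  finally show ?thesis .
qed

sublocale KK: left_module k "self_module k"
  by (rule left_module_self_module) (rule K.ring_axioms)

lemma abelian_group_MA: "abelian_group MA"
proof (rule abelian_groupI, goal_cases)
  case (6 x)
  then have "(\<lambda>w. \<ominus>\<^bsub>k\<^esub> x w) \<in> carrier MA" "(\<lambda>w. \<ominus>\<^bsub>k\<^esub> x w) \<oplus>\<^bsub>MA\<^esub> x = \<zero>\<^bsub>MA\<^esub>"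
    by (auto simp: monoid_algebra_simps monoid_algebra_carrier K.l_neg fsuppD intro!: K.fsupp_uminus)
  then show ?case by blast
qed (auto simp: monoid_algebra_simps monoid_algebra_carrier K.a_ac fsuppD
    intro!: K.fsupp_add K.fsupp_zero)

lemma lin_smult_fun:
  assumes N: "left_module k N" and f: "f \<in> fsupp k S" and h: "h \<in> S \<rightarrow> carrier N" and c: "c \<in> carrier k"
  shows "lin k N (\<lambda>w. c \<odot>\<^bsub>N\<^esub> h w) f = c \<odot>\<^bsub>N\<^esub> lin k N h f"
proof -
  interpret N: left_module k N by fact
  have "(\<lambda>x. c \<odot>\<^bsub>N\<^esub> x) \<in> LinearCombinations.module_hom k N N"
    using c by (auto simp: LinearCombinations.module_hom_def N.smult_closed N.smult_r_distr
      N.smult_assoc[symmetric] K.m_comm)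
  from lin_hom[OF N N this f h] show ?thesis by simp
qed

lemma bwc: "basis_elt k w u \<in> carrier k"
  by (simp add: basis_elt_def)

lemma inner_closed:
  assumes "g \<in> carrier MA"
  shows "lin k (self_module k) (\<lambda>v. basis_elt k w (q v)) g \<in> carrier k"
  using KK.lin_closed[OF assms[unfolded monoid_algebra_carrier], of "\<lambda>v. basis_elt k w (q v)"]
  by (auto simp: bwc)

text \<open>In each coordinate both bracketings of a triple product are the same threefold linear
  extension of a Kronecker delta, up to associativity in \<open>W\<close>. Distributivity is
  additivity of \<open>lin\<close> in the function on one side and in the coefficients on the
  other.\<close>

lemma ring_MA: "ring MA"
proof (rule ringI)
  show "abelian_group MA" by (rule abelian_group_MA)
  show "Group.monoid MA"
  proof (rule monoidI)
    show "\<one>\<^bsub>MA\<^esub> \<in> carrier MA"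
      by (auto simp: monoid_algebra_simps monoid_algebra_carrier intro: K.fsupp_basis_elt)
    fix x y z assume x: "x \<in> carrier MA" and y: "y \<in> carrier MA" and z: "z \<in> carrier MA"
    show "x \<otimes>\<^bsub>MA\<^esub> y \<otimes>\<^bsub>MA\<^esub> z = x \<otimes>\<^bsub>MA\<^esub> (y \<otimes>\<^bsub>MA\<^esub> z)"
    proof
      fix w
      let ?l = "lin k (self_module k)"
      have xs: "x \<in> fsupp k (carrier W)" and ys: "y \<in> fsupp k (carrier W)"
        using x y by (auto simp: monoid_algebra_carrier)
      have "(x \<otimes>\<^bsub>MA\<^esub> y \<otimes>\<^bsub>MA\<^esub> z) w = ?l (\<lambda>u. ?l (\<lambda>v. basis_elt k w (u \<otimes>\<^bsub>W\<^esub> v)) z) (x \<otimes>\<^bsub>MA\<^esub> y)"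
        by (rule conv_apply[OF conv_closed[OF x y] z])
      also have "\<dots> = ?l (\<lambda>u. ?l (\<lambda>u'. ?l (\<lambda>v. basis_elt k w (u \<otimes>\<^bsub>W\<^esub> u' \<otimes>\<^bsub>W\<^esub> v)) z) y) x"
        by (rule lin_conv[OF KK.left_module_axioms _ x y]) (auto intro: inner_closed z)
      also have "\<dots> = ?l (\<lambda>u. ?l (\<lambda>v. basis_elt k w (u \<otimes>\<^bsub>W\<^esub> v)) (y \<otimes>\<^bsub>MA\<^esub> z)) x"
      proof (rule KK.lin_cong[OF xs])
        show "(\<lambda>u. ?l (\<lambda>v. basis_elt k w (u \<otimes>\<^bsub>W\<^esub> v)) (y \<otimes>\<^bsub>MA\<^esub> z)) \<in> carrier W \<rightarrow> carrier (self_module k)"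
          by (auto intro!: inner_closed conv_closed y z)
        fix u assume u: "u \<in> carrier W"
        have "?l (\<lambda>v. basis_elt k w (u \<otimes>\<^bsub>W\<^esub> v)) (y \<otimes>\<^bsub>MA\<^esub> z)
          = ?l (\<lambda>u'. ?l (\<lambda>v. basis_elt k w (u \<otimes>\<^bsub>W\<^esub> (u' \<otimes>\<^bsub>W\<^esub> v))) z) y"
          by (rule lin_conv[OF KK.left_module_axioms _ y z]) (auto simp: bwc)
        also have "\<dots> = ?l (\<lambda>u'. ?l (\<lambda>v. basis_elt k w (u \<otimes>\<^bsub>W\<^esub> u' \<otimes>\<^bsub>W\<^esub> v)) z) y"
          by (rule KK.lin_cong[OF ys]) (auto intro!: inner_closed z KK.lin_cong[OF z[unfolded monoid_algebra_carrier]]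
            simp: W.m_assoc u bwc)
        finally show "?l (\<lambda>u'. ?l (\<lambda>v. basis_elt k w (u \<otimes>\<^bsub>W\<^esub> u' \<otimes>\<^bsub>W\<^esub> v)) z) y
          = ?l (\<lambda>v. basis_elt k w (u \<otimes>\<^bsub>W\<^esub> v)) (y \<otimes>\<^bsub>MA\<^esub> z)" by simp
      qed
      also have "\<dots> = (x \<otimes>\<^bsub>MA\<^esub> (y \<otimes>\<^bsub>MA\<^esub> z)) w"
        by (rule conv_apply[OF x conv_closed[OF y z], symmetric])
      finally show "(x \<otimes>\<^bsub>MA\<^esub> y \<otimes>\<^bsub>MA\<^esub> z) w = (x \<otimes>\<^bsub>MA\<^esub> (y \<otimes>\<^bsub>MA\<^esub> z)) w" .
    qed
  next
    fix x assume x: "x \<in> carrier MA"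
    have one: "\<one>\<^bsub>MA\<^esub> \<in> carrier MA"
      by (auto simp: monoid_algebra_simps monoid_algebra_carrier intro: K.fsupp_basis_elt)
    have xs: "x \<in> fsupp k (carrier W)" using x by (auto simp: monoid_algebra_carrier)
    let ?l = "lin k (self_module k)"
    show "\<one>\<^bsub>MA\<^esub> \<otimes>\<^bsub>MA\<^esub> x = x"
    proof
      fix w
      have "(\<one>\<^bsub>MA\<^esub> \<otimes>\<^bsub>MA\<^esub> x) w = ?l (\<lambda>v. basis_elt k w (\<one>\<^bsub>W\<^esub> \<otimes>\<^bsub>W\<^esub> v)) x"
        unfolding conv_apply[OF one x] unfolding monoid_algebra_simps
        by (rule KK.lin_basis_elt) (auto intro: inner_closed x)
      also have "\<dots> = ?l (basis_elt k w) x"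
        by (rule KK.lin_cong[OF xs]) (auto simp: bwc)
      finally show "(\<one>\<^bsub>MA\<^esub> \<otimes>\<^bsub>MA\<^esub> x) w = x w" using fsupp_coordinate[OF K.ring_axioms xs] by simp
    qed
    show "x \<otimes>\<^bsub>MA\<^esub> \<one>\<^bsub>MA\<^esub> = x"
    proof
      fix w
      have "(x \<otimes>\<^bsub>MA\<^esub> \<one>\<^bsub>MA\<^esub>) w = ?l (basis_elt k w) x"
        unfolding conv_apply[OF x one] unfolding monoid_algebra_simps
        by (rule KK.lin_cong[OF xs]) (auto simp: bwc KK.lin_basis_elt)
      then show "(x \<otimes>\<^bsub>MA\<^esub> \<one>\<^bsub>MA\<^esub>) w = x w" using fsupp_coordinate[OF K.ring_axioms xs] by simp
    qed
  qed (rule conv_closed)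
  fix x y z assume x: "x \<in> carrier MA" and y: "y \<in> carrier MA" and z: "z \<in> carrier MA"
  interpret MA: abelian_group MA by (rule abelian_group_MA)
  have xs: "x \<in> fsupp k (carrier W)" and ys: "y \<in> fsupp k (carrier W)" and zs: "z \<in> fsupp k (carrier W)"
    using x y z by (auto simp: monoid_algebra_carrier)
  show "(x \<oplus>\<^bsub>MA\<^esub> y) \<otimes>\<^bsub>MA\<^esub> z = x \<otimes>\<^bsub>MA\<^esub> z \<oplus>\<^bsub>MA\<^esub> y \<otimes>\<^bsub>MA\<^esub> z"
  proof
    fix w
    show "((x \<oplus>\<^bsub>MA\<^esub> y) \<otimes>\<^bsub>MA\<^esub> z) w = (x \<otimes>\<^bsub>MA\<^esub> z \<oplus>\<^bsub>MA\<^esub> y \<otimes>\<^bsub>MA\<^esub> z) w"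
      unfolding conv_apply[OF MA.a_closed[OF x y] z] unfolding monoid_algebra_simps conv_apply[OF x z] conv_apply[OF y z]
      by (subst KK.lin_add[OF xs ys]) (auto intro: inner_closed z)
  qed
  show "z \<otimes>\<^bsub>MA\<^esub> (x \<oplus>\<^bsub>MA\<^esub> y) = z \<otimes>\<^bsub>MA\<^esub> x \<oplus>\<^bsub>MA\<^esub> z \<otimes>\<^bsub>MA\<^esub> y"
  proof
    fix w
    let ?l = "lin k (self_module k)"
    have "?l (\<lambda>v. basis_elt k w (u \<otimes>\<^bsub>W\<^esub> v)) (\<lambda>w. x w \<oplus>\<^bsub>k\<^esub> y w)
      = ?l (\<lambda>v. basis_elt k w (u \<otimes>\<^bsub>W\<^esub> v)) x \<oplus>\<^bsub>self_module k\<^esub> ?l (\<lambda>v. basis_elt k w (u \<otimes>\<^bsub>W\<^esub> v)) y" for u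
      by (rule KK.lin_add[OF xs ys]) (auto simp: bwc)
    then show "(z \<otimes>\<^bsub>MA\<^esub> (x \<oplus>\<^bsub>MA\<^esub> y)) w = (z \<otimes>\<^bsub>MA\<^esub> x \<oplus>\<^bsub>MA\<^esub> z \<otimes>\<^bsub>MA\<^esub> y) w"
      unfolding conv_apply[OF z MA.a_closed[OF x y]] unfolding monoid_algebra_simps conv_apply[OF z x] conv_apply[OF z y]
      by (simp, subst KK.lin_fun_add[OF zs, simplified]) (auto intro: inner_closed x y)
  qed
qed

sublocale MA: kalgebra k MA
proof -
  interpret MA: ring MA by (rule ring_MA)
  interpret L: left_module k MA
    by unfold_locales (auto simp: monoid_algebra_simps monoid_algebra_carrier fsuppD K.l_distr K.r_distr K.m_assoc
        intro!: K.fsupp_smult)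
  show "kalgebra k MA"
  proof unfold_locales
    fix c d a b assume c: "c \<in> carrier k"
    show "d \<in> carrier k \<Longrightarrow> c \<otimes>\<^bsub>k\<^esub> d = d \<otimes>\<^bsub>k\<^esub> c" using c by (rule K.m_comm)
    assume a: "a \<in> carrier MA" and b: "b \<in> carrier MA"
    have as: "a \<in> fsupp k (carrier W)" and bs: "b \<in> fsupp k (carrier W)"
      using a b by (auto simp: monoid_algebra_carrier)
    note ca = L.smult_closed[OF c a] and cb = L.smult_closed[OF c b]
    show "(c \<odot>\<^bsub>MA\<^esub> a) \<otimes>\<^bsub>MA\<^esub> b = c \<odot>\<^bsub>MA\<^esub> (a \<otimes>\<^bsub>MA\<^esub> b)"
    proof
      fix w
      show "((c \<odot>\<^bsub>MA\<^esub> a) \<otimes>\<^bsub>MA\<^esub> b) w = (c \<odot>\<^bsub>MA\<^esub> (a \<otimes>\<^bsub>MA\<^esub> b)) w"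
        unfolding conv_apply[OF ca b] unfolding monoid_algebra_simps conv_apply[OF a b]
        by (subst KK.lin_smult[OF as _ c]) (auto intro: inner_closed b)
    qed
    show "a \<otimes>\<^bsub>MA\<^esub> (c \<odot>\<^bsub>MA\<^esub> b) = c \<odot>\<^bsub>MA\<^esub> (a \<otimes>\<^bsub>MA\<^esub> b)"
    proof
      fix w
      let ?l = "lin k (self_module k)"
      have "?l (\<lambda>v. basis_elt k w (u \<otimes>\<^bsub>W\<^esub> v)) (\<lambda>w. c \<otimes>\<^bsub>k\<^esub> b w)
        = c \<odot>\<^bsub>self_module k\<^esub> ?l (\<lambda>v. basis_elt k w (u \<otimes>\<^bsub>W\<^esub> v)) b" for u
        by (rule KK.lin_smult[OF bs _ c]) (auto simp: bwc)
      then show "(a \<otimes>\<^bsub>MA\<^esub> (c \<odot>\<^bsub>MA\<^esub> b)) w = (c \<odot>\<^bsub>MA\<^esub> (a \<otimes>\<^bsub>MA\<^esub> b)) w"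
        unfolding conv_apply[OF a cb] unfolding monoid_algebra_simps conv_apply[OF a b]
        using lin_smult_fun[OF KK.left_module_axioms as _ c, of "\<lambda>u. ?l (\<lambda>v. basis_elt k w (u \<otimes>\<^bsub>W\<^esub> v)) b"]
        by (auto simp: inner_closed b)
    qed
  qed
qed

lemma basis_elt_closed: "u \<in> carrier W \<Longrightarrow> basis_elt k u \<in> carrier MA"
  by (auto simp: monoid_algebra_carrier intro: K.fsupp_basis_elt)

lemma basis_elt_mult:
  assumes u: "u \<in> carrier W" and v: "v \<in> carrier W"
  shows "basis_elt k u \<otimes>\<^bsub>MA\<^esub> basis_elt k v = basis_elt k (u \<otimes>\<^bsub>W\<^esub> v)"
proof
  fix w
  show "(basis_elt k u \<otimes>\<^bsub>MA\<^esub> basis_elt k v) w = basis_elt k (u \<otimes>\<^bsub>W\<^esub> v) w"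
    unfolding conv_apply[OF basis_elt_closed[OF u] basis_elt_closed[OF v]]
    by (subst KK.lin_basis_elt) (auto simp: basis_elt_def KK.lin_basis_elt[unfolded basis_elt_def])
qed

lemma lin_basis_elt_id:
  assumes f: "f \<in> carrier MA"
  shows "lin k MA (basis_elt k) f = f"
proof
  fix w
  have fs: "f \<in> fsupp k (carrier W)" using f by (auto simp: monoid_algebra_carrier)
  have hom: "(\<lambda>g. g w) \<in> LinearCombinations.module_hom k MA (self_module k)"
    by (auto simp: LinearCombinations.module_hom_def monoid_algebra_simps monoid_algebra_carrier fsuppD)
  have "lin k MA (basis_elt k) f w = lin k (self_module k) (\<lambda>u. basis_elt k u w) f"
    by (rule lin_hom[OF MA.left_module_axioms KK.left_module_axioms hom fs]) (auto intro: basis_elt_closed)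
  also have "(\<lambda>u. basis_elt k u w) = basis_elt k w" by (auto simp: basis_elt_def)
  finally show "lin k MA (basis_elt k) f w = f w" using fsupp_coordinate[OF K.ring_axioms fs] by simp
qed

end

section \<open>Quotients\<close>

lemma quotient_carrier: "carrier (quotient A I) = (\<lambda>x. I +>\<^bsub>A\<^esub> x) ` carrier A"
  by (auto simp: quotient_def FactRing_def A_RCOSETS_def')

locale quotient_loc = Q?: abelian_subgroup I A for I and A :: "('s, 'a) module" (structure)
begin

lemma quotient_closed: "x \<in> carrier A \<Longrightarrow> I +>\<^bsub>A\<^esub> x \<in> carrier (quotient A I)"
  by (auto simp: quotient_carrier)

lemma quotient_add: "\<lbrakk>x \<in> carrier A; y \<in> carrier A\<rbrakk> \<Longrightarrow>
    (I +>\<^bsub>A\<^esub> x) \<oplus>\<^bsub>quotient A I\<^esub> (I +>\<^bsub>A\<^esub> y) = I +>\<^bsub>A\<^esub> (x \<oplus>\<^bsub>A\<^esub> y)"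
  by (simp add: quotient_def FactRing_def a_rcos_sum)

lemma quotient_zero: "\<zero>\<^bsub>quotient A I\<^esub> = I +>\<^bsub>A\<^esub> \<zero>\<^bsub>A\<^esub>"
  by (simp add: quotient_def FactRing_def a_subset)

lemma quotient_eq_iff: "\<lbrakk>x \<in> carrier A; y \<in> carrier A\<rbrakk> \<Longrightarrow>
    I +>\<^bsub>A\<^esub> x = I +>\<^bsub>A\<^esub> y \<longleftrightarrow> x \<ominus>\<^bsub>A\<^esub> y \<in> I"
  using a_rcos_module[of y x] a_repr_independence'[of x y] a_rcos_self[of x] by (auto simp: a_minus_def)

lemma quotient_eq_zero_iff: "x \<in> carrier A \<Longrightarrow> I +>\<^bsub>A\<^esub> x = \<zero>\<^bsub>quotient A I\<^esub> \<longleftrightarrow> x \<in> I"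
  using a_repr_independence'[of x "\<zero>\<^bsub>A\<^esub>"] a_rcos_self[of x] a_subset by (auto simp: quotient_zero)

lemma abelian_group_quotient: "abelian_group (quotient A I)"
proof (rule abelian_groupI)
  fix C assume "C \<in> carrier (quotient A I)"
  then obtain x where x: "x \<in> carrier A" "C = I +>\<^bsub>A\<^esub> x" by (auto simp: quotient_carrier)
  then have "(I +>\<^bsub>A\<^esub> (\<ominus>\<^bsub>A\<^esub> x)) \<oplus>\<^bsub>quotient A I\<^esub> C = \<zero>\<^bsub>quotient A I\<^esub>"
    by (simp add: quotient_add quotient_zero l_neg)
  then show "\<exists>D\<in>carrier (quotient A I). D \<oplus>\<^bsub>quotient A I\<^esub> C = \<zero>\<^bsub>quotient A I\<^esub>"
    using x by (auto simp: quotient_carrier)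
qed (auto simp: quotient_carrier quotient_add quotient_zero a_ac)

text \<open>The action on a quotient is defined as a union of cosets over all representatives.
  Stability of \<open>I\<close> under \<open>c\<close> makes these cosets coincide, so the union is
  a single coset. The statement concerns one fixed \<open>c\<close>, so it can be used before any
  module structure on the quotient is known.\<close>

lemma quotient_smult:
  assumes c: "\<And>x. x \<in> carrier A \<Longrightarrow> c \<odot>\<^bsub>A\<^esub> x \<in> carrier A"
    and add: "\<And>x y. \<lbrakk>x \<in> carrier A; y \<in> carrier A\<rbrakk> \<Longrightarrow> c \<odot>\<^bsub>A\<^esub> (x \<oplus>\<^bsub>A\<^esub> y) = c \<odot>\<^bsub>A\<^esub> x \<oplus>\<^bsub>A\<^esub> c \<odot>\<^bsub>A\<^esub> y"
    and I: "\<And>x. x \<in> I \<Longrightarrow> c \<odot>\<^bsub>A\<^esub> x \<in> I"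
    and x: "x \<in> carrier A"
  shows "c \<odot>\<^bsub>quotient A I\<^esub> (I +>\<^bsub>A\<^esub> x) = I +>\<^bsub>A\<^esub> (c \<odot>\<^bsub>A\<^esub> x)"
proof -
  have "I +>\<^bsub>A\<^esub> (c \<odot>\<^bsub>A\<^esub> y) = I +>\<^bsub>A\<^esub> (c \<odot>\<^bsub>A\<^esub> x)" if "y \<in> I +>\<^bsub>A\<^esub> x" for y
  proof -
    from that obtain h where h: "h \<in> I" "y = h \<oplus>\<^bsub>A\<^esub> x" by (auto simp: a_r_coset_def')
    have hc: "h \<in> carrier A" using h a_subset by auto
    have "c \<odot>\<^bsub>A\<^esub> y = c \<odot>\<^bsub>A\<^esub> h \<oplus>\<^bsub>A\<^esub> c \<odot>\<^bsub>A\<^esub> x" unfolding h(2) by (rule add[OF hc x])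
    then have "c \<odot>\<^bsub>A\<^esub> y \<ominus>\<^bsub>A\<^esub> c \<odot>\<^bsub>A\<^esub> x = c \<odot>\<^bsub>A\<^esub> h"
      using c[OF hc] c[OF x] by (simp add: a_minus_def a_assoc r_neg)
    moreover have "c \<odot>\<^bsub>A\<^esub> y \<in> carrier A" unfolding h(2) by (intro c a_closed hc x)
    ultimately show ?thesis using quotient_eq_iff[of "c \<odot>\<^bsub>A\<^esub> y" "c \<odot>\<^bsub>A\<^esub> x"] I[OF h(1)] c[OF x] by simp
  qed
  moreover have "x \<in> I +>\<^bsub>A\<^esub> x" by (rule a_rcos_self[OF x])
  ultimately have "(\<Union>y\<in>I +>\<^bsub>A\<^esub> x. I +>\<^bsub>A\<^esub> (c \<odot>\<^bsub>A\<^esub> y)) = I +>\<^bsub>A\<^esub> (c \<odot>\<^bsub>A\<^esub> x)" by blast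
  then show ?thesis by (simp add: quotient_def)
qed

end

text \<open>Serves twice: for algebras modulo ideals, and for cocycles modulo coboundaries.\<close>

lemma left_module_quotient:
  assumes A: "left_module S A" and I: "abelian_subgroup I A"
    and c: "\<And>c x. \<lbrakk>c \<in> carrier S; x \<in> I\<rbrakk> \<Longrightarrow> c \<odot>\<^bsub>A\<^esub> x \<in> I"
  shows "left_module S (quotient A I)"
    and "\<lbrakk>c \<in> carrier S; x \<in> carrier A\<rbrakk> \<Longrightarrow> c \<odot>\<^bsub>quotient A I\<^esub> (I +>\<^bsub>A\<^esub> x) = I +>\<^bsub>A\<^esub> (c \<odot>\<^bsub>A\<^esub> x)"
proof -
  interpret A: left_module S A by fact
  interpret quotient_loc I A by (rule quotient_loc.intro) fact
  interpret QQ: abelian_group "quotient A I" by (rule abelian_group_quotient)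
  have sm: "c \<odot>\<^bsub>quotient A I\<^esub> (I +>\<^bsub>A\<^esub> x) = I +>\<^bsub>A\<^esub> (c \<odot>\<^bsub>A\<^esub> x)" if "c \<in> carrier S" "x \<in> carrier A" for c x
    using that by (intro quotient_smult) (auto simp: A.smult_closed A.smult_r_distr c)
  then show "\<lbrakk>c \<in> carrier S; x \<in> carrier A\<rbrakk> \<Longrightarrow> c \<odot>\<^bsub>quotient A I\<^esub> (I +>\<^bsub>A\<^esub> x) = I +>\<^bsub>A\<^esub> (c \<odot>\<^bsub>A\<^esub> x)" .
  show "left_module S (quotient A I)"
    by unfold_locales (auto simp: quotient_carrier sm quotient_add A.smult_closed A.smult_l_distr
      A.smult_r_distr A.smult_assoc A.smult_one)
qed

text \<open>Scaling by \<open>c\<close> is multiplication by \<open>c 1\<close>, so ideals are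
  subspaces.\<close>

lemma (in kalgebra) ideal_smult_closed:
  assumes "ideal I A" "c \<in> carrier k" "x \<in> I"
  shows "c \<odot>\<^bsub>A\<^esub> x \<in> I"
proof -
  interpret I: ideal I A by fact
  have "x \<in> carrier A" using I.a_subset assms by auto
  then have "c \<odot>\<^bsub>A\<^esub> x = (c \<odot>\<^bsub>A\<^esub> \<one>\<^bsub>A\<^esub>) \<otimes>\<^bsub>A\<^esub> x"
    using assms by (simp add: smult_mult_l)
  then show ?thesis using assms I.I_l_closed smult_closed by simp
qed

locale ideal_quotient = KA?: kalgebra k A + I?: ideal I A
  for k :: "('k, 'z) ring_scheme" (structure) and A :: "('k, 'a) module" (structure) and I
begin

sublocale quotient_loc I A
  by (rule quotient_loc.intro) (rule I.abelian_subgroup_axioms)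

lemma quotient_smult': "\<lbrakk>c \<in> carrier k; x \<in> carrier A\<rbrakk> \<Longrightarrow> c \<odot>\<^bsub>quotient A I\<^esub> (I +>\<^bsub>A\<^esub> x) = I +>\<^bsub>A\<^esub> (c \<odot>\<^bsub>A\<^esub> x)"
  by (rule left_module_quotient(2)[OF KA.L.left_module_axioms I.abelian_subgroup_axioms])
    (auto intro: ideal_smult_closed I.ideal_axioms)

lemma quotient_mult: "\<lbrakk>x \<in> carrier A; y \<in> carrier A\<rbrakk> \<Longrightarrow>
    (I +>\<^bsub>A\<^esub> x) \<otimes>\<^bsub>quotient A I\<^esub> (I +>\<^bsub>A\<^esub> y) = I +>\<^bsub>A\<^esub> (x \<otimes>\<^bsub>A\<^esub> y)"
  by (simp add: quotient_def FactRing_def I.rcoset_mult_add)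

lemma quotient_one: "\<one>\<^bsub>quotient A I\<^esub> = I +>\<^bsub>A\<^esub> \<one>\<^bsub>A\<^esub>"
  by (simp add: quotient_def FactRing_def)

lemma kalgebra_quotient: "kalgebra k (quotient A I)"
proof -
  interpret L: left_module k "quotient A I"
    by (rule left_module_quotient(1)[OF KA.L.left_module_axioms I.abelian_subgroup_axioms])
      (auto intro: ideal_smult_closed I.ideal_axioms)
  show ?thesis
    by unfold_locales (auto simp: quotient_carrier quotient_mult quotient_one quotient_add quotient_smult'
      KA.A.m_assoc KA.A.l_distr KA.A.r_distr smult_mult_l smult_mult_r k_comm KA.L.smult_closed)
qed

lemma quotient_hom: "(\<lambda>x. I +>\<^bsub>A\<^esub> x) \<in> LinearCombinations.module_hom k A (quotient A I)"
  by (auto simp: LinearCombinations.module_hom_def quotient_carrier quotient_add quotient_smult')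

end

section \<open>Tensor products of algebras\<close>

definition bilinear ::
    "('k, 'z) ring_scheme \<Rightarrow> ('k, 'a) module \<Rightarrow> ('k, 'b) module \<Rightarrow> ('k, 'w) module \<Rightarrow> ('a \<Rightarrow> 'b \<Rightarrow> 'w) \<Rightarrow> bool"
  where "bilinear k A B W \<beta> \<longleftrightarrow>
    (\<forall>b\<in>carrier B. (\<lambda>a. \<beta> a b) \<in> LinearCombinations.module_hom k A W) \<and>
    (\<forall>a\<in>carrier A. \<beta> a \<in> LinearCombinations.module_hom k B W)"

lemma bilinearD:
  assumes "bilinear k A B W \<beta>"
  shows "\<lbrakk>a \<in> carrier A; b \<in> carrier B\<rbrakk> \<Longrightarrow> \<beta> a b \<in> carrier W"
    and "\<lbrakk>a \<in> carrier A; a' \<in> carrier A; b \<in> carrier B\<rbrakk> \<Longrightarrow> \<beta> (a \<oplus>\<^bsub>A\<^esub> a') b = \<beta> a b \<oplus>\<^bsub>W\<^esub> \<beta> a' b"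
    and "\<lbrakk>a \<in> carrier A; b \<in> carrier B; b' \<in> carrier B\<rbrakk> \<Longrightarrow> \<beta> a (b \<oplus>\<^bsub>B\<^esub> b') = \<beta> a b \<oplus>\<^bsub>W\<^esub> \<beta> a b'"
    and "\<lbrakk>c \<in> carrier k; a \<in> carrier A; b \<in> carrier B\<rbrakk> \<Longrightarrow> \<beta> (c \<odot>\<^bsub>A\<^esub> a) b = c \<odot>\<^bsub>W\<^esub> \<beta> a b"
    and "\<lbrakk>c \<in> carrier k; a \<in> carrier A; b \<in> carrier B\<rbrakk> \<Longrightarrow> \<beta> a (c \<odot>\<^bsub>B\<^esub> b) = c \<odot>\<^bsub>W\<^esub> \<beta> a b"
  using assms by (auto simp: bilinear_def LinearCombinations.module_hom_def)

lemma bilinearI: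
  assumes "\<And>a b. \<lbrakk>a \<in> carrier A; b \<in> carrier B\<rbrakk> \<Longrightarrow> \<beta> a b \<in> carrier W"
    and "\<And>a a' b. \<lbrakk>a \<in> carrier A; a' \<in> carrier A; b \<in> carrier B\<rbrakk> \<Longrightarrow> \<beta> (a \<oplus>\<^bsub>A\<^esub> a') b = \<beta> a b \<oplus>\<^bsub>W\<^esub> \<beta> a' b"
    and "\<And>a b b'. \<lbrakk>a \<in> carrier A; b \<in> carrier B; b' \<in> carrier B\<rbrakk> \<Longrightarrow> \<beta> a (b \<oplus>\<^bsub>B\<^esub> b') = \<beta> a b \<oplus>\<^bsub>W\<^esub> \<beta> a b'"
    and "\<And>a b c. \<lbrakk>c \<in> carrier k; a \<in> carrier A; b \<in> carrier B\<rbrakk> \<Longrightarrow> \<beta> (c \<odot>\<^bsub>A\<^esub> a) b = c \<odot>\<^bsub>W\<^esub> \<beta> a b"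
    and "\<And>a b c. \<lbrakk>c \<in> carrier k; a \<in> carrier A; b \<in> carrier B\<rbrakk> \<Longrightarrow> \<beta> a (c \<odot>\<^bsub>B\<^esub> b) = c \<odot>\<^bsub>W\<^esub> \<beta> a b"
  shows "bilinear k A B W \<beta>"
  using assms by (auto simp: bilinear_def LinearCombinations.module_hom_def)

locale tensor_loc = TA?: kalgebra k A + TB?: kalgebra k B
  for k :: "('k, 'z) ring_scheme" (structure) and A :: "('k, 'a) module" and B :: "('k, 'b) module"
begin

sublocale monoid_algebra_loc k "A \<times>\<times> B"
  by (intro monoid_algebra_loc.intro TA.cring_k DirProd_monoid TA.A.is_monoid TB.A.is_monoid)

abbreviation "F \<equiv> monoid_algebra k (A \<times>\<times> B)"
abbreviation "I \<equiv> Idl\<^bsub>F\<^esub> (bilinear_relations k A B)"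
abbreviation "T \<equiv> tensor_algebra k A B"
abbreviation "cls \<equiv> \<lambda>f. I +>\<^bsub>F\<^esub> f"
abbreviation "blin \<equiv> \<lambda>W \<beta>. lin k W (\<lambda>p. \<beta> (fst p) (snd p))"

lemma DirProd_carrier: "carrier (A \<times>\<times> B) = carrier A \<times> carrier B"
  by (simp add: DirProd_def)

lemma T_eq: "T = quotient F I"
  by (simp add: tensor_algebra_def Let_def)

lemma bilinear_relationsI:
  "\<lbrakk>a \<in> carrier A; a' \<in> carrier A; b \<in> carrier B\<rbrakk> \<Longrightarrow>
    basis_elt k (a \<oplus>\<^bsub>A\<^esub> a', b) \<ominus>\<^bsub>F\<^esub> (basis_elt k (a, b) \<oplus>\<^bsub>F\<^esub> basis_elt k (a', b)) \<in> bilinear_relations k A B"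
  "\<lbrakk>a \<in> carrier A; b \<in> carrier B; b' \<in> carrier B\<rbrakk> \<Longrightarrow>
    basis_elt k (a, b \<oplus>\<^bsub>B\<^esub> b') \<ominus>\<^bsub>F\<^esub> (basis_elt k (a, b) \<oplus>\<^bsub>F\<^esub> basis_elt k (a, b')) \<in> bilinear_relations k A B"
  "\<lbrakk>c \<in> carrier k; a \<in> carrier A; b \<in> carrier B\<rbrakk> \<Longrightarrow>
    basis_elt k (c \<odot>\<^bsub>A\<^esub> a, b) \<ominus>\<^bsub>F\<^esub> c \<odot>\<^bsub>F\<^esub> basis_elt k (a, b) \<in> bilinear_relations k A B"
  "\<lbrakk>c \<in> carrier k; a \<in> carrier A; b \<in> carrier B\<rbrakk> \<Longrightarrow>
    basis_elt k (a, c \<odot>\<^bsub>B\<^esub> b) \<ominus>\<^bsub>F\<^esub> c \<odot>\<^bsub>F\<^esub> basis_elt k (a, b) \<in> bilinear_relations k A B"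
  unfolding bilinear_relations_def Let_def
     apply (rule UnI1, rule UnI1, rule UnI1, rule CollectI, rule exI, rule exI, rule exI, rule conjI[OF refl], simp)
    apply (rule UnI1, rule UnI1, rule UnI2, rule CollectI, rule exI, rule exI, rule exI, rule conjI[OF refl], simp)
   apply (rule UnI1, rule UnI2, rule CollectI, rule exI, rule exI, rule exI, rule conjI[OF refl], simp)
  apply (rule UnI2, rule CollectI, rule exI, rule exI, rule exI, rule conjI[OF refl], simp)
  done

lemma bilinear_relationsE:
  assumes "r \<in> bilinear_relations k A B"
  obtains (addl) a a' b where "a \<in> carrier A" "a' \<in> carrier A" "b \<in> carrier B"
      "r = basis_elt k (a \<oplus>\<^bsub>A\<^esub> a', b) \<ominus>\<^bsub>F\<^esub> (basis_elt k (a, b) \<oplus>\<^bsub>F\<^esub> basis_elt k (a', b))"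
    | (addr) a b b' where "a \<in> carrier A" "b \<in> carrier B" "b' \<in> carrier B"
      "r = basis_elt k (a, b \<oplus>\<^bsub>B\<^esub> b') \<ominus>\<^bsub>F\<^esub> (basis_elt k (a, b) \<oplus>\<^bsub>F\<^esub> basis_elt k (a, b'))"
    | (smultl) c a b where "c \<in> carrier k" "a \<in> carrier A" "b \<in> carrier B"
      "r = basis_elt k (c \<odot>\<^bsub>A\<^esub> a, b) \<ominus>\<^bsub>F\<^esub> c \<odot>\<^bsub>F\<^esub> basis_elt k (a, b)"
    | (smultr) c a b where "c \<in> carrier k" "a \<in> carrier A" "b \<in> carrier B"
      "r = basis_elt k (a, c \<odot>\<^bsub>B\<^esub> b) \<ominus>\<^bsub>F\<^esub> c \<odot>\<^bsub>F\<^esub> basis_elt k (a, b)"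
  using assms unfolding bilinear_relations_def Let_def
  by (elim UnE CollectE exE conjE) (rule addl addr smultl smultr; assumption)+

lemma basis_pair: "\<lbrakk>a \<in> carrier A; b \<in> carrier B\<rbrakk> \<Longrightarrow> basis_elt k (a, b) \<in> carrier F"
  by (intro basis_elt_closed) (simp add: DirProd_carrier)

lemma relations_closed: "bilinear_relations k A B \<subseteq> carrier F"
proof
  fix r assume "r \<in> bilinear_relations k A B"
  then show "r \<in> carrier F"
    by (cases rule: bilinear_relationsE)
      (simp_all add: basis_pair TA.L.smult_closed TB.L.smult_closed MA.L.smult_closed)
qed

sublocale IQ: ideal_quotient k F I
  by (intro ideal_quotient.intro MA.kalgebra_axioms MA.A.genideal_ideal relations_closed)

lemma kalgebra_T: "kalgebra k T"
  unfolding T_eq by (rule IQ.kalgebra_quotient)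

lemma cls_hom: "cls \<in> LinearCombinations.module_hom k F T"
  unfolding T_eq by (rule IQ.quotient_hom)

definition tens :: "'a \<Rightarrow> 'b \<Rightarrow> ('a \<times> 'b \<Rightarrow> 'k) set"
  where "tens a b = cls (basis_elt k (a, b))"

lemma cls_eqI: "\<lbrakk>x \<ominus>\<^bsub>F\<^esub> y \<in> bilinear_relations k A B; x \<in> carrier F; y \<in> carrier F\<rbrakk> \<Longrightarrow> cls x = cls y"
  using MA.A.genideal_self[OF relations_closed] by (auto simp: IQ.quotient_eq_iff)

lemma tens_bilinear: "bilinear k A B T tens"
proof (rule bilinearI)
  show "tens a b \<in> carrier T" if "a \<in> carrier A" "b \<in> carrier B" for a b
    using that basis_pair by (auto simp: tens_def T_eq IQ.quotient_closed)
next
  fix a a' b assume H: "a \<in> carrier A" "a' \<in> carrier A" "b \<in> carrier B"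
  have "cls (basis_elt k (a \<oplus>\<^bsub>A\<^esub> a', b)) = cls (basis_elt k (a, b) \<oplus>\<^bsub>F\<^esub> basis_elt k (a', b))"
    by (rule cls_eqI, rule bilinear_relationsI(1)) (use H in \<open>simp_all add: basis_pair TA.L.smult_closed TB.L.smult_closed MA.L.smult_closed\<close>)
  then show "tens (a \<oplus>\<^bsub>A\<^esub> a') b = tens a b \<oplus>\<^bsub>T\<^esub> tens a' b"
    unfolding tens_def T_eq using H basis_pair by (simp add: IQ.quotient_add)
next
  fix a b b' assume H: "a \<in> carrier A" "b \<in> carrier B" "b' \<in> carrier B"
  have "cls (basis_elt k (a, b \<oplus>\<^bsub>B\<^esub> b')) = cls (basis_elt k (a, b) \<oplus>\<^bsub>F\<^esub> basis_elt k (a, b'))"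
    by (rule cls_eqI, rule bilinear_relationsI(2)) (use H in \<open>simp_all add: basis_pair TA.L.smult_closed TB.L.smult_closed MA.L.smult_closed\<close>)
  then show "tens a (b \<oplus>\<^bsub>B\<^esub> b') = tens a b \<oplus>\<^bsub>T\<^esub> tens a b'"
    unfolding tens_def T_eq using H basis_pair by (simp add: IQ.quotient_add)
next
  fix a b c assume H: "c \<in> carrier k" "a \<in> carrier A" "b \<in> carrier B"
  have "cls (basis_elt k (c \<odot>\<^bsub>A\<^esub> a, b)) = cls (c \<odot>\<^bsub>F\<^esub> basis_elt k (a, b))"
    by (rule cls_eqI, rule bilinear_relationsI(3)) (use H in \<open>simp_all add: basis_pair TA.L.smult_closed TB.L.smult_closed MA.L.smult_closed\<close>)
  then show "tens (c \<odot>\<^bsub>A\<^esub> a) b = c \<odot>\<^bsub>T\<^esub> tens a b"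
    unfolding tens_def T_eq using H basis_pair by (simp add: IQ.quotient_smult')
  have "cls (basis_elt k (a, c \<odot>\<^bsub>B\<^esub> b)) = cls (c \<odot>\<^bsub>F\<^esub> basis_elt k (a, b))"
    by (rule cls_eqI, rule bilinear_relationsI(4)) (use H in \<open>simp_all add: basis_pair TA.L.smult_closed TB.L.smult_closed MA.L.smult_closed\<close>)
  then show "tens a (c \<odot>\<^bsub>B\<^esub> b) = c \<odot>\<^bsub>T\<^esub> tens a b"
    unfolding tens_def T_eq using H basis_pair by (simp add: IQ.quotient_smult')
qed

lemmas tens_closed = bilinearD(1)[OF tens_bilinear]

lemma tens_mult:
  "\<lbrakk>a \<in> carrier A; a' \<in> carrier A; b \<in> carrier B; b' \<in> carrier B\<rbrakk> \<Longrightarrow>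
    tens a b \<otimes>\<^bsub>T\<^esub> tens a' b' = tens (a \<otimes>\<^bsub>A\<^esub> a') (b \<otimes>\<^bsub>B\<^esub> b')"
  unfolding tens_def T_eq
  by (simp add: IQ.quotient_mult basis_pair basis_elt_mult DirProd_carrier)

lemma tens_one: "\<one>\<^bsub>T\<^esub> = tens \<one>\<^bsub>A\<^esub> \<one>\<^bsub>B\<^esub>"
  unfolding tens_def T_eq by (simp add: IQ.quotient_one monoid_algebra_simps)

lemma T_carrier: "carrier T = cls ` carrier F"
  unfolding T_eq by (rule quotient_carrier)

lemma cls_lin:
  assumes f: "f \<in> carrier F"
  shows "cls f = blin T tens f"
proof -
  interpret T: kalgebra k T by (rule kalgebra_T)
  have "cls f = cls (lin k F (basis_elt k) f)" by (simp add: lin_basis_elt_id f)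
  also have "\<dots> = lin k T (\<lambda>p. cls (basis_elt k p)) f"
    by (rule lin_hom[OF MA.L.left_module_axioms T.L.left_module_axioms cls_hom
      f[unfolded monoid_algebra_carrier]]) (auto intro: basis_elt_closed)
  finally show ?thesis by (simp add: tens_def)
qed

lemma tensor_hom_ext:
  assumes W: "left_module k W" and \<phi>: "\<phi> \<in> LinearCombinations.module_hom k T W"
    and \<psi>: "\<psi> \<in> LinearCombinations.module_hom k T W"
    and eq: "\<And>a b. \<lbrakk>a \<in> carrier A; b \<in> carrier B\<rbrakk> \<Longrightarrow> \<phi> (tens a b) = \<psi> (tens a b)"
    and z: "z \<in> carrier T"
  shows "\<phi> z = \<psi> z"
proof -
  interpret W: left_module k W by fact
  interpret T: kalgebra k T by (rule kalgebra_T)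
  from z obtain f where f: "f \<in> carrier F" "z = cls f" by (auto simp: T_carrier)
  note fs = f(1)[unfolded monoid_algebra_carrier DirProd_carrier]
  have tc: "(\<lambda>p. tens (fst p) (snd p)) \<in> carrier A \<times> carrier B \<rightarrow> carrier T"
    using tens_closed by auto
  have "\<phi> z = lin k W (\<lambda>p. \<phi> (tens (fst p) (snd p))) f"
    unfolding f(2) cls_lin[OF f(1)]
    by (rule lin_hom[OF T.L.left_module_axioms W \<phi> fs tc])
  also have "\<dots> = lin k W (\<lambda>p. \<psi> (tens (fst p) (snd p))) f"
    using \<psi> tens_closed eq by (intro W.lin_cong[OF fs]) (auto simp: LinearCombinations.module_hom_def Pi_def)
  also have "\<dots> = \<psi> z"
    unfolding f(2) cls_lin[OF f(1)]
    by (rule lin_hom[OF T.L.left_module_axioms W \<psi> fs tc, symmetric])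
  finally show ?thesis .
qed

section \<open>The universal property of the tensor product\<close>

lemma blin_closed:
  assumes "left_module k W" "bilinear k A B W \<beta>" "f \<in> carrier F"
  shows "blin W \<beta> f \<in> carrier W"
  by (rule left_module.lin_closed[OF assms(1), of _ "carrier A \<times> carrier B"])
    (use assms(3) bilinearD(1)[OF assms(2)] in \<open>auto simp: monoid_algebra_carrier DirProd_carrier\<close>)

lemma blin_hom:
  assumes W: "left_module k W" and \<beta>: "bilinear k A B W \<beta>"
  shows "blin W \<beta> \<in> LinearCombinations.module_hom k F W"
proof -
  interpret W: left_module k W by fact
  have c: "(\<lambda>p. \<beta> (fst p) (snd p)) \<in> carrier A \<times> carrier B \<rightarrow> carrier W"
    using bilinearD(1)[OF \<beta>] by auto
  show ?thesis
    unfolding LinearCombinations.module_hom_def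
    using blin_closed[OF W \<beta>] W.lin_add[OF _ _ c] W.lin_smult[OF _ c]
    by (auto simp: monoid_algebra_simps monoid_algebra_carrier DirProd_carrier)
qed

lemma blin_basis:
  assumes W: "left_module k W" and \<beta>: "bilinear k A B W \<beta>" and ab: "a \<in> carrier A" "b \<in> carrier B"
  shows "blin W \<beta> (basis_elt k (a, b)) = \<beta> a b"
proof -
  interpret W: left_module k W by fact
  have "\<beta> (fst (a, b)) (snd (a, b)) \<in> carrier W" using bilinearD(1)[OF \<beta> ab] by simp
  from W.lin_basis_elt[of "\<lambda>p. \<beta> (fst p) (snd p)" "(a, b)", OF this] show ?thesis by simp
qed

lemma blin_relations:
  assumes W: "left_module k W" and \<beta>: "bilinear k A B W \<beta>" and r: "r \<in> bilinear_relations k A B"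
  shows "blin W \<beta> r = \<zero>\<^bsub>W\<^esub>"
proof -
  interpret W: left_module k W by fact
  note hom = blin_hom[OF W \<beta>]
  have add: "blin W \<beta> (x \<oplus>\<^bsub>F\<^esub> y) = blin W \<beta> x \<oplus>\<^bsub>W\<^esub> blin W \<beta> y" if "x \<in> carrier F" "y \<in> carrier F" for x y
    using hom that by (auto simp: LinearCombinations.module_hom_def)
  have sm: "blin W \<beta> (c \<odot>\<^bsub>F\<^esub> y) = c \<odot>\<^bsub>W\<^esub> blin W \<beta> y" if "c \<in> carrier k" "y \<in> carrier F" for c y
    using hom that by (auto simp: LinearCombinations.module_hom_def)
  have min: "blin W \<beta> (x \<ominus>\<^bsub>F\<^esub> y) = blin W \<beta> x \<ominus>\<^bsub>W\<^esub> blin W \<beta> y" if "x \<in> carrier F" "y \<in> carrier F" for x y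
    using that add blin_closed[OF W \<beta>]
    by (intro additive_minus[OF MA.A.is_abelian_group W.M.abelian_group_axioms]) auto
  have self: "x \<ominus>\<^bsub>W\<^esub> x = \<zero>\<^bsub>W\<^esub>" if "x \<in> carrier W" for x using that by (simp add: a_minus_def W.M.r_neg)
  note b = blin_basis[OF W \<beta>] and bD = bilinearD[OF \<beta>]
  from r show ?thesis
    by (cases rule: bilinear_relationsE)
      (simp_all add: min add sm b bD basis_pair self TA.L.smult_closed TB.L.smult_closed MA.L.smult_closed W.smult_closed)
qed

text \<open>The relations generate an ideal, so vanishing on the relations must be propagated
  through products. Multiplying by a fixed element turns \<open>\<beta>\<close> into another
  bilinear map; the set \<open>J\<close> therefore demands vanishing under all bilinear maps into
  \<open>W\<close> at once, and then it is a two-sided ideal.\<close>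

lemma blin_ideal:
  assumes W: "left_module k W" and \<beta>: "bilinear k A B W \<beta>" and f: "f \<in> I"
  shows "blin W \<beta> f = \<zero>\<^bsub>W\<^esub>"
proof -
  interpret W: left_module k W by fact
  define J where "J = {f \<in> carrier F. \<forall>\<gamma>. bilinear k A B W \<gamma> \<longrightarrow> blin W \<gamma> f = \<zero>\<^bsub>W\<^esub>}"
  have hom: "blin W \<gamma> (x \<oplus>\<^bsub>F\<^esub> y) = blin W \<gamma> x \<oplus>\<^bsub>W\<^esub> blin W \<gamma> y"
    if "bilinear k A B W \<gamma>" "x \<in> carrier F" "y \<in> carrier F" for x y \<gamma>
    using blin_hom[OF W that(1)] that by (auto simp: LinearCombinations.module_hom_def)
  have inv: "blin W \<gamma> (\<ominus>\<^bsub>F\<^esub> x) = \<ominus>\<^bsub>W\<^esub> blin W \<gamma> x" if "bilinear k A B W \<gamma>" "x \<in> carrier F" for x \<gamma>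
    using that hom blin_closed[OF W that(1)]
    by (intro additive_uminus[OF MA.A.is_abelian_group W.M.abelian_group_axioms]) auto
  have zero: "blin W \<gamma> \<zero>\<^bsub>F\<^esub> = \<zero>\<^bsub>W\<^esub>" for \<gamma> by (simp add: monoid_algebra_simps W.lin_zero)
  have zlin: "lin k W h u = \<zero>\<^bsub>W\<^esub>" if "u \<in> carrier F" "\<And>p. p \<in> carrier A \<times> carrier B \<Longrightarrow> h p = \<zero>\<^bsub>W\<^esub>" for h u
  proof -
    have "lin k W h u = lin k W (\<lambda>_. \<zero>\<^bsub>W\<^esub>) u"
      using that by (intro W.lin_cong[of _ "carrier A \<times> carrier B"]) (auto simp: monoid_algebra_carrier DirProd_carrier)
    also have "\<dots> = \<zero>\<^bsub>W\<^esub>"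
      using fsuppD(1)[OF that(1)[unfolded monoid_algebra_carrier]] by (simp add: lin_def W.smult_r_zero)
    finally show ?thesis .
  qed
  have "ideal J F"
  proof (rule idealI)
    show "ring F" by (rule ring_MA)
    show "subgroup J (add_monoid F)"
      by (rule group.subgroupI[OF abelian_group.a_group[OF MA.A.is_abelian_group]]) (auto simp: J_def hom inv zero a_inv_def[symmetric] intro: exI[of _ "\<zero>\<^bsub>F\<^esub>"])
    fix x u assume x: "x \<in> J" and u: "u \<in> carrier F"
    then have xc: "x \<in> carrier F" and Jx: "\<And>\<gamma>. bilinear k A B W \<gamma> \<Longrightarrow> blin W \<gamma> x = \<zero>\<^bsub>W\<^esub>"
      unfolding J_def by auto
    have "blin W \<gamma> (u \<otimes>\<^bsub>F\<^esub> x) = \<zero>\<^bsub>W\<^esub>" if \<gamma>: "bilinear k A B W \<gamma>" for \<gamma>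
    proof -
      have "blin W \<gamma> (u \<otimes>\<^bsub>F\<^esub> x) = lin k W (\<lambda>p. lin k W (\<lambda>q. \<gamma> (fst (p \<otimes>\<^bsub>A \<times>\<times> B\<^esub> q)) (snd (p \<otimes>\<^bsub>A \<times>\<times> B\<^esub> q))) x) u"
        by (rule lin_conv[OF W _ u xc]) (auto simp: DirProd_carrier bilinearD(1)[OF \<gamma>])
      also have "\<dots> = \<zero>\<^bsub>W\<^esub>"
      proof (rule zlin[OF u])
        fix p assume p: "p \<in> carrier A \<times> carrier B"
        have "bilinear k A B W (\<lambda>a b. \<gamma> (fst p \<otimes>\<^bsub>A\<^esub> a) (snd p \<otimes>\<^bsub>B\<^esub> b))"
          using p by (intro bilinearI) (auto simp: bilinearD[OF \<gamma>] TA.A.r_distr TB.A.r_distr TA.smult_mult_r TB.smult_mult_r)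
        from Jx[OF this]
        show "lin k W (\<lambda>q. \<gamma> (fst (p \<otimes>\<^bsub>A \<times>\<times> B\<^esub> q)) (snd (p \<otimes>\<^bsub>A \<times>\<times> B\<^esub> q))) x = \<zero>\<^bsub>W\<^esub>"
          by (simp add: DirProd_def case_prod_beta)
      qed
      finally show ?thesis .
    qed
    then show "u \<otimes>\<^bsub>F\<^esub> x \<in> J" using u xc by (simp add: J_def)
    have "blin W \<gamma> (x \<otimes>\<^bsub>F\<^esub> u) = \<zero>\<^bsub>W\<^esub>" if \<gamma>: "bilinear k A B W \<gamma>" for \<gamma>
    proof -
      \<comment> \<open>In a product with \<open>u\<close> on the right the sum over
        \<open>u\<close> is the inner one. It is absorbed into a new bilinear map as a whole,
        whereas for \<open>u\<close> on the left each term of \<open>u\<close> gives its own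
        bilinear map.\<close>
      define \<delta> where "\<delta> = (\<lambda>a b. lin k W (\<lambda>q. \<gamma> (a \<otimes>\<^bsub>A\<^esub> fst q) (b \<otimes>\<^bsub>B\<^esub> snd q)) u)"
      note us = u[unfolded monoid_algebra_carrier DirProd_carrier]
      have "bilinear k A B W \<delta>"
      proof (rule bilinearI)
        show "\<delta> a b \<in> carrier W" if "a \<in> carrier A" "b \<in> carrier B" for a b
          unfolding \<delta>_def using that by (intro W.lin_closed[OF us]) (auto simp: bilinearD[OF \<gamma>])
      next
        fix a a' b assume H: "a \<in> carrier A" "a' \<in> carrier A" "b \<in> carrier B"
        have "\<delta> (a \<oplus>\<^bsub>A\<^esub> a') b = lin k W (\<lambda>q. \<gamma> (a \<otimes>\<^bsub>A\<^esub> fst q) (b \<otimes>\<^bsub>B\<^esub> snd q) \<oplus>\<^bsub>W\<^esub> \<gamma> (a' \<otimes>\<^bsub>A\<^esub> fst q) (b \<otimes>\<^bsub>B\<^esub> snd q)) u"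
          unfolding \<delta>_def using H by (intro W.lin_cong[OF us]) (auto simp: bilinearD[OF \<gamma>] TA.A.l_distr)
        then show "\<delta> (a \<oplus>\<^bsub>A\<^esub> a') b = \<delta> a b \<oplus>\<^bsub>W\<^esub> \<delta> a' b"
          unfolding \<delta>_def using H by (simp, subst W.lin_fun_add[OF us]) (auto simp: bilinearD[OF \<gamma>])
      next
        fix a b b' assume H: "a \<in> carrier A" "b \<in> carrier B" "b' \<in> carrier B"
        have "\<delta> a (b \<oplus>\<^bsub>B\<^esub> b') = lin k W (\<lambda>q. \<gamma> (a \<otimes>\<^bsub>A\<^esub> fst q) (b \<otimes>\<^bsub>B\<^esub> snd q) \<oplus>\<^bsub>W\<^esub> \<gamma> (a \<otimes>\<^bsub>A\<^esub> fst q) (b' \<otimes>\<^bsub>B\<^esub> snd q)) u"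
          unfolding \<delta>_def using H by (intro W.lin_cong[OF us]) (auto simp: bilinearD[OF \<gamma>] TB.A.l_distr)
        then show "\<delta> a (b \<oplus>\<^bsub>B\<^esub> b') = \<delta> a b \<oplus>\<^bsub>W\<^esub> \<delta> a b'"
          unfolding \<delta>_def using H by (simp, subst W.lin_fun_add[OF us]) (auto simp: bilinearD[OF \<gamma>])
      next
        fix a b c assume H: "c \<in> carrier k" "a \<in> carrier A" "b \<in> carrier B"
        have gc: "(\<lambda>q. \<gamma> (a \<otimes>\<^bsub>A\<^esub> fst q) (b \<otimes>\<^bsub>B\<^esub> snd q)) \<in> carrier A \<times> carrier B \<rightarrow> carrier W"
          using H by (auto simp: bilinearD[OF \<gamma>])
        have "\<delta> (c \<odot>\<^bsub>A\<^esub> a) b = lin k W (\<lambda>q. c \<odot>\<^bsub>W\<^esub> \<gamma> (a \<otimes>\<^bsub>A\<^esub> fst q) (b \<otimes>\<^bsub>B\<^esub> snd q)) u"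
          unfolding \<delta>_def using H by (intro W.lin_cong[OF us]) (auto simp: bilinearD[OF \<gamma>] TA.smult_mult_l W.smult_closed)
        then show "\<delta> (c \<odot>\<^bsub>A\<^esub> a) b = c \<odot>\<^bsub>W\<^esub> \<delta> a b"
          unfolding \<delta>_def using lin_smult_fun[OF W us gc H(1)] by simp
        have "\<delta> a (c \<odot>\<^bsub>B\<^esub> b) = lin k W (\<lambda>q. c \<odot>\<^bsub>W\<^esub> \<gamma> (a \<otimes>\<^bsub>A\<^esub> fst q) (b \<otimes>\<^bsub>B\<^esub> snd q)) u"
          unfolding \<delta>_def using H by (intro W.lin_cong[OF us]) (auto simp: bilinearD[OF \<gamma>] TB.smult_mult_l W.smult_closed)
        then show "\<delta> a (c \<odot>\<^bsub>B\<^esub> b) = c \<odot>\<^bsub>W\<^esub> \<delta> a b"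
          unfolding \<delta>_def using lin_smult_fun[OF W us gc H(1)] by simp
      qed
      then have "blin W \<delta> x = \<zero>\<^bsub>W\<^esub>" by (rule Jx)
      moreover have "blin W \<gamma> (x \<otimes>\<^bsub>F\<^esub> u) = lin k W (\<lambda>p. lin k W (\<lambda>q. \<gamma> (fst (p \<otimes>\<^bsub>A \<times>\<times> B\<^esub> q)) (snd (p \<otimes>\<^bsub>A \<times>\<times> B\<^esub> q))) u) x"
        by (rule lin_conv[OF W _ xc u]) (auto simp: DirProd_carrier bilinearD(1)[OF \<gamma>])
      moreover have "\<dots> = blin W \<delta> x"
        by (simp add: \<delta>_def DirProd_def case_prod_beta)
      ultimately show ?thesis by simp
    qed
    then show "x \<otimes>\<^bsub>F\<^esub> u \<in> J" using u xc by (simp add: J_def)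
  qed
  moreover have "bilinear_relations k A B \<subseteq> J"
    using relations_closed blin_relations[OF W] by (auto simp: J_def)
  ultimately have "I \<subseteq> J" by (rule MA.A.genideal_minimal)
  then show ?thesis using f \<beta> by (auto simp: J_def)
qed

text \<open>Taking the only element of the image of a coset, rather than the value at a chosen
  representative, makes the action in \<open>regular_bimodule\<close> literally an instance; see
  \<open>regular_smult\<close>.\<close>

definition tlift :: "('k, 'w) module \<Rightarrow> ('a \<Rightarrow> 'b \<Rightarrow> 'w) \<Rightarrow> ('a \<times> 'b \<Rightarrow> 'k) set \<Rightarrow> 'w"
  where "tlift W \<beta> C = the_elem (blin W \<beta> ` C)"

lemma tlift_cls:
  assumes W: "left_module k W" and \<beta>: "bilinear k A B W \<beta>" and f: "f \<in> carrier F"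
  shows "tlift W \<beta> (cls f) = blin W \<beta> f"
proof -
  interpret W: left_module k W by fact
  have "blin W \<beta> g = blin W \<beta> f" if "g \<in> cls f" for g
  proof -
    from that obtain h where h: "h \<in> I" "g = h \<oplus>\<^bsub>F\<^esub> f" by (auto simp: a_r_coset_def')
    then have "h \<in> carrier F" using IQ.I.a_subset by auto
    then have "blin W \<beta> g = blin W \<beta> h \<oplus>\<^bsub>W\<^esub> blin W \<beta> f"
      using blin_hom[OF W \<beta>] f h by (auto simp: LinearCombinations.module_hom_def)
    then show ?thesis using blin_ideal[OF W \<beta> h(1)] blin_closed[OF W \<beta> f] by simp
  qed
  moreover have "f \<in> cls f" by (rule IQ.a_rcos_self[OF f])
  ultimately have "blin W \<beta> ` cls f = {blin W \<beta> f}" by blast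
  then show ?thesis by (simp add: tlift_def)
qed

lemma tlift_hom:
  assumes W: "left_module k W" and \<beta>: "bilinear k A B W \<beta>"
  shows "tlift W \<beta> \<in> LinearCombinations.module_hom k T W"
  using blin_hom[OF W \<beta>]
  unfolding LinearCombinations.module_hom_def T_eq
  by (auto simp: quotient_carrier tlift_cls[OF W \<beta>] IQ.quotient_add IQ.quotient_smult' MA.L.smult_closed)

lemma tlift_tens:
  assumes "left_module k W" "bilinear k A B W \<beta>" "a \<in> carrier A" "b \<in> carrier B"
  shows "tlift W \<beta> (tens a b) = \<beta> a b"
  unfolding tens_def using assms by (simp add: tlift_cls basis_pair blin_basis)

end

section \<open>The enveloping algebra\<close>

lemma opposite_simps [simp]:
  "carrier (opposite A) = carrier A" "\<one>\<^bsub>opposite A\<^esub> = \<one>\<^bsub>A\<^esub>" "\<zero>\<^bsub>opposite A\<^esub> = \<zero>\<^bsub>A\<^esub>"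
  "x \<oplus>\<^bsub>opposite A\<^esub> y = x \<oplus>\<^bsub>A\<^esub> y" "x \<otimes>\<^bsub>opposite A\<^esub> y = y \<otimes>\<^bsub>A\<^esub> x" "c \<odot>\<^bsub>opposite A\<^esub> x = c \<odot>\<^bsub>A\<^esub> x"
  by (simp_all add: opposite_def)

lemma (in kalgebra) kalgebra_opposite: "kalgebra k (opposite A)"
proof -
  interpret O: abelian_group "opposite A"
    by (rule abelian_groupI) (auto simp: L.M.a_ac intro: L.M.l_neg exI bexI[of _ "\<ominus>\<^bsub>A\<^esub> _"])
  show ?thesis
    by unfold_locales (auto simp: A.m_assoc A.l_distr A.r_distr smult_l_distr smult_r_distr smult_assoc
      smult_mult_l smult_mult_r k_comm smult_closed smult_one)
qed

locale enveloping_loc = EA?: kalgebra k A for k :: "('k, 'z) ring_scheme" (structure) and A :: "('k, 'a) module"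
begin

sublocale E: tensor_loc k A "opposite A"
  by (intro tensor_loc.intro EA.kalgebra_axioms EA.kalgebra_opposite)

abbreviation "Env \<equiv> enveloping_algebra k A"
abbreviation "Reg \<equiv> regular_bimodule k A"

sublocale Env: kalgebra k Env
  unfolding enveloping_algebra_def by (rule E.kalgebra_T)

lemma regular_simps [simp]:
  "carrier Reg = carrier A" "\<zero>\<^bsub>Reg\<^esub> = \<zero>\<^bsub>A\<^esub>" "x \<oplus>\<^bsub>Reg\<^esub> y = x \<oplus>\<^bsub>A\<^esub> y"
  by (simp_all add: regular_bimodule_def)

lemma regular_smult: "T \<odot>\<^bsub>Reg\<^esub> x = E.tlift A (\<lambda>a b. a \<otimes>\<^bsub>A\<^esub> x \<otimes>\<^bsub>A\<^esub> b) T"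
  by (simp add: regular_bimodule_def E.tlift_def lin_def)

lemma sandwich_bilinear: "x \<in> carrier A \<Longrightarrow> bilinear k A (opposite A) A (\<lambda>a b. a \<otimes>\<^bsub>A\<^esub> x \<otimes>\<^bsub>A\<^esub> b)"
  by (rule bilinearI) (auto simp: EA.A.l_distr EA.A.r_distr smult_mult_l smult_mult_r)

lemma abelian_group_Reg: "abelian_group Reg"
  by (rule abelian_groupI) (auto simp: EA.L.M.a_ac intro: EA.L.M.l_neg exI bexI[of _ "\<ominus>\<^bsub>A\<^esub> _"])

lemma regular_tens:
  "\<lbrakk>a \<in> carrier A; b \<in> carrier A; x \<in> carrier A\<rbrakk> \<Longrightarrow> E.tens a b \<odot>\<^bsub>Reg\<^esub> x = a \<otimes>\<^bsub>A\<^esub> x \<otimes>\<^bsub>A\<^esub> b"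
  unfolding regular_smult
  by (rule E.tlift_tens[OF EA.L.left_module_axioms sandwich_bilinear]) auto

lemma regular_cls: "\<lbrakk>f \<in> carrier E.F; x \<in> carrier A\<rbrakk> \<Longrightarrow>
    E.cls f \<odot>\<^bsub>Reg\<^esub> x = E.blin A (\<lambda>a b. a \<otimes>\<^bsub>A\<^esub> x \<otimes>\<^bsub>A\<^esub> b) f"
  unfolding regular_smult by (rule E.tlift_cls[OF EA.L.left_module_axioms sandwich_bilinear])

lemma regular_smult_hom: "x \<in> carrier A \<Longrightarrow> (\<lambda>T. T \<odot>\<^bsub>Reg\<^esub> x) \<in> LinearCombinations.module_hom k Env A"
  unfolding regular_smult enveloping_algebra_def
  by (rule E.tlift_hom[OF EA.L.left_module_axioms sandwich_bilinear])

text \<open>For associativity, the product of two cosets is expanded by \<open>lin_conv\<close> into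
  an iterated sum; the inner sum passes through \<open>y \<mapsto> a y b\<close> because this map is
  linear. The reversed product of the opposite algebra is what makes the two right factors
  match.\<close>

sublocale Reg: left_module Env Reg
proof -
  interpret Rg: abelian_group Reg by (rule abelian_group_Reg)
  have hom: "C \<odot>\<^bsub>Reg\<^esub> x \<in> carrier A" "(C \<oplus>\<^bsub>Env\<^esub> D) \<odot>\<^bsub>Reg\<^esub> x = C \<odot>\<^bsub>Reg\<^esub> x \<oplus>\<^bsub>A\<^esub> D \<odot>\<^bsub>Reg\<^esub> x"
    if "C \<in> carrier Env" "D \<in> carrier Env" "x \<in> carrier A" for C D x
    using regular_smult_hom[OF that(3)] that by (auto simp: LinearCombinations.module_hom_def)
  have cc: "\<exists>f. f \<in> carrier E.F \<and> C = E.cls f" if "C \<in> carrier Env" for C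
    using that E.T_carrier by (auto simp: enveloping_algebra_def)
  show "left_module Env Reg"
  proof unfold_locales
    fix C x y assume C: "C \<in> carrier Env" and "x \<in> carrier Reg" "y \<in> carrier Reg"
    then have x: "x \<in> carrier A" and y: "y \<in> carrier A" by auto
    from cc[OF C] obtain f where f: "f \<in> carrier E.F" "C = E.cls f" by auto
    note fs = f(1)[unfolded monoid_algebra_carrier E.DirProd_carrier]
    have "E.blin A (\<lambda>a b. a \<otimes>\<^bsub>A\<^esub> (x \<oplus>\<^bsub>A\<^esub> y) \<otimes>\<^bsub>A\<^esub> b) f
      = lin k A (\<lambda>p. fst p \<otimes>\<^bsub>A\<^esub> x \<otimes>\<^bsub>A\<^esub> snd p \<oplus>\<^bsub>A\<^esub> fst p \<otimes>\<^bsub>A\<^esub> y \<otimes>\<^bsub>A\<^esub> snd p) f"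
      using x y by (intro EA.L.lin_cong[OF fs]) (auto simp: EA.A.l_distr EA.A.r_distr)
    also have "\<dots> = E.blin A (\<lambda>a b. a \<otimes>\<^bsub>A\<^esub> x \<otimes>\<^bsub>A\<^esub> b) f \<oplus>\<^bsub>A\<^esub> E.blin A (\<lambda>a b. a \<otimes>\<^bsub>A\<^esub> y \<otimes>\<^bsub>A\<^esub> b) f"
      using x y by (intro EA.L.lin_fun_add[OF fs]) auto
    finally show "C \<odot>\<^bsub>Reg\<^esub> (x \<oplus>\<^bsub>Reg\<^esub> y) = C \<odot>\<^bsub>Reg\<^esub> x \<oplus>\<^bsub>Reg\<^esub> C \<odot>\<^bsub>Reg\<^esub> y"
      using x y f by (simp add: regular_cls)
  next
    fix C D x assume C: "C \<in> carrier Env" and D: "D \<in> carrier Env" and "x \<in> carrier Reg"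
    then have x: "x \<in> carrier A" by auto
    from cc[OF C] obtain f where f: "f \<in> carrier E.F" "C = E.cls f" by auto
    from cc[OF D] obtain g where g: "g \<in> carrier E.F" "D = E.cls g" by auto
    note fs = f(1)[unfolded monoid_algebra_carrier E.DirProd_carrier]
    note gs = g(1)[unfolded monoid_algebra_carrier E.DirProd_carrier]
    have yx: "D \<odot>\<^bsub>Reg\<^esub> x \<in> carrier A" using hom(1)[OF D D x] .
    have XY: "C \<otimes>\<^bsub>Env\<^esub> D = E.cls (f \<otimes>\<^bsub>E.F\<^esub> g)"
      unfolding f(2) g(2) enveloping_algebra_def E.T_eq by (rule E.IQ.quotient_mult[OF f(1) g(1)])
    have "(C \<otimes>\<^bsub>Env\<^esub> D) \<odot>\<^bsub>Reg\<^esub> x = lin k A (\<lambda>p. fst p \<otimes>\<^bsub>A\<^esub> x \<otimes>\<^bsub>A\<^esub> snd p) (f \<otimes>\<^bsub>E.F\<^esub> g)"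
      unfolding XY by (rule regular_cls[OF E.MA.A.m_closed[OF f(1) g(1)] x])
    also have "\<dots> = lin k A (\<lambda>p. lin k A (\<lambda>q. fst (p \<otimes>\<^bsub>A \<times>\<times> opposite A\<^esub> q) \<otimes>\<^bsub>A\<^esub> x \<otimes>\<^bsub>A\<^esub> snd (p \<otimes>\<^bsub>A \<times>\<times> opposite A\<^esub> q)) g) f"
      by (rule E.lin_conv[OF EA.L.left_module_axioms _ f(1) g(1)]) (use x in \<open>auto simp: E.DirProd_carrier\<close>)
    also have "\<dots> = lin k A (\<lambda>p. fst p \<otimes>\<^bsub>A\<^esub> (D \<odot>\<^bsub>Reg\<^esub> x) \<otimes>\<^bsub>A\<^esub> snd p) f"
    proof (rule EA.L.lin_cong[OF fs])
      fix p assume p: "p \<in> carrier A \<times> carrier (opposite A)"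
      have h: "(\<lambda>y. fst p \<otimes>\<^bsub>A\<^esub> y \<otimes>\<^bsub>A\<^esub> snd p) \<in> LinearCombinations.module_hom k A A"
        using p by (auto simp: LinearCombinations.module_hom_def EA.A.l_distr EA.A.r_distr smult_mult_l smult_mult_r)
      have "fst p \<otimes>\<^bsub>A\<^esub> (D \<odot>\<^bsub>Reg\<^esub> x) \<otimes>\<^bsub>A\<^esub> snd p = lin k A (\<lambda>q. fst p \<otimes>\<^bsub>A\<^esub> (fst q \<otimes>\<^bsub>A\<^esub> x \<otimes>\<^bsub>A\<^esub> snd q) \<otimes>\<^bsub>A\<^esub> snd p) g"
        unfolding g(2) regular_cls[OF g(1) x]
        by (rule lin_hom[OF EA.L.left_module_axioms EA.L.left_module_axioms h gs]) (use x in auto)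
      also have "\<dots> = lin k A (\<lambda>q. fst (p \<otimes>\<^bsub>A \<times>\<times> opposite A\<^esub> q) \<otimes>\<^bsub>A\<^esub> x \<otimes>\<^bsub>A\<^esub> snd (p \<otimes>\<^bsub>A \<times>\<times> opposite A\<^esub> q)) g"
        using p x by (intro EA.L.lin_cong[OF gs]) (auto simp: DirProd_def EA.A.m_assoc)
      finally show "lin k A (\<lambda>q. fst (p \<otimes>\<^bsub>A \<times>\<times> opposite A\<^esub> q) \<otimes>\<^bsub>A\<^esub> x \<otimes>\<^bsub>A\<^esub> snd (p \<otimes>\<^bsub>A \<times>\<times> opposite A\<^esub> q)) g
        = fst p \<otimes>\<^bsub>A\<^esub> (D \<odot>\<^bsub>Reg\<^esub> x) \<otimes>\<^bsub>A\<^esub> snd p" by simp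
    qed (use yx in auto)
    also have "\<dots> = C \<odot>\<^bsub>Reg\<^esub> (D \<odot>\<^bsub>Reg\<^esub> x)"
      unfolding f(2) by (rule regular_cls[OF f(1) yx, symmetric])
    finally show "(C \<otimes>\<^bsub>Env\<^esub> D) \<odot>\<^bsub>Reg\<^esub> x = C \<odot>\<^bsub>Reg\<^esub> (D \<odot>\<^bsub>Reg\<^esub> x)" .
  next
    fix x assume "x \<in> carrier Reg"
    then show "\<one>\<^bsub>Env\<^esub> \<odot>\<^bsub>Reg\<^esub> x = x"
      using regular_tens[of "\<one>\<^bsub>A\<^esub>" "\<one>\<^bsub>A\<^esub>" x] by (simp add: enveloping_algebra_def E.tens_one)
  qed (use hom in auto)
qed

end

section \<open>Homomorphisms of modules\<close>

abbreviation mhom where "mhom \<equiv> LinearCombinations.module_hom"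

lemma mhomI:
  assumes "\<And>x. x \<in> carrier M \<Longrightarrow> f x \<in> carrier N"
    and "\<And>x y. \<lbrakk>x \<in> carrier M; y \<in> carrier M\<rbrakk> \<Longrightarrow> f (x \<oplus>\<^bsub>M\<^esub> y) = f x \<oplus>\<^bsub>N\<^esub> f y"
    and "\<And>a x. \<lbrakk>a \<in> carrier R; x \<in> carrier M\<rbrakk> \<Longrightarrow> f (a \<odot>\<^bsub>M\<^esub> x) = a \<odot>\<^bsub>N\<^esub> f x"
  shows "f \<in> mhom R M N"
  using assms by (auto simp: LinearCombinations.module_hom_def)

lemma mhomD:
  assumes "f \<in> mhom R M N"
  shows "x \<in> carrier M \<Longrightarrow> f x \<in> carrier N"
    and "\<lbrakk>x \<in> carrier M; y \<in> carrier M\<rbrakk> \<Longrightarrow> f (x \<oplus>\<^bsub>M\<^esub> y) = f x \<oplus>\<^bsub>N\<^esub> f y"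
    and "\<lbrakk>a \<in> carrier R; x \<in> carrier M\<rbrakk> \<Longrightarrow> f (a \<odot>\<^bsub>M\<^esub> x) = a \<odot>\<^bsub>N\<^esub> f x"
  using assms by (auto simp: LinearCombinations.module_hom_def)

lemma mhom_zero:
  assumes "left_module R M" "left_module R N" "f \<in> mhom R M N"
  shows "f \<zero>\<^bsub>M\<^esub> = \<zero>\<^bsub>N\<^esub>"
proof -
  interpret M: left_module R M by fact
  interpret N: left_module R N by fact
  show ?thesis
    using mhomD(1,2)[OF assms(3)]
    by (intro additive_zero[OF M.M.abelian_group_axioms N.M.abelian_group_axioms]) auto
qed

lemma mhom_finsum:
  assumes "left_module R M" "left_module R N" "f \<in> mhom R M N" "g \<in> S \<rightarrow> carrier M"
  shows "f (\<Oplus>\<^bsub>M\<^esub>i\<in>S. g i) = (\<Oplus>\<^bsub>N\<^esub>i\<in>S. f (g i))"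
proof -
  interpret M: left_module R M by fact
  interpret N: left_module R N by fact
  show ?thesis
    using mhomD(1,2)[OF assms(3)] assms(4)
    by (intro additive_finsum[OF M.M.abelian_group_axioms N.M.abelian_group_axioms]) auto
qed

lemma mhom_minus_apply:
  assumes "left_module R M" "left_module R N" "f \<in> mhom R M N" "x \<in> carrier M" "y \<in> carrier M"
  shows "f (x \<ominus>\<^bsub>M\<^esub> y) = f x \<ominus>\<^bsub>N\<^esub> f y"
proof -
  interpret M: left_module R M by fact
  interpret N: left_module R N by fact
  show ?thesis
    using mhomD(1,2)[OF assms(3)] assms(4,5)
    by (intro additive_minus[OF M.M.abelian_group_axioms N.M.abelian_group_axioms]) auto
qed

lemma mhom_comp:
  assumes f: "f \<in> mhom R M N" and g: "g \<in> mhom R N L"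
  shows "(\<lambda>x. g (f x)) \<in> mhom R M L"
  by (rule mhomI) (simp_all add: mhomD[OF f] mhomD[OF g])

lemma mhom_cong:
  assumes M: "left_module R M" and f: "f \<in> mhom R M N" and eq: "\<And>x. x \<in> carrier M \<Longrightarrow> g x = f x"
  shows "g \<in> mhom R M N"
proof -
  interpret M: left_module R M by fact
  show ?thesis by (rule mhomI) (simp_all add: eq mhomD[OF f] M.smult_closed)
qed

lemma mhom_id: "(\<lambda>x. x) \<in> mhom R M M"
  by (auto simp: LinearCombinations.module_hom_def)

lemma mhom_add:
  assumes N: "left_module R N" and f: "f \<in> mhom R M N" and g: "g \<in> mhom R M N"
  shows "(\<lambda>x. f x \<oplus>\<^bsub>N\<^esub> g x) \<in> mhom R M N"
proof -
  interpret N: left_module R N by fact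
  show ?thesis
    by (rule mhomI) (auto simp: mhomD[OF f] mhomD[OF g] N.M.a_ac N.smult_r_distr)
qed

lemma mhom_uminus:
  assumes N: "left_module R N" and f: "f \<in> mhom R M N"
  shows "(\<lambda>x. \<ominus>\<^bsub>N\<^esub> f x) \<in> mhom R M N"
proof -
  interpret N: left_module R N by fact
  show ?thesis
    by (rule mhomI) (auto simp: mhomD[OF f] N.M.minus_add N.M.a_comm N.smult_r_uminus)
qed

lemma mhom_minus:
  assumes N: "left_module R N" and f: "f \<in> mhom R M N" and g: "g \<in> mhom R M N"
  shows "(\<lambda>x. f x \<ominus>\<^bsub>N\<^esub> g x) \<in> mhom R M N"
  unfolding a_minus_def by (intro mhom_add mhom_uminus assms)

section \<open>Free modules\<close>

lemma free_basis_iff: "free_basis R M B \<longleftrightarrow> B \<subseteq> carrier M \<and>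
    (\<forall>x\<in>carrier M. \<exists>!c. c \<in> fsupp R B \<and> x = lin R M (\<lambda>b. b) c)"
  by (simp add: free_basis_def fsupp_def lin_def conj_assoc)

text \<open>Coordinates with respect to a free basis are additive and homogeneous because they are
  unique; the extension is \<open>lin\<close> applied to them.\<close>

lemma free_basis_lift:
  assumes B: "free_basis R M B" and M: "left_module R M" and N: "left_module R N"
    and h: "h \<in> B \<rightarrow> carrier N"
  shows "\<exists>f\<in>mhom R M N. \<forall>b\<in>B. f b = h b"
proof -
  interpret M: left_module R M by fact
  interpret N: left_module R N by fact
  have BM: "(\<lambda>b. b) \<in> B \<rightarrow> carrier M" using B by (auto simp: free_basis_iff)
  define co where "co x = (THE c. c \<in> fsupp R B \<and> x = lin R M (\<lambda>b. b) c)" for x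
  have ex1: "\<exists>!c. c \<in> fsupp R B \<and> x = lin R M (\<lambda>b. b) c" if "x \<in> carrier M" for x
    using B that unfolding free_basis_iff by blast
  have co1: "co x \<in> fsupp R B" and co2: "lin R M (\<lambda>b. b) (co x) = x" if "x \<in> carrier M" for x
    using theI'[OF ex1[OF that]] unfolding co_def[symmetric] by (simp_all only:)
  have uniq: "co x = c" if "x \<in> carrier M" "c \<in> fsupp R B" "lin R M (\<lambda>b. b) c = x" for c x
    unfolding co_def by (rule the1_equality[OF ex1[OF that(1)]]) (simp add: that)
  have co_add: "co (x \<oplus>\<^bsub>M\<^esub> y) = (\<lambda>b. co x b \<oplus>\<^bsub>R\<^esub> co y b)" if "x \<in> carrier M" "y \<in> carrier M" for x y
    by (rule uniq[OF M.M.a_closed[OF that] M.R.fsupp_add[OF co1[OF that(1)] co1[OF that(2)]]])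
      (simp only: M.lin_add[OF co1[OF that(1)] co1[OF that(2)] BM] co2[OF that(1)] co2[OF that(2)])
  have co_smult: "co (a \<odot>\<^bsub>M\<^esub> x) = (\<lambda>b. a \<otimes>\<^bsub>R\<^esub> co x b)" if "a \<in> carrier R" "x \<in> carrier M" for a x
    by (rule uniq[OF M.smult_closed[OF that] M.R.fsupp_smult[OF co1[OF that(2)] that(1)]])
      (simp only: M.lin_smult[OF co1[OF that(2)] BM that(1)] co2[OF that(2)])
  have co_basis: "co b = basis_elt R b" if b: "b \<in> B" for b
  proof -
    have bM: "b \<in> carrier M" using b BM by auto
    show ?thesis
      by (rule uniq[OF bM M.R.fsupp_basis_elt[OF b]]) (rule M.lin_basis_elt[of "\<lambda>b. b", OF bM])
  qed
  show ?thesis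
  proof (intro bexI ballI)
    show "lin R N h (co b) = h b" if "b \<in> B" for b
      unfolding co_basis[OF that] by (rule N.lin_basis_elt) (use that h in auto)
    show "(\<lambda>x. lin R N h (co x)) \<in> mhom R M N"
    proof (rule mhomI)
      fix x y a assume x: "x \<in> carrier M"
      show "lin R N h (co x) \<in> carrier N" by (rule N.lin_closed[OF co1[OF x] h])
      show "y \<in> carrier M \<Longrightarrow> lin R N h (co (x \<oplus>\<^bsub>M\<^esub> y)) = lin R N h (co x) \<oplus>\<^bsub>N\<^esub> lin R N h (co y)"
        using x by (simp only: co_add N.lin_add[OF co1 co1 h])
      show "a \<in> carrier R \<Longrightarrow> lin R N h (co (a \<odot>\<^bsub>M\<^esub> x)) = a \<odot>\<^bsub>N\<^esub> lin R N h (co x)"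
        using x by (simp only: co_smult N.lin_smult[OF co1 h])
    qed
  qed
qed

lemma free_basis_ext:
  assumes B: "free_basis R M B" and M: "left_module R M" and N: "left_module R N"
    and f: "f \<in> mhom R M N" and g: "g \<in> mhom R M N" and eq: "\<And>b. b \<in> B \<Longrightarrow> f b = g b"
    and x: "x \<in> carrier M"
  shows "f x = g x"
proof -
  interpret N: left_module R N by fact
  have BM: "(\<lambda>b. b) \<in> B \<rightarrow> carrier M" using B by (auto simp: free_basis_iff)
  obtain c where c: "c \<in> fsupp R B" "x = lin R M (\<lambda>b. b) c"
    using B x unfolding free_basis_iff by blast
  have "f x = lin R N f c" unfolding c(2) by (rule lin_hom[OF M N f c(1) BM])
  also have "\<dots> = lin R N g c"
    using eq BM by (intro N.lin_cong[OF c(1)]) (auto simp: mhomD(1)[OF g] Pi_def)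
  also have "\<dots> = g x" unfolding c(2) by (rule lin_hom[OF M N g c(1) BM, symmetric])
  finally show ?thesis .
qed

text \<open>Liftability is asked for relative to the image of \<open>e\<close>, not for surjective
  \<open>e\<close>: in a resolution \<open>e\<close> is a differential, onto a kernel only.\<close>

lemma free_module_projective:
  assumes P: "free_module R P" and Q: "left_module R Q" and N: "left_module R N"
    and e: "e \<in> mhom R Q N" and f: "f \<in> mhom R P N"
    and im: "\<And>x. x \<in> carrier P \<Longrightarrow> f x \<in> e ` carrier Q"
  shows "\<exists>g\<in>mhom R P Q. \<forall>x\<in>carrier P. e (g x) = f x"
proof -
  from P obtain B where PM: "left_module R P" and B: "free_basis R P B" by (auto simp: free_module_def)
  have BP: "B \<subseteq> carrier P" using B by (simp add: free_basis_iff)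
  have "\<forall>b\<in>B. \<exists>y. y \<in> carrier Q \<and> e y = f b" using im BP by fastforce
  then obtain h where h: "\<forall>b\<in>B. h b \<in> carrier Q \<and> e (h b) = f b" by metis
  then obtain g where g: "g \<in> mhom R P Q" "\<forall>b\<in>B. g b = h b"
    using free_basis_lift[OF B PM Q, of h] by auto
  have "e (g x) = f x" if "x \<in> carrier P" for x
    using free_basis_ext[OF B PM N mhom_comp[OF g(1) e] f _ that] g h by auto
  with g show ?thesis by blast
qed

section \<open>Comparison of free resolutions\<close>

locale resolution =
  fixes R :: "('r, 'z) ring_scheme" and M :: "('r, 'm) module"
    and P :: "nat \<Rightarrow> ('r, 'p) module" and d :: "nat \<Rightarrow> 'p \<Rightarrow> 'p" and \<epsilon> :: "'p \<Rightarrow> 'm"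
  assumes M: "left_module R M" and res: "free_resolution R M P d \<epsilon>"
begin

lemma free: "free_module R (P i)"
  using res by (simp add: free_resolution_def)

lemma P: "left_module R (P i)"
  using free[of i] by (simp add: free_module_def)

lemma d_hom: "d i \<in> mhom R (P (Suc i)) (P i)"
  using res by (simp add: free_resolution_def)

lemma \<epsilon>_hom: "\<epsilon> \<in> mhom R (P 0) M"
  using res by (simp add: free_resolution_def)

lemma \<epsilon>_surj: "\<epsilon> ` carrier (P 0) = carrier M"
  using res by (simp add: free_resolution_def)

lemma exact_eq_0: "{x \<in> carrier (P 0). \<epsilon> x = \<zero>\<^bsub>M\<^esub>} = d 0 ` carrier (P (Suc 0))"
  using res by (simp add: free_resolution_def)

lemma exact_eq_Suc: "{x \<in> carrier (P (Suc i)). d i x = \<zero>\<^bsub>P i\<^esub>} = d (Suc i) ` carrier (P (Suc (Suc i)))"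
  using res by (simp add: free_resolution_def)

lemma \<epsilon>_d: "x \<in> carrier (P (Suc 0)) \<Longrightarrow> \<epsilon> (d 0 x) = \<zero>\<^bsub>M\<^esub>"
  using exact_eq_0 by blast

lemma d_d: "x \<in> carrier (P (Suc (Suc i))) \<Longrightarrow> d i (d (Suc i) x) = \<zero>\<^bsub>P i\<^esub>"
  using exact_eq_Suc[of i] by blast

lemma exact_0: "\<lbrakk>x \<in> carrier (P 0); \<epsilon> x = \<zero>\<^bsub>M\<^esub>\<rbrakk> \<Longrightarrow> x \<in> d 0 ` carrier (P (Suc 0))"
  using exact_eq_0 by blast

lemma exact_Suc: "\<lbrakk>x \<in> carrier (P (Suc i)); d i x = \<zero>\<^bsub>P i\<^esub>\<rbrakk> \<Longrightarrow> x \<in> d (Suc i) ` carrier (P (Suc (Suc i)))"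
  using exact_eq_Suc[of i] by blast

end

locale two_resolutions = P: resolution R M P d \<epsilon> + Q: resolution R M Q d' \<epsilon>'
  for R :: "('r, 'z) ring_scheme" and M :: "('r, 'm) module"
    and P :: "nat \<Rightarrow> ('r, 'p) module" and d \<epsilon>
    and Q :: "nat \<Rightarrow> ('r, 'q) module" and d' \<epsilon>'
begin

lemma chain_map_exists:
  obtains f where "\<And>i. f i \<in> mhom R (P i) (Q i)"
    "\<And>x. x \<in> carrier (P 0) \<Longrightarrow> \<epsilon>' (f 0 x) = \<epsilon> x"
    "\<And>i x. x \<in> carrier (P (Suc i)) \<Longrightarrow> d' i (f (Suc i) x) = f i (d i x)"
proof -
  \<comment> \<open>The last clause is exactly what the next lift requires. It is part of the
    predicate because, in dependent choice, the next component is found knowing only that the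
    present one satisfies \<open>I\<close>.\<close>
  define I where "I n g \<longleftrightarrow> g \<in> mhom R (P n) (Q n)
      \<and> (n = 0 \<longrightarrow> (\<forall>x\<in>carrier (P 0). \<epsilon>' (g x) = \<epsilon> x))
      \<and> (\<forall>x\<in>carrier (P (Suc n)). g (d n x) \<in> d' n ` carrier (Q (Suc n)))" for n g
  have "\<exists>f. \<forall>n. I n (f n) \<and> (\<forall>x\<in>carrier (P (Suc n)). d' n (f (Suc n) x) = f n (d n x))"
  proof (rule dependent_nat_choice)
    have "\<exists>g\<in>mhom R (P 0) (Q 0). \<forall>x\<in>carrier (P 0). \<epsilon>' (g x) = \<epsilon> x"
      by (rule free_module_projective[OF P.free Q.P P.M Q.\<epsilon>_hom P.\<epsilon>_hom])
        (simp add: Q.\<epsilon>_surj mhomD(1)[OF P.\<epsilon>_hom])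
    then obtain g where g: "g \<in> mhom R (P 0) (Q 0)" "\<forall>x\<in>carrier (P 0). \<epsilon>' (g x) = \<epsilon> x" by blast
    have "g (d 0 x) \<in> d' 0 ` carrier (Q (Suc 0))" if "x \<in> carrier (P (Suc 0))" for x
      using that g P.\<epsilon>_d[OF that] mhomD(1)[OF P.d_hom that]
      by (intro Q.exact_0) (auto simp: mhomD(1)[OF g(1)])
    with g show "\<exists>g. I 0 g" by (auto simp: I_def)
  next
    fix g n assume g: "I n g"
    then have gh: "g \<in> mhom R (P n) (Q n)" by (simp add: I_def)
    have "\<exists>h\<in>mhom R (P (Suc n)) (Q (Suc n)). \<forall>x\<in>carrier (P (Suc n)). d' n (h x) = g (d n x)"
      using g by (intro free_module_projective[OF P.free Q.P Q.P Q.d_hom mhom_comp[OF P.d_hom gh]])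
        (simp add: I_def)
    then obtain h where h: "h \<in> mhom R (P (Suc n)) (Q (Suc n))"
      "\<forall>x\<in>carrier (P (Suc n)). d' n (h x) = g (d n x)" by blast
    have "h (d (Suc n) x) \<in> d' (Suc n) ` carrier (Q (Suc (Suc n)))" if x: "x \<in> carrier (P (Suc (Suc n)))" for x
    proof (rule Q.exact_Suc)
      show "h (d (Suc n) x) \<in> carrier (Q (Suc n))" by (intro mhomD(1)[OF h(1)] mhomD(1)[OF P.d_hom] x)
      show "d' n (h (d (Suc n) x)) = \<zero>\<^bsub>Q n\<^esub>"
        using h(2) mhomD(1)[OF P.d_hom x] P.d_d[OF x] mhom_zero[OF P.P Q.P gh] by simp
    qed
    with h show "\<exists>h. I (Suc n) h \<and> (\<forall>x\<in>carrier (P (Suc n)). d' n (h x) = g (d n x))"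
      by (auto simp: I_def)
  qed
  then obtain f where "\<And>n. I n (f n)" "\<And>n x. x \<in> carrier (P (Suc n)) \<Longrightarrow> d' n (f (Suc n) x) = f n (d n x)"
    by blast
  then show thesis by (intro that[of f]) (auto simp: I_def)
qed

end

text \<open>Unlike \<open>hom_cocycles\<close> and \<open>hom_coboundaries\<close>, these predicates
  see only values on the carriers. Cochains can then be composed with chain maps without being cut
  back to extensional functions each time.\<close>

definition cocycle ::
    "('r, 'z) ring_scheme \<Rightarrow> (nat \<Rightarrow> ('r, 'p) module) \<Rightarrow> (nat \<Rightarrow> 'p \<Rightarrow> 'p) \<Rightarrow> ('r, 'n) module \<Rightarrow> nat \<Rightarrow> ('p \<Rightarrow> 'n) \<Rightarrow> bool"
  where "cocycle R P d N m z \<longleftrightarrow> z \<in> mhom R (P m) N \<and> (\<forall>x\<in>carrier (P (Suc m)). z (d m x) = \<zero>\<^bsub>N\<^esub>)"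

definition coboundary ::
    "('r, 'z) ring_scheme \<Rightarrow> (nat \<Rightarrow> ('r, 'p) module) \<Rightarrow> (nat \<Rightarrow> 'p \<Rightarrow> 'p) \<Rightarrow> ('r, 'n) module \<Rightarrow> nat \<Rightarrow> ('p \<Rightarrow> 'n) \<Rightarrow> bool"
  where "coboundary R P d N m z \<longleftrightarrow>
    (case m of 0 \<Rightarrow> \<forall>x\<in>carrier (P 0). z x = \<zero>\<^bsub>N\<^esub>
     | Suc j \<Rightarrow> \<exists>u\<in>mhom R (P j) N. \<forall>x\<in>carrier (P m). z x = u (d j x))"

context resolution
begin

lemma coboundary_minus:
  assumes N: "left_module R N" and "coboundary R P d N m z" "coboundary R P d N m y"
  shows "coboundary R P d N m (\<lambda>x. z x \<ominus>\<^bsub>N\<^esub> y x)"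
proof -
  interpret N: left_module R N by fact
  show ?thesis
  proof (cases m)
    case 0
    then show ?thesis using assms by (auto simp: coboundary_def a_minus_def N.M.r_neg)
  next
    case (Suc j)
    then obtain u v where "u \<in> mhom R (P j) N" "\<forall>x\<in>carrier (P m). z x = u (d j x)"
      "v \<in> mhom R (P j) N" "\<forall>x\<in>carrier (P m). y x = v (d j x)"
      using assms by (auto simp: coboundary_def)
    then show ?thesis
      using Suc mhom_minus[OF N, of u "P j" v] by (auto simp: coboundary_def intro!: bexI[of _ "\<lambda>x. u x \<ominus>\<^bsub>N\<^esub> v x"])
  qed
qed

lemma coboundary_cocycle:
  assumes N: "left_module R N" and "coboundary R P d N m z"
  shows "cocycle R P d N m z"
proof -
  interpret N: left_module R N by fact
  interpret Pm: left_module R "P m" by (rule P)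
  show ?thesis
  proof (cases m)
    case 0
    then have z: "z x = \<zero>\<^bsub>N\<^esub>" if "x \<in> carrier (P m)" for x using assms that by (auto simp: coboundary_def)
    then have "z \<in> mhom R (P m) N"
      by (intro mhomI) (auto simp: N.smult_r_zero Pm.smult_closed)
    then show ?thesis using z mhomD(1)[OF d_hom] by (auto simp: cocycle_def)
  next
    case (Suc j)
    then obtain u where u: "u \<in> mhom R (P j) N" "\<And>x. x \<in> carrier (P m) \<Longrightarrow> z x = u (d j x)"
      using assms by (auto simp: coboundary_def)
    have "z \<in> mhom R (P m) N"
      by (rule mhom_cong[OF P]) (use mhom_comp[OF d_hom u(1)] Suc u(2) in auto)
    moreover have "z (d m x) = \<zero>\<^bsub>N\<^esub>" if "x \<in> carrier (P (Suc m))" for x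
      using u(2) mhomD(1)[OF d_hom that] d_d[of x j] that Suc mhom_zero[OF P N u(1)] by simp
    ultimately show ?thesis by (simp add: cocycle_def)
  qed
qed

text \<open>A chain map lifting the zero map on \<open>M\<close> is null homotopic, hence kills cohomology.\<close>

lemma null_homotopic:
  assumes N: "left_module R N" and z: "cocycle R P d N m z"
    and h: "\<And>i. h i \<in> mhom R (P i) (P i)"
    and h0: "\<And>x. x \<in> carrier (P 0) \<Longrightarrow> \<epsilon> (h 0 x) = \<zero>\<^bsub>M\<^esub>"
    and hd: "\<And>i x. x \<in> carrier (P (Suc i)) \<Longrightarrow> d i (h (Suc i) x) = h i (d i x)"
  shows "coboundary R P d N m (\<lambda>x. z (h m x))"
proof -
  interpret N: left_module R N by fact
  have zh: "z \<in> mhom R (P m) N" and zd: "\<And>x. x \<in> carrier (P (Suc m)) \<Longrightarrow> z (d m x) = \<zero>\<^bsub>N\<^esub>"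
    using z by (auto simp: cocycle_def)
  have base: "\<exists>s\<in>mhom R (P 0) (P (Suc 0)). \<forall>x\<in>carrier (P 0). d 0 (s x) = h 0 x"
    by (rule free_module_projective[OF free P P d_hom h]) (auto intro!: exact_0 h0 mhomD(1)[OF h])
  have step: "\<exists>s\<in>mhom R (P (Suc n)) (P (Suc (Suc n))). \<forall>x\<in>carrier (P (Suc n)).
      d (Suc n) (s x) = h (Suc n) x \<ominus>\<^bsub>P (Suc n)\<^esub> t (d n x)"
    if t: "t \<in> mhom R (P n) (P (Suc n))" and td: "\<forall>x\<in>carrier (P (Suc n)). d n (t (d n x)) = h n (d n x)" for n t
  proof (rule free_module_projective[OF free P P d_hom])
    have td_hom: "(\<lambda>x. t (d n x)) \<in> mhom R (P (Suc n)) (P (Suc n))" by (rule mhom_comp[OF d_hom t])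
    show *: "(\<lambda>x. h (Suc n) x \<ominus>\<^bsub>P (Suc n)\<^esub> t (d n x)) \<in> mhom R (P (Suc n)) (P (Suc n))"
      by (rule mhom_minus[OF P h td_hom])
    fix x assume x: "x \<in> carrier (P (Suc n))"
    interpret Pn: left_module R "P n" by (rule P)
    have "d n (h (Suc n) x \<ominus>\<^bsub>P (Suc n)\<^esub> t (d n x)) = d n (h (Suc n) x) \<ominus>\<^bsub>P n\<^esub> d n (t (d n x))"
      by (rule mhom_minus_apply[OF P P d_hom mhomD(1)[OF h x] mhomD(1)[OF td_hom x]])
    also have "\<dots> = \<zero>\<^bsub>P n\<^esub>"
      using hd[OF x] td x mhomD(1)[OF h mhomD(1)[OF d_hom x]] by (simp add: Pn.M.minus_eq_zero_iff)
    finally show "h (Suc n) x \<ominus>\<^bsub>P (Suc n)\<^esub> t (d n x) \<in> d (Suc n) ` carrier (P (Suc (Suc n)))"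
      by (intro exact_Suc mhomD(1)[OF * x])
  qed
  \<comment> \<open>Of the homotopy identity in degree \<open>n\<close> only its composite with
    \<open>d n\<close> is kept. There the term coming from the previous component vanishes by
    \<open>d d = 0\<close>, so the induction has to remember a single map.\<close>
  have S: "\<exists>t\<in>mhom R (P n) (P (Suc n)). \<forall>x\<in>carrier (P (Suc n)). d n (t (d n x)) = h n (d n x)" for n
  proof (induction n)
    case 0
    then show ?case using base mhomD(1)[OF d_hom] by blast
  next
    case (Suc n)
    then obtain t where t: "t \<in> mhom R (P n) (P (Suc n))" "\<forall>x\<in>carrier (P (Suc n)). d n (t (d n x)) = h n (d n x)"
      by blast
    from step[OF this] obtain s where s: "s \<in> mhom R (P (Suc n)) (P (Suc (Suc n)))"
      "\<And>x. x \<in> carrier (P (Suc n)) \<Longrightarrow> d (Suc n) (s x) = h (Suc n) x \<ominus>\<^bsub>P (Suc n)\<^esub> t (d n x)" by blast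
    have "d (Suc n) (s (d (Suc n) x)) = h (Suc n) (d (Suc n) x)" if x: "x \<in> carrier (P (Suc (Suc n)))" for x
    proof -
      interpret Pn: left_module R "P (Suc n)" by (rule P)
      show ?thesis
        using s(2)[OF mhomD(1)[OF d_hom x]] d_d[OF x] mhom_zero[OF P P t(1)] mhomD(1)[OF h mhomD(1)[OF d_hom x]]
        by (simp add: a_minus_def)
    qed
    with s(1) show ?case by blast
  qed
  show ?thesis
  proof (cases m)
    case 0
    from base obtain s where s: "s \<in> mhom R (P 0) (P (Suc 0))" "\<And>x. x \<in> carrier (P 0) \<Longrightarrow> d 0 (s x) = h 0 x" by blast
    then have "z (h m x) = \<zero>\<^bsub>N\<^esub>" if "x \<in> carrier (P 0)" for x
      using zd[of "s x"] that 0 mhomD(1)[OF s(1) that] by auto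
    then show ?thesis using 0 by (simp add: coboundary_def)
  next
    case (Suc n)
    from S obtain t where t: "t \<in> mhom R (P n) (P (Suc n))" "\<forall>x\<in>carrier (P (Suc n)). d n (t (d n x)) = h n (d n x)"
      by blast
    from step[OF this] obtain s where s: "s \<in> mhom R (P (Suc n)) (P (Suc (Suc n)))"
      "\<And>x. x \<in> carrier (P (Suc n)) \<Longrightarrow> d (Suc n) (s x) = h (Suc n) x \<ominus>\<^bsub>P (Suc n)\<^esub> t (d n x)" by blast
    have zh': "z \<in> mhom R (P (Suc n)) N" using zh Suc by simp
    \<comment> \<open>The two arguments differ by the boundary \<open>d (s x)\<close>, which the
      cocycle \<open>z\<close> kills. Thus \<open>z\<close> composed with \<open>t\<close> is the
      cochain whose coboundary is sought.\<close>
    have "z (h m x) = z (t (d n x))" if x: "x \<in> carrier (P m)" for x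
    proof -
      have xS: "x \<in> carrier (P (Suc n))" using x Suc by simp
      have tx: "t (d n x) \<in> carrier (P (Suc n))" by (intro mhomD(1)[OF t(1)] mhomD(1)[OF d_hom] xS)
      have "z (h (Suc n) x) \<ominus>\<^bsub>N\<^esub> z (t (d n x)) = z (d (Suc n) (s x))"
        unfolding s(2)[OF xS] by (rule mhom_minus_apply[OF P N zh' mhomD(1)[OF h xS] tx, symmetric])
      also have "\<dots> = \<zero>\<^bsub>N\<^esub>" using zd[of "s x"] mhomD(1)[OF s(1) xS] Suc by simp
      finally show ?thesis
        using mhomD(1)[OF zh' mhomD(1)[OF h xS]] mhomD(1)[OF zh' tx] Suc by (simp add: N.M.minus_eq_zero_iff)
    qed
    then show ?thesis
      using Suc mhom_comp[OF t(1) zh'] by (auto simp: coboundary_def)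
  qed
qed

end

context two_resolutions
begin

lemma pullback_cocycle:
  assumes N: "left_module R N" and f: "\<And>i. f i \<in> mhom R (P i) (Q i)"
    and fd: "\<And>i x. x \<in> carrier (P (Suc i)) \<Longrightarrow> d' i (f (Suc i) x) = f i (d i x)"
    and z: "cocycle R Q d' N m z"
  shows "cocycle R P d N m (\<lambda>x. z (f m x))"
  unfolding cocycle_def
proof (intro conjI ballI)
  show "(\<lambda>x. z (f m x)) \<in> mhom R (P m) N"
    using z mhom_comp[OF f] by (auto simp: cocycle_def)
  fix x assume "x \<in> carrier (P (Suc m))"
  then show "z (f m (d m x)) = \<zero>\<^bsub>N\<^esub>"
    using z fd mhomD(1)[OF f] by (metis cocycle_def)
qed

lemma pullback_coboundary:
  assumes f: "\<And>i. f i \<in> mhom R (P i) (Q i)"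
    and fd: "\<And>i x. x \<in> carrier (P (Suc i)) \<Longrightarrow> d' i (f (Suc i) x) = f i (d i x)"
    and z: "coboundary R Q d' N m z"
  shows "coboundary R P d N m (\<lambda>x. z (f m x))"
proof (cases m)
  case 0
  then show ?thesis using z mhomD(1)[OF f] by (auto simp: coboundary_def)
next
  case (Suc j)
  then obtain u where u: "u \<in> mhom R (Q j) N" "\<And>x. x \<in> carrier (Q m) \<Longrightarrow> z x = u (d' j x)"
    using z by (auto simp: coboundary_def)
  have "z (f m x) = u (f j (d j x))" if "x \<in> carrier (P m)" for x
    using u(2)[OF mhomD(1)[OF f that]] fd[of x j] that Suc by simp
  then show ?thesis using Suc mhom_comp[OF f u(1)] by (auto simp: coboundary_def)
qed

text \<open>Both \<open>g f\<close> and the identity lift the identity of \<open>M\<close>, so their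
  difference lifts zero and \<open>null_homotopic\<close> applies.\<close>

lemma round_trip:
  assumes N: "left_module R N"
    and f: "\<And>i. f i \<in> mhom R (P i) (Q i)"
      "\<And>x. x \<in> carrier (P 0) \<Longrightarrow> \<epsilon>' (f 0 x) = \<epsilon> x"
      "\<And>i x. x \<in> carrier (P (Suc i)) \<Longrightarrow> d' i (f (Suc i) x) = f i (d i x)"
    and g: "\<And>i. g i \<in> mhom R (Q i) (P i)"
      "\<And>x. x \<in> carrier (Q 0) \<Longrightarrow> \<epsilon> (g 0 x) = \<epsilon>' x"
      "\<And>i x. x \<in> carrier (Q (Suc i)) \<Longrightarrow> d i (g (Suc i) x) = g i (d' i x)"
    and z: "cocycle R P d N m z"
  shows "coboundary R P d N m (\<lambda>x. z (g m (f m x)) \<ominus>\<^bsub>N\<^esub> z x)"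
proof -
  define h where "h i x = g i (f i x) \<ominus>\<^bsub>P i\<^esub> x" for i x
  have gf: "(\<lambda>x. g i (f i x)) \<in> mhom R (P i) (P i)" for i by (rule mhom_comp[OF f(1) g(1)])
  have hh: "h i \<in> mhom R (P i) (P i)" for i
    unfolding h_def by (intro mhom_minus P.P gf mhom_id)
  interpret M: left_module R M by (rule P.M)
  have "coboundary R P d N m (\<lambda>x. z (h m x))"
  proof (rule P.null_homotopic[OF N z hh])
    show "\<epsilon> (h 0 x) = \<zero>\<^bsub>M\<^esub>" if x: "x \<in> carrier (P 0)" for x
      unfolding h_def using mhom_minus_apply[OF P.P P.M P.\<epsilon>_hom mhomD(1)[OF gf x] x] f(2)[OF x]
        g(2)[OF mhomD(1)[OF f(1) x]] mhomD(1)[OF P.\<epsilon>_hom x]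
      by (simp add: M.M.minus_eq_zero_iff)
    show "d i (h (Suc i) x) = h i (d i x)" if x: "x \<in> carrier (P (Suc i))" for i x
      unfolding h_def using mhom_minus_apply[OF P.P P.P P.d_hom mhomD(1)[OF gf x] x] f(3)[OF x]
        g(3)[OF mhomD(1)[OF f(1) x]] by simp
  qed
  moreover have "z (h m x) = z (g m (f m x)) \<ominus>\<^bsub>N\<^esub> z x" if "x \<in> carrier (P m)" for x
    unfolding h_def using z that
    by (intro mhom_minus_apply[OF P.P N _ mhomD(1)[OF gf that]]) (auto simp: cocycle_def)
  ultimately show ?thesis by (auto simp: coboundary_def split: nat.splits)
qed

end

section \<open>Dimension of cohomology\<close>

text \<open>Functionals with common kernel \<open>B\<close> and a dual family \<open>\<zeta>\<close>
  determine the quotient: the classes of the \<open>\<zeta> t\<close> form a basis. \<open>V\<close>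
  itself may be infinite-dimensional, as the cochains on an arbitrary resolution can be.\<close>

lemma quotient_dim:
  assumes k: "field k" and V: "left_module k V" and T: "finite T"
    and \<Theta>c: "\<And>z t. \<lbrakk>z \<in> carrier V; t \<in> T\<rbrakk> \<Longrightarrow> \<Theta> z t \<in> carrier k"
    and \<Theta>add: "\<And>z y t. \<lbrakk>z \<in> carrier V; y \<in> carrier V; t \<in> T\<rbrakk> \<Longrightarrow> \<Theta> (z \<oplus>\<^bsub>V\<^esub> y) t = \<Theta> z t \<oplus>\<^bsub>k\<^esub> \<Theta> y t"
    and \<Theta>smult: "\<And>c z t. \<lbrakk>c \<in> carrier k; z \<in> carrier V; t \<in> T\<rbrakk> \<Longrightarrow> \<Theta> (c \<odot>\<^bsub>V\<^esub> z) t = c \<otimes>\<^bsub>k\<^esub> \<Theta> z t"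
    and surj: "\<And>t. t \<in> T \<Longrightarrow> \<exists>z\<in>carrier V. \<forall>s\<in>T. \<Theta> z s = (if s = t then \<one>\<^bsub>k\<^esub> else \<zero>\<^bsub>k\<^esub>)"
    and B: "B = {z \<in> carrier V. \<forall>t\<in>T. \<Theta> z t = \<zero>\<^bsub>k\<^esub>}"
  shows "vectorspace k (quotient V B) \<and> vectorspace.fin_dim k (quotient V B) \<and>
    vectorspace.dim k (quotient V B) = card T"
proof -
  interpret k: field k by fact
  interpret V: left_module k V by fact
  have \<Theta>hom: "(\<lambda>z. \<Theta> z t) \<in> mhom k V (self_module k)" if "t \<in> T" for t
    using that by (intro mhomI) (auto simp: \<Theta>c \<Theta>add \<Theta>smult)
  have Ksm: "left_module k (self_module k)" by (rule left_module_self_module) (rule k.ring_axioms)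
  have \<Theta>0: "\<Theta> \<zero>\<^bsub>V\<^esub> t = \<zero>\<^bsub>k\<^esub>" if "t \<in> T" for t using mhom_zero[OF V Ksm \<Theta>hom[OF that]] by simp
  have Bsub: "B \<subseteq> carrier V" by (auto simp: B)
  have Bs: "c \<odot>\<^bsub>V\<^esub> x \<in> B" if "c \<in> carrier k" "x \<in> B" for c x
    using that by (auto simp: B V.smult_closed \<Theta>smult)
  have Bi: "\<ominus>\<^bsub>V\<^esub> x \<in> B" if "x \<in> B" for x
    using Bs[of "\<ominus>\<^bsub>k\<^esub> \<one>\<^bsub>k\<^esub>" x] that Bsub by (auto simp: V.smult_l_uminus V.smult_one subset_iff)
  have "subgroup B (add_monoid V)"
    by (rule group.subgroupI[OF V.M.a_group])
      (use Bi \<Theta>0 in \<open>auto simp: B a_inv_def[symmetric] \<Theta>add intro!: exI[of _ "\<zero>\<^bsub>V\<^esub>"]\<close>)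
  then have Bas: "abelian_subgroup B V"
    by (intro abelian_subgroupI3 additive_subgroup.intro V.M.abelian_group_axioms)
  interpret Bq: quotient_loc B V by (rule quotient_loc.intro) (rule Bas)
  let ?Q = "quotient V B"
  have Q: "left_module k ?Q" and Qs: "\<And>c x. \<lbrakk>c \<in> carrier k; x \<in> carrier V\<rbrakk> \<Longrightarrow> c \<odot>\<^bsub>?Q\<^esub> (B +>\<^bsub>V\<^esub> x) = B +>\<^bsub>V\<^esub> (c \<odot>\<^bsub>V\<^esub> x)"
    using left_module_quotient[OF V Bas] Bs by auto
  interpret Q: left_module k ?Q by (rule Q)
  have QM: "Module.module k ?Q" by (rule module_if_left_module[OF Q]) (rule k.is_cring)
  have QV: "vectorspace k ?Q" by (intro vectorspace.intro QM k)
  interpret Qv: vectorspace k ?Q by (rule QV)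
  have cl: "(\<lambda>x. B +>\<^bsub>V\<^esub> x) \<in> mhom k V ?Q"
    by (rule mhomI) (auto simp: Bq.quotient_closed Bq.quotient_add Qs)
  obtain \<zeta> where \<zeta>: "\<And>t. t \<in> T \<Longrightarrow> \<zeta> t \<in> carrier V"
    "\<And>s t. \<lbrakk>s \<in> T; t \<in> T\<rbrakk> \<Longrightarrow> \<Theta> (\<zeta> t) s = (if s = t then \<one>\<^bsub>k\<^esub> else \<zero>\<^bsub>k\<^esub>)"
    using surj by metis
  define b where "b t = B +>\<^bsub>V\<^esub> \<zeta> t" for t
  have bc: "b t \<in> carrier ?Q" if "t \<in> T" for t using \<zeta>(1)[OF that] by (simp add: b_def Bq.quotient_closed)
  define lc where "lc c = (\<Oplus>\<^bsub>V\<^esub>t\<in>T. c t \<odot>\<^bsub>V\<^esub> \<zeta> t)" for c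
  have lcc: "lc c \<in> carrier V" if "c \<in> T \<rightarrow> carrier k" for c
    unfolding lc_def using that \<zeta>(1) by (auto intro!: V.M.finsum_closed V.smult_closed)
  have lc\<Theta>: "\<Theta> (lc c) s = c s" if c: "c \<in> T \<rightarrow> carrier k" and s: "s \<in> T" for c s
  proof -
    have "\<Theta> (lc c) s = (\<Oplus>\<^bsub>self_module k\<^esub>t\<in>T. \<Theta> (c t \<odot>\<^bsub>V\<^esub> \<zeta> t) s)"
      unfolding lc_def using c \<zeta>(1) by (intro mhom_finsum[OF V Ksm \<Theta>hom[OF s]]) (auto intro!: V.smult_closed)
    also have "\<dots> = (\<Oplus>\<^bsub>k\<^esub>t\<in>T. c t \<otimes>\<^bsub>k\<^esub> (if s = t then \<one>\<^bsub>k\<^esub> else \<zero>\<^bsub>k\<^esub>))"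
      unfolding finsum_self_module using c \<zeta> s by (intro k.finsum_cong') (auto simp: \<Theta>smult Pi_def)
    also have "\<dots> = c s"
      using c s T by (subst k.finsum_single[of T _ s]) (auto simp: Pi_def)
    finally show ?thesis .
  qed
  have lcb: "B +>\<^bsub>V\<^esub> lc c = (\<Oplus>\<^bsub>?Q\<^esub>t\<in>T. c t \<odot>\<^bsub>?Q\<^esub> b t)" if c: "c \<in> T \<rightarrow> carrier k" for c
  proof -
    have "B +>\<^bsub>V\<^esub> lc c = (\<Oplus>\<^bsub>?Q\<^esub>t\<in>T. B +>\<^bsub>V\<^esub> (c t \<odot>\<^bsub>V\<^esub> \<zeta> t))"
      unfolding lc_def using c \<zeta>(1) by (intro mhom_finsum[OF V Q cl]) (auto intro!: V.smult_closed)
    also have "\<dots> = (\<Oplus>\<^bsub>?Q\<^esub>t\<in>T. c t \<odot>\<^bsub>?Q\<^esub> b t)"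
    proof (intro Q.M.finsum_cong' refl)
      show "(\<lambda>t. c t \<odot>\<^bsub>?Q\<^esub> b t) \<in> T \<rightarrow> carrier ?Q" using c bc by (auto intro!: Q.smult_closed)
      fix t assume t: "t \<in> T"
      show "B +>\<^bsub>V\<^esub> (c t \<odot>\<^bsub>V\<^esub> \<zeta> t) = c t \<odot>\<^bsub>?Q\<^esub> b t"
        unfolding b_def by (rule Qs[symmetric]) (use c t \<zeta>(1) in auto)
    qed
    finally show ?thesis .
  qed
  have inj: "inj_on b T"
  proof (rule inj_onI)
    fix s t assume st: "s \<in> T" "t \<in> T" "b s = b t"
    then have "\<zeta> s \<ominus>\<^bsub>V\<^esub> \<zeta> t \<in> B"
      using Bq.quotient_eq_iff[OF \<zeta>(1)[OF st(1)] \<zeta>(1)[OF st(2)]] unfolding b_def by blast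
    then have "\<Theta> (\<zeta> s \<ominus>\<^bsub>V\<^esub> \<zeta> t) s = \<zero>\<^bsub>k\<^esub>" using st(1) unfolding B by blast
    moreover have "\<Theta> (\<zeta> s \<ominus>\<^bsub>V\<^esub> \<zeta> t) s = \<Theta> (\<zeta> s) s \<ominus>\<^bsub>self_module k\<^esub> \<Theta> (\<zeta> t) s"
      by (rule mhom_minus_apply[OF V Ksm \<Theta>hom[OF st(1)] \<zeta>(1)[OF st(1)] \<zeta>(1)[OF st(2)]])
    moreover interpret KK: left_module k "self_module k" by (rule Ksm)
    have "\<Theta> (\<zeta> s) s \<ominus>\<^bsub>self_module k\<^esub> \<Theta> (\<zeta> t) s = \<zero>\<^bsub>self_module k\<^esub> \<longleftrightarrow> \<Theta> (\<zeta> s) s = \<Theta> (\<zeta> t) s"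
      by (rule KK.M.minus_eq_zero_iff) (simp_all add: \<Theta>c \<zeta>(1) st(1,2))
    ultimately have "\<Theta> (\<zeta> s) s = \<Theta> (\<zeta> t) s" by simp
    then show "s = t" unfolding \<zeta>(2)[OF st(1,1)] \<zeta>(2)[OF st(1,2)] by (simp split: if_splits)
  qed
  have lin: "Qv.lincomb a (b ` T) = (\<Oplus>\<^bsub>?Q\<^esub>t\<in>T. a (b t) \<odot>\<^bsub>?Q\<^esub> b t)" if a: "a \<in> b ` T \<rightarrow> carrier k" for a
    unfolding Qv.lincomb_def
  proof (rule Q.M.finsum_reindex[OF _ inj])
    show "(\<lambda>v. a v \<odot>\<^bsub>?Q\<^esub> v) \<in> b ` T \<rightarrow> carrier ?Q"
    proof
      fix v assume "v \<in> b ` T"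
      then show "a v \<odot>\<^bsub>?Q\<^esub> v \<in> carrier ?Q" using a bc by (intro Q.smult_closed) auto
    qed
  qed
  have bT: "finite (b ` T)" "b ` T \<subseteq> carrier ?Q" using T bc by auto
  have gen: "Qv.gen_set (b ` T)"
  proof (intro equalityI subsetI)
    fix q assume "q \<in> Qv.span (b ` T)"
    then show "q \<in> carrier ?Q" using Qv.span_is_subset2[OF bT(2)] by auto
  next
    fix q assume "q \<in> carrier ?Q"
    then obtain z where z: "z \<in> carrier V" "q = B +>\<^bsub>V\<^esub> z" by (auto simp: quotient_carrier)
    \<comment> \<open>Subtracting the combination of the \<open>\<zeta> t\<close> with coefficients
      \<open>\<Theta> z t\<close> kills every functional, so the difference lies in
      \<open>B\<close>.\<close>
    define c where "c = \<Theta> z"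
    have c: "c \<in> T \<rightarrow> carrier k" using z \<Theta>c by (auto simp: c_def)
    have c': "(\<lambda>v. c (the_inv_into T b v)) \<in> b ` T \<rightarrow> carrier k"
      using c by (auto simp: the_inv_into_f_f[OF inj])
    interpret KK: left_module k "self_module k" by (rule Ksm)
    have "\<Theta> (z \<ominus>\<^bsub>V\<^esub> lc c) t = \<zero>\<^bsub>k\<^esub>" if t: "t \<in> T" for t
    proof -
      have "\<Theta> (z \<ominus>\<^bsub>V\<^esub> lc c) t = c t \<ominus>\<^bsub>self_module k\<^esub> c t"
        using mhom_minus_apply[OF V Ksm \<Theta>hom[OF t] z(1) lcc[OF c]] lc\<Theta>[OF c t] by (simp only: c_def)
      moreover have "c t \<ominus>\<^bsub>self_module k\<^esub> c t = \<zero>\<^bsub>self_module k\<^esub>"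
        using KK.M.minus_eq_zero_iff[of "c t" "c t"] c t by (auto simp: Pi_def)
      ultimately show ?thesis by simp
    qed
    then have "z \<ominus>\<^bsub>V\<^esub> lc c \<in> B" unfolding B using V.M.minus_closed[OF z(1) lcc[OF c]] by blast
    then have "q = B +>\<^bsub>V\<^esub> lc c" unfolding z(2) using Bq.quotient_eq_iff[OF z(1) lcc[OF c]] by blast
    also have "\<dots> = (\<Oplus>\<^bsub>?Q\<^esub>t\<in>T. c t \<odot>\<^bsub>?Q\<^esub> b t)" by (rule lcb[OF c])
    also have "\<dots> = (\<Oplus>\<^bsub>?Q\<^esub>t\<in>T. c (the_inv_into T b (b t)) \<odot>\<^bsub>?Q\<^esub> b t)"
    proof (intro Q.M.finsum_cong' refl)
      fix t assume t: "t \<in> T"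
      show "c t \<odot>\<^bsub>?Q\<^esub> b t = c (the_inv_into T b (b t)) \<odot>\<^bsub>?Q\<^esub> b t" unfolding the_inv_into_f_f[OF inj t] ..
    next
      show "(\<lambda>t. c (the_inv_into T b (b t)) \<odot>\<^bsub>?Q\<^esub> b t) \<in> T \<rightarrow> carrier ?Q"
      proof
        fix t assume t: "t \<in> T"
        show "c (the_inv_into T b (b t)) \<odot>\<^bsub>?Q\<^esub> b t \<in> carrier ?Q"
          unfolding the_inv_into_f_f[OF inj t] using c t bc by (intro Q.smult_closed) auto
      qed
    qed
    also have "\<dots> = Qv.lincomb (\<lambda>v. c (the_inv_into T b v)) (b ` T)"
      by (rule lin[symmetric]) (rule c')
    finally show "q \<in> Qv.span (b ` T)"
      unfolding Qv.finite_span[OF bT] using c' by blast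
  qed
  have indpt: "Qv.lin_indpt (b ` T)"
  proof (rule Qv.finite_lin_indpt2[OF bT])
    fix a assume a: "a \<in> b ` T \<rightarrow> carrier k" "Qv.lincomb a (b ` T) = \<zero>\<^bsub>?Q\<^esub>"
    have c: "(\<lambda>t. a (b t)) \<in> T \<rightarrow> carrier k" using a by auto
    have "B +>\<^bsub>V\<^esub> lc (\<lambda>t. a (b t)) = \<zero>\<^bsub>?Q\<^esub>" unfolding lcb[OF c] lin[OF a(1), symmetric] by (rule a(2))
    then have "lc (\<lambda>t. a (b t)) \<in> B" using Bq.quotient_eq_zero_iff[OF lcc[OF c]] by blast
    then have "\<Theta> (lc (\<lambda>t. a (b t))) t = \<zero>\<^bsub>k\<^esub>" if "t \<in> T" for t using that unfolding B by blast
    then show "\<forall>v\<in>b ` T. a v = \<zero>\<^bsub>k\<^esub>" unfolding ball_simps using lc\<Theta>[OF c] by simp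
  qed
  have "Qv.basis (b ` T)" unfolding Qv.basis_def using gen indpt bT by auto
  then have "Qv.dim = card (b ` T)" by (rule Qv.dim_basis[OF bT(1)])
  moreover have "Qv.fin_dim" unfolding Qv.fin_dim_def using gen bT by blast
  ultimately show ?thesis using QV card_image[OF inj] by simp
qed

section \<open>Cohomology of an arbitrary resolution from functionals on a known one\<close>

lemma hom_module_simps:
  "carrier (hom_module R M N) = mhom R M N \<inter> extensional (carrier M)"
  "\<zero>\<^bsub>hom_module R M N\<^esub> = (\<lambda>x\<in>carrier M. \<zero>\<^bsub>N\<^esub>)"
  "f \<oplus>\<^bsub>hom_module R M N\<^esub> g = (\<lambda>x\<in>carrier M. f x \<oplus>\<^bsub>N\<^esub> g x)"
  "c \<odot>\<^bsub>hom_module R M N\<^esub> f = (\<lambda>x\<in>carrier M. (c \<odot>\<^bsub>R\<^esub> \<one>\<^bsub>R\<^esub>) \<odot>\<^bsub>N\<^esub> f x)"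
  by (simp_all add: hom_module_def)

lemma restrict_mhom: "\<lbrakk>left_module R M; f \<in> mhom R M N\<rbrakk> \<Longrightarrow> restrict f (carrier M) \<in> mhom R M N \<inter> extensional (carrier M)"
  by (auto intro: mhom_cong)

context kalgebra
begin

lemma scalar_closed: "c \<in> carrier k \<Longrightarrow> c \<odot>\<^bsub>A\<^esub> \<one>\<^bsub>A\<^esub> \<in> carrier A"
  by (simp add: smult_closed)

lemma scalar_central: "\<lbrakk>c \<in> carrier k; a \<in> carrier A\<rbrakk> \<Longrightarrow> (c \<odot>\<^bsub>A\<^esub> \<one>\<^bsub>A\<^esub>) \<otimes>\<^bsub>A\<^esub> a = a \<otimes>\<^bsub>A\<^esub> (c \<odot>\<^bsub>A\<^esub> \<one>\<^bsub>A\<^esub>)"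
  by (simp add: smult_mult_l smult_mult_r)

lemma mhom_scalar:
  assumes N: "left_module A N" and c: "c \<in> carrier k" and f: "f \<in> mhom A M N"
  shows "(\<lambda>x. (c \<odot>\<^bsub>A\<^esub> \<one>\<^bsub>A\<^esub>) \<odot>\<^bsub>N\<^esub> f x) \<in> mhom A M N"
proof -
  interpret N: left_module A N by fact
  show ?thesis
    by (rule mhomI) (auto simp: mhomD[OF f] N.smult_closed N.smult_r_distr scalar_closed c N.smult_assoc[symmetric] scalar_central)
qed

text \<open>\<open>hom_cohomology\<close> replaces only the carrier of \<open>hom_module\<close> by
  the cocycles and keeps its operations, so the module laws are needed for a subset \<open>Z\<close>
  with the operations of the whole. Negatives in \<open>Z\<close> arise as multiples by
  \<open>-1\<close>.\<close>

lemma left_module_cocycles: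
  assumes M: "left_module A M" and N: "left_module A N"
    and ZM: "Z \<subseteq> carrier (hom_module A M N)" and Z0: "\<zero>\<^bsub>hom_module A M N\<^esub> \<in> Z"
    and Zadd: "\<And>f g. \<lbrakk>f \<in> Z; g \<in> Z\<rbrakk> \<Longrightarrow> f \<oplus>\<^bsub>hom_module A M N\<^esub> g \<in> Z"
    and Zsmult: "\<And>c f. \<lbrakk>c \<in> carrier k; f \<in> Z\<rbrakk> \<Longrightarrow> c \<odot>\<^bsub>hom_module A M N\<^esub> f \<in> Z"
  shows "left_module k ((hom_module A M N)\<lparr>carrier := Z\<rparr>)" (is "left_module k ?V")
proof -
  interpret M: left_module A M by fact
  interpret N: left_module A N by fact
  have Zh: "f \<in> mhom A M N" "f \<in> extensional (carrier M)" if "f \<in> Z" for f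
    using ZM that by (auto simp: hom_module_simps)
  have Zc: "f x \<in> carrier N" if "f \<in> Z" "x \<in> carrier M" for f x
    using mhomD(1)[OF Zh(1)] that by auto
  have inv: "\<exists>g\<in>Z. g \<oplus>\<^bsub>hom_module A M N\<^esub> f = \<zero>\<^bsub>hom_module A M N\<^esub>" if f: "f \<in> Z" for f
  proof (rule bexI[OF _ Zsmult[OF _ f]])
    show "(\<ominus>\<^bsub>k\<^esub> \<one>\<^bsub>k\<^esub>) \<odot>\<^bsub>hom_module A M N\<^esub> f \<oplus>\<^bsub>hom_module A M N\<^esub> f = \<zero>\<^bsub>hom_module A M N\<^esub>"
      by (auto simp: hom_module_simps restrict_def fun_eq_iff smult_l_uminus smult_one N.smult_l_uminus
        N.smult_one Zc[OF f] N.M.l_neg)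
  qed simp
  have Zu: "f x = undefined" if "f \<in> Z" "x \<notin> carrier M" for f x
    using Zh(2)[OF that(1)] that(2) by (auto simp: extensional_def)
  interpret ab: abelian_group ?V
    by (rule abelian_groupI)
      (use inv Z0 Zadd in \<open>auto simp: hom_module_simps restrict_def Zc N.M.a_ac fun_eq_iff Zu\<close>)
  show ?thesis
  proof unfold_locales
    fix a b f g assume a: "a \<in> carrier k" and "f \<in> carrier ?V"
    then have f: "f \<in> Z" by simp
    show "a \<odot>\<^bsub>?V\<^esub> f \<in> carrier ?V" using Zsmult[OF a f] by simp
    have oneA: "c \<odot>\<^bsub>A\<^esub> \<one>\<^bsub>A\<^esub> \<in> carrier A" if "c \<in> carrier k" for c using that by (rule scalar_closed)
    { assume b: "b \<in> carrier k"
      show "(a \<oplus>\<^bsub>k\<^esub> b) \<odot>\<^bsub>?V\<^esub> f = a \<odot>\<^bsub>?V\<^esub> f \<oplus>\<^bsub>?V\<^esub> b \<odot>\<^bsub>?V\<^esub> f"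
        using a b by (auto simp: hom_module_simps fun_eq_iff smult_l_distr N.smult_l_distr oneA Zc[OF f])
      have "(a \<otimes>\<^bsub>k\<^esub> b) \<odot>\<^bsub>A\<^esub> \<one>\<^bsub>A\<^esub> = (a \<odot>\<^bsub>A\<^esub> \<one>\<^bsub>A\<^esub>) \<otimes>\<^bsub>A\<^esub> (b \<odot>\<^bsub>A\<^esub> \<one>\<^bsub>A\<^esub>)"
        using a b by (simp add: smult_assoc smult_mult_l smult_closed)
      then show "(a \<otimes>\<^bsub>k\<^esub> b) \<odot>\<^bsub>?V\<^esub> f = a \<odot>\<^bsub>?V\<^esub> (b \<odot>\<^bsub>?V\<^esub> f)"
        using a b by (auto simp: hom_module_simps fun_eq_iff N.smult_assoc oneA Zc[OF f]) }
    assume "g \<in> carrier ?V"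
    then have g: "g \<in> Z" by simp
    show "a \<odot>\<^bsub>?V\<^esub> (f \<oplus>\<^bsub>?V\<^esub> g) = a \<odot>\<^bsub>?V\<^esub> f \<oplus>\<^bsub>?V\<^esub> a \<odot>\<^bsub>?V\<^esub> g"
      using a by (auto simp: hom_module_simps fun_eq_iff N.smult_r_distr oneA Zc[OF f] Zc[OF g])
  next
    fix f assume "f \<in> carrier ?V"
    then have f: "f \<in> Z" by simp
    show "\<one>\<^bsub>k\<^esub> \<odot>\<^bsub>?V\<^esub> f = f"
      using Zh(2)[OF f] by (auto simp: hom_module_simps fun_eq_iff smult_one N.smult_one Zc[OF f] extensional_def)
  qed
qed

end

text \<open>The functionals are given on cochains of a known resolution \<open>K\<close>, and the
  conclusion is about any resolution \<open>P\<close>. Together \<open>cob\<close>,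
  \<open>ker\<close> and \<open>surj\<close> say that they are coordinates on the cohomology of
  \<open>K\<close>. \<open>\<Theta>cong\<close> makes them blind to values outside the carrier,
  where composites with chain maps are uncontrolled.\<close>

lemma cohomology_dim:
  fixes k :: "('k, 'z) ring_scheme" and A :: "('k, 'r) module" and M :: "('r, 'm) module" and N :: "('r, 'n) module"
    and P :: "nat \<Rightarrow> ('r, 'p) module" and K :: "nat \<Rightarrow> ('r, 'q) module" and \<Theta> :: "('q \<Rightarrow> 'n) \<Rightarrow> 't \<Rightarrow> 'k"
  assumes k: "field k" and A: "kalgebra k A" and M: "left_module A M" and N: "left_module A N"
    and P: "free_resolution A M P d \<epsilon>" and K: "free_resolution A M K \<delta> \<eta>" and T: "finite T"
    and \<Theta>c: "\<And>z t. \<lbrakk>z \<in> mhom A (K m) N; t \<in> T\<rbrakk> \<Longrightarrow> \<Theta> z t \<in> carrier k"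
    and \<Theta>cong: "\<And>z y t. \<lbrakk>\<And>x. x \<in> carrier (K m) \<Longrightarrow> z x = y x; t \<in> T\<rbrakk> \<Longrightarrow> \<Theta> z t = \<Theta> y t"
    and \<Theta>add: "\<And>z y t. \<lbrakk>z \<in> mhom A (K m) N; y \<in> mhom A (K m) N; t \<in> T\<rbrakk> \<Longrightarrow> \<Theta> (\<lambda>x. z x \<oplus>\<^bsub>N\<^esub> y x) t = \<Theta> z t \<oplus>\<^bsub>k\<^esub> \<Theta> y t"
    and \<Theta>smult: "\<And>c z t. \<lbrakk>c \<in> carrier k; z \<in> mhom A (K m) N; t \<in> T\<rbrakk> \<Longrightarrow>
      \<Theta> (\<lambda>x. (c \<odot>\<^bsub>A\<^esub> \<one>\<^bsub>A\<^esub>) \<odot>\<^bsub>N\<^esub> z x) t = c \<otimes>\<^bsub>k\<^esub> \<Theta> z t"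
    and cob: "\<And>z t. \<lbrakk>coboundary A K \<delta> N m z; t \<in> T\<rbrakk> \<Longrightarrow> \<Theta> z t = \<zero>\<^bsub>k\<^esub>"
    and ker: "\<And>z. \<lbrakk>cocycle A K \<delta> N m z; \<And>t. t \<in> T \<Longrightarrow> \<Theta> z t = \<zero>\<^bsub>k\<^esub>\<rbrakk> \<Longrightarrow> coboundary A K \<delta> N m z"
    and surj: "\<And>t. t \<in> T \<Longrightarrow> \<exists>z. cocycle A K \<delta> N m z \<and> (\<forall>s\<in>T. \<Theta> z s = (if s = t then \<one>\<^bsub>k\<^esub> else \<zero>\<^bsub>k\<^esub>))"
  shows "vectorspace k (hom_cohomology A P d N m) \<and> vectorspace.fin_dim k (hom_cohomology A P d N m) \<and>
    vectorspace.dim k (hom_cohomology A P d N m) = card T"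
proof -
  interpret A: kalgebra k A by fact
  interpret N: left_module A N by fact
  interpret F: field k by fact
  interpret PK: two_resolutions A M P d \<epsilon> K \<delta> \<eta>
    by (intro two_resolutions.intro resolution.intro M P K)
  interpret KP: two_resolutions A M K \<delta> \<eta> P d \<epsilon>
    by (intro two_resolutions.intro resolution.intro M P K)
  obtain f where f: "\<And>i. f i \<in> mhom A (P i) (K i)"
    "\<And>x. x \<in> carrier (P 0) \<Longrightarrow> \<eta> (f 0 x) = \<epsilon> x"
    "\<And>i x. x \<in> carrier (P (Suc i)) \<Longrightarrow> \<delta> i (f (Suc i) x) = f i (d i x)"
    by (rule PK.chain_map_exists) blast
  obtain g where g: "\<And>i. g i \<in> mhom A (K i) (P i)"
    "\<And>x. x \<in> carrier (K 0) \<Longrightarrow> \<epsilon> (g 0 x) = \<eta> x"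
    "\<And>i x. x \<in> carrier (K (Suc i)) \<Longrightarrow> d i (g (Suc i) x) = g i (\<delta> i x)"
    by (rule KP.chain_map_exists) blast
  let ?H = "hom_module A (P m) N"
  define Z where "Z = hom_cocycles A P d N m"
  have Zeq: "Z = {z \<in> extensional (carrier (P m)). cocycle A P d N m z}"
    unfolding Z_def hom_cocycles_def
    by (auto simp: hom_module_simps cocycle_def compose_def fun_eq_iff restrict_def)
  have Zrestr: "restrict z (carrier (P m)) \<in> Z" if "cocycle A P d N m z" for z
  proof -
    have "restrict z (carrier (P m)) \<in> mhom A (P m) N"
      using that restrict_mhom[OF PK.P.P] by (auto simp: cocycle_def)
    then show ?thesis using that mhomD(1)[OF PK.P.d_hom] by (auto simp: Zeq cocycle_def)
  qed
  let ?V = "?H\<lparr>carrier := Z\<rparr>"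
  have V: "left_module k ?V"
  proof (rule A.left_module_cocycles[OF PK.P.P N])
    show "Z \<subseteq> carrier ?H" by (auto simp: Zeq hom_module_simps cocycle_def)
    show "\<zero>\<^bsub>?H\<^esub> \<in> Z" unfolding hom_module_simps
      by (rule Zrestr, rule PK.P.coboundary_cocycle[OF N])
        (auto simp: coboundary_def split: nat.splits intro!: bexI[of _ "\<lambda>_. \<zero>\<^bsub>N\<^esub>"] mhomI simp: N.smult_r_zero)
    show "y \<oplus>\<^bsub>?H\<^esub> z \<in> Z" if "y \<in> Z" "z \<in> Z" for y z
      unfolding hom_module_simps
      by (rule Zrestr) (use that mhom_add[OF N, of y "P m" z] in \<open>auto simp: Zeq cocycle_def\<close>)
    show "c \<odot>\<^bsub>?H\<^esub> z \<in> Z" if "c \<in> carrier k" "z \<in> Z" for c z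
      unfolding hom_module_simps
      by (rule Zrestr) (use that A.mhom_scalar[OF N, of c z "P m"] in \<open>auto simp: Zeq cocycle_def N.smult_r_zero A.scalar_closed\<close>)
  qed
  \<comment> \<open>The functionals are pulled back along the comparison map \<open>g\<close> from
    \<open>K\<close> to \<open>P\<close>.\<close>
  define \<Psi> where "\<Psi> z t = \<Theta> (\<lambda>x. z (g m x)) t" for z t
  have zg: "(\<lambda>x. z (g m x)) \<in> mhom A (K m) N" if "z \<in> Z" for z
    using that mhom_comp[OF g(1)] by (auto simp: Zeq cocycle_def)
  have "vectorspace k (quotient ?V (hom_coboundaries A P d N m)) \<and>
      vectorspace.fin_dim k (quotient ?V (hom_coboundaries A P d N m)) \<and>
      vectorspace.dim k (quotient ?V (hom_coboundaries A P d N m)) = card T"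
  proof (rule quotient_dim[OF k V T, of \<Psi>])
    show "\<Psi> z t \<in> carrier k" if "z \<in> carrier ?V" "t \<in> T" for z t
      using that zg \<Theta>c by (simp add: \<Psi>_def)
    show "\<Psi> (z \<oplus>\<^bsub>?V\<^esub> y) t = \<Psi> z t \<oplus>\<^bsub>k\<^esub> \<Psi> y t" if "z \<in> carrier ?V" "y \<in> carrier ?V" "t \<in> T" for z y t
    proof -
      have "\<Psi> (z \<oplus>\<^bsub>?V\<^esub> y) t = \<Theta> (\<lambda>x. z (g m x) \<oplus>\<^bsub>N\<^esub> y (g m x)) t"
        unfolding \<Psi>_def using that by (intro \<Theta>cong) (auto simp: hom_module_simps mhomD(1)[OF g(1)])
      then show ?thesis using \<Theta>add[OF zg zg] that by (simp add: \<Psi>_def)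
    qed
    show "\<Psi> (c \<odot>\<^bsub>?V\<^esub> z) t = c \<otimes>\<^bsub>k\<^esub> \<Psi> z t" if "c \<in> carrier k" "z \<in> carrier ?V" "t \<in> T" for c z t
    proof -
      have "\<Psi> (c \<odot>\<^bsub>?V\<^esub> z) t = \<Theta> (\<lambda>x. (c \<odot>\<^bsub>A\<^esub> \<one>\<^bsub>A\<^esub>) \<odot>\<^bsub>N\<^esub> z (g m x)) t"
        unfolding \<Psi>_def using that by (intro \<Theta>cong) (auto simp: hom_module_simps mhomD(1)[OF g(1)])
      then show ?thesis using \<Theta>smult[OF _ zg] that by (simp add: \<Psi>_def)
    qed
    show "\<exists>z\<in>carrier ?V. \<forall>s\<in>T. \<Psi> z s = (if s = t then \<one>\<^bsub>k\<^esub> else \<zero>\<^bsub>k\<^esub>)" if t: "t \<in> T" for t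
    proof -
      from surj[OF t] obtain y where y: "cocycle A K \<delta> N m y" "\<forall>s\<in>T. \<Theta> y s = (if s = t then \<one>\<^bsub>k\<^esub> else \<zero>\<^bsub>k\<^esub>)" by blast
      define z where "z = (\<lambda>x\<in>carrier (P m). y (f m x))"
      have "z \<in> Z" unfolding z_def by (rule Zrestr) (rule PK.pullback_cocycle[OF N f(1,3) y(1)])
      have yh: "y \<in> mhom A (K m) N" using y by (simp add: cocycle_def)
      have cb: "coboundary A K \<delta> N m (\<lambda>x. y (f m (g m x)) \<ominus>\<^bsub>N\<^esub> y x)"
        by (rule KP.round_trip[OF N g f y(1)])
      have yfg: "(\<lambda>x. y (f m (g m x))) \<in> mhom A (K m) N" by (rule mhom_comp[OF g(1) mhom_comp[OF f(1) yh]])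
      have "\<Psi> z s = \<Theta> y s" if s: "s \<in> T" for s
      proof -
        \<comment> \<open>Writing \<open>y f g\<close> as \<open>(y f g - y) + y\<close> isolates a
          coboundary, on which \<open>\<Theta>\<close> vanishes; so the pullback of \<open>y\<close>
          has the coordinates of \<open>y\<close>.\<close>
        have "\<Psi> z s = \<Theta> (\<lambda>x. (y (f m (g m x)) \<ominus>\<^bsub>N\<^esub> y x) \<oplus>\<^bsub>N\<^esub> y x) s"
          unfolding \<Psi>_def using s
          by (intro \<Theta>cong) (auto simp: z_def mhomD(1)[OF g(1)] mhomD(1)[OF yh] mhomD(1)[OF yfg] a_minus_def N.M.a_assoc N.M.l_neg)
        also have "\<dots> = \<Theta> (\<lambda>x. y (f m (g m x)) \<ominus>\<^bsub>N\<^esub> y x) s \<oplus>\<^bsub>k\<^esub> \<Theta> y s"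
          by (rule \<Theta>add[OF mhom_minus[OF N yfg yh] yh s])
        finally show ?thesis using cob[OF cb s] \<Theta>c[OF yh s] by simp
      qed
      with y \<open>z \<in> Z\<close> show ?thesis by (intro bexI[of _ z]) auto
    qed
    show "hom_coboundaries A P d N m = {z \<in> carrier ?V. \<forall>t\<in>T. \<Psi> z t = \<zero>\<^bsub>k\<^esub>}"
    proof -
      have "hom_coboundaries A P d N m = {z \<in> extensional (carrier (P m)). coboundary A P d N m z}"
      proof (cases m)
        case 0
        then show ?thesis by (auto simp: coboundary_def hom_module_simps extensional_def restrict_def fun_eq_iff)
      next
        case (Suc j)
        show ?thesis
        proof (intro equalityI subsetI)
          fix z assume "z \<in> hom_coboundaries A P d N m"
          then obtain u where u: "u \<in> mhom A (P j) N" "z = compose (carrier (P (Suc j))) u (d j)"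
            using Suc by (auto simp: hom_module_simps)
          then show "z \<in> {z \<in> extensional (carrier (P m)). coboundary A P d N m z}"
            using Suc by (auto simp: coboundary_def compose_def)
        next
          fix z assume "z \<in> {z \<in> extensional (carrier (P m)). coboundary A P d N m z}"
          then obtain u where u: "u \<in> mhom A (P j) N" "\<And>x. x \<in> carrier (P m) \<Longrightarrow> z x = u (d j x)"
            and z: "z \<in> extensional (carrier (P m))"
            using Suc by (auto simp: coboundary_def)
          have "z = compose (carrier (P (Suc j))) (restrict u (carrier (P j))) (d j)"
            using u z Suc mhomD(1)[OF PK.P.d_hom] by (auto simp: compose_def fun_eq_iff restrict_def extensional_def)
          then show "z \<in> hom_coboundaries A P d N m"
            using Suc restrict_mhom[OF PK.P.P u(1)] by (auto simp: hom_module_simps)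
        qed
      qed
      also have "\<dots> = {z \<in> carrier ?V. \<forall>t\<in>T. \<Psi> z t = \<zero>\<^bsub>k\<^esub>}"
      proof (intro equalityI subsetI)
        fix z assume "z \<in> {z \<in> extensional (carrier (P m)). coboundary A P d N m z}"
        then have z: "z \<in> extensional (carrier (P m))" "coboundary A P d N m z" by auto
        have "z \<in> Z" using z PK.P.coboundary_cocycle[OF N z(2)] by (simp add: Zeq)
        moreover have "\<Psi> z t = \<zero>\<^bsub>k\<^esub>" if "t \<in> T" for t
          unfolding \<Psi>_def by (rule cob[OF KP.pullback_coboundary[OF g(1,3) z(2)] that])
        ultimately show "z \<in> {z \<in> carrier ?V. \<forall>t\<in>T. \<Psi> z t = \<zero>\<^bsub>k\<^esub>}" by simp
      next
        fix z assume "z \<in> {z \<in> carrier ?V. \<forall>t\<in>T. \<Psi> z t = \<zero>\<^bsub>k\<^esub>}"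
        then have zZ: "z \<in> Z" and z0: "\<And>t. t \<in> T \<Longrightarrow> \<Theta> (\<lambda>x. z (g m x)) t = \<zero>\<^bsub>k\<^esub>" by (auto simp: \<Psi>_def)
        then have z: "cocycle A P d N m z" by (simp add: Zeq)
        then have zh: "z \<in> mhom A (P m) N" by (simp add: cocycle_def)
        have "coboundary A K \<delta> N m (\<lambda>x. z (g m x))"
          by (rule ker[OF KP.pullback_cocycle[OF N g(1,3) z] z0])
        from PK.pullback_coboundary[OF f(1,3) this]
        have "coboundary A P d N m (\<lambda>x. z (g m (f m x)))" .
        moreover have "coboundary A P d N m (\<lambda>x. z (g m (f m x)) \<ominus>\<^bsub>N\<^esub> z x)"
          by (rule PK.round_trip[OF N f g z])
        \<comment> \<open>Here \<open>z\<close> is recovered as \<open>z g f - (z g f - z)\<close>,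
          a difference of two coboundaries.\<close>
        ultimately have c: "coboundary A P d N m (\<lambda>x. z (g m (f m x)) \<ominus>\<^bsub>N\<^esub> (z (g m (f m x)) \<ominus>\<^bsub>N\<^esub> z x))"
          by (rule PK.P.coboundary_minus[OF N])
        have zgf: "(\<lambda>x. z (g m (f m x))) \<in> mhom A (P m) N" by (rule mhom_comp[OF f(1) mhom_comp[OF g(1) zh]])
        have "z (g m (f m x)) \<ominus>\<^bsub>N\<^esub> (z (g m (f m x)) \<ominus>\<^bsub>N\<^esub> z x) = z x" if "x \<in> carrier (P m)" for x
          using mhomD(1)[OF zgf that] mhomD(1)[OF zh that]
          by (simp add: a_minus_def N.M.minus_add N.M.a_assoc[symmetric] N.M.r_neg)
        then have "coboundary A P d N m z" using c by (auto simp: coboundary_def split: nat.splits)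
        then show "z \<in> {z \<in> extensional (carrier (P m)). coboundary A P d N m z}" using zZ by (simp add: Zeq)
      qed
      finally show ?thesis .
    qed
  qed
  then show ?thesis by (simp add: hom_cohomology_def Z_def)
qed

section \<open>Signed operators on functions of subsets\<close>

text \<open>The number of factors that \<open>x_i\<close> has to pass, coming from the left, to
  reach its place in the sorted monomial of \<open>I\<close>; its parity is the sign.\<close>

definition cnt :: "nat \<Rightarrow> nat set \<Rightarrow> nat"
  where "cnt i I = card {j \<in> I. j < i}"

lemma cnt_Diff_self [simp]: "cnt i (I - {i}) = cnt i I"
  unfolding cnt_def by (rule arg_cong[of _ _ card]) auto

lemma cnt_insert_self [simp]: "cnt i (insert i I) = cnt i I"
  unfolding cnt_def by (rule arg_cong[of _ _ card]) auto

lemma cnt_insert: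
  assumes "finite I" "j \<notin> I"
  shows "cnt i (insert j I) = cnt i I + (if j < i then 1 else 0)"
proof -
  have "{l \<in> insert j I. l < i} = (if j < i then insert j {l \<in> I. l < i} else {l \<in> I. l < i})" by auto
  then show ?thesis using assms by (simp add: cnt_def)
qed

lemma cnt_Diff:
  assumes "finite I" "j \<in> I"
  shows "cnt i I = cnt i (I - {j}) + (if j < i then 1 else 0)"
  using cnt_insert[of "I - {j}" j i] assms by (simp add: insert_absorb)

context cring
begin

definition sg :: "nat \<Rightarrow> 'a"
  where "sg m = (if even m then \<one> else \<ominus> \<one>)"

lemma sg_closed [simp]: "sg m \<in> carrier R"
  by (simp add: sg_def)

lemma sg_0 [simp]: "sg 0 = \<one>"
  by (simp add: sg_def)

lemma sg_Suc [simp]: "sg (Suc m) = \<ominus> sg m"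
  by (simp add: sg_def)

lemma sg_add: "sg (a + b) = sg a \<otimes> sg b"
  by (auto simp: sg_def l_minus r_minus)

lemma sg_sq [simp]: "sg a \<otimes> sg a = \<one>"
  by (auto simp: sg_def l_minus r_minus)

lemma sg_sq_left: "x \<in> carrier R \<Longrightarrow> sg a \<otimes> (sg a \<otimes> x) = x"
  by (simp add: m_assoc[symmetric])

text \<open>A function \<open>v\<close> of subsets stands for the sum of \<open>v I\<close> times
  the sorted monomial of \<open>I\<close>. This is left multiplication by \<open>x_i\<close>,
  written for coefficients.\<close>

definition Lop :: "nat \<Rightarrow> (nat set \<Rightarrow> 'a) \<Rightarrow> nat set \<Rightarrow> 'a"
  where "Lop i v I = (if i \<in> I then sg (cnt i I) \<otimes> v (I - {i}) else \<zero>)"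

text \<open>The left derivative with respect to \<open>x_j\<close>: it moves the factor
  \<open>x_j\<close> to the front and deletes it.\<close>

definition Dop :: "nat \<Rightarrow> (nat set \<Rightarrow> 'a) \<Rightarrow> nat set \<Rightarrow> 'a"
  where "Dop j v I = (if j \<in> I then \<zero> else sg (cnt j I) \<otimes> v (insert j I))"

text \<open>The grading involution, with sign \<open>-1\<close> on odd degree.\<close>

definition tau :: "(nat set \<Rightarrow> 'a) \<Rightarrow> nat set \<Rightarrow> 'a"
  where "tau v I = sg (card I) \<otimes> v I"

text \<open>Right multiplication by \<open>x_i\<close>: moving \<open>x_i\<close> from the right end
  of a monomial to its left end costs the sign of the degree of the monomial.\<close>

definition Rop :: "nat \<Rightarrow> (nat set \<Rightarrow> 'a) \<Rightarrow> nat set \<Rightarrow> 'a"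
  where "Rop i v = Lop i (tau v)"

text \<open>The right derivative, which moves \<open>x_j\<close> to the end and deletes it. The
  involution comes last because the sign is that of the monomial that remains.\<close>

definition RDop :: "nat \<Rightarrow> (nat set \<Rightarrow> 'a) \<Rightarrow> nat set \<Rightarrow> 'a"
  where "RDop j v = tau (Dop j v)"

lemma sg_cnt_remove_remove:
  assumes "finite I" "i \<in> I" "j \<in> I" "i \<noteq> j"
  shows "sg (cnt i I) \<otimes> sg (cnt j (I - {i})) = \<ominus> (sg (cnt j I) \<otimes> sg (cnt i (I - {j})))"
  using cnt_Diff[OF assms(1,2), of j] cnt_Diff[OF assms(1,3), of i] assms(4)
  by (cases "i < j") (simp_all add: l_minus r_minus m_comm)

lemma sg_cnt_remove_insert:
  assumes "finite I" "i \<in> I" "j \<notin> I"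
  shows "sg (cnt i I) \<otimes> sg (cnt j (I - {i})) = \<ominus> (sg (cnt j I) \<otimes> sg (cnt i (insert j I)))"
proof -
  have "i \<noteq> j" using assms by auto
  then show ?thesis
    using cnt_Diff[OF assms(1,2), of j] cnt_insert[OF assms(1,3), of i]
    by (cases "i < j") (simp_all add: l_minus r_minus m_comm)
qed

lemma Lop_closed: "(\<And>I. v I \<in> carrier R) \<Longrightarrow> Lop i v I \<in> carrier R"
  by (simp add: Lop_def)

lemma Dop_closed: "(\<And>I. v I \<in> carrier R) \<Longrightarrow> Dop i v I \<in> carrier R"
  by (simp add: Dop_def)

lemma tau_closed: "(\<And>I. v I \<in> carrier R) \<Longrightarrow> tau v I \<in> carrier R"
  by (simp add: tau_def)

lemma Lop_Lop_same: "Lop i (Lop i v) I = \<zero>"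
  by (simp add: Lop_def)

lemma Lop_Lop:
  assumes v: "\<And>I. v I \<in> carrier R" and I: "finite I" and ij: "i \<noteq> j"
  shows "Lop i (Lop j v) I = \<ominus> Lop j (Lop i v) I"
proof (cases "i \<in> I \<and> j \<in> I")
  case True
  have "Lop i (Lop j v) I = (sg (cnt i I) \<otimes> sg (cnt j (I - {i}))) \<otimes> v (I - {i} - {j})"
    using True ij v by (simp add: Lop_def m_assoc)
  also have "\<dots> = \<ominus> (sg (cnt j I) \<otimes> sg (cnt i (I - {j})) \<otimes> v (I - {j} - {i}))"
    using True sg_cnt_remove_remove[OF I _ _ ij] v by (simp add: l_minus Diff_insert2[symmetric] insert_commute)
  also have "\<dots> = \<ominus> Lop j (Lop i v) I" using True ij v by (simp add: Lop_def m_assoc)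
  finally show ?thesis .
qed (use v in \<open>auto simp: Lop_def\<close>)

lemma Dop_Lop_same:
  assumes v: "\<And>I. v I \<in> carrier R"
  shows "Dop i (Lop i v) I = (if i \<in> I then \<zero> else v I)"
    and "Lop i (Dop i v) I = (if i \<in> I then v I else \<zero>)"
  using v by (auto simp: Dop_def Lop_def sg_sq_left insert_absorb)

text \<open>Together with \<open>Dop_Lop_same\<close> these are the canonical anticommutation
  relations of multiplication and contraction. Only the relative order of \<open>i\<close> and
  \<open>j\<close> affects the two signs.\<close>

lemma Dop_Lop:
  assumes v: "\<And>I. v I \<in> carrier R" and I: "finite I" and ij: "i \<noteq> j"
  shows "Lop i (Dop j v) I = \<ominus> Dop j (Lop i v) I"
proof (cases "i \<in> I \<and> j \<notin> I")
  case True
  have "Lop i (Dop j v) I = (sg (cnt i I) \<otimes> sg (cnt j (I - {i}))) \<otimes> v (insert j (I - {i}))"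
    using True ij v by (simp add: Lop_def Dop_def m_assoc)
  also have "\<dots> = \<ominus> (sg (cnt j I) \<otimes> sg (cnt i (insert j I)) \<otimes> v (insert j I - {i}))"
    using True sg_cnt_remove_insert[OF I] v ij by (simp add: l_minus insert_Diff_if)
  also have "\<dots> = \<ominus> Dop j (Lop i v) I" using True ij v by (simp add: Lop_def Dop_def m_assoc)
  finally show ?thesis .
qed (use v ij in \<open>auto simp: Lop_def Dop_def\<close>)

lemma tau_tau: "(\<And>I. v I \<in> carrier R) \<Longrightarrow> tau (tau v) I = v I"
  by (simp add: tau_def sg_sq_left)

lemma tau_Lop:
  assumes v: "\<And>I. v I \<in> carrier R" and I: "finite I"
  shows "tau (Lop i v) I = \<ominus> Lop i (tau v) I"
proof (cases "i \<in> I")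
  case True
  then have "card I = Suc (card (I - {i}))" using card_Suc_Diff1[OF I] by simp
  then have s: "sg (card I) = \<ominus> sg (card (I - {i}))" by simp
  show ?thesis using True v
    by (simp add: Lop_def tau_def s l_minus r_minus m_lcomm del: card_Diff_insert card_Diff_singleton)
qed (simp add: Lop_def tau_def)

lemma tau_Dop:
  assumes v: "\<And>I. v I \<in> carrier R" and I: "finite I"
  shows "tau (Dop i v) I = \<ominus> Dop i (tau v) I"
  using assms by (cases "i \<in> I") (simp_all add: Dop_def tau_def l_minus r_minus m_lcomm)

lemma Lop_uminus: "(\<And>I. v I \<in> carrier R) \<Longrightarrow> Lop i (\<lambda>I. \<ominus> v I) I = \<ominus> Lop i v I"
  by (simp add: Lop_def r_minus)

text \<open>Associativity of the exterior product on the level of operators: the sign from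
  exchanging \<open>Lop i\<close> and \<open>Lop j\<close> cancels the one from moving
  \<open>tau\<close> past \<open>Lop i\<close>.\<close>

lemma Lop_Rop:
  assumes v: "\<And>I. v I \<in> carrier R" and I: "finite I"
  shows "Lop i (Rop j v) I = Rop j (Lop i v) I"
proof (cases "i = j")
  case True
  then show ?thesis by (simp add: Rop_def Lop_def tau_def)
next
  case False
  have tv: "tau v I \<in> carrier R" for I by (rule tau_closed) (rule v)
  have "Rop j (Lop i v) I = Lop j (\<lambda>I. \<ominus> Lop i (tau v) I) I"
    using I tau_Lop[of v "I - {j}" i] v by (simp add: Rop_def Lop_def[of j])
  also have "\<dots> = \<ominus> Lop j (Lop i (tau v)) I"
    by (rule Lop_uminus) (rule Lop_closed, rule tv)
  also have "\<dots> = Lop i (Rop j v) I"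
    using Lop_Lop[OF tv I False] by (simp add: Rop_def)
  finally show ?thesis by simp
qed

lemma RDop_apply: "RDop j v I = sg (card I) \<otimes> Dop j v I"
  by (simp add: RDop_def tau_def)

text \<open>\<open>Rop\<close> applies \<open>tau\<close> first and \<open>RDop\<close> applies it
  last. Hence in \<open>Rop i (RDop j v)\<close> the two involutions cancel and leave
  \<open>Lop i (Dop j v)\<close>. For \<open>i \<noteq> j\<close> the other order collects three
  signs, from \<open>Dop_Lop\<close>, \<open>tau_Lop\<close> and \<open>tau_Dop\<close>, which gives
  the minus sign.\<close>

lemma RDop_Rop:
  assumes v: "\<And>I. v I \<in> carrier R" and I: "finite I"
  shows "RDop j (Rop i v) I = (if i = j then v I else \<zero>) \<ominus> Rop i (RDop j v) I"
proof -
  have tv: "tau v I \<in> carrier R" for I by (rule tau_closed) (rule v)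
  have Dv: "Dop j v I \<in> carrier R" for I by (rule Dop_closed) (rule v)
  have R: "Rop i (RDop j v) I = Lop i (Dop j v) I"
    unfolding Rop_def RDop_def by (simp add: Lop_def tau_tau Dv)
  show ?thesis
  proof (cases "i = j")
    case True
    have "RDop j (Rop i v) I = sg (card I) \<otimes> Dop i (Lop i (tau v)) I"
      using True by (simp add: RDop_apply Rop_def)
    also have "\<dots> = (if i \<in> I then \<zero> else v I)"
      using v by (simp add: Dop_Lop_same(1)[where v = "tau v", OF tv] tau_def sg_sq_left)
    finally show ?thesis
      using True R Dop_Lop_same(2)[where v = v and i = i and I = I, OF v] v by (simp add: a_minus_def r_neg)
  next
    case False
    have "RDop j (Rop i v) I = \<ominus> tau (Lop i (Dop j (tau v))) I"
      unfolding RDop_apply Rop_def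
      using Dop_Lop[where v = "tau v", OF tv I False]
      by (simp add: tau_def[of "Lop i (Dop j (tau v))"] r_minus Dop_closed Lop_closed tv)
    also have "\<dots> = Lop i (tau (Dop j (tau v))) I"
      using tau_Lop[OF _ I, of "Dop j (tau v)" i] by (simp add: Dop_closed tv Lop_closed tau_closed)
    also have "\<dots> = Lop i (\<lambda>I. \<ominus> Dop j v I) I"
    proof -
      have "tau (Dop j (tau v)) (I - {i}) = \<ominus> Dop j v (I - {i})"
        using tau_Dop[of "tau v" "I - {i}" j] I tv by (simp add: Dop_def tau_tau v)
      then show ?thesis by (simp add: Lop_def)
    qed
    also have "\<dots> = \<ominus> Lop i (Dop j v) I" by (rule Lop_uminus) (rule Dv)
    finally show ?thesis using False R by (simp add: a_minus_def Lop_closed Dv)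
  qed
qed

end

section \<open>A basis of the exterior algebra\<close>

lemma word_monoid_simps [simp]:
  "carrier (word_monoid S) = lists S" "u \<otimes>\<^bsub>word_monoid S\<^esub> v = u @ v" "\<one>\<^bsub>word_monoid S\<^esub> = []"
  by (simp_all add: word_monoid_def)

lemma (in abelian_group) finsum_mem:
  assumes "\<zero> \<in> H" "\<And>x y. \<lbrakk>x \<in> H; y \<in> H\<rbrakk> \<Longrightarrow> x \<oplus> y \<in> H" "H \<subseteq> carrier G"
    and "\<And>i. i \<in> S \<Longrightarrow> f i \<in> H"
  shows "(\<Oplus>i\<in>S. f i) \<in> H"
  using assms(4)
proof (induction S rule: infinite_finite_induct)
  case (insert x F)
  then have "f \<in> F \<rightarrow> carrier G" "f x \<in> carrier G" using assms(3) by auto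
  with insert show ?case using assms(2) by (simp add: finsum_insert)
qed (use assms(1) in \<open>auto simp: finsum_infinite\<close>)

locale exterior_loc = field k for k :: "('k, 'z) ring_scheme" (structure) +
  fixes n :: nat
begin

definition Ix :: "nat set"
  where "Ix = {1..n}"

lemma finite_Ix [simp]: "finite Ix"
  by (simp add: Ix_def)

sublocale FA: monoid_algebra_loc k "word_monoid Ix"
proof -
  interpret W: Group.monoid "word_monoid Ix" by (rule monoidI) auto
  show "monoid_algebra_loc k (word_monoid Ix)"
    by (intro monoid_algebra_loc.intro is_cring W.monoid_axioms)
qed

abbreviation "F \<equiv> monoid_algebra k (word_monoid Ix)"
abbreviation "I\<^sub>F \<equiv> Idl\<^bsub>F\<^esub> (exterior_relations k n)"
abbreviation "\<Lambda> \<equiv> exterior_algebra k n"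
abbreviation "K \<equiv> self_module k"
abbreviation "W \<equiv> lists Ix"

definition mon :: "nat list \<Rightarrow> (nat list \<Rightarrow> 'k) set"
  where "mon w = I\<^sub>F +>\<^bsub>F\<^esub> basis_elt k w"

lemma basis_word: "w \<in> W \<Longrightarrow> basis_elt k w \<in> carrier F"
  by (rule FA.basis_elt_closed) simp

lemma basis_word_mult: "\<lbrakk>u \<in> W; v \<in> W\<rbrakk> \<Longrightarrow> basis_elt k u \<otimes>\<^bsub>F\<^esub> basis_elt k v = basis_elt k (u @ v)"
  by (subst FA.basis_elt_mult) simp_all

lemma exterior_relations_eq: "exterior_relations k n =
    {basis_elt k [i, i] | i. i \<in> Ix} \<union>
    {basis_elt k [i, j] \<oplus>\<^bsub>F\<^esub> basis_elt k [j, i] | i j. i \<in> Ix \<and> j \<in> Ix \<and> i < j}"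
proof -
  have "basis_elt k [i] \<otimes>\<^bsub>F\<^esub> basis_elt k [j] = basis_elt k [i, j]" if "i \<in> Ix" "j \<in> Ix" for i j
    using that basis_word_mult[of "[i]" "[j]"] by simp
  then show ?thesis
    unfolding exterior_relations_def free_algebra_def Let_def Ix_def[symmetric]
    by (intro arg_cong2[of _ _ _ _ "(\<union>)"] Collect_cong ex_cong1) (auto simp: Ix_def)
qed

lemma exterior_relations_closed: "exterior_relations k n \<subseteq> carrier F"
  unfolding exterior_relations_eq by (auto intro!: FA.MA.L.M.a_closed basis_word)

sublocale EQ: ideal_quotient k F I\<^sub>F
  by (intro ideal_quotient.intro FA.MA.kalgebra_axioms FA.MA.A.genideal_ideal exterior_relations_closed)

lemma \<Lambda>_eq: "\<Lambda> = quotient F I\<^sub>F"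
  by (simp add: exterior_algebra_def free_algebra_def Ix_def)

sublocale \<Lambda>: kalgebra k \<Lambda>
  unfolding \<Lambda>_eq by (rule EQ.kalgebra_quotient)

abbreviation "cl \<equiv> \<lambda>f. I\<^sub>F +>\<^bsub>F\<^esub> f"

lemma \<Lambda>_carrier: "carrier \<Lambda> = cl ` carrier F"
  unfolding \<Lambda>_eq by (rule quotient_carrier)

lemma cl_hom: "cl \<in> mhom k F \<Lambda>"
  unfolding \<Lambda>_eq by (rule EQ.quotient_hom)

lemma cl_mult: "\<lbrakk>f \<in> carrier F; g \<in> carrier F\<rbrakk> \<Longrightarrow> cl f \<otimes>\<^bsub>\<Lambda>\<^esub> cl g = cl (f \<otimes>\<^bsub>F\<^esub> g)"
  unfolding \<Lambda>_eq by (rule EQ.quotient_mult)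

lemma mon_closed: "w \<in> W \<Longrightarrow> mon w \<in> carrier \<Lambda>"
  by (auto simp: mon_def \<Lambda>_carrier basis_word)

lemma mon_Nil: "mon [] = \<one>\<^bsub>\<Lambda>\<^esub>"
  unfolding \<Lambda>_eq by (simp add: mon_def EQ.quotient_one monoid_algebra_simps)

lemma mon_append: "\<lbrakk>u \<in> W; v \<in> W\<rbrakk> \<Longrightarrow> mon (u @ v) = mon u \<otimes>\<^bsub>\<Lambda>\<^esub> mon v"
  by (simp add: mon_def cl_mult basis_word basis_word_mult)

lemma relation_zero: "r \<in> exterior_relations k n \<Longrightarrow> cl r = \<zero>\<^bsub>\<Lambda>\<^esub>"
  using FA.MA.A.genideal_self[OF exterior_relations_closed] exterior_relations_closed
  unfolding \<Lambda>_eq by (subst EQ.quotient_eq_zero_iff) auto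

lemma mon_same: "i \<in> Ix \<Longrightarrow> mon [i] \<otimes>\<^bsub>\<Lambda>\<^esub> mon [i] = \<zero>\<^bsub>\<Lambda>\<^esub>"
  using mon_append[of "[i]" "[i]"] relation_zero[of "basis_elt k [i, i]"]
  by (auto simp: exterior_relations_eq mon_def)

lemma mon_anticomm_less:
  assumes "i \<in> Ix" "j \<in> Ix" "i < j"
  shows "mon [i] \<otimes>\<^bsub>\<Lambda>\<^esub> mon [j] \<oplus>\<^bsub>\<Lambda>\<^esub> mon [j] \<otimes>\<^bsub>\<Lambda>\<^esub> mon [i] = \<zero>\<^bsub>\<Lambda>\<^esub>"
proof -
  have w: "[i] \<in> W" "[j] \<in> W" "[i, j] \<in> W" "[j, i] \<in> W" using assms by auto
  have "mon [i] \<otimes>\<^bsub>\<Lambda>\<^esub> mon [j] \<oplus>\<^bsub>\<Lambda>\<^esub> mon [j] \<otimes>\<^bsub>\<Lambda>\<^esub> mon [i] = mon [i, j] \<oplus>\<^bsub>\<Lambda>\<^esub> mon [j, i]"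
    using mon_append[OF w(1,2)] mon_append[OF w(2,1)] by simp
  also have "\<dots> = cl (basis_elt k [i, j] \<oplus>\<^bsub>F\<^esub> basis_elt k [j, i])"
    unfolding mon_def by (rule mhomD(2)[OF cl_hom, symmetric]) (rule basis_word[OF w(3)], rule basis_word[OF w(4)])
  also have "\<dots> = \<zero>\<^bsub>\<Lambda>\<^esub>"
    by (rule relation_zero) (use assms in \<open>auto simp: exterior_relations_eq\<close>)
  finally show ?thesis .
qed

lemma mon_anticomm:
  assumes "i \<in> Ix" "j \<in> Ix" "i \<noteq> j"
  shows "mon [i] \<otimes>\<^bsub>\<Lambda>\<^esub> mon [j] \<oplus>\<^bsub>\<Lambda>\<^esub> mon [j] \<otimes>\<^bsub>\<Lambda>\<^esub> mon [i] = \<zero>\<^bsub>\<Lambda>\<^esub>"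
proof (cases "i < j")
  case True
  then show ?thesis using mon_anticomm_less[of i j] assms by simp
next
  case False
  have "mon [i] \<in> carrier \<Lambda>" "mon [j] \<in> carrier \<Lambda>" using assms by (auto intro!: mon_closed)
  with False show ?thesis using mon_anticomm_less[of j i] assms by (simp add: \<Lambda>.L.M.a_comm)
qed

lemma \<Lambda>_lin:
  assumes f: "f \<in> carrier F"
  shows "cl f = lin k \<Lambda> mon f"
proof -
  have "cl f = cl (lin k F (basis_elt k) f)" by (simp add: FA.lin_basis_elt_id f)
  also have "\<dots> = lin k \<Lambda> (\<lambda>p. cl (basis_elt k p)) f"
    by (rule lin_hom[OF FA.MA.L.left_module_axioms \<Lambda>.L.left_module_axioms cl_hom
      f[unfolded monoid_algebra_carrier]]) (auto intro: basis_word)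
  finally show ?thesis by (simp add: mon_def[abs_def])
qed

lemma \<Lambda>_induct:
  assumes "z \<in> carrier \<Lambda>" "P \<zero>\<^bsub>\<Lambda>\<^esub>"
    and "\<And>x y. \<lbrakk>x \<in> carrier \<Lambda>; y \<in> carrier \<Lambda>; P x; P y\<rbrakk> \<Longrightarrow> P (x \<oplus>\<^bsub>\<Lambda>\<^esub> y)"
    and "\<And>c w. \<lbrakk>c \<in> carrier k; w \<in> W\<rbrakk> \<Longrightarrow> P (c \<odot>\<^bsub>\<Lambda>\<^esub> mon w)"
  shows "P z"
proof -
  obtain f where f: "f \<in> carrier F" "z = cl f" using assms(1) by (auto simp: \<Lambda>_carrier)
  note fD = fsuppD[OF f(1)[unfolded monoid_algebra_carrier word_monoid_simps]]
  have "(\<Oplus>\<^bsub>\<Lambda>\<^esub>w\<in>{w. f w \<noteq> \<zero>}. f w \<odot>\<^bsub>\<Lambda>\<^esub> mon w) \<in> {x \<in> carrier \<Lambda>. P x}"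
  proof (rule \<Lambda>.L.M.finsum_mem)
    fix w assume "w \<in> {w. f w \<noteq> \<zero>}"
    then have w: "w \<in> W" using fD(3) by blast
    show "f w \<odot>\<^bsub>\<Lambda>\<^esub> mon w \<in> {x \<in> carrier \<Lambda>. P x}"
      using assms(4)[OF fD(1) w] \<Lambda>.L.smult_closed[OF fD(1) mon_closed[OF w]] by blast
  qed (use assms(2,3) in auto)
  then show ?thesis using f \<Lambda>_lin[OF f(1)] by (simp add: lin_def)
qed

section \<open>Straightening words into sorted monomials\<close>

lemma strict_sorted_set: "sorted_wrt (<) l \<Longrightarrow> sorted_list_of_set (set l) = (l :: nat list)"
  by (simp add: strict_sorted_iff sorted_list_of_set.idem_if_sorted_distinct)

definition emon :: "nat set \<Rightarrow> (nat list \<Rightarrow> 'k) set"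
  where "emon S = mon (sorted_list_of_set S)"

lemma sorted_word: "S \<subseteq> Ix \<Longrightarrow> sorted_list_of_set S \<in> W"
  using finite_subset[of S "Ix"] by auto

lemma emon_closed: "S \<subseteq> Ix \<Longrightarrow> emon S \<in> carrier \<Lambda>"
  unfolding emon_def by (intro mon_closed sorted_word)

text \<open>One pass of insertion sort: the letter moves right, each exchange costing a sign, until
  it fits or meets its equal and the product vanishes. The bound
  \<open>S \<subseteq> insert i (set l)\<close> is the invariant: it keeps \<open>h\<close> below
  every element of \<open>S\<close>, so that \<open>h\<close> may be put back in front.\<close>

lemma straighten_letter:
  assumes i: "i \<in> Ix" and "sorted_wrt (<) l" "l \<in> W"
  shows "\<exists>c\<in>carrier k. \<exists>S. S \<subseteq> insert i (set l) \<and> mon [i] \<otimes>\<^bsub>\<Lambda>\<^esub> mon l = c \<odot>\<^bsub>\<Lambda>\<^esub> emon S"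
  using assms(2,3)
proof (induction l)
  case Nil
  have "mon [i] \<otimes>\<^bsub>\<Lambda>\<^esub> mon [] = \<one> \<odot>\<^bsub>\<Lambda>\<^esub> emon {i}"
    using i mon_closed[of "[i]"] by (simp add: emon_def mon_Nil \<Lambda>.L.smult_one)
  then show ?case by (intro bexI[of _ \<one>] exI[of _ "{i}"]) auto
next
  case (Cons h t)
  have h: "h \<in> Ix" "t \<in> W" "sorted_wrt (<) t" "\<And>x. x \<in> set t \<Longrightarrow> h < x" using Cons.prems by auto
  have mc: "mon [i] \<in> carrier \<Lambda>" "mon [h] \<in> carrier \<Lambda>" "mon t \<in> carrier \<Lambda>"
    using i h by (auto intro!: mon_closed)
  have ht: "mon (h # t) = mon [h] \<otimes>\<^bsub>\<Lambda>\<^esub> mon t" using mon_append[of "[h]" t] h by simp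
  consider "i < h" | "i = h" | "h < i" by linarith
  then show ?case
  proof cases
    case 1
    have "i < x" if "x \<in> set t" for x using h(4)[OF that] 1 by simp
    then have s: "sorted_wrt (<) (i # h # t)" using 1 h(3,4) by simp
    have "mon [i] \<otimes>\<^bsub>\<Lambda>\<^esub> mon (h # t) = mon (i # h # t)" using mon_append[of "[i]" "h # t"] i h by simp
    also have "\<dots> = emon (set (i # h # t))" unfolding emon_def strict_sorted_set[OF s] ..
    also have "\<dots> = \<one> \<odot>\<^bsub>\<Lambda>\<^esub> emon (set (i # h # t))"
      by (rule \<Lambda>.L.smult_one[symmetric], rule emon_closed) (use i h in auto)
    finally show ?thesis by (intro bexI[of _ \<one>] exI[of _ "set (i # h # t)"]) auto
  next
    case 2
    have "mon [i] \<otimes>\<^bsub>\<Lambda>\<^esub> mon (h # t) = (mon [i] \<otimes>\<^bsub>\<Lambda>\<^esub> mon [i]) \<otimes>\<^bsub>\<Lambda>\<^esub> mon t"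
      unfolding ht unfolding 2[symmetric] by (rule \<Lambda>.A.m_assoc[OF mc(1,1,3), symmetric])
    also have "\<dots> = \<zero>\<^bsub>\<Lambda>\<^esub>" unfolding mon_same[OF i] by (rule \<Lambda>.A.l_null[OF mc(3)])
    also have "\<dots> = \<zero> \<odot>\<^bsub>\<Lambda>\<^esub> emon {}" by (rule \<Lambda>.L.smult_l_zero[OF emon_closed, symmetric]) simp
    finally show ?thesis by (intro bexI[of _ \<zero>] exI[of _ "{}"]) auto
  next
    case 3
    from Cons.IH[OF h(3,2)] obtain c S where c: "c \<in> carrier k" "S \<subseteq> insert i (set t)"
      "mon [i] \<otimes>\<^bsub>\<Lambda>\<^esub> mon t = c \<odot>\<^bsub>\<Lambda>\<^esub> emon S" by blast
    have "set t \<subseteq> Ix" using h(2) by auto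
    then have S: "S \<subseteq> Ix" using c(2) i by blast
    have fS: "finite S" using finite_subset[OF S finite_Ix] .
    have hS: "h < x" if "x \<in> S" for x using c(2) 3 h(4) that by blast
    have s: "sorted_wrt (<) (h # sorted_list_of_set S)" using hS fS by simp
    have hemon: "mon [h] \<otimes>\<^bsub>\<Lambda>\<^esub> emon S = emon (insert h S)"
    proof -
      have "mon [h] \<otimes>\<^bsub>\<Lambda>\<^esub> emon S = mon (h # sorted_list_of_set S)"
        unfolding emon_def using mon_append[of "[h]" "sorted_list_of_set S"] h(1) sorted_word[OF S] by simp
      also have "\<dots> = emon (set (h # sorted_list_of_set S))" unfolding emon_def strict_sorted_set[OF s] ..
      finally show ?thesis using fS by simp
    qed
    have anti: "mon [i] \<otimes>\<^bsub>\<Lambda>\<^esub> mon [h] = \<ominus>\<^bsub>\<Lambda>\<^esub> (mon [h] \<otimes>\<^bsub>\<Lambda>\<^esub> mon [i])"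
      using mon_anticomm[of i h] i h(1) 3 mc by (intro \<Lambda>.L.M.minus_equality[symmetric]) auto
    have "mon [i] \<otimes>\<^bsub>\<Lambda>\<^esub> mon (h # t) = (mon [i] \<otimes>\<^bsub>\<Lambda>\<^esub> mon [h]) \<otimes>\<^bsub>\<Lambda>\<^esub> mon t"
      unfolding ht using mc by (simp add: \<Lambda>.A.m_assoc)
    also have "\<dots> = \<ominus>\<^bsub>\<Lambda>\<^esub> (mon [h] \<otimes>\<^bsub>\<Lambda>\<^esub> (mon [i] \<otimes>\<^bsub>\<Lambda>\<^esub> mon t))"
      unfolding anti using mc by (simp add: \<Lambda>.A.l_minus \<Lambda>.A.m_assoc)
    also have "\<dots> = \<ominus>\<^bsub>\<Lambda>\<^esub> (c \<odot>\<^bsub>\<Lambda>\<^esub> emon (insert h S))"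
      unfolding c(3) using c(1) mc emon_closed[OF S] hemon by (simp add: \<Lambda>.smult_mult_r)
    also have "\<dots> = (\<ominus> c) \<odot>\<^bsub>\<Lambda>\<^esub> emon (insert h S)"
      using c(1) S h(1) by (intro \<Lambda>.L.smult_l_uminus[symmetric] emon_closed) auto
    finally show ?thesis using c(1,2) by (intro bexI[of _ "\<ominus> c"] exI[of _ "insert h S"]) auto
  qed
qed

lemma straighten:
  assumes "w \<in> W"
  shows "\<exists>c\<in>carrier k. \<exists>S. S \<subseteq> Ix \<and> mon w = c \<odot>\<^bsub>\<Lambda>\<^esub> emon S"
  using assms
proof (induction w)
  case Nil
  have "mon [] = \<one> \<odot>\<^bsub>\<Lambda>\<^esub> emon {}" by (simp add: emon_def mon_closed \<Lambda>.L.smult_one)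
  then show ?case by (intro bexI[of _ \<one>] exI[of _ "{}"]) auto
next
  case (Cons i w)
  then obtain c S where c: "c \<in> carrier k" "S \<subseteq> Ix" "mon w = c \<odot>\<^bsub>\<Lambda>\<^esub> emon S" by auto
  have i: "i \<in> Ix" "[i] \<in> W" "w \<in> W" using Cons by auto
  have "sorted_wrt (<) (sorted_list_of_set S)" by simp
  from straighten_letter[OF i(1) this sorted_word[OF c(2)]] obtain c' S' where
    c': "c' \<in> carrier k" "S' \<subseteq> insert i (set (sorted_list_of_set S))" "mon [i] \<otimes>\<^bsub>\<Lambda>\<^esub> emon S = c' \<odot>\<^bsub>\<Lambda>\<^esub> emon S'"
    unfolding emon_def by blast
  have S': "S' \<subseteq> Ix" using c'(2) i sorted_word[OF c(2)] by auto
  have "mon (i # w) = mon [i] \<otimes>\<^bsub>\<Lambda>\<^esub> mon w" using mon_append[OF i(2,3)] by simp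
  also have "\<dots> = c \<odot>\<^bsub>\<Lambda>\<^esub> (c' \<odot>\<^bsub>\<Lambda>\<^esub> emon S')"
    unfolding c(3) using c(1) mon_closed[OF i(2)] emon_closed[OF c(2)] c'(3) by (simp add: \<Lambda>.smult_mult_r)
  also have "\<dots> = (c \<otimes> c') \<odot>\<^bsub>\<Lambda>\<^esub> emon S'" using c c' emon_closed[OF S'] by (simp add: \<Lambda>.L.smult_assoc)
  finally show ?case using c(1) c'(1) S' by blast
qed

lemma emon_induct:
  assumes "z \<in> carrier \<Lambda>" "P \<zero>\<^bsub>\<Lambda>\<^esub>"
    and "\<And>x y. \<lbrakk>x \<in> carrier \<Lambda>; y \<in> carrier \<Lambda>; P x; P y\<rbrakk> \<Longrightarrow> P (x \<oplus>\<^bsub>\<Lambda>\<^esub> y)"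
    and "\<And>c S. \<lbrakk>c \<in> carrier k; S \<subseteq> Ix\<rbrakk> \<Longrightarrow> P (c \<odot>\<^bsub>\<Lambda>\<^esub> emon S)"
  shows "P z"
proof (rule \<Lambda>_induct[OF assms(1), where P = P])
  fix c w assume c: "c \<in> carrier k" "w \<in> W"
  from straighten[OF c(2)] obtain c' S where "c' \<in> carrier k" "S \<subseteq> Ix" "mon w = c' \<odot>\<^bsub>\<Lambda>\<^esub> emon S" by blast
  then have "c \<odot>\<^bsub>\<Lambda>\<^esub> mon w = (c \<otimes> c') \<odot>\<^bsub>\<Lambda>\<^esub> emon S" "c \<otimes> c' \<in> carrier k" "S \<subseteq> Ix"
    using c emon_closed by (auto simp: \<Lambda>.L.smult_assoc)
  then show "P (c \<odot>\<^bsub>\<Lambda>\<^esub> mon w)" using assms(4)[of "c \<otimes> c'" S] by simp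
qed (use assms in auto)

section \<open>The action of the free algebra on functions of subsets\<close>

definition V :: "(nat set \<Rightarrow> 'k) set"
  where "V = {v. (\<forall>I. v I \<in> carrier k) \<and> (\<forall>I. \<not> I \<subseteq> Ix \<longrightarrow> v I = \<zero>)}"

lemma V_D: "v \<in> V \<Longrightarrow> v I \<in> carrier k" "\<lbrakk>v \<in> V; \<not> I \<subseteq> Ix\<rbrakk> \<Longrightarrow> v I = \<zero>"
  by (auto simp: V_def)

text \<open>The sign rules hold for finite sets; at infinite ones the vectors in \<open>V\<close>
  vanish, so identities between operators hold there as well.\<close>

lemma V_finite: "\<lbrakk>v \<in> V; infinite I\<rbrakk> \<Longrightarrow> v I = \<zero>"
  by (rule V_D(2)) (use finite_subset[OF _ finite_Ix] in blast)+

lemma V_ext: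
  assumes "v \<in> V" "u \<in> V" and eq: "\<And>I. I \<subseteq> Ix \<Longrightarrow> v I = u I"
  shows "v = u"
proof
  fix I
  show "v I = u I"
    using eq[of I] V_D(2)[OF assms(1), of I] V_D(2)[OF assms(2), of I] by (cases "I \<subseteq> Ix") simp_all
qed

lemma Lop_V:
  assumes v: "v \<in> V" and i: "i \<in> Ix"
  shows "Lop i v \<in> V"
proof -
  have "v (I - {i}) = \<zero>" if "\<not> I \<subseteq> Ix" for I
    by (rule V_D(2)[OF v]) (use that i in blast)
  then show ?thesis using V_D(1)[OF v] by (simp add: V_def Lop_def)
qed

lemma tau_V: "v \<in> V \<Longrightarrow> tau v \<in> V"
  by (auto simp: V_def tau_def)

lemma Rop_V: "\<lbrakk>v \<in> V; i \<in> Ix\<rbrakk> \<Longrightarrow> Rop i v \<in> V"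
  unfolding Rop_def by (intro Lop_V tau_V)

lemma RDop_V:
  assumes v: "v \<in> V"
  shows "RDop i v \<in> V"
proof -
  have "v (insert i I) = \<zero>" if "\<not> I \<subseteq> Ix" for I
    by (rule V_D(2)[OF v]) (use that in blast)
  then have "Dop i v \<in> V" using V_D(1)[OF v] by (simp add: V_def Dop_def)
  then show ?thesis unfolding RDop_def by (rule tau_V)
qed

fun act :: "nat list \<Rightarrow> (nat set \<Rightarrow> 'k) \<Rightarrow> nat set \<Rightarrow> 'k"
  where "act [] v = v"
  | "act (i # w) v = Lop i (act w v)"

lemma act_append: "act (u @ w) v = act u (act w v)"
  by (induction u) auto

lemma act_V: "\<lbrakk>v \<in> V; w \<in> W\<rbrakk> \<Longrightarrow> act w v \<in> V"
  by (induction w) (simp_all add: Lop_V)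

definition vac :: "nat set \<Rightarrow> 'k"
  where "vac I = (if I = {} then \<one> else \<zero>)"

lemma vac_V: "vac \<in> V"
  by (auto simp: V_def vac_def)

lemma tau_vac: "tau vac = vac"
  by (auto simp: tau_def vac_def)

text \<open>The vector obtained by letting \<open>f\<close> act on \<open>v\<close>. Applied to
  \<open>vac\<close>, the coordinate vector of 1, it gives the coordinates of the class of
  \<open>f\<close>.\<close>

definition ev :: "(nat set \<Rightarrow> 'k) \<Rightarrow> (nat list \<Rightarrow> 'k) \<Rightarrow> nat set \<Rightarrow> 'k"
  where "ev v f I = lin k K (\<lambda>w. act w v I) f"

lemma fsW: "f \<in> carrier F \<Longrightarrow> f \<in> fsupp k W"
  by (simp add: monoid_algebra_carrier)

lemma lin_K_zero: "f \<in> fsupp k W \<Longrightarrow> (\<And>w. w \<in> W \<Longrightarrow> h w = \<zero>) \<Longrightarrow> lin k K h f = \<zero>"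
proof -
  assume f: "f \<in> fsupp k W" and h: "\<And>w. w \<in> W \<Longrightarrow> h w = \<zero>"
  have "lin k K h f = lin k K (\<lambda>_. \<zero>) f"
    by (rule FA.KK.lin_cong[OF f]) (use h in auto)
  also have "\<dots> = \<zero>" using fsuppD[OF f] by (simp add: lin_def)
  finally show ?thesis .
qed

lemma Lop_lin:
  assumes f: "f \<in> fsupp k W" and g: "\<And>w. w \<in> W \<Longrightarrow> g w \<in> V"
  shows "Lop i (\<lambda>I. lin k K (\<lambda>w. g w I) f) I = lin k K (\<lambda>w. Lop i (g w) I) f"
proof (cases "i \<in> I")
  case True
  have "lin k K (\<lambda>w. sg (cnt i I) \<odot>\<^bsub>K\<^esub> g w (I - {i})) f = sg (cnt i I) \<odot>\<^bsub>K\<^esub> lin k K (\<lambda>w. g w (I - {i})) f"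
    by (rule FA.lin_smult_fun[OF FA.KK.left_module_axioms f]) (use V_D(1)[OF g] in auto)
  with True show ?thesis by (simp add: Lop_def)
next
  case False
  then show ?thesis using lin_K_zero[OF f] by (simp add: Lop_def)
qed

lemma tau_lin:
  assumes f: "f \<in> fsupp k W" and g: "\<And>w. w \<in> W \<Longrightarrow> g w \<in> V"
  shows "tau (\<lambda>I. lin k K (\<lambda>w. g w I) f) I = lin k K (\<lambda>w. tau (g w) I) f"
proof -
  have "lin k K (\<lambda>w. sg (card I) \<odot>\<^bsub>K\<^esub> g w I) f = sg (card I) \<odot>\<^bsub>K\<^esub> lin k K (\<lambda>w. g w I) f"
    by (rule FA.lin_smult_fun[OF FA.KK.left_module_axioms f]) (use V_D(1)[OF g] in auto)
  then show ?thesis by (simp add: tau_def)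
qed

lemma act_lin:
  assumes f: "f \<in> fsupp k W" and g: "\<And>w. w \<in> W \<Longrightarrow> g w \<in> V" and u: "u \<in> W"
  shows "act u (\<lambda>I. lin k K (\<lambda>w. g w I) f) I = lin k K (\<lambda>w. act u (g w) I) f"
  using u
proof (induction u arbitrary: I rule: lists.induct)
  case (Cons i u)
  have "act (i # u) (\<lambda>I. lin k K (\<lambda>w. g w I) f) I = Lop i (\<lambda>I. lin k K (\<lambda>w. act u (g w) I) f) I"
    using Cons by (simp add: Lop_def)
  also have "\<dots> = lin k K (\<lambda>w. Lop i (act u (g w)) I) f"
    by (rule Lop_lin[OF f], rule act_V, rule g, assumption) (use Cons.hyps in blast)
  finally show ?case by simp
qed simp

lemma ev_V:
  assumes v: "v \<in> V" and f: "f \<in> carrier F"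
  shows "ev v f \<in> V"
proof -
  have "lin k K (\<lambda>w. act w v I) f \<in> carrier k" for I
    using FA.KK.lin_closed[OF fsW[OF f], of "\<lambda>w. act w v I"] V_D(1)[OF act_V[OF v]] by auto
  moreover have "lin k K (\<lambda>w. act w v I) f = \<zero>" if "\<not> I \<subseteq> Ix" for I
    by (rule lin_K_zero[OF fsW[OF f]]) (use V_D(2)[OF act_V[OF v] that] in auto)
  ultimately show ?thesis by (auto simp: V_def ev_def)
qed

lemma ev_mult:
  assumes v: "v \<in> V" and f: "f \<in> carrier F" and g: "g \<in> carrier F"
  shows "ev v (f \<otimes>\<^bsub>F\<^esub> g) I = ev (ev v g) f I"
proof -
  have "ev v (f \<otimes>\<^bsub>F\<^esub> g) I = lin k K (\<lambda>u. lin k K (\<lambda>w. act (u @ w) v I) g) f"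
    unfolding ev_def
    by (subst FA.lin_conv[OF FA.KK.left_module_axioms _ f g]) (use V_D(1)[OF act_V[OF v]] in auto)
  also have "\<dots> = lin k K (\<lambda>u. act u (ev v g) I) f"
  proof (rule FA.KK.lin_cong[OF fsW[OF f]])
    show "(\<lambda>u. act u (ev v g) I) \<in> W \<rightarrow> carrier K"
      using V_D(1)[OF act_V[OF ev_V[OF v g]]] by auto
    fix u assume u: "u \<in> W"
    show "lin k K (\<lambda>w. act (u @ w) v I) g = act u (ev v g) I"
      unfolding ev_def[abs_def] act_append
      by (rule act_lin[OF fsW[OF g] _ u, symmetric]) (rule act_V[OF v])
  qed
  finally show ?thesis by (simp add: ev_def)
qed

lemma ev_add: "\<lbrakk>v \<in> V; f \<in> carrier F; g \<in> carrier F\<rbrakk> \<Longrightarrow> ev v (f \<oplus>\<^bsub>F\<^esub> g) I = ev v f I \<oplus> ev v g I"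
  unfolding ev_def monoid_algebra_simps
  using FA.KK.lin_add[OF fsW fsW, of f g "\<lambda>w. act w v I"] V_D(1)[OF act_V] by auto

lemma ev_smult: "\<lbrakk>v \<in> V; f \<in> carrier F; c \<in> carrier k\<rbrakk> \<Longrightarrow> ev v (c \<odot>\<^bsub>F\<^esub> f) I = c \<otimes> ev v f I"
  unfolding ev_def monoid_algebra_simps
  using FA.KK.lin_smult[OF fsW, of f "\<lambda>w. act w v I" c] V_D(1)[OF act_V] by auto

lemma ev_basis: "\<lbrakk>v \<in> V; w \<in> W\<rbrakk> \<Longrightarrow> ev v (basis_elt k w) I = act w v I"
  unfolding ev_def using FA.KK.lin_basis_elt[of "\<lambda>w. act w v I" w] V_D(1)[OF act_V] by simp

lemma ev_uminus:
  assumes "v \<in> V" "f \<in> carrier F"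
  shows "ev v (\<ominus>\<^bsub>F\<^esub> f) I = \<ominus> ev v f I"
  by (rule additive_uminus[OF FA.MA.A.is_abelian_group abelian_group_axioms, of "\<lambda>f. ev v f I"])
    (use assms V_D(1)[OF ev_V] ev_add in auto)

lemma ev_zero: "ev v \<zero>\<^bsub>F\<^esub> I = \<zero>"
  by (simp add: ev_def monoid_algebra_simps lin_def)

text \<open>A product \<open>f g\<close> acts on \<open>v\<close> as \<open>f\<close> does on the
  image of \<open>v\<close> under \<open>g\<close>, so right multiplication changes the vector. The
  annihilator \<open>J\<close> is therefore taken over all of \<open>V\<close>, which makes it
  two-sided; that it contains the generating relations is the anticommutation of the
  \<open>Lop i\<close>.\<close>

lemma ev_ideal:
  assumes f: "f \<in> I\<^sub>F" and v: "v \<in> V"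
  shows "ev v f I = \<zero>"
proof -
  define J where "J = {f \<in> carrier F. \<forall>v\<in>V. \<forall>I. ev v f I = \<zero>}"
  have "ideal J F"
  proof (rule idealI)
    show "ring F" by (rule FA.ring_MA)
    show "subgroup J (add_monoid F)"
    proof (rule group.subgroupI[OF abelian_group.a_group[OF FA.MA.A.is_abelian_group]])
      show "J \<noteq> {}" using ev_zero by (auto simp: J_def intro!: exI[of _ "\<zero>\<^bsub>F\<^esub>"])
    qed (auto simp: J_def a_inv_def[symmetric] ev_uminus ev_add)
    fix x u assume "x \<in> J" and u: "u \<in> carrier F"
    then have xc: "x \<in> carrier F" and x: "\<And>v I. v \<in> V \<Longrightarrow> ev v x I = \<zero>" by (auto simp: J_def)
    have "ev v (u \<otimes>\<^bsub>F\<^esub> x) I = \<zero>" if v: "v \<in> V" for v I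
    proof -
      have "ev v x = (\<lambda>_. \<zero>)" using x[OF v] by auto
      then have e: "ev v (u \<otimes>\<^bsub>F\<^esub> x) I = lin k K (\<lambda>w. act w (\<lambda>_. \<zero>) I) u"
        unfolding ev_mult[OF v u xc] by (simp add: ev_def)
      have "act w (\<lambda>_. \<zero>) I = \<zero>" for w I by (induction w arbitrary: I) (auto simp: Lop_def)
      then show ?thesis unfolding e by (intro lin_K_zero fsW u)
    qed
    then show "u \<otimes>\<^bsub>F\<^esub> x \<in> J" using u xc by (simp add: J_def)
    show "x \<otimes>\<^bsub>F\<^esub> u \<in> J"
      using u xc x ev_V by (simp add: J_def ev_mult)
  qed
  moreover have "exterior_relations k n \<subseteq> J"
  proof
    fix r assume r: "r \<in> exterior_relations k n"
    have "ev v r I = \<zero>" if v: "v \<in> V" for v I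
      using r unfolding exterior_relations_eq
    proof (elim UnE CollectE exE conjE)
      fix i assume "r = basis_elt k [i, i]" "i \<in> Ix"
      then show ?thesis using v by (simp add: ev_basis Lop_Lop_same)
    next
      fix i j assume r: "r = basis_elt k [i, j] \<oplus>\<^bsub>F\<^esub> basis_elt k [j, i]" and ij: "i \<in> Ix" "j \<in> Ix" "i < j"
      have w: "[i, j] \<in> W" "[j, i] \<in> W" using ij by auto
      have e: "ev v r I = Lop i (Lop j v) I \<oplus> Lop j (Lop i v) I"
        unfolding r using v w by (simp add: ev_add basis_word ev_basis)
      have L: "Lop i (Lop j v) \<in> V" "Lop j (Lop i v) \<in> V" using v ij by (auto intro!: Lop_V)
      show ?thesis
      proof (cases "finite I")
        case True
        show ?thesis unfolding e
          using Lop_Lop[OF V_D(1)[OF v] True, of i j] ij V_D(1)[OF L(2)] by (simp add: l_neg)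
      next
        case False
        then show ?thesis unfolding e using V_finite[OF L(1)] V_finite[OF L(2)] by simp
      qed
    qed
    then show "r \<in> J" using r exterior_relations_closed by (auto simp: J_def)
  qed
  ultimately have "I\<^sub>F \<subseteq> J" by (rule FA.MA.A.genideal_minimal)
  then show ?thesis using f v by (auto simp: J_def)
qed

text \<open>The coordinate vector of an element of \<open>\<Lambda>\<close>. That the chosen
  representative does not matter is \<open>ev_ideal\<close>.\<close>

definition co :: "(nat list \<Rightarrow> 'k) set \<Rightarrow> nat set \<Rightarrow> 'k"
  where "co z = ev vac (SOME f. f \<in> carrier F \<and> z = cl f)"

lemma co_cl:
  assumes f: "f \<in> carrier F"
  shows "co (cl f) = ev vac f"
proof -
  define g where "g = (SOME g. g \<in> carrier F \<and> cl f = cl g)"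
  have g: "g \<in> carrier F" "cl f = cl g"
    using someI[of "\<lambda>g. g \<in> carrier F \<and> cl f = cl g" f] f unfolding g_def by auto
  then have "f \<ominus>\<^bsub>F\<^esub> g \<in> I\<^sub>F" using f by (simp add: EQ.quotient_eq_iff)
  have "ev vac f I = ev vac g I" for I
  proof -
    have "ev vac f I \<ominus> ev vac g I = ev vac (f \<ominus>\<^bsub>F\<^esub> g) I"
      unfolding a_minus_def using f g vac_V by (simp add: ev_add ev_uminus)
    also have "\<dots> = \<zero>" by (rule ev_ideal[OF \<open>f \<ominus>\<^bsub>F\<^esub> g \<in> I\<^sub>F\<close> vac_V])
    finally show ?thesis using V_D(1)[OF ev_V[OF vac_V]] f g by (simp add: minus_eq_zero_iff)
  qed
  then show ?thesis unfolding co_def g_def[symmetric] by auto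
qed

lemma co_V:
  assumes "z \<in> carrier \<Lambda>"
  shows "co z \<in> V"
proof -
  obtain f where f: "f \<in> carrier F" "z = cl f" using assms by (auto simp: \<Lambda>_carrier)
  then show ?thesis by (simp only: co_cl ev_V[OF vac_V])
qed

lemma co_closed: "z \<in> carrier \<Lambda> \<Longrightarrow> co z I \<in> carrier k"
  by (rule V_D(1)[OF co_V])

lemma co_add: "\<lbrakk>x \<in> carrier \<Lambda>; y \<in> carrier \<Lambda>\<rbrakk> \<Longrightarrow> co (x \<oplus>\<^bsub>\<Lambda>\<^esub> y) I = co x I \<oplus> co y I"
  using FA.MA.L.M.a_closed by (auto simp: \<Lambda>_carrier mhomD(2)[OF cl_hom, symmetric] co_cl ev_add vac_V)

lemma co_smult: "\<lbrakk>c \<in> carrier k; x \<in> carrier \<Lambda>\<rbrakk> \<Longrightarrow> co (c \<odot>\<^bsub>\<Lambda>\<^esub> x) I = c \<otimes> co x I"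
  using FA.MA.L.smult_closed by (auto simp: \<Lambda>_carrier mhomD(3)[OF cl_hom, symmetric] co_cl ev_smult vac_V)

lemma co_hom: "(\<lambda>z. co z I) \<in> mhom k \<Lambda> K"
  by (rule mhomI) (auto simp: co_closed co_add co_smult)

lemma co_zero: "co \<zero>\<^bsub>\<Lambda>\<^esub> I = \<zero>"
  using mhom_zero[OF \<Lambda>.L.left_module_axioms FA.KK.left_module_axioms co_hom] by simp

lemma co_uminus: "x \<in> carrier \<Lambda> \<Longrightarrow> co (\<ominus>\<^bsub>\<Lambda>\<^esub> x) I = \<ominus> co x I"
  by (rule additive_uminus[OF \<Lambda>.A.is_abelian_group abelian_group_axioms, of "\<lambda>f. co f I"])
    (auto simp: co_closed co_add)

lemma co_minus: "\<lbrakk>x \<in> carrier \<Lambda>; y \<in> carrier \<Lambda>\<rbrakk> \<Longrightarrow> co (x \<ominus>\<^bsub>\<Lambda>\<^esub> y) I = co x I \<ominus> co y I"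
  by (simp add: a_minus_def co_add co_uminus)

lemma co_finsum: "f \<in> S \<rightarrow> carrier \<Lambda> \<Longrightarrow> co (\<Oplus>\<^bsub>\<Lambda>\<^esub>i\<in>S. f i) I = (\<Oplus>i\<in>S. co (f i) I)"
  using mhom_finsum[OF \<Lambda>.L.left_module_axioms FA.KK.left_module_axioms co_hom] by simp

text \<open>The largest letter acts first, and each further letter is smaller than all those
  present, so no sign ever arises.\<close>

lemma act_sorted:
  assumes "sorted_wrt (<) l"
  shows "act l vac I = (if I = set l then \<one> else \<zero>)"
  using assms
proof (induction l arbitrary: I)
  case Nil
  then show ?case by (simp add: vac_def)
next
  case (Cons i l)
  have c0: "cnt i (insert i (set l)) = 0"
    using Cons.prems by (auto simp: cnt_def)
  have eq: "i \<in> I \<Longrightarrow> I - {i} = set l \<longleftrightarrow> I = insert i (set l)"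
    using Cons.prems by auto
  show ?case using Cons eq c0 by (auto simp: Lop_def)
qed

lemma co_emon:
  assumes S: "S \<subseteq> Ix"
  shows "co (emon S) I = (if I = S then \<one> else \<zero>)"
proof -
  have "finite S" by (rule finite_subset[OF S finite_Ix])
  then show ?thesis
    unfolding emon_def mon_def using sorted_word[OF S] vac_V
    by (simp add: co_cl basis_word ev_basis act_sorted)
qed

lemma co_mon_left:
  assumes i: "i \<in> Ix" and x: "x \<in> carrier \<Lambda>"
  shows "co (mon [i] \<otimes>\<^bsub>\<Lambda>\<^esub> x) = Lop i (co x)"
proof -
  obtain f where f: "f \<in> carrier F" "x = cl f" using x by (auto simp: \<Lambda>_carrier)
  have w: "[i] \<in> W" using i by simp
  have "co (mon [i] \<otimes>\<^bsub>\<Lambda>\<^esub> x) = ev vac (basis_elt k [i] \<otimes>\<^bsub>F\<^esub> f)"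
    unfolding mon_def f(2) cl_mult[OF basis_word[OF w] f(1)] by (rule co_cl) (simp add: basis_word[OF w] f(1))
  also have "\<dots> = Lop i (ev vac f)"
    using ev_mult[OF vac_V basis_word[OF w] f(1)] ev_basis[OF ev_V[OF vac_V f(1)] w] by auto
  finally show ?thesis unfolding f(2) co_cl[OF f(1)] .
qed

lemma Rop_act:
  assumes v: "v \<in> V" and i: "i \<in> Ix" and w: "w \<in> W"
  shows "act w (Rop i v) = Rop i (act w v)"
  using w
proof (induction w)
  case (Cons j w)
  have wV: "act w v \<in> V" using v Cons by (auto intro: act_V)
  have "Lop j (Rop i (act w v)) = Rop i (Lop j (act w v))"
  proof (rule V_ext)
    show "Lop j (Rop i (act w v)) \<in> V" "Rop i (Lop j (act w v)) \<in> V"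
      using wV i Cons by (auto intro!: Lop_V Rop_V)
    fix I :: "nat set" assume "I \<subseteq> Ix"
    then show "Lop j (Rop i (act w v)) I = Rop i (Lop j (act w v)) I"
      by (intro Lop_Rop V_D(1)[OF wV] finite_subset[OF _ finite_Ix])
  qed
  then show ?case using Cons by simp
qed simp

text \<open>Since \<open>tau\<close> fixes the vacuum, \<open>x_i\<close> applied to it is also
  \<open>Rop i vac\<close>. Left multiplications commute with \<open>Rop i\<close>
  (\<open>Rop_act\<close>), so \<open>Rop i\<close> can be pulled out past every word of
  \<open>f\<close>.\<close>

lemma co_mon_right:
  assumes i: "i \<in> Ix" and x: "x \<in> carrier \<Lambda>"
  shows "co (x \<otimes>\<^bsub>\<Lambda>\<^esub> mon [i]) = Rop i (co x)"
proof -
  obtain f where f: "f \<in> carrier F" "x = cl f" using x by (auto simp: \<Lambda>_carrier)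
  have w: "[i] \<in> W" using i by simp
  have "ev vac (basis_elt k [i]) = Rop i vac"
  proof
    fix I show "ev vac (basis_elt k [i]) I = Rop i vac I"
      using ev_basis[OF vac_V w, of I] by (simp add: Rop_def tau_vac)
  qed
  then have "ev vac (f \<otimes>\<^bsub>F\<^esub> basis_elt k [i]) I = Rop i (ev vac f) I" for I
  proof -
    assume e: "ev vac (basis_elt k [i]) = Rop i vac"
    have "ev vac (f \<otimes>\<^bsub>F\<^esub> basis_elt k [i]) I = lin k K (\<lambda>w. act w (Rop i vac) I) f"
      unfolding ev_mult[OF vac_V f(1) basis_word[OF w]] e by (simp add: ev_def)
    also have "\<dots> = lin k K (\<lambda>w. Lop i (tau (act w vac)) I) f"
      using Rop_V[OF act_V[OF vac_V] i]
      by (intro FA.KK.lin_cong[OF fsW[OF f(1)]]) (auto simp: Rop_act[OF vac_V i] Rop_def[symmetric] V_D(1))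
    also have "\<dots> = Lop i (\<lambda>I. lin k K (\<lambda>w. tau (act w vac) I) f) I"
      by (rule Lop_lin[OF fsW[OF f(1)], symmetric]) (intro tau_V act_V vac_V)
    also have "(\<lambda>I. lin k K (\<lambda>w. tau (act w vac) I) f) = tau (ev vac f)"
      unfolding ev_def[abs_def] by (rule ext, rule tau_lin[OF fsW[OF f(1)], symmetric]) (intro act_V vac_V)
    finally show ?thesis by (simp add: Rop_def)
  qed
  then have "ev vac (f \<otimes>\<^bsub>F\<^esub> basis_elt k [i]) = Rop i (ev vac f)" by auto
  moreover have "co (x \<otimes>\<^bsub>\<Lambda>\<^esub> mon [i]) = ev vac (f \<otimes>\<^bsub>F\<^esub> basis_elt k [i])"
    unfolding mon_def f(2) cl_mult[OF f(1) basis_word[OF w]] by (rule co_cl) (simp add: basis_word[OF w] f(1))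
  ultimately show ?thesis unfolding f(2) co_cl[OF f(1)] by simp
qed

definition unco :: "(nat set \<Rightarrow> 'k) \<Rightarrow> (nat list \<Rightarrow> 'k) set"
  where "unco v = (\<Oplus>\<^bsub>\<Lambda>\<^esub>S\<in>Pow Ix. v S \<odot>\<^bsub>\<Lambda>\<^esub> emon S)"

lemma unco_terms: "v \<in> V \<Longrightarrow> (\<lambda>S. v S \<odot>\<^bsub>\<Lambda>\<^esub> emon S) \<in> Pow Ix \<rightarrow> carrier \<Lambda>"
  using emon_closed V_D(1) by (auto intro!: \<Lambda>.L.smult_closed)

lemma unco_closed: "v \<in> V \<Longrightarrow> unco v \<in> carrier \<Lambda>"
  unfolding unco_def by (intro \<Lambda>.L.M.finsum_closed unco_terms)

text \<open>This half is the independence of the sorted monomials: by \<open>co_emon\<close> their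
  coordinate vectors are the unit vectors.\<close>

lemma co_unco:
  assumes v: "v \<in> V"
  shows "co (unco v) = v"
proof (rule V_ext)
  show "co (unco v) \<in> V" by (intro co_V unco_closed v)
  show "v \<in> V" by (rule v)
  fix I assume I: "I \<subseteq> Ix"
  have "co (unco v) I = (\<Oplus>S\<in>Pow Ix. co (v S \<odot>\<^bsub>\<Lambda>\<^esub> emon S) I)"
    unfolding unco_def by (rule co_finsum[OF unco_terms[OF v]])
  also have "\<dots> = (\<Oplus>S\<in>Pow Ix. v S \<otimes> (if I = S then \<one> else \<zero>))"
    using V_D(1)[OF v] emon_closed by (intro finsum_cong') (auto simp: co_smult co_emon)
  also have "\<dots> = v I"
    using I V_D(1)[OF v] by (subst finsum_single[of _ _ I]) auto
  finally show "co (unco v) I = v I" .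
qed

lemma unco_add:
  assumes u: "u \<in> V" and v: "v \<in> V"
  shows "unco (\<lambda>I. u I \<oplus> v I) = unco u \<oplus>\<^bsub>\<Lambda>\<^esub> unco v"
proof -
  have "unco (\<lambda>I. u I \<oplus> v I) = (\<Oplus>\<^bsub>\<Lambda>\<^esub>S\<in>Pow Ix. u S \<odot>\<^bsub>\<Lambda>\<^esub> emon S \<oplus>\<^bsub>\<Lambda>\<^esub> v S \<odot>\<^bsub>\<Lambda>\<^esub> emon S)"
    unfolding unco_def using V_D(1)[OF u] V_D(1)[OF v] emon_closed
    by (intro \<Lambda>.L.M.finsum_cong') (auto simp: \<Lambda>.L.smult_l_distr \<Lambda>.L.smult_closed)
  then show ?thesis
    unfolding unco_def using \<Lambda>.L.M.finsum_addf[OF unco_terms[OF u] unco_terms[OF v]] by simp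
qed

text \<open>This half is the spanning property, which enters through the straightening in
  \<open>emon_induct\<close>.\<close>

lemma unco_co:
  assumes "x \<in> carrier \<Lambda>"
  shows "unco (co x) = x"
  using assms
proof (rule emon_induct[where P = "\<lambda>x. unco (co x) = x"])
  have "(\<Oplus>\<^bsub>\<Lambda>\<^esub>S\<in>Pow Ix. co \<zero>\<^bsub>\<Lambda>\<^esub> S \<odot>\<^bsub>\<Lambda>\<^esub> emon S) = (\<Oplus>\<^bsub>\<Lambda>\<^esub>S\<in>Pow Ix. \<zero>\<^bsub>\<Lambda>\<^esub>)"
    using emon_closed by (intro \<Lambda>.L.M.finsum_cong') (auto simp: co_zero \<Lambda>.L.smult_l_zero)
  then show "unco (co \<zero>\<^bsub>\<Lambda>\<^esub>) = \<zero>\<^bsub>\<Lambda>\<^esub>" by (simp add: unco_def)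
next
  fix x y assume xy: "x \<in> carrier \<Lambda>" "y \<in> carrier \<Lambda>" "unco (co x) = x" "unco (co y) = y"
  have "co (x \<oplus>\<^bsub>\<Lambda>\<^esub> y) = (\<lambda>I. co x I \<oplus> co y I)" using xy co_add by auto
  then show "unco (co (x \<oplus>\<^bsub>\<Lambda>\<^esub> y)) = x \<oplus>\<^bsub>\<Lambda>\<^esub> y" using xy unco_add[OF co_V co_V] by simp
next
  fix c S assume c: "c \<in> carrier k" and S: "S \<subseteq> Ix"
  have cc: "co (c \<odot>\<^bsub>\<Lambda>\<^esub> emon S) I = (if I = S then c else \<zero>)" for I
    using c S emon_closed[OF S] by (simp add: co_smult co_emon)
  have "unco (co (c \<odot>\<^bsub>\<Lambda>\<^esub> emon S)) = co (c \<odot>\<^bsub>\<Lambda>\<^esub> emon S) S \<odot>\<^bsub>\<Lambda>\<^esub> emon S"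
    unfolding unco_def
    using S c emon_closed by (intro \<Lambda>.L.M.finsum_single unco_terms co_V \<Lambda>.L.smult_closed) (auto simp: cc \<Lambda>.L.smult_l_zero)
  then show "unco (co (c \<odot>\<^bsub>\<Lambda>\<^esub> emon S)) = c \<odot>\<^bsub>\<Lambda>\<^esub> emon S" by (simp add: cc)
qed

lemma co_inject:
  assumes x: "x \<in> carrier \<Lambda>" and y: "y \<in> carrier \<Lambda>" and eq: "\<And>I. I \<subseteq> Ix \<Longrightarrow> co x I = co y I"
  shows "x = y"
proof -
  have "co x = co y" by (rule V_ext[OF co_V[OF x] co_V[OF y] eq])
  then have "unco (co x) = unco (co y)" by simp
  then show ?thesis unfolding unco_co[OF x] unco_co[OF y] .
qed

section \<open>The right derivative on the exterior algebra\<close>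

definition RD :: "nat \<Rightarrow> (nat list \<Rightarrow> 'k) set \<Rightarrow> (nat list \<Rightarrow> 'k) set"
  where "RD j x = unco (RDop j (co x))"

lemma RD_closed: "x \<in> carrier \<Lambda> \<Longrightarrow> RD j x \<in> carrier \<Lambda>"
  unfolding RD_def by (intro unco_closed RDop_V co_V)

lemma co_RD: "x \<in> carrier \<Lambda> \<Longrightarrow> co (RD j x) = RDop j (co x)"
  unfolding RD_def by (intro co_unco RDop_V co_V)

lemma RD_hom: "RD j \<in> mhom k \<Lambda> \<Lambda>"
proof (rule mhomI)
  show "x \<in> carrier \<Lambda> \<Longrightarrow> RD j x \<in> carrier \<Lambda>" for x by (rule RD_closed)
  fix x y assume x: "x \<in> carrier \<Lambda>"
  { assume y: "y \<in> carrier \<Lambda>"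
    show "RD j (x \<oplus>\<^bsub>\<Lambda>\<^esub> y) = RD j x \<oplus>\<^bsub>\<Lambda>\<^esub> RD j y"
      using x y by (intro co_inject)
        (auto simp: RD_closed co_RD co_add RDop_def tau_def Dop_def co_closed r_distr) }
  fix c assume c: "c \<in> carrier k"
  show "RD j (c \<odot>\<^bsub>\<Lambda>\<^esub> x) = c \<odot>\<^bsub>\<Lambda>\<^esub> RD j x"
    using x c by (intro co_inject)
      (auto simp: RD_closed co_RD co_smult RDop_def tau_def Dop_def co_closed \<Lambda>.L.smult_closed m_lcomm)
qed

lemma RD_mult:
  assumes x: "x \<in> carrier \<Lambda>" and i: "i \<in> Ix"
  shows "RD j (x \<otimes>\<^bsub>\<Lambda>\<^esub> mon [i]) = (if i = j then x else \<zero>\<^bsub>\<Lambda>\<^esub>) \<ominus>\<^bsub>\<Lambda>\<^esub> RD j x \<otimes>\<^bsub>\<Lambda>\<^esub> mon [i]"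
proof -
  have m: "mon [i] \<in> carrier \<Lambda>" using i by (intro mon_closed) auto
  show ?thesis
  proof (rule co_inject)
    fix I :: "nat set" assume "I \<subseteq> Ix"
    then have I: "finite I" by (rule finite_subset[OF _ finite_Ix])
    have "co (RD j (x \<otimes>\<^bsub>\<Lambda>\<^esub> mon [i])) I = (if i = j then co x I else \<zero>) \<ominus> Rop i (RDop j (co x)) I"
      using x m I by (simp add: co_RD co_mon_right i RDop_Rop co_closed)
    also have "\<dots> = co ((if i = j then x else \<zero>\<^bsub>\<Lambda>\<^esub>) \<ominus>\<^bsub>\<Lambda>\<^esub> RD j x \<otimes>\<^bsub>\<Lambda>\<^esub> mon [i]) I"
      using x m by (simp add: co_minus RD_closed co_mon_right i co_RD co_zero)
    finally show "co (RD j (x \<otimes>\<^bsub>\<Lambda>\<^esub> mon [i])) I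
      = co ((if i = j then x else \<zero>\<^bsub>\<Lambda>\<^esub>) \<ominus>\<^bsub>\<Lambda>\<^esub> RD j x \<otimes>\<^bsub>\<Lambda>\<^esub> mon [i]) I" .
  qed (use x m in \<open>auto intro!: RD_closed \<Lambda>.L.M.minus_closed\<close>)
qed

end

section \<open>The Koszul resolution\<close>

definition fun_module :: "('r, 'z) ring_scheme \<Rightarrow> 'x set \<Rightarrow> ('r, 'x \<Rightarrow> 'r) module"
  where "fun_module R S = \<lparr>carrier = fsupp R S, monoid.mult = undefined, monoid.one = undefined,
    ring.zero = (\<lambda>_. \<zero>\<^bsub>R\<^esub>), ring.add = (\<lambda>f g l. f l \<oplus>\<^bsub>R\<^esub> g l), smult = (\<lambda>r f l. r \<otimes>\<^bsub>R\<^esub> f l)\<rparr>"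

lemma fun_module_simps [simp]:
  "carrier (fun_module R S) = fsupp R S" "\<zero>\<^bsub>fun_module R S\<^esub> = (\<lambda>_. \<zero>\<^bsub>R\<^esub>)"
  "f \<oplus>\<^bsub>fun_module R S\<^esub> g = (\<lambda>l. f l \<oplus>\<^bsub>R\<^esub> g l)" "r \<odot>\<^bsub>fun_module R S\<^esub> f = (\<lambda>l. r \<otimes>\<^bsub>R\<^esub> f l)"
  by (simp_all add: fun_module_def)

context ring
begin

lemma fsupp_finite: "\<lbrakk>finite S; \<And>w. f w \<in> carrier R; \<And>w. w \<notin> S \<Longrightarrow> f w = \<zero>\<rbrakk> \<Longrightarrow> f \<in> fsupp R S"
  by (rule fsuppI[of _ _ S]) auto

lemma left_module_fun_module: "left_module R (fun_module R S)"
proof -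
  interpret F: abelian_group "fun_module R S"
  proof (rule abelian_groupI)
    fix f assume f: "f \<in> carrier (fun_module R S)"
    then have "(\<lambda>l. \<ominus> f l) \<in> carrier (fun_module R S)" by (simp add: fsupp_uminus)
    moreover have "(\<lambda>l. \<ominus> f l) \<oplus>\<^bsub>fun_module R S\<^esub> f = \<zero>\<^bsub>fun_module R S\<^esub>"
      using f fsuppD(1) by (fastforce simp: l_neg)
    ultimately show "\<exists>g\<in>carrier (fun_module R S). g \<oplus>\<^bsub>fun_module R S\<^esub> f = \<zero>\<^bsub>fun_module R S\<^esub>" by blast
  qed (simp_all add: fsupp_add fsupp_zero fsuppD a_ac)
  show ?thesis
    by unfold_locales (simp_all add: fsupp_smult fsuppD l_distr r_distr m_assoc)
qed

lemma coordinate_mhom: "(\<lambda>f. f l) \<in> mhom R (fun_module R S) (self_module R)"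
  by (rule mhomI) (simp_all add: fsuppD)

lemma finsum_fun_module_apply:
  assumes "f \<in> A \<rightarrow> fsupp R S"
  shows "(\<Oplus>\<^bsub>fun_module R S\<^esub>i\<in>A. f i) l = (\<Oplus>i\<in>A. f i l)"
  using mhom_finsum[OF left_module_fun_module left_module_self_module[OF ring_axioms] coordinate_mhom, of f A S l] assms
  by simp

lemma uminus_fun_module_apply:
  assumes "f \<in> fsupp R S"
  shows "(\<ominus>\<^bsub>fun_module R S\<^esub> f) l = \<ominus> f l"
proof -
  interpret F: left_module R "fun_module R S" by (rule left_module_fun_module)
  have "(\<lambda>l. \<ominus> f l) \<oplus>\<^bsub>fun_module R S\<^esub> f = \<zero>\<^bsub>fun_module R S\<^esub>"
    using fsuppD(1)[OF assms] by (auto simp: l_neg)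
  then have "\<ominus>\<^bsub>fun_module R S\<^esub> f = (\<lambda>l. \<ominus> f l)"
    using assms fsupp_uminus[OF assms] by (intro F.M.minus_equality) simp_all
  then show ?thesis by simp
qed

lemma minus_fun_module_apply:
  assumes "f \<in> fsupp R S" "g \<in> fsupp R S"
  shows "(f \<ominus>\<^bsub>fun_module R S\<^esub> g) l = f l \<ominus> g l"
  using uminus_fun_module_apply[OF assms(2)] by (simp add: a_minus_def)

text \<open>\<open>free_basis\<close> speaks of a set of vectors, with coefficients indexed by the
  vectors themselves. The hypothesis \<open>\<one> \<noteq> \<zero>\<close> makes
  \<open>basis_elt\<close> injective, so that they can be indexed by \<open>S\<close> as
  well.\<close>

lemma free_basis_fun_module:
  fixes S :: "'x set"
  assumes S: "finite S" and nt: "\<one> \<noteq> \<zero>"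
  shows "free_basis R (fun_module R S) (basis_elt R ` S)"
  unfolding free_basis_iff
proof (intro conjI ballI)
  let ?B = "basis_elt R ` S"
  show sub: "?B \<subseteq> carrier (fun_module R S)" using fsupp_basis_elt by auto
  interpret F: left_module R "fun_module R S" by (rule left_module_fun_module)
  interpret S: left_module R "self_module R" by (rule left_module_self_module[OF ring_axioms])
  have inj: "basis_elt R l = basis_elt R l' \<longleftrightarrow> l = l'" for l l' :: 'x
    using nt by (auto simp: basis_elt_def fun_eq_iff)
  have injS: "inj_on (basis_elt R) S" by (simp add: inj_on_def inj)
  have id: "(\<lambda>b. b) \<in> ?B \<rightarrow> carrier (fun_module R S)" using sub by auto
  have val: "lin R (fun_module R S) (\<lambda>b. b) c l = c (basis_elt R l)" if c: "c \<in> fsupp R ?B" and l: "l \<in> S" for c l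
  proof -
    have "lin R (fun_module R S) (\<lambda>b. b) c l = lin R (self_module R) (\<lambda>b. b l) c"
      by (rule lin_hom[OF F.left_module_axioms S.left_module_axioms coordinate_mhom c id])
    also have "\<dots> = (\<Oplus>\<^bsub>self_module R\<^esub>b\<in>?B. c b \<odot>\<^bsub>self_module R\<^esub> b l)"
      using S fsuppD(3)[OF c] by (intro S.lin_eq_finsum[OF c]) (auto simp: basis_elt_def)
    also have "\<dots> = c (basis_elt R l) \<otimes> basis_elt R l l"
      unfolding finsum_self_module self_module_simps using S l fsuppD(1)[OF c]
      by (intro finsum_single) (auto simp: basis_elt_def)
    finally show ?thesis using fsuppD(1)[OF c] by (simp add: basis_elt_def)
  qed
  fix x assume "x \<in> carrier (fun_module R S)"
  then have x: "x \<in> fsupp R S" by simp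
  show "\<exists>!c. c \<in> fsupp R ?B \<and> x = lin R (fun_module R S) (\<lambda>b. b) c"
  proof (rule ex1I)
    define c where "c b = (if b \<in> ?B then x (inv_into S (basis_elt R) b) else \<zero>)" for b
    have c: "c \<in> fsupp R ?B"
      by (rule fsupp_finite) (use S fsuppD(1)[OF x] in \<open>auto simp: c_def\<close>)
    have cl: "c (basis_elt R l) = x l" if "l \<in> S" for l
      using inv_into_f_f[OF injS that] that by (simp add: c_def)
    have "x l = lin R (fun_module R S) (\<lambda>b. b) c l" for l
    proof (cases "l \<in> S")
      case True
      then show ?thesis using val[OF c True] cl[OF True] by simp
    next
      case False
      have "lin R (fun_module R S) (\<lambda>b. b) c \<in> fsupp R S" using F.lin_closed[OF c id] by simp
      then show ?thesis using False fsuppD(3)[OF x] fsuppD(3) by metis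
    qed
    then show "c \<in> fsupp R ?B \<and> x = lin R (fun_module R S) (\<lambda>b. b) c" using c by auto
    fix c' assume c': "c' \<in> fsupp R ?B \<and> x = lin R (fun_module R S) (\<lambda>b. b) c'"
    show "c' = c"
    proof
      fix b
      show "c' b = c b"
      proof (cases "b \<in> ?B")
        case True
        then obtain l where l: "l \<in> S" "b = basis_elt R l" by auto
        have "c' b = x l" using val[of c' l] c' l by simp
        then show ?thesis using cl l by simp
      next
        case False
        then show ?thesis using c' fsuppD(3)[of c' R ?B b] by (auto simp: c_def)
      qed
    qed
  qed
qed

end

text \<open>The elements of a resolution have to be functions on lists over a prescribed type. Only
  the length of the list carries information: it is the number of the multiset in an enumeration, in
  unary, and so the code works whatever the entries are.\<close>

definition enc :: "nat multiset \<Rightarrow> 'x list"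
  where "enc b = replicate (to_nat (sorted_list_of_multiset b)) undefined"

lemma enc_inject: "(enc b :: 'x list) = enc b' \<longleftrightarrow> b = b'"
proof
  assume "(enc b :: 'x list) = enc b'"
  then have "length (enc b :: 'x list) = length (enc b' :: 'x list)" by simp
  then have "sorted_list_of_multiset b = sorted_list_of_multiset b'" by (simp add: enc_def)
  then show "b = b'" by (metis mset_sorted_list_of_multiset)
qed simp

definition dec :: "'x list \<Rightarrow> nat multiset"
  where "dec l = (THE b. enc b = l)"

lemma dec_enc [simp]: "dec (enc b) = b"
  unfolding dec_def by (rule the_equality) (auto simp: enc_inject)

definition mindex :: "nat set \<Rightarrow> nat \<Rightarrow> nat multiset set"
  where "mindex S m = {b. size b = m \<and> set_mset b \<subseteq> S}"

lemma finite_mindex: "finite S \<Longrightarrow> finite (mindex S m)"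
proof -
  assume "finite S"
  then have "finite {l. set l \<subseteq> S \<and> length l = m}" by (rule finite_lists_length_eq)
  then have "finite (mset ` {l. set l \<subseteq> S \<and> length l = m})" by simp
  moreover have "mindex S m \<subseteq> mset ` {l. set l \<subseteq> S \<and> length l = m}"
  proof
    fix b assume "b \<in> mindex S m"
    moreover obtain l where "mset l = b" using ex_mset by blast
    ultimately show "b \<in> mset ` {l. set l \<subseteq> S \<and> length l = m}" by (auto simp: mindex_def)
  qed
  ultimately show ?thesis by (rule finite_subset[rotated])
qed

lemma mindex_add: "\<lbrakk>b \<in> mindex S m; i \<in> S\<rbrakk> \<Longrightarrow> add_mset i b \<in> mindex S (Suc m)"
  by (simp add: mindex_def)

lemma mindex_diff: "\<lbrakk>b \<in> mindex S (Suc m); i \<in># b\<rbrakk> \<Longrightarrow> b - {#i#} \<in> mindex S m"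
  by (auto simp: mindex_def size_Diff_singleton dest: in_diffD)

lemma mindex_elem: "\<lbrakk>b \<in> mindex S m; i \<in># b\<rbrakk> \<Longrightarrow> i \<in> S"
  by (auto simp: mindex_def)

lemma mindex_0 [simp]: "mindex S 0 = {{#}}"
  by (auto simp: mindex_def)

text \<open>Isolates what exactness requires of the enveloping algebra, so that no cosets occur in
  the argument: \<open>\<xi>\<close> and \<open>\<upsilon>\<close> are the two families of
  generators, \<open>D j\<close> is the right derivative in the first factor, and \<open>N\<close>
  is cyclic with annihilator generated by the differences. \<open>D j\<close> is only assumed
  additive, as a contraction may be. \<open>index_type\<close> fixes the entries of the lists behind
  \<open>enc\<close>.\<close>

locale koszul_data = N?: left_module R N for R :: "('r, 'z) ring_scheme" (structure) and N :: "('r, 'n) module" +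
  fixes Ix :: "nat set" and \<xi> \<upsilon> :: "nat \<Rightarrow> 'r" and D :: "nat \<Rightarrow> 'r \<Rightarrow> 'r" and e :: 'n
    and index_type :: "'x itself"
  assumes nontrivial: "\<one> \<noteq> \<zero>" and Ix: "finite Ix"
    and X_closed: "i \<in> Ix \<Longrightarrow> \<xi> i \<in> carrier R" and Y_closed: "i \<in> Ix \<Longrightarrow> \<upsilon> i \<in> carrier R"
    and X_sq: "i \<in> Ix \<Longrightarrow> \<xi> i \<otimes> \<xi> i = \<zero>" and Y_sq: "i \<in> Ix \<Longrightarrow> \<upsilon> i \<otimes> \<upsilon> i = \<zero>"
    and X_anti: "\<lbrakk>i \<in> Ix; j \<in> Ix; i \<noteq> j\<rbrakk> \<Longrightarrow> \<xi> i \<otimes> \<xi> j \<oplus> \<xi> j \<otimes> \<xi> i = \<zero>"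
    and Y_anti: "\<lbrakk>i \<in> Ix; j \<in> Ix; i \<noteq> j\<rbrakk> \<Longrightarrow> \<upsilon> i \<otimes> \<upsilon> j \<oplus> \<upsilon> j \<otimes> \<upsilon> i = \<zero>"
    and X_Y: "\<lbrakk>i \<in> Ix; j \<in> Ix\<rbrakk> \<Longrightarrow> \<upsilon> j \<otimes> \<xi> i = \<xi> i \<otimes> \<upsilon> j"
    and D_closed: "r \<in> carrier R \<Longrightarrow> D j r \<in> carrier R"
    and D_add: "\<lbrakk>r \<in> carrier R; s \<in> carrier R\<rbrakk> \<Longrightarrow> D j (r \<oplus> s) = D j r \<oplus> D j s"
    and D_X: "\<lbrakk>r \<in> carrier R; i \<in> Ix\<rbrakk> \<Longrightarrow> D j (r \<otimes> \<xi> i) = (if i = j then r else \<zero>) \<ominus> D j r \<otimes> \<xi> i"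
    and D_Y: "\<lbrakk>r \<in> carrier R; i \<in> Ix\<rbrakk> \<Longrightarrow> D j (r \<otimes> \<upsilon> i) = D j r \<otimes> \<upsilon> i"
    and e: "e \<in> carrier N" and cyclic: "x \<in> carrier N \<Longrightarrow> \<exists>r\<in>carrier R. r \<odot>\<^bsub>N\<^esub> e = x"
    and e_XY: "i \<in> Ix \<Longrightarrow> \<xi> i \<odot>\<^bsub>N\<^esub> e = \<upsilon> i \<odot>\<^bsub>N\<^esub> e"
    and annihilator: "\<lbrakk>r \<in> carrier R; r \<odot>\<^bsub>N\<^esub> e = \<zero>\<^bsub>N\<^esub>\<rbrakk> \<Longrightarrow>
      \<exists>w. (\<forall>i\<in>Ix. w i \<in> carrier R) \<and> r = (\<Oplus>i\<in>Ix. w i \<otimes> (\<xi> i \<ominus> \<upsilon> i))"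
begin

definition Z :: "nat \<Rightarrow> nat \<Rightarrow> 'r"
  where "Z m i = (if even m then \<upsilon> i else \<ominus> \<upsilon> i)"

text \<open>The two families commute with each other instead of anticommuting, so the square of
  \<open>\<xi> i \<ominus> \<upsilon> i\<close> is \<open>-2 \<xi> i \<upsilon> i\<close>.
  Alternating the sign with the degree repairs this for consecutive factors: see
  \<open>Pm_sq\<close> and \<open>Pm_anti\<close>.\<close>

definition Pm :: "nat \<Rightarrow> nat \<Rightarrow> 'r"
  where "Pm m i = \<xi> i \<oplus> Z m i"

lemma Z_closed: "i \<in> Ix \<Longrightarrow> Z m i \<in> carrier R"
  by (simp add: Z_def Y_closed)

lemma Pm_closed: "i \<in> Ix \<Longrightarrow> Pm m i \<in> carrier R"
  by (simp add: Pm_def X_closed Z_closed)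

lemma Pm_Suc: "i \<in> Ix \<Longrightarrow> Pm (Suc m) i = \<xi> i \<ominus> Z m i"
  by (simp add: Pm_def Z_def Y_closed a_minus_def)

lemma Z_anti: "\<lbrakk>i \<in> Ix; j \<in> Ix\<rbrakk> \<Longrightarrow> Z m i \<otimes> Z m j = \<upsilon> i \<otimes> \<upsilon> j"
  by (simp add: Z_def Y_closed l_minus r_minus)

lemma X_Z: "\<lbrakk>i \<in> Ix; j \<in> Ix\<rbrakk> \<Longrightarrow> Z m j \<otimes> \<xi> i = \<xi> i \<otimes> Z m j"
  by (simp add: Z_def Y_closed X_closed l_minus r_minus X_Y)

lemma Pm_expand:
  assumes i: "i \<in> Ix" and j: "j \<in> Ix"
  shows "Pm (Suc m) i \<otimes> Pm m j = (\<xi> i \<otimes> \<xi> j \<ominus> \<upsilon> i \<otimes> \<upsilon> j) \<oplus> (\<xi> i \<otimes> Z m j \<ominus> \<xi> j \<otimes> Z m i)"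
proof -
  note c = X_closed[OF i] X_closed[OF j] Z_closed[OF i, of m] Z_closed[OF j, of m] Y_closed[OF i] Y_closed[OF j]
  have "Pm (Suc m) i \<otimes> Pm m j = \<xi> i \<otimes> \<xi> j \<oplus> \<xi> i \<otimes> Z m j \<oplus> (\<ominus> (Z m i \<otimes> \<xi> j) \<oplus> \<ominus> (Z m i \<otimes> Z m j))"
    unfolding Pm_Suc[OF i] unfolding Pm_def using c by (simp add: a_minus_def l_distr r_distr l_minus R.a_ac)
  also have "\<dots> = (\<xi> i \<otimes> \<xi> j \<ominus> \<upsilon> i \<otimes> \<upsilon> j) \<oplus> (\<xi> i \<otimes> Z m j \<ominus> \<xi> j \<otimes> Z m i)"
    unfolding X_Z[OF j i] Z_anti[OF i j] using c by (simp add: a_minus_def R.a_ac)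
  finally show ?thesis .
qed

lemma Pm_sq: "i \<in> Ix \<Longrightarrow> Pm (Suc m) i \<otimes> Pm m i = \<zero>"
  unfolding Pm_expand by (simp add: X_sq Y_sq X_closed Z_closed a_minus_def R.r_neg)

text \<open>In \<open>Pm_expand\<close> the mixed part is antisymmetric in \<open>i\<close> and
  \<open>j\<close>, while the pure parts anticommute within each family.\<close>

lemma Pm_anti:
  assumes i: "i \<in> Ix" and j: "j \<in> Ix" and ij: "i \<noteq> j"
  shows "Pm (Suc m) i \<otimes> Pm m j \<oplus> Pm (Suc m) j \<otimes> Pm m i = \<zero>"
proof -
  define a b c d p q where "a = \<xi> i \<otimes> \<xi> j" and "b = \<xi> j \<otimes> \<xi> i" and "c = \<upsilon> i \<otimes> \<upsilon> j" and "d = \<upsilon> j \<otimes> \<upsilon> i"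
    and "p = \<xi> i \<otimes> Z m j" and "q = \<xi> j \<otimes> Z m i"
  have cl: "a \<in> carrier R" "b \<in> carrier R" "c \<in> carrier R" "d \<in> carrier R" "p \<in> carrier R" "q \<in> carrier R"
    using i j by (simp_all add: a_def b_def c_def d_def p_def q_def X_closed Y_closed Z_closed)
  have "(a \<ominus> c \<oplus> (p \<ominus> q)) \<oplus> (b \<ominus> d \<oplus> (q \<ominus> p)) = ((a \<oplus> b) \<ominus> (c \<oplus> d)) \<oplus> ((p \<oplus> q) \<ominus> (q \<oplus> p))"
    using cl by (simp add: a_minus_def R.minus_add R.a_ac)
  also have "\<dots> = \<zero>"
    using X_anti[OF i j ij] Y_anti[OF i j ij] cl R.minus_eq_zero_iff[of "p \<oplus> q" "q \<oplus> p"]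
    by (simp add: a_def b_def c_def d_def a_minus_def R.a_comm)
  finally show ?thesis
    unfolding Pm_expand[OF i j] Pm_expand[OF j i] a_def b_def c_def d_def p_def q_def .
qed

lemma D_hom_uminus: "r \<in> carrier R \<Longrightarrow> D j (\<ominus> r) = \<ominus> D j r"
  by (rule additive_uminus[OF R.is_abelian_group R.is_abelian_group, of "D j"]) (auto simp: D_closed D_add)

lemma D_zero: "D j \<zero> = \<zero>"
  by (rule additive_zero[OF R.is_abelian_group R.is_abelian_group, of "D j"]) (auto simp: D_closed D_add)

lemma D_finsum: "f \<in> A \<rightarrow> carrier R \<Longrightarrow> D j (\<Oplus>i\<in>A. f i) = (\<Oplus>i\<in>A. D j (f i))"
  by (rule additive_finsum[OF R.is_abelian_group R.is_abelian_group, of "D j"]) (auto simp: D_closed D_add)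

text \<open>Moving \<open>D j\<close> past \<open>\<xi> i\<close> changes the sign and moving it
  past \<open>\<upsilon> i\<close> does not. The relative sign of the two summands thus flips, which
  turns \<open>Pm m\<close> into \<open>Pm (Suc m)\<close>, the factor of the differential one
  degree higher.\<close>

lemma D_Pm:
  assumes r: "r \<in> carrier R" and i: "i \<in> Ix"
  shows "D j r \<otimes> Pm (Suc m) i = (if i = j then r else \<zero>) \<ominus> D j (r \<otimes> Pm m i)"
proof -
  define t where "t = (if i = j then r else \<zero>)"
  have t: "t \<in> carrier R" using r by (simp add: t_def)
  note c = r t X_closed[OF i] Z_closed[OF i, of m] D_closed[OF r, of j] Y_closed[OF i]
  have DZ: "D j (r \<otimes> Z m i) = D j r \<otimes> Z m i"
    using c i by (simp add: Z_def r_minus D_hom_uminus D_Y)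
  have "D j (r \<otimes> Pm m i) = D j (r \<otimes> \<xi> i) \<oplus> D j r \<otimes> Z m i"
    unfolding Pm_def using c by (simp add: r_distr D_add DZ)
  also have "\<dots> = (t \<ominus> D j r \<otimes> \<xi> i) \<oplus> D j r \<otimes> Z m i"
    using D_X[OF r i, of j] by (simp add: t_def)
  finally have "t \<ominus> D j (r \<otimes> Pm m i) = t \<ominus> ((t \<ominus> D j r \<otimes> \<xi> i) \<oplus> D j r \<otimes> Z m i)" by simp
  also have "\<dots> = D j r \<otimes> \<xi> i \<ominus> D j r \<otimes> Z m i"
    using c by (simp add: a_minus_def R.minus_add R.r_neg1 R.a_assoc[symmetric] R.r_neg)
  also have "\<dots> = D j r \<otimes> Pm (Suc m) i"
    unfolding Pm_Suc[OF i] using c by (simp add: a_minus_def r_distr r_minus)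
  finally show ?thesis by (simp add: t_def)
qed

abbreviation "Mi \<equiv> mindex Ix"

definition K :: "nat \<Rightarrow> ('r, 'x list \<Rightarrow> 'r) module"
  where "K m = fun_module R (enc ` Mi m)"

definition build :: "nat \<Rightarrow> (nat multiset \<Rightarrow> 'r) \<Rightarrow> 'x list \<Rightarrow> 'r"
  where "build m f l = (if l \<in> enc ` Mi m then f (dec l) else \<zero>)"

text \<open>The differential in coordinates: the coefficient at \<open>b\<close> collects those at
  \<open>b + i\<close>, one for every variable \<open>i\<close>. Scalars act from the left, so
  \<open>Pm\<close> multiplies from the right. The form on basis vectors is
  \<open>dK_unit\<close>.\<close>

definition dK :: "nat \<Rightarrow> ('x list \<Rightarrow> 'r) \<Rightarrow> 'x list \<Rightarrow> 'r"
  where "dK m z = build m (\<lambda>b. \<Oplus>i\<in>Ix. z (enc (add_mset i b)) \<otimes> Pm (Suc m) i)"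

definition aug :: "('x list \<Rightarrow> 'r) \<Rightarrow> 'n"
  where "aug z = z (enc {#}) \<odot>\<^bsub>N\<^esub> e"

lemma K_carrier: "carrier (K m) = fsupp R (enc ` Mi m)"
  by (simp add: K_def)

lemma K_closed: "z \<in> carrier (K m) \<Longrightarrow> z l \<in> carrier R"
  by (simp add: K_carrier fsuppD)

lemma left_module_K: "left_module R (K m)"
  unfolding K_def by (rule R.left_module_fun_module)

lemma K_free_basis: "free_basis R (K m) (basis_elt R ` enc ` Mi m)"
  unfolding K_def by (rule R.free_basis_fun_module) (simp_all add: finite_mindex Ix nontrivial)

lemma free_K: "free_module R (K m)"
  unfolding free_module_def using left_module_K K_free_basis by blast

lemma build_enc: "b \<in> Mi m \<Longrightarrow> build m f (enc b) = f b"
  by (simp add: build_def)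

lemma build_closed: "(\<And>b. b \<in> Mi m \<Longrightarrow> f b \<in> carrier R) \<Longrightarrow> build m f \<in> carrier (K m)"
  unfolding K_carrier by (rule R.fsupp_finite) (auto simp: build_def finite_mindex Ix)

lemma K_ext:
  assumes z: "z \<in> carrier (K m)" and y: "y \<in> carrier (K m)"
    and eq: "\<And>b. b \<in> Mi m \<Longrightarrow> z (enc b) = y (enc b)"
  shows "z = y"
proof
  fix l
  show "z l = y l"
  proof (cases "l \<in> enc ` Mi m")
    case True
    then show ?thesis using eq by auto
  next
    case False
    then have "z l = \<zero>" "y l = \<zero>" using z y fsuppD(3) unfolding K_carrier by metis+
    then show ?thesis by simp
  qed
qed

lemma dK_enc: "b \<in> Mi m \<Longrightarrow> dK m z (enc b) = (\<Oplus>i\<in>Ix. z (enc (add_mset i b)) \<otimes> Pm (Suc m) i)"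
  by (simp add: dK_def build_enc)

lemma terms_closed: "z \<in> carrier (K m) \<Longrightarrow> (\<lambda>i. z (g i) \<otimes> Pm m' i) \<in> Ix \<rightarrow> carrier R"
  by (rule Pi_I) (simp add: K_closed Pm_closed)

lemma dK_closed: "z \<in> carrier (K (Suc m)) \<Longrightarrow> dK m z \<in> carrier (K m)"
  unfolding dK_def by (intro build_closed R.finsum_closed terms_closed)

lemma dK_hom: "dK m \<in> mhom R (K (Suc m)) (K m)"
proof (rule mhomI)
  interpret K1: left_module R "K (Suc m)" by (rule left_module_K)
  interpret K0: left_module R "K m" by (rule left_module_K)
  show c: "dK m z \<in> carrier (K m)" if "z \<in> carrier (K (Suc m))" for z by (rule dK_closed[OF that])
  show "dK m (z \<oplus>\<^bsub>K (Suc m)\<^esub> y) = dK m z \<oplus>\<^bsub>K m\<^esub> dK m y"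
    if z: "z \<in> carrier (K (Suc m))" and y: "y \<in> carrier (K (Suc m))" for z y
  proof (rule K_ext)
    show "dK m (z \<oplus>\<^bsub>K (Suc m)\<^esub> y) \<in> carrier (K m)" by (intro c K1.M.a_closed z y)
    show "dK m z \<oplus>\<^bsub>K m\<^esub> dK m y \<in> carrier (K m)" by (intro K0.M.a_closed c z y)
    fix b assume b: "b \<in> Mi m"
    have "dK m (z \<oplus>\<^bsub>K (Suc m)\<^esub> y) (enc b) = (\<Oplus>i\<in>Ix. z (enc (add_mset i b)) \<otimes> Pm (Suc m) i \<oplus> y (enc (add_mset i b)) \<otimes> Pm (Suc m) i)"
      unfolding dK_enc[OF b] using K_closed[OF z] K_closed[OF y] Pm_closed
      by (intro R.finsum_cong') (auto simp: K_def l_distr)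
    also have "\<dots> = dK m z (enc b) \<oplus> dK m y (enc b)"
      unfolding dK_enc[OF b] by (rule R.finsum_addf[OF terms_closed[OF z] terms_closed[OF y]])
    finally show "dK m (z \<oplus>\<^bsub>K (Suc m)\<^esub> y) (enc b) = (dK m z \<oplus>\<^bsub>K m\<^esub> dK m y) (enc b)" by (simp add: K_def)
  qed
  show "dK m (r \<odot>\<^bsub>K (Suc m)\<^esub> z) = r \<odot>\<^bsub>K m\<^esub> dK m z" if r: "r \<in> carrier R" and z: "z \<in> carrier (K (Suc m))" for r z
  proof (rule K_ext)
    show "dK m (r \<odot>\<^bsub>K (Suc m)\<^esub> z) \<in> carrier (K m)" by (intro c K1.smult_closed r z)
    show "r \<odot>\<^bsub>K m\<^esub> dK m z \<in> carrier (K m)" by (intro K0.smult_closed r c z)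
    fix b assume b: "b \<in> Mi m"
    have "dK m (r \<odot>\<^bsub>K (Suc m)\<^esub> z) (enc b) = (\<Oplus>i\<in>Ix. r \<otimes> (z (enc (add_mset i b)) \<otimes> Pm (Suc m) i))"
      unfolding dK_enc[OF b] using K_closed[OF z] r Pm_closed
      by (intro R.finsum_cong') (auto simp: K_def m_assoc)
    also have "\<dots> = r \<otimes> dK m z (enc b)"
      unfolding dK_enc[OF b] by (rule R.finsum_rdistr[OF Ix r terms_closed[OF z], symmetric])
    finally show "dK m (r \<odot>\<^bsub>K (Suc m)\<^esub> z) (enc b) = (r \<odot>\<^bsub>K m\<^esub> dK m z) (enc b)" by (simp add: K_def)
  qed
qed

lemma dK_minus:
  assumes z: "z \<in> carrier (K (Suc m))" and y: "y \<in> carrier (K (Suc m))"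
  shows "dK m (z \<ominus>\<^bsub>K (Suc m)\<^esub> y) = dK m z \<ominus>\<^bsub>K m\<^esub> dK m y"
  by (rule mhom_minus_apply[OF left_module_K left_module_K dK_hom z y])

lemma K_minus_apply: "\<lbrakk>z \<in> carrier (K m); y \<in> carrier (K m)\<rbrakk> \<Longrightarrow> (z \<ominus>\<^bsub>K m\<^esub> y) l = z l \<ominus> y l"
  using R.minus_fun_module_apply[of z "enc ` Mi m" y l] by (simp add: K_def)

lemma K_minus_closed: "\<lbrakk>z \<in> carrier (K m); y \<in> carrier (K m)\<rbrakk> \<Longrightarrow> z \<ominus>\<^bsub>K m\<^esub> y \<in> carrier (K m)"
  by (rule abelian_group.minus_closed[OF left_module.axioms(2)[OF left_module_K]])

text \<open>Two steps give a double sum over \<open>i\<close> and \<open>j\<close> in which the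
  coefficient of \<open>z\<close> is symmetric, since the order of insertion into a multiset is
  irrelevant, while the factors are antisymmetric by \<open>Pm_anti\<close> and vanish on the
  diagonal by \<open>Pm_sq\<close>.\<close>

lemma dK_dK:
  assumes z: "z \<in> carrier (K (Suc (Suc m)))"
  shows "dK m (dK (Suc m) z) = \<zero>\<^bsub>K m\<^esub>"
proof (rule K_ext)
  interpret K0: left_module R "K m" by (rule left_module_K)
  show "dK m (dK (Suc m) z) \<in> carrier (K m)" by (intro dK_closed z)
  show "\<zero>\<^bsub>K m\<^esub> \<in> carrier (K m)" by simp
  fix b assume b: "b \<in> Mi m"
  define f where "f i j = z (enc (add_mset j (add_mset i b))) \<otimes> (Pm (Suc (Suc m)) j \<otimes> Pm (Suc m) i)" for i j
  have fc: "f i j \<in> carrier R" if "i \<in> Ix" "j \<in> Ix" for i j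
    using that K_closed[OF z] by (simp add: f_def Pm_closed)
  have "dK m (dK (Suc m) z) (enc b) = (\<Oplus>i\<in>Ix. \<Oplus>j\<in>Ix. f i j)"
    unfolding dK_enc[OF b]
  proof (intro R.finsum_cong' refl)
    show "(\<lambda>i. \<Oplus>j\<in>Ix. f i j) \<in> Ix \<rightarrow> carrier R" using fc by (auto intro!: R.finsum_closed)
    fix i assume i: "i \<in> Ix"
    have "dK (Suc m) z (enc (add_mset i b)) \<otimes> Pm (Suc m) i
      = (\<Oplus>j\<in>Ix. z (enc (add_mset j (add_mset i b))) \<otimes> Pm (Suc (Suc m)) j \<otimes> Pm (Suc m) i)"
      unfolding dK_enc[OF mindex_add[OF b i]]
      by (rule R.finsum_ldistr[OF Ix Pm_closed[OF i] terms_closed[OF z]])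
    also have "\<dots> = (\<Oplus>j\<in>Ix. f i j)"
      using fc i K_closed[OF z] by (intro R.finsum_cong') (auto simp: f_def m_assoc Pm_closed)
    finally show "dK (Suc m) z (enc (add_mset i b)) \<otimes> Pm (Suc m) i = (\<Oplus>j\<in>Ix. f i j)" .
  qed
  also have "\<dots> = \<zero>"
  proof (rule R.finsum_finsum_antisym[OF Ix fc])
    show "f i i = \<zero>" if "i \<in> Ix" for i using that K_closed[OF z] by (simp add: f_def Pm_sq)
    fix i j assume ij: "i \<in> Ix" "j \<in> Ix" "i \<noteq> j"
    define x where "x = z (enc (add_mset j (add_mset i b)))"
    have x: "x \<in> carrier R" unfolding x_def by (rule K_closed[OF z])
    have "f i j \<oplus> f j i = x \<otimes> (Pm (Suc (Suc m)) j \<otimes> Pm (Suc m) i \<oplus> Pm (Suc (Suc m)) i \<otimes> Pm (Suc m) j)"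
      using x ij by (simp add: f_def x_def add_mset_commute[of i j] r_distr Pm_closed)
    then show "f i j \<oplus> f j i = \<zero>" using Pm_anti[of j i "Suc m"] ij x by simp
  qed
  finally show "dK m (dK (Suc m) z) (enc b) = \<zero>\<^bsub>K m\<^esub> (enc b)" by (simp add: K_def)
qed

text \<open>One step of the contraction: subtracting the boundary of \<open>w\<close> kills all
  coordinates of the cycle \<open>z\<close> whose index contains \<open>j\<close>.\<close>

lemma contraction_step:
  assumes z: "z \<in> carrier (K (Suc m))" and dz: "dK m z = \<zero>\<^bsub>K m\<^esub>" and j: "j \<in> Ix"
    and w: "w = build (Suc (Suc m)) (\<lambda>a. if j \<in># a then D j (z (enc (a - {#j#}))) else \<zero>)"
  shows "w \<in> carrier (K (Suc (Suc m)))"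
    and "b \<in> Mi (Suc m) \<Longrightarrow> dK (Suc m) w (enc b) =
      z (enc b) \<ominus> (if j \<in># b then \<zero> else D j (z (enc b) \<otimes> Pm (Suc m) j))"
proof -
  note zc = K_closed[OF z]
  show wc: "w \<in> carrier (K (Suc (Suc m)))"
    unfolding w by (rule build_closed) (simp add: D_closed zc)
  assume b: "b \<in> Mi (Suc m)"
  have wv: "w (enc (add_mset i b)) = (if j \<in># add_mset i b then D j (z (enc (add_mset i b - {#j#}))) else \<zero>)"
    if "i \<in> Ix" for i
    unfolding w by (rule build_enc[OF mindex_add[OF b that]])
  show "dK (Suc m) w (enc b) = z (enc b) \<ominus> (if j \<in># b then \<zero> else D j (z (enc b) \<otimes> Pm (Suc m) j))"
  proof (cases "j \<in># b")
    case True
    define c where "c = b - {#j#}"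
    have c: "c \<in> Mi m" unfolding c_def by (rule mindex_diff[OF b True])
    have bc: "b = add_mset j c" using True by (simp add: c_def)
    define g where "g i = z (enc (add_mset i c)) \<otimes> Pm (Suc m) i" for i
    have gc: "g i \<in> carrier R" if "i \<in> Ix" for i using that zc by (simp add: g_def Pm_closed)
    \<comment> \<open>The delta terms leave \<open>z\<close> at \<open>b\<close>; the remaining
      terms add up to minus \<open>D j\<close> of the coordinate of \<open>dK m z\<close> at
      \<open>c = b - {#j#}\<close>, which is zero.\<close>
    have trm: "w (enc (add_mset i b)) \<otimes> Pm (Suc (Suc m)) i = (if i = j then z (enc b) else \<zero>) \<oplus> \<ominus> D j (g i)"
      if i: "i \<in> Ix" for i
    proof -
      have "w (enc (add_mset i b)) = D j (z (enc (add_mset i c)))"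
        using wv[OF i] by (simp add: bc add_mset_commute[of i j])
      then show ?thesis
        using D_Pm[OF zc i, of j "enc (add_mset i c)" "Suc m"] by (simp add: g_def a_minus_def bc split: if_splits)
    qed
    have "dK (Suc m) w (enc b) = (\<Oplus>i\<in>Ix. (if i = j then z (enc b) else \<zero>) \<oplus> \<ominus> D j (g i))"
      unfolding dK_enc[OF b] using zc gc by (intro R.finsum_cong') (auto simp: trm D_closed)
    also have "\<dots> = (\<Oplus>i\<in>Ix. if i = j then z (enc b) else \<zero>) \<oplus> (\<Oplus>i\<in>Ix. \<ominus> D j (g i))"
      using zc gc by (intro R.finsum_addf) (auto simp: D_closed)
    also have "(\<Oplus>i\<in>Ix. if i = j then z (enc b) else \<zero>) = z (enc b)"
      using zc j Ix by (subst R.finsum_single[of _ _ j]) auto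
    also have "(\<Oplus>i\<in>Ix. \<ominus> D j (g i)) = \<ominus> (\<Oplus>i\<in>Ix. D j (g i))"
      by (rule additive_finsum[OF R.is_abelian_group R.is_abelian_group, of "a_inv R", symmetric])
        (auto simp: R.minus_add R.a_comm D_closed gc)
    also have "(\<Oplus>i\<in>Ix. D j (g i)) = D j (\<Oplus>i\<in>Ix. g i)"
      by (rule D_finsum[symmetric]) (auto simp: gc)
    also have "(\<Oplus>i\<in>Ix. g i) = dK m z (enc c)" by (simp add: dK_enc[OF c] g_def)
    finally show ?thesis using True dz zc by (simp add: K_def D_zero a_minus_def)
  next
    case False
    \<comment> \<open>If \<open>j\<close> is not in \<open>b\<close>, then \<open>w\<close> vanishes
      at \<open>b + i\<close> for all \<open>i \<noteq> j\<close>, and a single term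
      remains.\<close>
    have "dK (Suc m) w (enc b) = w (enc (add_mset j b)) \<otimes> Pm (Suc (Suc m)) j"
      unfolding dK_enc[OF b]
    proof (rule R.finsum_single[OF Ix terms_closed[OF wc] j])
      fix i assume "i \<in> Ix" "i \<noteq> j"
      then show "w (enc (add_mset i b)) \<otimes> Pm (Suc (Suc m)) i = \<zero>" using False by (simp add: wv Pm_closed)
    qed
    also have "\<dots> = z (enc b) \<ominus> D j (z (enc b) \<otimes> Pm (Suc m) j)"
      using D_Pm[OF zc j, of j "enc b" "Suc m"] by (simp add: wv[OF j])
    finally show ?thesis using False by simp
  qed
qed

text \<open>Treating a further variable must not spoil the ones already treated. By
  \<open>contraction_step\<close> the correction at an index without \<open>j\<close> is an
  expression in the current remainder at that same index; where the remainder is zero, the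
  correction is zero too.\<close>

lemma contraction:
  assumes "finite S" "S \<subseteq> Ix" and z: "z \<in> carrier (K (Suc m))" and dz: "dK m z = \<zero>\<^bsub>K m\<^esub>"
  shows "\<exists>w\<in>carrier (K (Suc (Suc m))). \<forall>b\<in>Mi (Suc m). (\<exists>i\<in>S. i \<in># b) \<longrightarrow> dK (Suc m) w (enc b) = z (enc b)"
  using assms(1,2)
proof (induction S)
  case empty
  interpret K2: left_module R "K (Suc (Suc m))" by (rule left_module_K)
  show ?case using K2.M.zero_closed by blast
next
  case (insert j S)
  then obtain w where w: "w \<in> carrier (K (Suc (Suc m)))"
    "\<And>b i. \<lbrakk>b \<in> Mi (Suc m); i \<in> S; i \<in># b\<rbrakk> \<Longrightarrow> dK (Suc m) w (enc b) = z (enc b)" by blast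
  have j: "j \<in> Ix" using insert by simp
  interpret K0: left_module R "K m" by (rule left_module_K)
  interpret K2: left_module R "K (Suc (Suc m))" by (rule left_module_K)
  note dw = dK_closed[OF w(1)]
  define y where "y = z \<ominus>\<^bsub>K (Suc m)\<^esub> dK (Suc m) w"
  have y: "y \<in> carrier (K (Suc m))" unfolding y_def by (rule K_minus_closed[OF z dw])
  have yv: "y l = z l \<ominus> dK (Suc m) w l" for l unfolding y_def by (rule K_minus_apply[OF z dw])
  have dy: "dK m y = \<zero>\<^bsub>K m\<^esub>"
    unfolding y_def dK_minus[OF z dw] dz dK_dK[OF w(1)] by (simp add: K0.M.minus_eq_zero_iff)
  define u where "u = build (Suc (Suc m)) (\<lambda>a. if j \<in># a then D j (y (enc (a - {#j#}))) else \<zero>)"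
  note u = contraction_step[OF y dy j u_def]
  show ?case
  proof (intro bexI[of _ "w \<oplus>\<^bsub>K (Suc (Suc m))\<^esub> u"] ballI impI)
    show "w \<oplus>\<^bsub>K (Suc (Suc m))\<^esub> u \<in> carrier (K (Suc (Suc m)))" by (intro K2.M.a_closed w(1) u(1))
    fix b assume b: "b \<in> Mi (Suc m)" and i: "\<exists>i\<in>insert j S. i \<in># b"
    have s: "dK (Suc m) (w \<oplus>\<^bsub>K (Suc (Suc m))\<^esub> u) (enc b) = dK (Suc m) w (enc b) \<oplus> dK (Suc m) u (enc b)"
      using mhomD(2)[OF dK_hom w(1) u(1)] by (simp add: K_def)
    note c = K_closed[OF z, of "enc b"] K_closed[OF dw, of "enc b"]
    have du: "dK (Suc m) u (enc b) = y (enc b)"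
    proof (cases "j \<in># b")
      case True
      then show ?thesis using u(2)[OF b] K_closed[OF y] by (simp add: a_minus_def)
    next
      case False
      then obtain i where "i \<in> S" "i \<in># b" using i by auto
      then have "y (enc b) = \<zero>" using w(2)[OF b] yv[of "enc b"] c by (simp add: a_minus_def R.r_neg)
      then show ?thesis using u(2)[OF b] False Pm_closed[OF j] by (simp add: D_zero a_minus_def)
    qed
    show "dK (Suc m) (w \<oplus>\<^bsub>K (Suc (Suc m))\<^esub> u) (enc b) = z (enc b)"
      unfolding s du yv using c by (simp add: a_minus_def R.a_lcomm R.r_neg)
  qed
qed

lemma exact_K:
  assumes z: "z \<in> carrier (K (Suc m))" and dz: "dK m z = \<zero>\<^bsub>K m\<^esub>"
  shows "z \<in> dK (Suc m) ` carrier (K (Suc (Suc m)))"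
proof -
  obtain w where w: "w \<in> carrier (K (Suc (Suc m)))"
    "\<And>b. \<lbrakk>b \<in> Mi (Suc m); \<exists>i\<in>Ix. i \<in># b\<rbrakk> \<Longrightarrow> dK (Suc m) w (enc b) = z (enc b)"
    using contraction[OF Ix subset_refl z dz] by blast
  have "\<exists>i\<in>Ix. i \<in># b" if "b \<in> Mi (Suc m)" for b
  proof -
    from that have "size b = Suc m" by (simp add: mindex_def)
    then obtain i where "i \<in># b" by (metis size_eq_Suc_imp_elem)
    then show ?thesis using mindex_elem[OF that] by blast
  qed
  then have "z = dK (Suc m) w" by (intro K_ext[OF z dK_closed[OF w(1)]]) (simp add: w(2))
  then show ?thesis using w(1) by blast
qed

section \<open>The augmentation and exactness in degree zero\<close>

lemma aug_hom: "aug \<in> mhom R (K 0) N"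
  by (rule mhomI)
    (simp_all add: aug_def K_def fsuppD smult_closed smult_l_distr smult_assoc e)

lemma aug_surj: "aug ` carrier (K 0) = carrier N"
proof (intro equalityI subsetI)
  fix x assume "x \<in> carrier N"
  then obtain r where r: "r \<in> carrier R" "r \<odot>\<^bsub>N\<^esub> e = x" using cyclic by blast
  have "build 0 (\<lambda>_. r) \<in> carrier (K 0)" using r by (intro build_closed)
  moreover have "aug (build 0 (\<lambda>_. r)) = x" by (simp add: aug_def build_enc r)
  ultimately show "x \<in> aug ` carrier (K 0)" by blast
next
  fix x assume "x \<in> aug ` carrier (K 0)"
  then show "x \<in> carrier N" using mhomD(1)[OF aug_hom] by blast
qed

lemma Pm_1: "i \<in> Ix \<Longrightarrow> Pm (Suc 0) i = \<xi> i \<ominus> \<upsilon> i"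
  by (simp add: Pm_Suc Z_def)

lemma exact_K0: "{z \<in> carrier (K 0). aug z = \<zero>\<^bsub>N\<^esub>} = dK 0 ` carrier (K (Suc 0))"
proof (intro equalityI subsetI)
  fix z assume "z \<in> {z \<in> carrier (K 0). aug z = \<zero>\<^bsub>N\<^esub>}"
  then have z: "z \<in> carrier (K 0)" "z (enc {#}) \<odot>\<^bsub>N\<^esub> e = \<zero>\<^bsub>N\<^esub>" by (auto simp: aug_def)
  obtain w where w: "\<And>i. i \<in> Ix \<Longrightarrow> w i \<in> carrier R" "z (enc {#}) = (\<Oplus>i\<in>Ix. w i \<otimes> (\<xi> i \<ominus> \<upsilon> i))"
    using annihilator[OF K_closed[OF z(1)] z(2)] by blast
  \<comment> \<open>The multisets of size 1 are the singletons, so the \<open>w i\<close> furnished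
    by \<open>annihilator\<close> are the coordinates of a chain of degree 1.\<close>
  define u where "u = build (Suc 0) (\<lambda>a. w (THE i. a = {#i#}))"
  have single: "\<exists>i\<in>Ix. a = {#i#}" if "a \<in> Mi (Suc 0)" for a
    using that size_1_singleton_mset[of a] by (auto simp: mindex_def)
  have u: "u \<in> carrier (K (Suc 0))"
    unfolding u_def by (rule build_closed) (use single w(1) in fastforce)
  have "z = dK 0 u"
  proof (rule K_ext[OF z(1) dK_closed[OF u]])
    fix b assume "b \<in> Mi 0"
    then have b: "b = {#}" by simp
    have "dK 0 u (enc {#}) = (\<Oplus>i\<in>Ix. w i \<otimes> (\<xi> i \<ominus> \<upsilon> i))"
      unfolding dK_enc[of "{#}" 0, simplified mindex_0, OF singletonI]
    proof (intro R.finsum_cong' refl)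
      show "(\<lambda>i. w i \<otimes> (\<xi> i \<ominus> \<upsilon> i)) \<in> Ix \<rightarrow> carrier R" using w(1) X_closed Y_closed by auto
      fix i assume i: "i \<in> Ix"
      have "{#i#} \<in> Mi (Suc 0)" using i by (simp add: mindex_def)
      then have "u (enc {#i#}) = w i" unfolding u_def by (subst build_enc) auto
      then show "u (enc {#i#}) \<otimes> Pm (Suc 0) i = w i \<otimes> (\<xi> i \<ominus> \<upsilon> i)" using i by (simp add: Pm_1)
    qed
    then show "z (enc b) = dK 0 u (enc b)" using w(2) b by simp
  qed
  then show "z \<in> dK 0 ` carrier (K (Suc 0))" using u by blast
next
  fix z assume "z \<in> dK 0 ` carrier (K (Suc 0))"
  then obtain w where w: "w \<in> carrier (K (Suc 0))" "z = dK 0 w" by blast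
  have "aug z = (\<Oplus>\<^bsub>N\<^esub>i\<in>Ix. (w (enc {#i#}) \<otimes> Pm (Suc 0) i) \<odot>\<^bsub>N\<^esub> e)"
    unfolding aug_def w(2) dK_enc[of "{#}" 0, simplified mindex_0, OF singletonI]
    by (rule smult_l_finsum[OF terms_closed[OF w(1)] e])
  also have "\<dots> = (\<Oplus>\<^bsub>N\<^esub>i\<in>Ix. \<zero>\<^bsub>N\<^esub>)"
  proof (intro N.M.finsum_cong' refl)
    fix i assume i: "i \<in> Ix"
    have "Pm (Suc 0) i \<odot>\<^bsub>N\<^esub> e = \<zero>\<^bsub>N\<^esub>"
      unfolding Pm_1[OF i] using i X_closed[OF i] Y_closed[OF i] e
      by (simp add: a_minus_def smult_l_distr smult_l_uminus e_XY smult_closed N.M.r_neg)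
    then show "(w (enc {#i#}) \<otimes> Pm (Suc 0) i) \<odot>\<^bsub>N\<^esub> e = \<zero>\<^bsub>N\<^esub>"
      using K_closed[OF w(1)] Pm_closed[OF i] e by (simp add: smult_assoc smult_r_zero)
  qed simp
  finally have "aug z = \<zero>\<^bsub>N\<^esub>" by simp
  then show "z \<in> {z \<in> carrier (K 0). aug z = \<zero>\<^bsub>N\<^esub>}" using w dK_closed[OF w(1)] by simp
qed

theorem koszul_resolution: "free_resolution R N K dK aug"
proof -
  have "{z \<in> carrier (K (Suc i)). dK i z = \<zero>\<^bsub>K i\<^esub>} = dK (Suc i) ` carrier (K (Suc (Suc i)))" for i
    using exact_K dK_dK dK_closed by blast
  then show ?thesis
    unfolding free_resolution_def One_nat_def
    by (intro conjI allI free_K dK_hom aug_hom aug_surj exact_K0)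
qed

section \<open>Maps out of the Koszul modules\<close>

abbreviation unit :: "nat multiset \<Rightarrow> 'x list \<Rightarrow> 'r"
  where "unit b \<equiv> basis_elt R (enc b)"

lemma unit_closed: "b \<in> Mi m \<Longrightarrow> unit b \<in> carrier (K m)"
  unfolding K_carrier by (rule R.fsupp_basis_elt) simp

lemma K_hom_ext:
  assumes "left_module R L" "f \<in> mhom R (K m) L" "g \<in> mhom R (K m) L"
    and "\<And>b. b \<in> Mi m \<Longrightarrow> f (unit b) = g (unit b)" "x \<in> carrier (K m)"
  shows "f x = g x"
  by (rule free_basis_ext[OF K_free_basis left_module_K assms(1-3) _ assms(5)]) (use assms(4) in blast)

lemma K_hom_exists:
  assumes L: "left_module R L" and F: "\<And>b. b \<in> Mi m \<Longrightarrow> F b \<in> carrier L"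
  shows "\<exists>f\<in>mhom R (K m) L. \<forall>b\<in>Mi m. f (unit b) = F b"
proof -
  define h :: "('x list \<Rightarrow> 'r) \<Rightarrow> _" where "h y = F (THE b. y = unit b)" for y
  have unit_eq: "unit b = unit b' \<longleftrightarrow> b = b'" for b b'
    using nontrivial by (metis (mono_tags) basis_elt_def enc_inject)
  have hu: "h (unit b) = F b" for b unfolding h_def unit_eq by simp
  have "h \<in> basis_elt R ` enc ` Mi m \<rightarrow> carrier L" using hu F by auto
  from free_basis_lift[OF K_free_basis left_module_K L this] hu show ?thesis by auto
qed

text \<open>Evaluated at \<open>c\<close>, the coordinate form has a nonzero term only for the
  \<open>i\<close> with \<open>c + i = a\<close>. Hence every element of \<open>a\<close>
  contributes once, without its multiplicity.\<close>

lemma dK_unit: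
  assumes a: "a \<in> Mi (Suc m)"
  shows "dK m (unit a) = (\<Oplus>\<^bsub>K m\<^esub>i\<in>set_mset a. Pm (Suc m) i \<odot>\<^bsub>K m\<^esub> unit (a - {#i#}))"
proof (rule K_ext)
  interpret K0: left_module R "K m" by (rule left_module_K)
  have aI: "set_mset a \<subseteq> Ix" using mindex_elem[OF a] by blast
  have tc: "Pm (Suc m) i \<odot>\<^bsub>K m\<^esub> unit (a - {#i#}) \<in> carrier (K m)" if "i \<in># a" for i
    by (intro K0.smult_closed Pm_closed unit_closed mindex_diff[OF a] mindex_elem[OF a] that)
  show "dK m (unit a) \<in> carrier (K m)" by (intro dK_closed unit_closed a)
  show "(\<Oplus>\<^bsub>K m\<^esub>i\<in>set_mset a. Pm (Suc m) i \<odot>\<^bsub>K m\<^esub> unit (a - {#i#})) \<in> carrier (K m)"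
    using tc by (intro K0.M.finsum_closed) auto
  fix c assume c: "c \<in> Mi m"
  have "(\<Oplus>\<^bsub>K m\<^esub>i\<in>set_mset a. Pm (Suc m) i \<odot>\<^bsub>K m\<^esub> unit (a - {#i#})) (enc c)
    = (\<Oplus>i\<in>set_mset a. (Pm (Suc m) i \<odot>\<^bsub>K m\<^esub> unit (a - {#i#})) (enc c))"
    unfolding K_def by (rule R.finsum_fun_module_apply) (use tc in \<open>simp add: K_def Pi_def\<close>)
  also have "\<dots> = (\<Oplus>i\<in>Ix. unit a (enc (add_mset i c)) \<otimes> Pm (Suc m) i)"
  proof (rule R.add.finprod_mono_neutral_cong_left[OF Ix aI])
    show "unit a (enc (add_mset i c)) \<otimes> Pm (Suc m) i = \<zero>" if "i \<in> Ix - set_mset a" for i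
      using that Pm_closed[of i] by (auto simp: basis_elt_def enc_inject)
    show "(Pm (Suc m) i \<odot>\<^bsub>K m\<^esub> unit (a - {#i#})) (enc c) = unit a (enc (add_mset i c)) \<otimes> Pm (Suc m) i"
      if i: "i \<in># a" for i
    proof -
      have "add_mset i c = a \<longleftrightarrow> c = a - {#i#}" using i by auto
      then show ?thesis using Pm_closed[OF mindex_elem[OF a i]] by (simp add: K_def basis_elt_def enc_inject)
    qed
    show "(\<lambda>i. unit a (enc (add_mset i c)) \<otimes> Pm (Suc m) i) \<in> Ix \<rightarrow> carrier R"
      by (rule terms_closed[OF unit_closed[OF a]])
  qed
  finally show "dK m (unit a) (enc c) = (\<Oplus>\<^bsub>K m\<^esub>i\<in>set_mset a. Pm (Suc m) i \<odot>\<^bsub>K m\<^esub> unit (a - {#i#})) (enc c)"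
    by (simp add: dK_enc[OF c])
qed

lemma hom_dK_unit:
  assumes a: "a \<in> Mi (Suc m)" and L: "left_module R L" and f: "f \<in> mhom R (K m) L"
  shows "f (dK m (unit a)) = (\<Oplus>\<^bsub>L\<^esub>i\<in>set_mset a. Pm (Suc m) i \<odot>\<^bsub>L\<^esub> f (unit (a - {#i#})))"
proof -
  interpret K0: left_module R "K m" by (rule left_module_K)
  interpret L: left_module R L by (rule L)
  have cl: "Pm (Suc m) i \<in> carrier R" "unit (a - {#i#}) \<in> carrier (K m)" if "i \<in># a" for i
    by (intro Pm_closed unit_closed mindex_diff[OF a] mindex_elem[OF a] that)+
  have "f (dK m (unit a)) = (\<Oplus>\<^bsub>L\<^esub>i\<in>set_mset a. f (Pm (Suc m) i \<odot>\<^bsub>K m\<^esub> unit (a - {#i#})))"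
    unfolding dK_unit[OF a] by (rule mhom_finsum[OF left_module_K L f]) (use cl K0.smult_closed in blast)
  also have "\<dots> = (\<Oplus>\<^bsub>L\<^esub>i\<in>set_mset a. Pm (Suc m) i \<odot>\<^bsub>L\<^esub> f (unit (a - {#i#})))"
    using cl mhomD(1,3)[OF f] L.smult_closed by (intro L.M.finsum_cong') auto
  finally show ?thesis .
qed

end

section \<open>Multiplication by the canonical element\<close>

text \<open>Pascal's rule: multisets that avoid \<open>x\<close> lie over the smaller set, and
  removing one copy of \<open>x\<close> from the others lowers the size by one. For empty
  \<open>S\<close> truncated subtraction gives the right values: 1 at size 0, and
  \<open>(m - 1) choose m = 0\<close> otherwise.\<close>

lemma card_mindex: "finite S \<Longrightarrow> card (mindex S m) = (card S + m - 1) choose m"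
proof (induction S arbitrary: m rule: finite_induct)
  case empty
  have "mindex {} (Suc m) = {}" for m by (auto simp: mindex_def)
  then show ?case by (cases m) simp_all
next
  case (insert x S)
  show ?case
  proof (induction m)
    case 0
    then show ?case by simp
  next
    case (Suc m)
    let ?A = "mindex S (Suc m)" and ?B = "add_mset x ` mindex (insert x S) m"
    have "mindex (insert x S) (Suc m) = ?A \<union> ?B"
    proof (intro equalityI subsetI)
      fix b assume b: "b \<in> mindex (insert x S) (Suc m)"
      show "b \<in> ?A \<union> ?B"
      proof (cases "x \<in># b")
        case True
        then have "b = add_mset x (b - {#x#})" by simp
        then show ?thesis using mindex_diff[OF b True] by blast
      next
        case False
        then show ?thesis using b by (auto simp: mindex_def)
      qed
    qed (auto simp: mindex_def)
    moreover have "?A \<inter> ?B = {}" using insert.hyps by (auto simp: mindex_def)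
    moreover have "finite ?A" "finite ?B" using insert.hyps by (simp_all add: finite_mindex)
    ultimately have "card (mindex (insert x S) (Suc m)) = card ?A + card ?B"
      by (simp add: card_Un_disjoint)
    also have "card ?B = card (mindex (insert x S) m)" by (rule card_image) (simp add: inj_on_def)
    finally show ?case using Suc insert.IH[of "Suc m"] insert.hyps by simp
  qed
qed

text \<open>Toggling membership of \<open>x\<close> is an involution that exchanges the two
  parities, so each is taken by half of the subsets.\<close>

lemma card_subsets_parity:
  assumes S: "finite S" "x \<in> S"
  shows "card {I. I \<subseteq> S \<and> even (m + card I)} = 2 ^ (card S - 1)"
proof -
  let ?E = "{I. I \<subseteq> S \<and> even (m + card I)}" and ?O = "{I. I \<subseteq> S \<and> odd (m + card I)}"
  define t where "t I = (if x \<in> I then I - {x} else insert x I)" for I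
  have fin: "finite I" if "I \<subseteq> S" for I using finite_subset[OF that S(1)] .
  have cardt: "even (m + card (t I)) \<longleftrightarrow> odd (m + card I)" if "I \<subseteq> S" for I
  proof (cases "x \<in> I")
    case True
    then have "card I = Suc (card (t I))" using card_Suc_Diff1[OF fin[OF that] True] by (simp add: t_def)
    then show ?thesis by simp
  next
    case False
    then show ?thesis using fin[OF that] by (simp add: t_def)
  qed
  have tS: "t I \<subseteq> S" if "I \<subseteq> S" for I using that S(2) by (auto simp: t_def)
  have tt: "t (t I) = I" for I by (auto simp: t_def)
  have "bij_betw t ?E ?O"
    by (rule bij_betw_byWitness[of _ t]) (use tt cardt tS[THEN subsetD] in auto)
  then have EO: "card ?E = card ?O" by (rule bij_betw_same_card)
  have "Pow S = ?E \<union> ?O" by auto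
  moreover have "?E \<inter> ?O = {}" by auto
  moreover have "finite ?E" "finite ?O" using S by auto
  ultimately have "2 ^ card S = card ?E + card ?O"
    using card_Un_disjoint[of ?E ?O] card_Pow[OF S(1)] by simp
  also have "\<dots> = 2 * card ?E" using EO by simp
  finally show ?thesis using S by (cases "card S") auto
qed

text \<open>\<open>characteristic\<close> is the additive order of one. If \<open>1 + 1 = 0\<close>
  this order divides 2, and it is not 1 because \<open>1 \<noteq> 0\<close>.\<close>

lemma (in field) characteristic_eq_2_iff: "characteristic R = 2 \<longleftrightarrow> \<one> \<oplus> \<one> = \<zero>"
proof -
  have pow: "\<one> [^]\<^bsub>add_monoid R\<^esub> m = \<zero> \<longleftrightarrow> characteristic R dvd m" for m :: nat
    using group.pow_eq_id[OF a_group, of "\<one>" m] by (simp add: characteristic_def)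
  have p2: "\<one> [^]\<^bsub>add_monoid R\<^esub> (2::nat) = \<one> \<oplus> \<one>" and p1: "\<one> [^]\<^bsub>add_monoid R\<^esub> (1::nat) = \<one>"
    by (simp_all add: nat_pow_def numeral_2_eq_2)
  show ?thesis
  proof
    assume "characteristic R = 2"
    then show "\<one> \<oplus> \<one> = \<zero>" using pow[of 2] p2 by simp
  next
    assume "\<one> \<oplus> \<one> = \<zero>"
    then have "characteristic R dvd 2" using pow[of 2] p2 by simp
    moreover have "characteristic R \<noteq> 1" using pow[of 1] p1 one_not_zero by auto
    ultimately show "characteristic R = 2" using two_is_prime_nat prime_nat_iff by blast
  qed
qed

context exterior_loc
begin

text \<open>Multiplication by the sum of the \<open>x_i y_i\<close>, where \<open>v b\<close> is the
  coefficient of the monomial \<open>y^b\<close>. The coefficient of \<open>y^a\<close> receives a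
  term from \<open>y^a / y_i\<close> for each variable \<open>i\<close> that occurs in
  \<open>a\<close>.\<close>

definition om :: "(nat multiset \<Rightarrow> nat set \<Rightarrow> 'k) \<Rightarrow> nat multiset \<Rightarrow> nat set \<Rightarrow> 'k"
  where "om v a I = (\<Oplus>i\<in>set_mset a. Lop i (v (a - {#i#})) I)"

abbreviation "Mi \<equiv> mindex Ix"

lemma Dop_V:
  assumes v: "v \<in> V"
  shows "Dop j v \<in> V"
proof -
  have "v (insert j I) = \<zero>" if "\<not> I \<subseteq> Ix" for I
    by (rule V_D(2)[OF v]) (use that in blast)
  then show ?thesis using V_D(1)[OF v] by (simp add: V_def Dop_def)
qed

lemma Lop_carrier: "v \<in> V \<Longrightarrow> Lop i v I \<in> carrier k"
  by (rule Lop_closed) (rule V_D(1))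

lemma om_closed: "(\<And>b. v b \<in> V) \<Longrightarrow> om v a I \<in> carrier k"
  unfolding om_def by (rule finsum_closed) (simp add: Lop_carrier)

lemma om_add:
  assumes u: "\<And>b. u b \<in> V" and v: "\<And>b. v b \<in> V"
  shows "om (\<lambda>b I. u b I \<oplus> v b I) a I = om u a I \<oplus> om v a I"
proof -
  have "om (\<lambda>b I. u b I \<oplus> v b I) a I = (\<Oplus>i\<in>set_mset a. Lop i (u (a - {#i#})) I \<oplus> Lop i (v (a - {#i#})) I)"
    unfolding om_def using V_D(1)[OF u] V_D(1)[OF v]
    by (intro finsum_cong') (auto simp: Lop_def r_distr)
  also have "\<dots> = om u a I \<oplus> om v a I"
    unfolding om_def using Lop_carrier[OF u] Lop_carrier[OF v] by (intro finsum_addf) auto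
  finally show ?thesis .
qed

lemma om_smult:
  assumes v: "\<And>b. v b \<in> V" and c: "c \<in> carrier k"
  shows "om (\<lambda>b I. c \<otimes> v b I) a I = c \<otimes> om v a I"
proof -
  have "om (\<lambda>b I. c \<otimes> v b I) a I = (\<Oplus>i\<in>set_mset a. c \<otimes> Lop i (v (a - {#i#})) I)"
    unfolding om_def using V_D(1)[OF v] c
    by (intro finsum_cong') (auto simp: Lop_def m_lcomm)
  also have "\<dots> = c \<otimes> om v a I"
    unfolding om_def using Lop_carrier[OF v] c by (intro finsum_rdistr[symmetric]) auto
  finally show ?thesis .
qed

text \<open>Dividing by \<open>y_j\<close> and differentiating by \<open>x_j\<close> contracts the
  factor of the complex that belongs to \<open>j\<close>. For one variable, multiplication by
  \<open>x y\<close> takes \<open>y^b\<close> to \<open>x y^(b+1)\<close>, and the only class left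
  is that of \<open>x\<close>. This is the exceptional case \<open>j \<in> I\<close>,
  \<open>j \<notin># b\<close>.\<close>

lemma om_contract:
  assumes v: "\<And>b. v b \<in> V" and j: "j \<in> Ix" and b: "b \<in> Mi m" and I: "I \<subseteq> Ix"
    and cyc: "\<And>a I. \<lbrakk>a \<in> Mi (Suc m); I \<subseteq> Ix\<rbrakk> \<Longrightarrow> om v a I = \<zero>"
  shows "om (\<lambda>c. Dop j (v (add_mset j c))) b I = (if j \<in> I \<and> j \<notin># b then \<zero> else v b I)"
proof -
  have fI: "finite I" by (rule finite_subset[OF I finite_Ix])
  note vc = V_D(1)[OF v] and Lc = Lop_carrier[OF v]
  define g where "g i = Lop i (Dop j (v (add_mset j (b - {#i#})))) I" for i
  have gc: "g \<in> set_mset b \<rightarrow> carrier k" unfolding g_def by (intro Pi_I Lop_carrier Dop_V v)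
  have om: "om (\<lambda>c. Dop j (v (add_mset j c))) b I = (\<Oplus>i\<in>set_mset b. g i)" by (simp add: om_def g_def)
  show ?thesis
  proof (cases "j \<in> I")
    case True
    \<comment> \<open>The derivative by \<open>x_j\<close> has no coefficient at sets containing
      \<open>j\<close>, so only \<open>Lop j\<close>, which removes \<open>j\<close>, can reach
      it.\<close>
    have g0: "g i = \<zero>" if "i \<noteq> j" for i using that True by (simp add: g_def Lop_def Dop_def)
    show ?thesis
    proof (cases "j \<in># b")
      case jb: True
      have "(\<Oplus>i\<in>set_mset b. g i) = g j" by (rule finsum_single[OF _ gc jb]) (simp_all add: g0)
      also have "\<dots> = v b I"
        using True jb Dop_Lop_same(2)[where v = "v b" and i = j and I = I, OF vc] by (simp add: g_def)
      finally show ?thesis using jb om by simp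
    next
      case jb: False
      have "g i = \<zero>" if "i \<in># b" for i by (rule g0) (use jb that in blast)
      then have "(\<Oplus>i\<in>set_mset b. g i) = (\<Oplus>i\<in>set_mset b. \<zero>)"
        by (intro finsum_cong') auto
      then show ?thesis using True jb om by simp
    qed
  next
    case False
    \<comment> \<open>For \<open>j \<notin> I\<close> the cycle condition is applied with
      \<open>j\<close> added to both indices. Its term for \<open>j\<close> is \<open>v b I\<close>
      up to sign, and its other terms are those of the contraction.\<close>
    define a' I' where "a' = add_mset j b" and "I' = insert j I"
    define h where "h i = Lop i (v (a' - {#i#})) I'" for i
    have hc: "h i \<in> carrier k" for i unfolding h_def by (rule Lc)
    have gj: "g j = \<zero>" using False by (simp add: g_def Lop_def)
    have gi: "g i = (\<ominus> sg (cnt j I)) \<otimes> h i" if i: "i \<noteq> j" "i \<in># b" for i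
    proof -
      have e: "add_mset j (b - {#i#}) = a' - {#i#}" using i by (simp add: a'_def)
      have "g i = \<ominus> Dop j (Lop i (v (a' - {#i#}))) I"
        unfolding g_def e by (rule Dop_Lop[OF vc fI i(1)])
      then show ?thesis using False hc by (simp add: Dop_def h_def I'_def l_minus)
    qed
    let ?S = "set_mset b - {j}"
    have "(\<Oplus>i\<in>set_mset b. g i) = (\<Oplus>i\<in>?S. (\<ominus> sg (cnt j I)) \<otimes> h i)"
      by (rule add.finprod_mono_neutral_cong_right) (use gc gj gi in auto)
    also have "\<dots> = (\<ominus> sg (cnt j I)) \<otimes> (\<Oplus>i\<in>?S. h i)"
      using hc by (intro finsum_rdistr[symmetric]) auto
    finally have 1: "(\<Oplus>i\<in>set_mset b. g i) = (\<ominus> sg (cnt j I)) \<otimes> (\<Oplus>i\<in>?S. h i)" .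
    have "set_mset a' = insert j ?S" by (auto simp: a'_def)
    then have "om v a' I' = (\<Oplus>i\<in>insert j ?S. h i)" by (simp add: om_def h_def)
    also have "\<dots> = h j \<oplus> (\<Oplus>i\<in>?S. h i)" using hc by (intro finsum_insert) auto
    also have "h j = sg (cnt j I) \<otimes> v b I" using False by (simp add: h_def Lop_def I'_def a'_def)
    finally have "sg (cnt j I) \<otimes> v b I \<oplus> (\<Oplus>i\<in>?S. h i) = \<zero>"
      using cyc[of a' I'] mindex_add[OF b j] I j by (simp add: a'_def I'_def)
    then have "sg (cnt j I) \<otimes> v b I = \<ominus> (\<Oplus>i\<in>?S. h i)"
      using vc hc by (intro sum_zero_eq_neg) (auto intro!: finsum_closed)
    then have "sg (cnt j I) \<otimes> (sg (cnt j I) \<otimes> v b I) = \<ominus> (sg (cnt j I) \<otimes> (\<Oplus>i\<in>?S. h i))"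
      using hc by (simp add: r_minus finsum_closed Pi_def)
    then show ?thesis
      using False om 1 vc hc by (simp add: sg_sq_left l_minus finsum_closed Pi_def)
  qed
qed

text \<open>A term of \<open>om\<close> adds one letter \<open>i\<close> to both indices. If the
  target has \<open>j\<close> in \<open>I\<close> but not in \<open>a\<close>, then
  \<open>i \<noteq> j\<close>, so all its sources have this form too. If the target is not of this
  form, neither is any source. Thus the part left over by \<open>om_contract\<close> is again a
  cycle.\<close>

lemma om_restrict:
  assumes v: "\<And>b. v b \<in> V" and cyc: "om v a I = \<zero>"
  shows "om (\<lambda>b I. if j \<in> I \<and> j \<notin># b then v b I else \<zero>) a I = \<zero>"
proof -
  let ?w = "\<lambda>b I. if j \<in> I \<and> j \<notin># b then v b I else \<zero>"
  note vc = V_D(1)[OF v] and Lc = Lop_carrier[OF v]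
  show ?thesis
  proof (cases "j \<in> I \<and> j \<notin># a")
    case True
    have "om ?w a I = om v a I"
      unfolding om_def using True Lc
      by (intro finsum_cong') (auto simp: Lop_def dest: in_diffD)
    then show ?thesis using cyc by simp
  next
    case False
    have "Lop i (?w (a - {#i#})) I = \<zero>" if "i \<in># a" for i
    proof (cases "j \<in> I \<and> j \<noteq> i")
      case True
      then have "j \<in># a - {#i#}" using False by (simp add: in_diff_count)
      then show ?thesis by (simp add: Lop_def)
    qed (auto simp: Lop_def)
    then have "om ?w a I = (\<Oplus>i\<in>set_mset a. \<zero>)"
      unfolding om_def by (intro finsum_cong' refl) auto
    then show ?thesis by simp
  qed
qed

lemma restrict_V: "v \<in> V \<Longrightarrow> (\<lambda>I. if P I then v I else \<zero>) \<in> V"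
  by (auto simp: V_def)

text \<open>After the variables in \<open>S\<close> have been treated, what remains contains each
  \<open>x_i\<close> and no \<open>y_i\<close> for \<open>i \<in> S\<close>. The remainder
  \<open>w\<close> of one contraction is passed to the induction hypothesis, which is why
  \<open>v\<close> is arbitrary.\<close>

lemma om_exact_partial:
  assumes "finite S" "S \<subseteq> Ix" "\<And>b. v b \<in> V" "\<And>a I. \<lbrakk>a \<in> Mi (Suc m); I \<subseteq> Ix\<rbrakk> \<Longrightarrow> om v a I = \<zero>"
  shows "\<exists>\<mu>. (\<forall>c. \<mu> c \<in> V) \<and> (\<forall>b\<in>Mi m. \<forall>I\<subseteq>Ix.
    v b I = om \<mu> b I \<oplus> (if S \<subseteq> I \<and> (\<forall>i\<in>S. i \<notin># b) then v b I else \<zero>))"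
  using assms
proof (induction S arbitrary: v)
  case empty
  have z: "(\<lambda>_. \<zero>) \<in> V" by (simp add: V_def)
  have "om (\<lambda>_ _. \<zero>) b I = \<zero>" for b I by (simp add: om_def Lop_def)
  then show ?case using z V_D(1)[OF empty.prems(2)] by (intro exI[of _ "\<lambda>_ _. \<zero>"]) simp
next
  case (insert j S)
  have j: "j \<in> Ix" and S: "S \<subseteq> Ix" using insert.prems(1) by auto
  note v = insert.prems(2) and cyc = insert.prems(3)
  define w where "w b I = (if j \<in> I \<and> j \<notin># b then v b I else \<zero>)" for b I
  have wV: "w b \<in> V" for b
    unfolding w_def[abs_def] by (rule restrict_V[OF v])
  have wcyc: "om w a I = \<zero>" if "a \<in> Mi (Suc m)" "I \<subseteq> Ix" for a I
    unfolding w_def[abs_def] by (rule om_restrict[OF v cyc[OF that]])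
  from insert.IH[OF S wV wcyc] obtain \<mu> where \<mu>: "\<And>c. \<mu> c \<in> V"
    "\<And>b I. \<lbrakk>b \<in> Mi m; I \<subseteq> Ix\<rbrakk> \<Longrightarrow> w b I = om \<mu> b I \<oplus> (if S \<subseteq> I \<and> (\<forall>i\<in>S. i \<notin># b) then w b I else \<zero>)"
    by blast
  define \<nu> where "\<nu> c = Dop j (v (add_mset j c))" for c
  have \<nu>V: "\<nu> c \<in> V" for c unfolding \<nu>_def by (intro Dop_V v)
  show ?case
  proof (intro exI[of _ "\<lambda>c I. \<nu> c I \<oplus> \<mu> c I"] conjI allI ballI impI)
    show "(\<lambda>I. \<nu> c I \<oplus> \<mu> c I) \<in> V" for c using \<nu>V[of c] \<mu>(1)[of c] by (simp add: V_def)
    fix b I assume b: "b \<in> Mi m" and I: "I \<subseteq> Ix"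
    let ?r = "if insert j S \<subseteq> I \<and> (\<forall>i\<in>insert j S. i \<notin># b) then v b I else \<zero>"
    have vc: "v b I \<in> carrier k" by (rule V_D(1)[OF v])
    have r: "(if S \<subseteq> I \<and> (\<forall>i\<in>S. i \<notin># b) then w b I else \<zero>) = ?r" by (auto simp: w_def)
    have "om \<nu> b I = (if j \<in> I \<and> j \<notin># b then \<zero> else v b I)"
      unfolding \<nu>_def[abs_def] by (rule om_contract[OF v j b I cyc])
    then have "v b I = om \<nu> b I \<oplus> w b I" using vc by (simp add: w_def)
    also have "w b I = om \<mu> b I \<oplus> ?r" using \<mu>(2)[OF b I] unfolding r .
    also have "om \<nu> b I \<oplus> (om \<mu> b I \<oplus> ?r) = om (\<lambda>c I. \<nu> c I \<oplus> \<mu> c I) b I \<oplus> ?r"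
      unfolding om_add[OF \<nu>V \<mu>(1)] using om_closed[OF \<nu>V] om_closed[OF \<mu>(1)] vc by (intro a_assoc[symmetric]) simp_all
    finally show "v b I = om (\<lambda>c I. \<nu> c I \<oplus> \<mu> c I) b I \<oplus> ?r" .
  qed
qed

text \<open>With all variables treated, a remainder could sit only at a multiset containing no
  variable; in positive degree there is none.\<close>

lemma om_exact:
  assumes v: "\<And>b. v b \<in> V" and cyc: "\<And>a I. \<lbrakk>a \<in> Mi (Suc (Suc m)); I \<subseteq> Ix\<rbrakk> \<Longrightarrow> om v a I = \<zero>"
  shows "\<exists>\<mu>. (\<forall>c. \<mu> c \<in> V) \<and> (\<forall>b\<in>Mi (Suc m). \<forall>I\<subseteq>Ix. om \<mu> b I = v b I)"
proof -
  have "\<exists>\<mu>. (\<forall>c. \<mu> c \<in> V) \<and> (\<forall>b\<in>Mi (Suc m). \<forall>I\<subseteq>Ix.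
      v b I = om \<mu> b I \<oplus> (if Ix \<subseteq> I \<and> (\<forall>i\<in>Ix. i \<notin># b) then v b I else \<zero>))"
    by (rule om_exact_partial[OF finite_Ix subset_refl v]) (rule cyc)
  then obtain \<mu> where \<mu>0: "(\<forall>c. \<mu> c \<in> V) \<and> (\<forall>b\<in>Mi (Suc m). \<forall>I\<subseteq>Ix.
      v b I = om \<mu> b I \<oplus> (if Ix \<subseteq> I \<and> (\<forall>i\<in>Ix. i \<notin># b) then v b I else \<zero>))"
    by (elim exE) (rule that)
  have \<mu>1: "\<mu> c \<in> V" for c using conjunct1[OF \<mu>0] by (rule spec)
  have "om \<mu> b I = v b I" if b: "b \<in> Mi (Suc m)" and I: "I \<subseteq> Ix" for b I
  proof -
    have "size b = Suc m" using b by (simp add: mindex_def)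
    then obtain i where "i \<in># b" by (metis size_eq_Suc_imp_elem)
    then have "\<not> (\<forall>i\<in>Ix. i \<notin># b)" using mindex_elem[OF b] by blast
    then have "(if Ix \<subseteq> I \<and> (\<forall>i\<in>Ix. i \<notin># b) then v b I else \<zero>) = \<zero>" by argo
    then have "v b I = om \<mu> b I \<oplus> \<zero>" using mp[OF spec[OF bspec[OF conjunct2[OF \<mu>0] b], of I] I] by (simp only:)
    then show ?thesis using om_closed[where v = \<mu>, OF \<mu>1] by simp
  qed
  then show ?thesis using \<mu>1 by (intro exI[of _ \<mu>]) simp
qed

end

section \<open>Hochschild cohomology of the exterior algebra\<close>

type_synonym 'k lam = "(nat list \<Rightarrow> 'k) set"
type_synonym 'k env = "('k lam \<times> 'k lam \<Rightarrow> 'k) set"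

context exterior_loc
begin

section \<open>The Koszul data of the enveloping algebra\<close>

sublocale Ev: enveloping_loc k \<Lambda>
  by (rule enveloping_loc.intro) (rule \<Lambda>.kalgebra_axioms)

abbreviation "Env \<equiv> enveloping_algebra k \<Lambda>"
abbreviation "Reg \<equiv> regular_bimodule k \<Lambda>"
abbreviation T :: "'k lam \<Rightarrow> 'k lam \<Rightarrow> 'k env"
  where "T \<equiv> Ev.E.tens"

lemma Env_eq: "tensor_algebra k \<Lambda> (opposite \<Lambda>) = Env"
  by (simp add: enveloping_algebra_def)

lemmas T_bilinear = Ev.E.tens_bilinear[unfolded Env_eq]
lemmas T_D = bilinearD[OF T_bilinear, unfolded opposite_simps]

lemma T_mult: "\<lbrakk>a \<in> carrier \<Lambda>; a' \<in> carrier \<Lambda>; b \<in> carrier \<Lambda>; b' \<in> carrier \<Lambda>\<rbrakk> \<Longrightarrow>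
    T a b \<otimes>\<^bsub>Env\<^esub> T a' b' = T (a \<otimes>\<^bsub>\<Lambda>\<^esub> a') (b' \<otimes>\<^bsub>\<Lambda>\<^esub> b)"
  using Ev.E.tens_mult[of a a' b b'] unfolding Env_eq by simp

lemma T_one: "\<one>\<^bsub>Env\<^esub> = T \<one>\<^bsub>\<Lambda>\<^esub> \<one>\<^bsub>\<Lambda>\<^esub>"
  using Ev.E.tens_one unfolding Env_eq by simp

lemma T_left_hom: "b \<in> carrier \<Lambda> \<Longrightarrow> (\<lambda>a. T a b) \<in> mhom k \<Lambda> Env"
  using T_bilinear by (auto simp: bilinear_def)

lemma T_zero_left: "b \<in> carrier \<Lambda> \<Longrightarrow> T \<zero>\<^bsub>\<Lambda>\<^esub> b = \<zero>\<^bsub>Env\<^esub>"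
  using mhom_zero[OF \<Lambda>.L.left_module_axioms Ev.Env.L.left_module_axioms T_left_hom] .

lemma T_right_hom: "a \<in> carrier \<Lambda> \<Longrightarrow> T a \<in> mhom k (opposite \<Lambda>) Env"
  using T_bilinear by (auto simp: bilinear_def)

lemma T_zero_right: "a \<in> carrier \<Lambda> \<Longrightarrow> T a \<zero>\<^bsub>\<Lambda>\<^esub> = \<zero>\<^bsub>Env\<^esub>"
  using mhom_zero[OF Ev.E.TB.L.left_module_axioms Ev.Env.L.left_module_axioms T_right_hom] by simp

definition xi :: "nat \<Rightarrow> 'k env"
  where "xi i = T (mon [i]) \<one>\<^bsub>\<Lambda>\<^esub>"

definition yi :: "nat \<Rightarrow> 'k env"
  where "yi i = T \<one>\<^bsub>\<Lambda>\<^esub> (mon [i])"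

text \<open>\<open>D j\<close> of the overview. The derivative is linear over \<open>k\<close> but
  not over the enveloping algebra, so it is obtained from the universal property of the tensor
  product over \<open>k\<close>.\<close>

definition DD :: "nat \<Rightarrow> 'k env \<Rightarrow> 'k env"
  where "DD j = Ev.E.tlift Env (\<lambda>a b. T (RD j a) b)"

lemma letter_closed: "i \<in> Ix \<Longrightarrow> mon [i] \<in> carrier \<Lambda>"
  by (rule mon_closed) simp

lemma xi_closed: "i \<in> Ix \<Longrightarrow> xi i \<in> carrier Env"
  unfolding xi_def by (intro T_D(1) letter_closed \<Lambda>.A.one_closed)

lemma yi_closed: "i \<in> Ix \<Longrightarrow> yi i \<in> carrier Env"
  unfolding yi_def by (intro T_D(1) letter_closed \<Lambda>.A.one_closed)

lemma RD_bilinear: "bilinear k \<Lambda> (opposite \<Lambda>) Env (\<lambda>a b. T (RD j a) b)"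
  by (rule bilinearI) (simp_all add: T_D RD_closed mhomD[OF RD_hom])

lemma DD_hom: "DD j \<in> mhom k Env Env"
  unfolding DD_def using Ev.E.tlift_hom[OF Ev.Env.L.left_module_axioms RD_bilinear] unfolding Env_eq .

lemma DD_T: "\<lbrakk>a \<in> carrier \<Lambda>; b \<in> carrier \<Lambda>\<rbrakk> \<Longrightarrow> DD j (T a b) = T (RD j a) b"
  unfolding DD_def using Ev.E.tlift_tens[OF Ev.Env.L.left_module_axioms RD_bilinear, of a b] by simp

lemma Env_hom_ext:
  assumes "\<phi> \<in> mhom k Env Env" "\<psi> \<in> mhom k Env Env"
    and "\<And>a b. \<lbrakk>a \<in> carrier \<Lambda>; b \<in> carrier \<Lambda>\<rbrakk> \<Longrightarrow> \<phi> (T a b) = \<psi> (T a b)"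
    and "z \<in> carrier Env"
  shows "\<phi> z = \<psi> z"
  using Ev.E.tensor_hom_ext[OF Ev.Env.L.left_module_axioms, of \<phi> \<psi> z] assms unfolding Env_eq by simp

lemma right_mult_hom: "s \<in> carrier Env \<Longrightarrow> (\<lambda>r. r \<otimes>\<^bsub>Env\<^esub> s) \<in> mhom k Env Env"
  by (rule mhomI) (simp_all add: Ev.Env.A.l_distr Ev.Env.smult_mult_l)

lemma DD_xi:
  assumes r: "r \<in> carrier Env" and i: "i \<in> Ix"
  shows "DD j (r \<otimes>\<^bsub>Env\<^esub> xi i) = (if i = j then r else \<zero>\<^bsub>Env\<^esub>) \<ominus>\<^bsub>Env\<^esub> DD j r \<otimes>\<^bsub>Env\<^esub> xi i"
proof (rule Env_hom_ext[OF _ _ _ r])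
  note li = letter_closed[OF i]
  show "(\<lambda>r. DD j (r \<otimes>\<^bsub>Env\<^esub> xi i)) \<in> mhom k Env Env"
    by (rule mhom_comp[OF right_mult_hom[OF xi_closed[OF i]] DD_hom])
  have "(\<lambda>r. if i = j then r else \<zero>\<^bsub>Env\<^esub>) \<in> mhom k Env Env"
    by (rule mhomI) (simp_all add: Ev.Env.L.smult_r_zero)
  then show "(\<lambda>r. (if i = j then r else \<zero>\<^bsub>Env\<^esub>) \<ominus>\<^bsub>Env\<^esub> DD j r \<otimes>\<^bsub>Env\<^esub> xi i) \<in> mhom k Env Env"
    by (rule mhom_minus[OF Ev.Env.L.left_module_axioms _ mhom_comp[OF DD_hom right_mult_hom[OF xi_closed[OF i]]]])
  fix a b assume a: "a \<in> carrier \<Lambda>" and b: "b \<in> carrier \<Lambda>"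
  have "DD j (T a b \<otimes>\<^bsub>Env\<^esub> xi i) = T (RD j (a \<otimes>\<^bsub>\<Lambda>\<^esub> mon [i])) b"
    unfolding xi_def using a b li by (simp add: T_mult DD_T)
  also have "\<dots> = T (if i = j then a else \<zero>\<^bsub>\<Lambda>\<^esub>) b \<ominus>\<^bsub>Env\<^esub> T (RD j a \<otimes>\<^bsub>\<Lambda>\<^esub> mon [i]) b"
    unfolding RD_mult[OF a i] using a li RD_closed[OF a]
    by (intro mhom_minus_apply[OF \<Lambda>.L.left_module_axioms Ev.Env.L.left_module_axioms T_left_hom[OF b]]) simp_all
  also have "\<dots> = (if i = j then T a b else \<zero>\<^bsub>Env\<^esub>) \<ominus>\<^bsub>Env\<^esub> DD j (T a b) \<otimes>\<^bsub>Env\<^esub> xi i"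
    unfolding xi_def using a b li RD_closed[OF a] by (simp add: T_mult DD_T T_zero_left)
  finally show "DD j (T a b \<otimes>\<^bsub>Env\<^esub> xi i) = (if i = j then T a b else \<zero>\<^bsub>Env\<^esub>) \<ominus>\<^bsub>Env\<^esub> DD j (T a b) \<otimes>\<^bsub>Env\<^esub> xi i" .
qed

lemma DD_yi:
  assumes r: "r \<in> carrier Env" and i: "i \<in> Ix"
  shows "DD j (r \<otimes>\<^bsub>Env\<^esub> yi i) = DD j r \<otimes>\<^bsub>Env\<^esub> yi i"
proof (rule Env_hom_ext[OF _ _ _ r])
  show "(\<lambda>r. DD j (r \<otimes>\<^bsub>Env\<^esub> yi i)) \<in> mhom k Env Env"
    by (rule mhom_comp[OF right_mult_hom[OF yi_closed[OF i]] DD_hom])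
  show "(\<lambda>r. DD j r \<otimes>\<^bsub>Env\<^esub> yi i) \<in> mhom k Env Env"
    by (rule mhom_comp[OF DD_hom right_mult_hom[OF yi_closed[OF i]]])
  fix a b assume a: "a \<in> carrier \<Lambda>" and b: "b \<in> carrier \<Lambda>"
  then show "DD j (T a b \<otimes>\<^bsub>Env\<^esub> yi i) = DD j (T a b) \<otimes>\<^bsub>Env\<^esub> yi i"
    unfolding yi_def using letter_closed[OF i] RD_closed[OF a] by (simp add: T_mult DD_T)
qed

text \<open>\<open>hom_module\<close> lets \<open>k\<close> act on cochains through
  \<open>c 1\<close> in the enveloping algebra. On values this is the scalar action of
  \<open>\<Lambda>\<close>, for which \<open>co\<close> is linear.\<close>

lemma Env_smult_scalar:
  assumes c: "c \<in> carrier k" and x: "x \<in> carrier \<Lambda>"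
  shows "(c \<odot>\<^bsub>Env\<^esub> \<one>\<^bsub>Env\<^esub>) \<odot>\<^bsub>Reg\<^esub> x = c \<odot>\<^bsub>\<Lambda>\<^esub> x"
proof -
  have "c \<odot>\<^bsub>Env\<^esub> \<one>\<^bsub>Env\<^esub> = T (c \<odot>\<^bsub>\<Lambda>\<^esub> \<one>\<^bsub>\<Lambda>\<^esub>) \<one>\<^bsub>\<Lambda>\<^esub>"
    unfolding T_one using c by (simp add: T_D(4))
  then show ?thesis
    using c x by (simp add: Ev.regular_tens \<Lambda>.L.smult_closed \<Lambda>.smult_mult_l)
qed

lemma \<Lambda>_one_not_zero: "\<one>\<^bsub>\<Lambda>\<^esub> \<noteq> \<zero>\<^bsub>\<Lambda>\<^esub>"
proof
  assume "\<one>\<^bsub>\<Lambda>\<^esub> = \<zero>\<^bsub>\<Lambda>\<^esub>"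
  moreover have "co \<one>\<^bsub>\<Lambda>\<^esub> {} = \<one>" using co_emon[of "{}" "{}"] by (simp add: emon_def mon_Nil)
  ultimately show False using co_zero[of "{}"] by simp
qed

lemma Env_one_not_zero: "\<one>\<^bsub>Env\<^esub> \<noteq> \<zero>\<^bsub>Env\<^esub>"
proof
  assume eq: "\<one>\<^bsub>Env\<^esub> = \<zero>\<^bsub>Env\<^esub>"
  have "\<one>\<^bsub>Env\<^esub> \<odot>\<^bsub>Reg\<^esub> \<one>\<^bsub>\<Lambda>\<^esub> = \<one>\<^bsub>\<Lambda>\<^esub>" by (rule Ev.Reg.smult_one) simp
  moreover have "\<zero>\<^bsub>Env\<^esub> \<odot>\<^bsub>Reg\<^esub> \<one>\<^bsub>\<Lambda>\<^esub> = \<zero>\<^bsub>Reg\<^esub>" by (rule Ev.Reg.smult_l_zero) simp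
  ultimately show False using eq \<Lambda>_one_not_zero by simp
qed

text \<open>Modulo the right multiples of \<open>x\<^sub>i \<otimes> 1 - 1 \<otimes> x\<^sub>i\<close> every tensor can be moved to the right factor.\<close>

lemma Env_decompose:
  assumes "r \<in> carrier Env"
  shows "\<exists>w b. (\<forall>i\<in>Ix. w i \<in> carrier Env) \<and> b \<in> carrier \<Lambda> \<and>
    r = (\<Oplus>\<^bsub>Env\<^esub>i\<in>Ix. w i \<otimes>\<^bsub>Env\<^esub> (xi i \<ominus>\<^bsub>Env\<^esub> yi i)) \<oplus>\<^bsub>Env\<^esub> T \<one>\<^bsub>\<Lambda>\<^esub> b"
proof -
  let ?d = "\<lambda>i. xi i \<ominus>\<^bsub>Env\<^esub> yi i"
  define s where "s w = (\<Oplus>\<^bsub>Env\<^esub>i\<in>Ix. w i \<otimes>\<^bsub>Env\<^esub> ?d i)" for w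
  define H where "H = {r. \<exists>w b. (\<forall>i\<in>Ix. w i \<in> carrier Env) \<and> b \<in> carrier \<Lambda> \<and> r = s w \<oplus>\<^bsub>Env\<^esub> T \<one>\<^bsub>\<Lambda>\<^esub> b}"
  have d: "?d i \<in> carrier Env" if "i \<in> Ix" for i
    by (rule Ev.Env.L.M.minus_closed[OF xi_closed[OF that] yi_closed[OF that]])
  have sc: "s w \<in> carrier Env" if "\<forall>i\<in>Ix. w i \<in> carrier Env" for w
    unfolding s_def using that d by (intro Ev.Env.L.M.finsum_closed) auto
  have T1: "T \<one>\<^bsub>\<Lambda>\<^esub> b \<in> carrier Env" if "b \<in> carrier \<Lambda>" for b using that by (simp add: T_D(1))
  have HI: "s w \<oplus>\<^bsub>Env\<^esub> T \<one>\<^bsub>\<Lambda>\<^esub> b \<in> H" if "\<forall>i\<in>Ix. w i \<in> carrier Env" "b \<in> carrier \<Lambda>" for w b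
    unfolding H_def by (rule CollectI, rule exI[of _ w], rule exI[of _ b]) (intro conjI refl that)
  have Hc: "H \<subseteq> carrier Env"
  proof
    fix x assume "x \<in> H"
    then show "x \<in> carrier Env"
      unfolding H_def by (elim CollectE exE conjE) (simp only: Ev.Env.L.M.a_closed[OF sc T1])
  qed
  have Hadd: "x \<oplus>\<^bsub>Env\<^esub> y \<in> H" if "x \<in> H" "y \<in> H" for x y
  proof -
    from that obtain w b w' b' where w: "\<forall>i\<in>Ix. w i \<in> carrier Env" "b \<in> carrier \<Lambda>" "x = s w \<oplus>\<^bsub>Env\<^esub> T \<one>\<^bsub>\<Lambda>\<^esub> b"
      and w': "\<forall>i\<in>Ix. w' i \<in> carrier Env" "b' \<in> carrier \<Lambda>" "y = s w' \<oplus>\<^bsub>Env\<^esub> T \<one>\<^bsub>\<Lambda>\<^esub> b'"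
      unfolding H_def by (elim CollectE exE conjE) (rule that)
    have "s (\<lambda>i. w i \<oplus>\<^bsub>Env\<^esub> w' i) = (\<Oplus>\<^bsub>Env\<^esub>i\<in>Ix. w i \<otimes>\<^bsub>Env\<^esub> ?d i \<oplus>\<^bsub>Env\<^esub> w' i \<otimes>\<^bsub>Env\<^esub> ?d i)"
      unfolding s_def using w(1) w'(1) d by (intro Ev.Env.L.M.finsum_cong') (auto simp: Ev.Env.A.l_distr)
    also have "\<dots> = s w \<oplus>\<^bsub>Env\<^esub> s w'"
      unfolding s_def using w(1) w'(1) d by (intro Ev.Env.L.M.finsum_addf) auto
    finally have s: "s (\<lambda>i. w i \<oplus>\<^bsub>Env\<^esub> w' i) = s w \<oplus>\<^bsub>Env\<^esub> s w'" .
    have "x \<oplus>\<^bsub>Env\<^esub> y = s (\<lambda>i. w i \<oplus>\<^bsub>Env\<^esub> w' i) \<oplus>\<^bsub>Env\<^esub> T \<one>\<^bsub>\<Lambda>\<^esub> (b \<oplus>\<^bsub>\<Lambda>\<^esub> b')"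
      unfolding s w(3) w'(3) using sc[OF w(1)] sc[OF w'(1)] T1[OF w(2)] T1[OF w'(2)] w(2) w'(2)
      by (simp add: T_D(3) Ev.Env.L.M.a_ac)
    then show ?thesis
      by (simp only:) (rule HI, use w(1,2) w'(1,2) in simp_all)
  qed
  have HT1: "T \<one>\<^bsub>\<Lambda>\<^esub> b \<in> H" if "b \<in> carrier \<Lambda>" for b
  proof -
    have "s (\<lambda>_. \<zero>\<^bsub>Env\<^esub>) = (\<Oplus>\<^bsub>Env\<^esub>i\<in>Ix. \<zero>\<^bsub>Env\<^esub>)"
      unfolding s_def using d by (intro Ev.Env.L.M.finsum_cong') auto
    then have "T \<one>\<^bsub>\<Lambda>\<^esub> b = s (\<lambda>_. \<zero>\<^bsub>Env\<^esub>) \<oplus>\<^bsub>Env\<^esub> T \<one>\<^bsub>\<Lambda>\<^esub> b" using T1[OF that] by simp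
    then show ?thesis using HI[of "\<lambda>_. \<zero>\<^bsub>Env\<^esub>" b] that by simp
  qed
  have Hd: "r \<otimes>\<^bsub>Env\<^esub> ?d i \<in> H" if r: "r \<in> carrier Env" and i: "i \<in> Ix" for r i
  proof -
    define w where "w l = (if l = i then r else \<zero>\<^bsub>Env\<^esub>)" for l
    have wc: "\<forall>l\<in>Ix. w l \<in> carrier Env" using r by (simp add: w_def)
    have "s w = w i \<otimes>\<^bsub>Env\<^esub> ?d i"
      unfolding s_def using i wc d by (intro Ev.Env.L.M.finsum_single) (auto simp: w_def)
    then have "r \<otimes>\<^bsub>Env\<^esub> ?d i = s w \<oplus>\<^bsub>Env\<^esub> T \<one>\<^bsub>\<Lambda>\<^esub> \<zero>\<^bsub>\<Lambda>\<^esub>"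
      using r d[OF i] by (simp add: T_zero_right w_def)
    then show ?thesis using HI[OF wc, of "\<zero>\<^bsub>\<Lambda>\<^esub>"] by simp
  qed
  have Hw: "T (mon w) b \<in> H" if "w \<in> W" "b \<in> carrier \<Lambda>" for w b
    using that
  \<comment> \<open>The last letter is the one that can be moved: \<open>w x_i \<otimes> b\<close>
    is \<open>w \<otimes> b\<close> times \<open>x_i \<otimes> 1\<close>. Modulo the differences
    this factor becomes \<open>1 \<otimes> x_i\<close>, which puts \<open>x_i\<close> in front of
    \<open>b\<close>. So \<open>b\<close> has to vary.\<close>
  proof (induction w arbitrary: b rule: rev_induct)
    case Nil
    then show ?case using HT1 by (simp add: mon_Nil)
  next
    case (snoc i w)
    have i: "i \<in> Ix" and w: "w \<in> W" using snoc.prems(1) by auto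
    note c = letter_closed[OF i] mon_closed[OF w] snoc.prems(2)
    have Tc: "T (mon w) b \<in> carrier Env" by (rule T_D(1)[OF c(2,3)])
    have "T (mon (w @ [i])) b = T (mon w) b \<otimes>\<^bsub>Env\<^esub> xi i"
      unfolding xi_def using c i w mon_append[of w "[i]"] by (simp add: T_mult)
    also have "\<dots> = T (mon w) b \<otimes>\<^bsub>Env\<^esub> ?d i \<oplus>\<^bsub>Env\<^esub> T (mon w) b \<otimes>\<^bsub>Env\<^esub> yi i"
      using Tc xi_closed[OF i] yi_closed[OF i]
      by (simp add: a_minus_def Ev.Env.A.r_distr Ev.Env.A.r_minus Ev.Env.L.M.a_assoc Ev.Env.L.M.l_neg)
    also have "T (mon w) b \<otimes>\<^bsub>Env\<^esub> yi i = T (mon w) (mon [i] \<otimes>\<^bsub>\<Lambda>\<^esub> b)"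
      unfolding yi_def using c by (simp add: T_mult)
    finally show ?case
      using Hadd[OF Hd[OF Tc i] snoc.IH[OF w, of "mon [i] \<otimes>\<^bsub>\<Lambda>\<^esub> b"]] c by simp
  qed
  have HT: "\<forall>b\<in>carrier \<Lambda>. T a b \<in> H" if "a \<in> carrier \<Lambda>" for a
    using that
  proof (rule \<Lambda>_induct[where P = "\<lambda>a. \<forall>b\<in>carrier \<Lambda>. T a b \<in> H"])
    show "\<forall>b\<in>carrier \<Lambda>. T \<zero>\<^bsub>\<Lambda>\<^esub> b \<in> H"
      using HT1[of "\<zero>\<^bsub>\<Lambda>\<^esub>"] by (simp add: T_zero_left T_zero_right)
  next
    fix x y assume "x \<in> carrier \<Lambda>" "y \<in> carrier \<Lambda>" "\<forall>b\<in>carrier \<Lambda>. T x b \<in> H" "\<forall>b\<in>carrier \<Lambda>. T y b \<in> H"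
    then show "\<forall>b\<in>carrier \<Lambda>. T (x \<oplus>\<^bsub>\<Lambda>\<^esub> y) b \<in> H" using Hadd by (simp add: T_D(2))
  next
    fix c w assume c: "c \<in> carrier k" "w \<in> W"
    have "T (c \<odot>\<^bsub>\<Lambda>\<^esub> mon w) b \<in> H" if b: "b \<in> carrier \<Lambda>" for b
    proof -
      have "T (c \<odot>\<^bsub>\<Lambda>\<^esub> mon w) b = T (mon w) (c \<odot>\<^bsub>\<Lambda>\<^esub> b)"
        using c b mon_closed[OF c(2)] by (simp add: T_D(4,5))
      then show ?thesis using Hw[OF c(2) \<Lambda>.L.smult_closed[OF c(1) b]] by simp
    qed
    then show "\<forall>b\<in>carrier \<Lambda>. T (c \<odot>\<^bsub>\<Lambda>\<^esub> mon w) b \<in> H" by blast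
  qed
  have "r \<in> carrier (tensor_algebra k \<Lambda> (opposite \<Lambda>))" using assms unfolding Env_eq .
  then obtain f where f: "f \<in> carrier Ev.E.F" "r = Ev.E.cls f" unfolding Ev.E.T_carrier by blast
  note fD = fsuppD[OF f(1)[unfolded monoid_algebra_carrier Ev.E.DirProd_carrier opposite_simps]]
  have "r = (\<Oplus>\<^bsub>Env\<^esub>p\<in>{p. f p \<noteq> \<zero>}. f p \<odot>\<^bsub>Env\<^esub> T (fst p) (snd p))"
    using Ev.E.cls_lin[OF f(1)] unfolding f(2) lin_def Env_eq .
  also have "\<dots> \<in> H"
  proof (rule Ev.Env.L.M.finsum_mem[OF _ Hadd Hc])
    show "\<zero>\<^bsub>Env\<^esub> \<in> H" using HT1[of "\<zero>\<^bsub>\<Lambda>\<^esub>"] by (simp add: T_zero_right)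
    fix p assume "p \<in> {p. f p \<noteq> \<zero>}"
    then have p: "fst p \<in> carrier \<Lambda>" "snd p \<in> carrier \<Lambda>" using fD(3)[of p] by auto
    have "f p \<odot>\<^bsub>Env\<^esub> T (fst p) (snd p) = T (f p \<odot>\<^bsub>\<Lambda>\<^esub> fst p) (snd p)"
      using fD(1) p by (simp add: T_D(4))
    then show "f p \<odot>\<^bsub>Env\<^esub> T (fst p) (snd p) \<in> H"
      using HT[OF \<Lambda>.L.smult_closed[OF fD(1) p(1)]] p(2) by simp
  qed
  finally show ?thesis unfolding H_def s_def by (rule CollectD)
qed

lemma Reg_xi: "\<lbrakk>i \<in> Ix; x \<in> carrier \<Lambda>\<rbrakk> \<Longrightarrow> xi i \<odot>\<^bsub>Reg\<^esub> x = mon [i] \<otimes>\<^bsub>\<Lambda>\<^esub> x"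
  unfolding xi_def by (simp add: Ev.regular_tens letter_closed)

lemma Reg_yi: "\<lbrakk>i \<in> Ix; x \<in> carrier \<Lambda>\<rbrakk> \<Longrightarrow> yi i \<odot>\<^bsub>Reg\<^esub> x = x \<otimes>\<^bsub>\<Lambda>\<^esub> mon [i]"
  unfolding yi_def by (simp add: Ev.regular_tens letter_closed)

text \<open>The index type is the one which \<open>HH\<close> prescribes, so that the Koszul complex
  is an admissible choice in \<open>Ext\<close>.\<close>

sublocale KZ: koszul_data Env Reg Ix xi yi DD "\<one>\<^bsub>\<Lambda>\<^esub>" "TYPE('k lam \<times> 'k env)"
proof (intro koszul_data.intro koszul_data_axioms.intro)
  show "left_module Env Reg" by (rule Ev.Reg.left_module_axioms)
  show "\<one>\<^bsub>Env\<^esub> \<noteq> \<zero>\<^bsub>Env\<^esub>" by (rule Env_one_not_zero)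
  show "finite Ix" by simp
  show "i \<in> Ix \<Longrightarrow> xi i \<in> carrier Env" for i by (rule xi_closed)
  show "i \<in> Ix \<Longrightarrow> yi i \<in> carrier Env" for i by (rule yi_closed)
  show "i \<in> Ix \<Longrightarrow> xi i \<otimes>\<^bsub>Env\<^esub> xi i = \<zero>\<^bsub>Env\<^esub>" for i
    unfolding xi_def by (simp add: T_mult letter_closed mon_same T_zero_left)
  show "i \<in> Ix \<Longrightarrow> yi i \<otimes>\<^bsub>Env\<^esub> yi i = \<zero>\<^bsub>Env\<^esub>" for i
    unfolding yi_def by (simp add: T_mult letter_closed mon_same T_zero_right)
  show "xi i \<otimes>\<^bsub>Env\<^esub> xi j \<oplus>\<^bsub>Env\<^esub> xi j \<otimes>\<^bsub>Env\<^esub> xi i = \<zero>\<^bsub>Env\<^esub>" if "i \<in> Ix" "j \<in> Ix" "i \<noteq> j" for i j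
    unfolding xi_def using that mon_anticomm[OF that]
    by (simp add: T_mult letter_closed T_D(2)[symmetric] T_zero_left)
  show "yi i \<otimes>\<^bsub>Env\<^esub> yi j \<oplus>\<^bsub>Env\<^esub> yi j \<otimes>\<^bsub>Env\<^esub> yi i = \<zero>\<^bsub>Env\<^esub>" if "i \<in> Ix" "j \<in> Ix" "i \<noteq> j" for i j
    unfolding yi_def using that mon_anticomm[OF that(2,1)]
    by (simp add: T_mult letter_closed T_D(3)[symmetric] T_zero_right)
  show "yi j \<otimes>\<^bsub>Env\<^esub> xi i = xi i \<otimes>\<^bsub>Env\<^esub> yi j" if "i \<in> Ix" "j \<in> Ix" for i j
    unfolding xi_def yi_def using that by (simp add: T_mult letter_closed)
  show "r \<in> carrier Env \<Longrightarrow> DD j r \<in> carrier Env" for r j by (rule mhomD(1)[OF DD_hom])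
  show "\<lbrakk>r \<in> carrier Env; s \<in> carrier Env\<rbrakk> \<Longrightarrow> DD j (r \<oplus>\<^bsub>Env\<^esub> s) = DD j r \<oplus>\<^bsub>Env\<^esub> DD j s" for r s j
    by (rule mhomD(2)[OF DD_hom])
  show "\<lbrakk>r \<in> carrier Env; i \<in> Ix\<rbrakk> \<Longrightarrow>
      DD j (r \<otimes>\<^bsub>Env\<^esub> xi i) = (if i = j then r else \<zero>\<^bsub>Env\<^esub>) \<ominus>\<^bsub>Env\<^esub> DD j r \<otimes>\<^bsub>Env\<^esub> xi i" for r i j
    by (rule DD_xi)
  show "\<lbrakk>r \<in> carrier Env; i \<in> Ix\<rbrakk> \<Longrightarrow> DD j (r \<otimes>\<^bsub>Env\<^esub> yi i) = DD j r \<otimes>\<^bsub>Env\<^esub> yi i" for r i j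
    by (rule DD_yi)
  show "\<one>\<^bsub>\<Lambda>\<^esub> \<in> carrier Reg" by simp
  show "\<exists>r\<in>carrier Env. r \<odot>\<^bsub>Reg\<^esub> \<one>\<^bsub>\<Lambda>\<^esub> = x" if "x \<in> carrier Reg" for x
    using that by (intro bexI[of _ "T x \<one>\<^bsub>\<Lambda>\<^esub>"]) (simp_all add: Ev.regular_tens T_D(1))
  show e: "xi i \<odot>\<^bsub>Reg\<^esub> \<one>\<^bsub>\<Lambda>\<^esub> = yi i \<odot>\<^bsub>Reg\<^esub> \<one>\<^bsub>\<Lambda>\<^esub>" if "i \<in> Ix" for i
    using that by (simp add: Reg_xi Reg_yi letter_closed)
  show "\<exists>w. (\<forall>i\<in>Ix. w i \<in> carrier Env) \<and> r = (\<Oplus>\<^bsub>Env\<^esub>i\<in>Ix. w i \<otimes>\<^bsub>Env\<^esub> (xi i \<ominus>\<^bsub>Env\<^esub> yi i))"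
    if r: "r \<in> carrier Env" and r0: "r \<odot>\<^bsub>Reg\<^esub> \<one>\<^bsub>\<Lambda>\<^esub> = \<zero>\<^bsub>Reg\<^esub>" for r
  proof -
    let ?d = "\<lambda>i. xi i \<ominus>\<^bsub>Env\<^esub> yi i"
    obtain w b where w: "\<forall>i\<in>Ix. w i \<in> carrier Env" "b \<in> carrier \<Lambda>"
      "r = (\<Oplus>\<^bsub>Env\<^esub>i\<in>Ix. w i \<otimes>\<^bsub>Env\<^esub> ?d i) \<oplus>\<^bsub>Env\<^esub> T \<one>\<^bsub>\<Lambda>\<^esub> b"
      using Env_decompose[OF r] by blast
    have d: "?d i \<in> carrier Env" if "i \<in> Ix" for i
      by (rule Ev.Env.L.M.minus_closed[OF xi_closed[OF that] yi_closed[OF that]])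
    have one: "\<one>\<^bsub>\<Lambda>\<^esub> \<in> carrier Reg" by simp
    have sc: "(\<lambda>i. w i \<otimes>\<^bsub>Env\<^esub> ?d i) \<in> Ix \<rightarrow> carrier Env" using w(1) d by auto
    have Tb: "T \<one>\<^bsub>\<Lambda>\<^esub> b \<in> carrier Env" using w(2) by (simp add: T_D(1))
    have d0: "?d i \<odot>\<^bsub>Reg\<^esub> \<one>\<^bsub>\<Lambda>\<^esub> = \<zero>\<^bsub>Reg\<^esub>" if i: "i \<in> Ix" for i
    proof -
      have c: "yi i \<odot>\<^bsub>Reg\<^esub> \<one>\<^bsub>\<Lambda>\<^esub> \<in> carrier Reg" by (rule Ev.Reg.smult_closed[OF yi_closed[OF i] one])
      have "?d i \<odot>\<^bsub>Reg\<^esub> \<one>\<^bsub>\<Lambda>\<^esub> = xi i \<odot>\<^bsub>Reg\<^esub> \<one>\<^bsub>\<Lambda>\<^esub> \<oplus>\<^bsub>Reg\<^esub> \<ominus>\<^bsub>Reg\<^esub> (yi i \<odot>\<^bsub>Reg\<^esub> \<one>\<^bsub>\<Lambda>\<^esub>)"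
        unfolding a_minus_def
        using Ev.Reg.smult_l_distr[OF xi_closed[OF i] Ev.Env.L.M.a_inv_closed[OF yi_closed[OF i]] one]
          Ev.Reg.smult_l_uminus[OF yi_closed[OF i] one] by simp
      also have "\<dots> = \<zero>\<^bsub>Reg\<^esub>" unfolding e[OF i] by (rule Ev.Reg.M.r_neg[OF c])
      finally show ?thesis .
    qed
    have "(\<Oplus>\<^bsub>Env\<^esub>i\<in>Ix. w i \<otimes>\<^bsub>Env\<^esub> ?d i) \<odot>\<^bsub>Reg\<^esub> \<one>\<^bsub>\<Lambda>\<^esub> = (\<Oplus>\<^bsub>Reg\<^esub>i\<in>Ix. (w i \<otimes>\<^bsub>Env\<^esub> ?d i) \<odot>\<^bsub>Reg\<^esub> \<one>\<^bsub>\<Lambda>\<^esub>)"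
      by (rule Ev.Reg.smult_l_finsum[OF sc one])
    also have "\<dots> = (\<Oplus>\<^bsub>Reg\<^esub>i\<in>Ix. \<zero>\<^bsub>Reg\<^esub>)"
    proof (intro Ev.Reg.M.finsum_cong' refl)
      fix i assume i: "i \<in> Ix"
      then have "(w i \<otimes>\<^bsub>Env\<^esub> ?d i) \<odot>\<^bsub>Reg\<^esub> \<one>\<^bsub>\<Lambda>\<^esub> = w i \<odot>\<^bsub>Reg\<^esub> (?d i \<odot>\<^bsub>Reg\<^esub> \<one>\<^bsub>\<Lambda>\<^esub>)"
        using w(1) d one by (intro Ev.Reg.smult_assoc) auto
      then show "(w i \<otimes>\<^bsub>Env\<^esub> ?d i) \<odot>\<^bsub>Reg\<^esub> \<one>\<^bsub>\<Lambda>\<^esub> = \<zero>\<^bsub>Reg\<^esub>"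
        using w(1) i d0[OF i] Ev.Reg.smult_r_zero[of "w i"] by (simp del: Ev.regular_simps)
    qed (rule Pi_I, rule Ev.Reg.M.zero_closed)
    also have "\<dots> = \<zero>\<^bsub>Reg\<^esub>" by (rule Ev.Reg.M.finsum_zero)
    finally have s0: "(\<Oplus>\<^bsub>Env\<^esub>i\<in>Ix. w i \<otimes>\<^bsub>Env\<^esub> ?d i) \<odot>\<^bsub>Reg\<^esub> \<one>\<^bsub>\<Lambda>\<^esub> = \<zero>\<^bsub>Reg\<^esub>" .
    have "\<zero>\<^bsub>Reg\<^esub> = \<zero>\<^bsub>Reg\<^esub> \<oplus>\<^bsub>Reg\<^esub> T \<one>\<^bsub>\<Lambda>\<^esub> b \<odot>\<^bsub>Reg\<^esub> \<one>\<^bsub>\<Lambda>\<^esub>"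
      using r0 Ev.Reg.smult_l_distr[OF Ev.Env.L.M.finsum_closed[OF sc] Tb one] unfolding w(3) s0 by simp
    \<comment> \<open>Applied to 1, every difference gives zero and \<open>1 \<otimes> b\<close>
      gives \<open>b\<close>. Hence only the sum of multiples of the differences remains of an
      annihilating element.\<close>
    then have "b = \<zero>\<^bsub>\<Lambda>\<^esub>" using w(2) by (simp add: Ev.regular_tens)
    then have "r = (\<Oplus>\<^bsub>Env\<^esub>i\<in>Ix. w i \<otimes>\<^bsub>Env\<^esub> ?d i)"
      using w(3) Ev.Env.L.M.finsum_closed[OF sc] by (simp add: T_zero_right)
    then show ?thesis using w(1) by blast
  qed
qed

end

section \<open>The Koszul cochain complex in coordinates\<close>

context exterior_loc
begin

text \<open>The scalar \<open>1 + (-1)^(m + |I|)\<close> in which left and right multiplication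
  combine. Here \<open>I\<close> is the set after multiplication by \<open>x_i\<close>, of size one
  more than before, so even \<open>m + |I|\<close> corresponds to odd total degree of the
  cochain.\<close>

definition \<kappa> :: "nat \<Rightarrow> nat set \<Rightarrow> 'k"
  where "\<kappa> m I = (if even (m + card I) then \<one> \<oplus> \<one> else \<zero>)"

lemma \<kappa>_eq: "\<kappa> m I = \<one> \<oplus> sg (m + card I)"
  by (simp add: \<kappa>_def sg_def r_neg)

lemma \<kappa>_closed [simp]: "\<kappa> m I \<in> carrier k"
  by (simp add: \<kappa>_def)

lemma Reg_Pm:
  assumes i: "i \<in> Ix" and x: "x \<in> carrier \<Lambda>"
  shows "KZ.Pm m i \<odot>\<^bsub>Reg\<^esub> x =
    mon [i] \<otimes>\<^bsub>\<Lambda>\<^esub> x \<oplus>\<^bsub>\<Lambda>\<^esub> (if even m then x \<otimes>\<^bsub>\<Lambda>\<^esub> mon [i] else \<ominus>\<^bsub>\<Lambda>\<^esub> (x \<otimes>\<^bsub>\<Lambda>\<^esub> mon [i]))"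
proof -
  have xR: "x \<in> carrier Reg" using x by simp
  have y: "yi i \<odot>\<^bsub>Reg\<^esub> x \<in> carrier Reg" by (rule Ev.Reg.smult_closed[OF yi_closed[OF i] xR])
  have neg: "(\<ominus>\<^bsub>Env\<^esub> yi i) \<odot>\<^bsub>Reg\<^esub> x = \<ominus>\<^bsub>\<Lambda>\<^esub> (yi i \<odot>\<^bsub>Reg\<^esub> x)"
  proof (rule \<Lambda>.L.M.minus_equality[symmetric])
    have "(\<ominus>\<^bsub>Env\<^esub> yi i) \<odot>\<^bsub>Reg\<^esub> x \<oplus>\<^bsub>Reg\<^esub> yi i \<odot>\<^bsub>Reg\<^esub> x = (\<ominus>\<^bsub>Env\<^esub> yi i \<oplus>\<^bsub>Env\<^esub> yi i) \<odot>\<^bsub>Reg\<^esub> x"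
      by (rule Ev.Reg.smult_l_distr[symmetric, OF Ev.Env.L.M.a_inv_closed[OF yi_closed[OF i]] yi_closed[OF i] xR])
    also have "\<dots> = \<zero>\<^bsub>Reg\<^esub>"
      unfolding Ev.Env.L.M.l_neg[OF yi_closed[OF i]] by (rule Ev.Reg.smult_l_zero[OF xR])
    finally show "(\<ominus>\<^bsub>Env\<^esub> yi i) \<odot>\<^bsub>Reg\<^esub> x \<oplus>\<^bsub>\<Lambda>\<^esub> yi i \<odot>\<^bsub>Reg\<^esub> x = \<zero>\<^bsub>\<Lambda>\<^esub>" by simp
    show "yi i \<odot>\<^bsub>Reg\<^esub> x \<in> carrier \<Lambda>" using y by simp
    show "(\<ominus>\<^bsub>Env\<^esub> yi i) \<odot>\<^bsub>Reg\<^esub> x \<in> carrier \<Lambda>"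
      using Ev.Reg.smult_closed[OF Ev.Env.L.M.a_inv_closed[OF yi_closed[OF i]] xR] by simp
  qed
  have "KZ.Pm m i \<odot>\<^bsub>Reg\<^esub> x = xi i \<odot>\<^bsub>Reg\<^esub> x \<oplus>\<^bsub>Reg\<^esub> KZ.Z m i \<odot>\<^bsub>Reg\<^esub> x"
    unfolding KZ.Pm_def by (rule Ev.Reg.smult_l_distr[OF xi_closed[OF i] KZ.Z_closed[OF i] xR])
  then show ?thesis
    using i x neg by (simp add: KZ.Z_def Reg_xi Reg_yi)
qed

lemma co_Pm:
  assumes i: "i \<in> Ix" and x: "x \<in> carrier \<Lambda>" and I: "I \<subseteq> Ix"
  shows "co (KZ.Pm (Suc m) i \<odot>\<^bsub>Reg\<^esub> x) I = \<kappa> m I \<otimes> Lop i (co x) I"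
proof -
  have fI: "finite I" by (rule finite_subset[OF I finite_Ix])
  note c = letter_closed[OF i]
  have R: "co (x \<otimes>\<^bsub>\<Lambda>\<^esub> mon [i]) I \<in> carrier k" using x c by (simp add: co_closed)
  have "co (KZ.Pm (Suc m) i \<odot>\<^bsub>Reg\<^esub> x) I = Lop i (co x) I \<oplus> sg (Suc m) \<otimes> Rop i (co x) I"
    unfolding Reg_Pm[OF i x] using x c R
    by (simp add: co_add co_uminus co_mon_left[OF i] co_mon_right[OF i] sg_def l_minus)
  also have "\<dots> = \<kappa> m I \<otimes> Lop i (co x) I"
  proof (cases "i \<in> I")
    case True
    have cI: "card I = Suc (card (I - {i}))" using card_Suc_Diff1[OF fI True] by simp
    define y where "y = sg (cnt i I) \<otimes> co x (I - {i})"
    have y: "y \<in> carrier k" using x by (simp add: y_def co_closed)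
    have L: "Lop i (co x) I = y" using True by (simp add: Lop_def y_def)
    have "Rop i (co x) I = sg (card (I - {i})) \<otimes> y"
      unfolding Rop_def using True co_closed[OF x] by (simp add: Lop_def tau_def y_def m_lcomm)
    then have "sg (Suc m) \<otimes> Rop i (co x) I = sg (Suc m + card (I - {i})) \<otimes> y"
      unfolding sg_add using y by (simp only: m_assoc sg_closed)
    \<comment> \<open>The shift of degree in the differential and the letter missing in
      \<open>I - {i}\<close> compensate each other. The combined sign therefore depends on
      \<open>I\<close> and not on \<open>i\<close>, and can leave the sum over
      \<open>i\<close>.\<close>
    also have "Suc m + card (I - {i}) = m + card I" using cI by simp
    finally show ?thesis unfolding \<kappa>_eq L using y by (simp add: l_distr)
  next
    case False
    then show ?thesis by (simp add: Lop_def Rop_def)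
  qed
  finally show ?thesis .
qed

abbreviation "KK \<equiv> KZ.K"
abbreviation "unit \<equiv> KZ.unit"

text \<open>Extended by zero to multisets of other sizes, so that every \<open>val m z b\<close>
  lies in \<open>V\<close>, as the lemmas on \<open>om\<close> require.\<close>

definition val :: "nat \<Rightarrow> ((('k lam \<times> 'k env) list \<Rightarrow> 'k env) \<Rightarrow> 'k lam) \<Rightarrow> nat multiset \<Rightarrow> nat set \<Rightarrow> 'k"
  where "val m z b = (if b \<in> Mi m then co (z (unit b)) else (\<lambda>_. \<zero>))"

lemma hom_unit_closed: "\<lbrakk>z \<in> mhom Env (KK m) Reg; b \<in> Mi m\<rbrakk> \<Longrightarrow> z (unit b) \<in> carrier \<Lambda>"
  using mhomD(1)[OF _ KZ.unit_closed, of z Env m Reg b] by simp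

lemma val_V: "z \<in> mhom Env (KK m) Reg \<Longrightarrow> val m z b \<in> V"
  by (simp add: val_def co_V hom_unit_closed) (simp add: V_def)

lemma co_finsum_Reg: "f \<in> S \<rightarrow> carrier \<Lambda> \<Longrightarrow> co (\<Oplus>\<^bsub>Reg\<^esub>i\<in>S. f i) I = (\<Oplus>i\<in>S. co (f i) I)"
proof -
  assume f: "f \<in> S \<rightarrow> carrier \<Lambda>"
  have "co (\<Oplus>\<^bsub>Reg\<^esub>i\<in>S. f i) I = (\<Oplus>i\<in>S. co (f i) I)"
    by (rule additive_finsum[OF Ev.Reg.M.abelian_group_axioms abelian_group_axioms, of "\<lambda>x. co x I"])
      (use f in \<open>auto simp: co_closed co_add\<close>)
  then show ?thesis .
qed

lemma co_dK:
  assumes z: "z \<in> mhom Env (KK m) Reg" and a: "a \<in> Mi (Suc m)" and I: "I \<subseteq> Ix"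
  shows "co (z (KZ.dK m (unit a))) I = \<kappa> m I \<otimes> om (val m z) a I"
proof -
  have zc: "z (unit (a - {#i#})) \<in> carrier \<Lambda>" if "i \<in># a" for i
    by (rule hom_unit_closed[OF z mindex_diff[OF a that]])
  have iI: "i \<in> Ix" if "i \<in># a" for i by (rule mindex_elem[OF a that])
  have "co (z (KZ.dK m (unit a))) I = (\<Oplus>i\<in>set_mset a. co (KZ.Pm (Suc m) i \<odot>\<^bsub>Reg\<^esub> z (unit (a - {#i#}))) I)"
    unfolding KZ.hom_dK_unit[OF a Ev.Reg.left_module_axioms z]
  proof (rule co_finsum_Reg, rule Pi_I)
    fix i assume i: "i \<in># a"
    show "KZ.Pm (Suc m) i \<odot>\<^bsub>Reg\<^esub> z (unit (a - {#i#})) \<in> carrier \<Lambda>"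
      using Ev.Reg.smult_closed[OF KZ.Pm_closed[OF iI[OF i]], of "z (unit (a - {#i#}))"] zc[OF i] by simp
  qed
  also have "\<dots> = (\<Oplus>i\<in>set_mset a. \<kappa> m I \<otimes> Lop i (val m z (a - {#i#})) I)"
  proof (intro finsum_cong' refl)
    show "(\<lambda>i. \<kappa> m I \<otimes> Lop i (val m z (a - {#i#})) I) \<in> set_mset a \<rightarrow> carrier k"
      using Lop_carrier[OF val_V[OF z]] by simp
    fix i assume i: "i \<in> set_mset a"
    show "co (KZ.Pm (Suc m) i \<odot>\<^bsub>Reg\<^esub> z (unit (a - {#i#}))) I = \<kappa> m I \<otimes> Lop i (val m z (a - {#i#})) I"
      unfolding co_Pm[OF iI[OF i] zc[OF i] I] using mindex_diff[OF a i] by (simp add: val_def)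
  qed
  also have "\<dots> = \<kappa> m I \<otimes> om (val m z) a I"
    unfolding om_def using Lop_carrier[OF val_V[OF z]] by (intro finsum_rdistr[symmetric]) auto
  finally show ?thesis .
qed

lemma zero_hom: "(\<lambda>_. \<zero>\<^bsub>\<Lambda>\<^esub>) \<in> mhom Env (KK m) Reg"
  by (rule mhomI) (simp_all add: Ev.Reg.smult_r_zero[simplified])

lemma cocycle_iff:
  assumes z: "z \<in> mhom Env (KK m) Reg"
  shows "cocycle Env KK KZ.dK Reg m z \<longleftrightarrow> (\<forall>a\<in>Mi (Suc m). \<forall>I\<subseteq>Ix. \<kappa> m I \<otimes> om (val m z) a I = \<zero>)"
proof
  assume "cocycle Env KK KZ.dK Reg m z"
  then have "z (KZ.dK m (unit a)) = \<zero>\<^bsub>\<Lambda>\<^esub>" if "a \<in> Mi (Suc m)" for a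
    using KZ.unit_closed[OF that] by (simp add: cocycle_def)
  then show "\<forall>a\<in>Mi (Suc m). \<forall>I\<subseteq>Ix. \<kappa> m I \<otimes> om (val m z) a I = \<zero>"
    using co_dK[OF z] co_zero by metis
next
  assume *: "\<forall>a\<in>Mi (Suc m). \<forall>I\<subseteq>Ix. \<kappa> m I \<otimes> om (val m z) a I = \<zero>"
  have h: "(\<lambda>x. z (KZ.dK m x)) \<in> mhom Env (KK (Suc m)) Reg" by (rule mhom_comp[OF KZ.dK_hom z])
  have "z (KZ.dK m x) = \<zero>\<^bsub>\<Lambda>\<^esub>" if x: "x \<in> carrier (KK (Suc m))" for x
  proof (rule KZ.K_hom_ext[OF Ev.Reg.left_module_axioms h zero_hom _ x])
    fix a assume a: "a \<in> Mi (Suc m)"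
    show "z (KZ.dK m (unit a)) = \<zero>\<^bsub>\<Lambda>\<^esub>"
    proof (rule co_inject)
      show "z (KZ.dK m (unit a)) \<in> carrier \<Lambda>" using hom_unit_closed[OF h a] .
      show "co (z (KZ.dK m (unit a))) I = co \<zero>\<^bsub>\<Lambda>\<^esub> I" if "I \<subseteq> Ix" for I
        using co_dK[OF z a that] * a that by (simp add: co_zero)
    qed simp
  qed
  then show "cocycle Env KK KZ.dK Reg m z" using z by (simp add: cocycle_def)
qed

lemma zero_coboundary:
  assumes z: "z \<in> mhom Env (KK m) Reg" and v0: "\<And>b I. \<lbrakk>b \<in> Mi m; I \<subseteq> Ix\<rbrakk> \<Longrightarrow> co (z (unit b)) I = \<zero>"
  shows "coboundary Env KK KZ.dK Reg m z"
proof -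
  have z0: "z x = \<zero>\<^bsub>\<Lambda>\<^esub>" if x: "x \<in> carrier (KK m)" for x
  proof (rule KZ.K_hom_ext[OF Ev.Reg.left_module_axioms z zero_hom _ x])
    fix b assume b: "b \<in> Mi m"
    show "z (unit b) = \<zero>\<^bsub>\<Lambda>\<^esub>"
      by (rule co_inject) (simp_all add: v0[OF b] co_zero hom_unit_closed[OF z b])
  qed
  show ?thesis
  proof (cases m)
    case 0
    then show ?thesis using z0 by (simp add: coboundary_def)
  next
    case (Suc j)
    then show ?thesis using z0 zero_hom[of j] by (auto simp: coboundary_def intro!: bexI[of _ "\<lambda>_. \<zero>\<^bsub>\<Lambda>\<^esub>"])
  qed
qed

text \<open>The coboundary vanishes on cochains of even total degree and is twice the multiplication
  by \<open>\<Sum>\<^sub>i x\<^sub>i y\<^sub>i\<close> on those of odd total degree. The latter complex is exact except for the top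
  exterior power in degree \<open>0\<close>.\<close>

definition surviving :: "nat \<Rightarrow> nat set \<Rightarrow> bool"
  where "surviving m I \<longleftrightarrow> \<one> \<oplus> \<one> = \<zero> \<or> even (m + card I) \<or> (m = 0 \<and> I = Ix)"

text \<open>A cochain supported at the single set \<open>J0\<close> has image supported at the sets
  \<open>J0\<close> with one new letter. In particular \<open>J0 = Ix\<close> leaves no room, which
  is why the top monomial gives a cocycle in any parity.\<close>

lemma om_delta:
  assumes "om v a I \<noteq> \<zero>" "\<And>b J. v b J \<noteq> \<zero> \<Longrightarrow> J = J0" "I \<subseteq> Ix"
  shows "J0 \<subseteq> Ix \<and> J0 \<noteq> Ix \<and> card I = Suc (card J0)"
proof -
  have "\<exists>i\<in>set_mset a. Lop i (v (a - {#i#})) I \<noteq> \<zero>"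
  proof (rule ccontr)
    assume "\<not> (\<exists>i\<in>set_mset a. Lop i (v (a - {#i#})) I \<noteq> \<zero>)"
    then have "om v a I = (\<Oplus>i\<in>set_mset a. \<zero>)" unfolding om_def by (intro finsum_cong') auto
    then show False using assms(1) by simp
  qed
  then obtain i where L: "Lop i (v (a - {#i#})) I \<noteq> \<zero>" by blast
  then have "i \<in> I" by (auto simp: Lop_def split: if_splits)
  moreover have "v (a - {#i#}) (I - {i}) \<noteq> \<zero>"
  proof
    assume "v (a - {#i#}) (I - {i}) = \<zero>"
    then show False using L by (simp add: Lop_def split: if_splits)
  qed
  ultimately have "i \<in> I" "J0 = I - {i}" using assms(2) by auto
  then show ?thesis using assms(3) card_Suc_Diff1[OF finite_subset[OF assms(3) finite_Ix]] by auto
qed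

text \<open>If \<open>2 = 0\<close>, every coordinate survives and \<open>z\<close> vanishes.
  Otherwise the vanishing coordinates include all those of even total degree, so \<open>z\<close> is
  concentrated where \<open>\<kappa>\<close> is the invertible scalar 2. There the cocycle condition
  becomes \<open>om v = 0\<close>, and \<open>om_exact\<close> provides a preimage up to that
  scalar.\<close>

lemma cohomology_kernel:
  assumes z: "cocycle Env KK KZ.dK Reg m z"
    and v0: "\<And>b I. \<lbrakk>b \<in> Mi m; I \<subseteq> Ix; surviving m I\<rbrakk> \<Longrightarrow> co (z (unit b)) I = \<zero>"
  shows "coboundary Env KK KZ.dK Reg m z"
proof (cases "\<one> \<oplus> \<one> = \<zero>")
  case True
  then show ?thesis using z v0 by (intro zero_coboundary) (auto simp: cocycle_def surviving_def)
next
  case two: False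
  have zh: "z \<in> mhom Env (KK m) Reg" using z by (simp add: cocycle_def)
  define v where "v = val m z"
  have vV: "v b \<in> V" for b unfolding v_def by (rule val_V[OF zh])
  have vco: "v b I = co (z (unit b)) I" if "b \<in> Mi m" for b I using that by (simp add: v_def val_def)
  have ve: "v b I = \<zero>" if "even (m + card I)" for b I
  proof (cases "b \<in> Mi m \<and> I \<subseteq> Ix")
    case True
    then show ?thesis using v0[of b I] vco[of b I] that by (simp add: surviving_def)
  next
    case False
    show ?thesis
    proof (cases "b \<in> Mi m")
      case True
      then have "\<not> I \<subseteq> Ix" using False by simp
      then show ?thesis by (rule V_D(2)[OF vV])
    qed (simp add: v_def val_def)
  qed
  have cyc: "om v a I = \<zero>" if a: "a \<in> Mi (Suc m)" and I: "I \<subseteq> Ix" for a I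
  proof (cases "even (m + card I)")
    case True
    have "\<kappa> m I \<otimes> om v a I = \<zero>" using z a I unfolding cocycle_iff[OF zh] v_def by blast
    then show ?thesis using True two om_closed[where v = v, OF vV] by (simp add: \<kappa>_def integral_iff)
  next
    case False
    \<comment> \<open>At these \<open>I\<close> the factor \<open>\<kappa> m I\<close> is zero and
      the cocycle condition is void, but \<open>om\<close> reads \<open>v\<close> only at
      \<open>I - {i}\<close>, of even total degree, where \<open>v\<close> vanishes.\<close>
    have "Lop i (v (a - {#i#})) I = \<zero>" for i
    proof (cases "i \<in> I")
      case True
      then have "card I = Suc (card (I - {i}))"
        using card_Suc_Diff1[OF finite_subset[OF I finite_Ix]] by simp
      then have "even (m + card (I - {i}))" using False by simp
      then show ?thesis using True ve by (simp add: Lop_def)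
    qed (simp add: Lop_def)
    then show ?thesis by (simp add: om_def)
  qed
  show ?thesis
  proof (cases m)
    case 0
    have "v {#} J = \<zero>" if J: "J \<subseteq> Ix" for J
    proof (cases "even (card J) \<or> J = Ix")
      case True
      then show ?thesis using v0[of "{#}" J] vco[of "{#}" J] 0 J by (auto simp: surviving_def)
    next
      case False
      \<comment> \<open>There are no coboundaries to subtract in degree 0. Multiplication by
        \<open>x_i\<close> with \<open>i\<close> outside \<open>J\<close> recovers the coefficient
        at \<open>J\<close> up to sign; it is possible for every \<open>J\<close> except the top
        one.\<close>
      then obtain i where i: "i \<in> Ix" "i \<notin> J" using J by blast
      have "om v {#i#} (insert i J) = \<zero>" using cyc[of "{#i#}" "insert i J"] i J 0 by (simp add: mindex_def)
      then have "sg (cnt i J) \<otimes> v {#} J = \<zero>"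
        using i V_D(1)[OF vV] by (simp add: om_def Lop_def)
      then have "sg (cnt i J) \<otimes> (sg (cnt i J) \<otimes> v {#} J) = \<zero>" by simp
      then show ?thesis using V_D(1)[OF vV] by (simp add: sg_sq_left)
    qed
    then show ?thesis using 0 vco by (intro zero_coboundary[OF zh]) simp
  next
    case (Suc j)
    have "\<exists>\<mu>. (\<forall>c. \<mu> c \<in> V) \<and> (\<forall>b\<in>Mi (Suc j). \<forall>I\<subseteq>Ix. om \<mu> b I = v b I)"
      by (rule om_exact[where v = v, OF vV]) (use cyc Suc in simp)
    then obtain \<mu> where \<mu>: "(\<forall>c. \<mu> c \<in> V) \<and> (\<forall>b\<in>Mi (Suc j). \<forall>I\<subseteq>Ix. om \<mu> b I = v b I)"
      by (elim exE) (rule that)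
    have \<mu>V: "\<mu> c \<in> V" for c using conjunct1[OF \<mu>] by (rule spec)
    have \<mu>om: "om \<mu> b I = v b I" if "b \<in> Mi (Suc j)" "I \<subseteq> Ix" for b I
      by (rule mp[OF spec[OF bspec[OF conjunct2[OF \<mu>] that(1)]] that(2)])
    \<comment> \<open>The preimage under \<open>om\<close> is halved, since the coboundary is
      \<open>\<kappa> = 2\<close> times \<open>om\<close>.\<close>
    define h where "h = inv (\<one> \<oplus> \<one>)"
    have h: "h \<in> carrier k" "(\<one> \<oplus> \<one>) \<otimes> h = \<one>"
      using two field_Units by (auto simp: h_def)
    define \<nu> where "\<nu> c I = h \<otimes> \<mu> c I" for c I
    have \<nu>V: "\<nu> c \<in> V" for c using \<mu>V[of c] h(1) by (simp add: V_def \<nu>_def)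
    have "\<exists>u\<in>mhom Env (KK j) Reg. \<forall>c\<in>Mi j. u (unit c) = unco (\<nu> c)"
      by (rule KZ.K_hom_exists[OF Ev.Reg.left_module_axioms]) (simp add: unco_closed[OF \<nu>V])
    then obtain u where u: "u \<in> mhom Env (KK j) Reg" and uc: "\<forall>c\<in>Mi j. u (unit c) = unco (\<nu> c)"
      by (elim bexE) (rule that)
    have omu: "om (val j u) b I = h \<otimes> v b I" if b: "b \<in> Mi (Suc j)" and I: "I \<subseteq> Ix" for b I
    proof -
      have "om (val j u) b I = om \<nu> b I"
        unfolding om_def using Lop_carrier[OF \<nu>V] mindex_diff[OF b]
        by (intro finsum_cong') (simp_all add: val_def uc co_unco \<nu>V)
      also have "\<dots> = h \<otimes> v b I"
        unfolding \<nu>_def[abs_def] om_smult[where v = \<mu>, OF \<mu>V h(1)] \<mu>om[OF b I] ..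
      finally show ?thesis .
    qed
    have du: "(\<lambda>x. u (KZ.dK j x)) \<in> mhom Env (KK m) Reg"
      unfolding Suc by (rule mhom_comp[OF KZ.dK_hom u])
    have "z x = u (KZ.dK j x)" if x: "x \<in> carrier (KK m)" for x
    proof (rule KZ.K_hom_ext[OF Ev.Reg.left_module_axioms zh du _ x])
      fix b assume b: "b \<in> Mi m"
      then have bS: "b \<in> Mi (Suc j)" using Suc by simp
      show "z (unit b) = u (KZ.dK j (unit b))"
      proof (rule co_inject[OF hom_unit_closed[OF zh b] hom_unit_closed[OF du b]])
        fix I assume I: "I \<subseteq> Ix"
        have c: "v b I \<in> carrier k" by (rule V_D(1)[OF vV])
        have "co (u (KZ.dK j (unit b))) I = \<kappa> j I \<otimes> (h \<otimes> v b I)"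
          unfolding co_dK[OF u bS I] omu[OF bS I] ..
        also have "\<dots> = v b I"
        proof (cases "even (j + card I)")
          case True
          then have "\<kappa> j I \<otimes> (h \<otimes> v b I) = ((\<one> \<oplus> \<one>) \<otimes> h) \<otimes> v b I"
            using h(1) c by (simp add: \<kappa>_def m_assoc)
          then show ?thesis using h(2) c by simp
        next
          case False
          then have "v b I = \<zero>" using Suc by (intro ve) simp
          then show ?thesis using False h(1) by (simp add: \<kappa>_def)
        qed
        finally show "co (z (unit b)) I = co (u (KZ.dK j (unit b))) I" by (simp add: vco[OF b])
      qed
    qed
    then show ?thesis using Suc u by (auto simp: coboundary_def)
  qed
qed

text \<open>The functionals for \<open>cohomology_dim\<close> are the coordinates at the pairs of a
  multiset of size \<open>m\<close> and a surviving subset. A cochain with value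
  \<open>emon J0\<close> at one unit and zero at the others provides the dual family.\<close>

lemma HH_dim:
  "vectorspace k (HH k \<Lambda> m) \<and> vectorspace.fin_dim k (HH k \<Lambda> m) \<and>
    vectorspace.dim k (HH k \<Lambda> m) = card (Mi m) * card {I. I \<subseteq> Ix \<and> surviving m I}"
proof -
  define t where "t = (SOME (P :: nat \<Rightarrow> ('k env, ('k lam \<times> 'k env) list \<Rightarrow> 'k env) module, d, \<epsilon>). free_resolution Env Reg P d \<epsilon>)"
  \<comment> \<open>The Koszul resolution justifies the choice in \<open>Ext\<close>; of the chosen
    resolution only its defining property is kept.\<close>
  have "case t of (P, d, \<epsilon>) \<Rightarrow> free_resolution Env Reg P d \<epsilon>"
    unfolding t_def by (rule someI[of _ "(KK, KZ.dK, KZ.aug)"]) (simp add: KZ.koszul_resolution)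
  then obtain P d \<epsilon> where t: "t = (P, d, \<epsilon>)" and P: "free_resolution Env Reg P d \<epsilon>"
    by (cases t) auto
  have HH: "HH k \<Lambda> m = hom_cohomology Env P d Reg m"
    unfolding HH_def Ext_def t_def[symmetric] t by simp
  let ?T = "Mi m \<times> {I. I \<subseteq> Ix \<and> surviving m I}"
  define \<Theta> :: "((('k lam \<times> 'k env) list \<Rightarrow> 'k env) \<Rightarrow> 'k lam) \<Rightarrow> nat multiset \<times> nat set \<Rightarrow> 'k"
    where "\<Theta> z s = co (z (unit (fst s))) (snd s)" for z s
  have T: "finite ?T" using finite_mindex[OF finite_Ix] by simp
  have "vectorspace k (hom_cohomology Env P d Reg m) \<and> vectorspace.fin_dim k (hom_cohomology Env P d Reg m) \<and>
    vectorspace.dim k (hom_cohomology Env P d Reg m) = card ?T"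
  proof (rule cohomology_dim[OF field_axioms Ev.Env.kalgebra_axioms Ev.Reg.left_module_axioms
        Ev.Reg.left_module_axioms P KZ.koszul_resolution T, where \<Theta> = \<Theta>])
    fix z s assume s: "s \<in> ?T"
    then have b: "fst s \<in> Mi m" and I: "snd s \<subseteq> Ix" and surv: "surviving m (snd s)" by auto
    { assume z: "z \<in> mhom Env (KK m) Reg"
      note zc = hom_unit_closed[OF z b]
      show "\<Theta> z s \<in> carrier k" unfolding \<Theta>_def by (rule co_closed[OF zc])
      show "\<Theta> (\<lambda>x. (c \<odot>\<^bsub>Env\<^esub> \<one>\<^bsub>Env\<^esub>) \<odot>\<^bsub>Reg\<^esub> z x) s = c \<otimes> \<Theta> z s" if "c \<in> carrier k" for c
        unfolding \<Theta>_def Env_smult_scalar[OF that zc] by (rule co_smult[OF that zc])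
      show "\<Theta> (\<lambda>x. z x \<oplus>\<^bsub>Reg\<^esub> y x) s = \<Theta> z s \<oplus> \<Theta> y s" if "y \<in> mhom Env (KK m) Reg" for y
        unfolding \<Theta>_def using co_add[OF zc hom_unit_closed[OF that b]] by simp }
    show "\<Theta> z s = \<Theta> y s" if "\<And>x. x \<in> carrier (KK m) \<Longrightarrow> z x = y x" for y
      unfolding \<Theta>_def that[OF KZ.unit_closed[OF b]] ..
    assume z: "coboundary Env KK KZ.dK Reg m z"
    show "\<Theta> z s = \<zero>"
    proof (cases m)
      case 0
      then show ?thesis using z KZ.unit_closed[OF b] by (simp add: coboundary_def \<Theta>_def co_zero)
    next
      case (Suc j)
      then obtain u where u: "u \<in> mhom Env (KK j) Reg" "\<And>x. x \<in> carrier (KK m) \<Longrightarrow> z x = u (KZ.dK j x)"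
        using z by (auto simp: coboundary_def)
      have bS: "fst s \<in> Mi (Suc j)" using b Suc by simp
      have vV: "val j u c \<in> V" for c by (rule val_V[OF u(1)])
      \<comment> \<open>The coboundary comes from degree \<open>j = m - 1\<close>. A surviving set
        in positive degree has \<open>m + |I|\<close> even, hence \<open>j + |I|\<close> odd, unless
        \<open>2 = 0\<close>; in both cases the scalar vanishes.\<close>
      have "\<kappa> j (snd s) = \<zero>" using surv Suc by (auto simp: \<kappa>_def surviving_def)
      then show ?thesis
        unfolding \<Theta>_def u(2)[OF KZ.unit_closed[OF b]] co_dK[OF u(1) bS I]
        using om_closed[where v = "val j u", OF vV] by simp
    qed
  next
    fix z assume "cocycle Env KK KZ.dK Reg m z" and "\<And>s. s \<in> ?T \<Longrightarrow> \<Theta> z s = \<zero>"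
    then show "coboundary Env KK KZ.dK Reg m z"
      by (intro cohomology_kernel) (auto simp: \<Theta>_def)
  next
    fix s assume "s \<in> ?T"
    then obtain b0 J0 where s: "s = (b0, J0)" "b0 \<in> Mi m" "J0 \<subseteq> Ix" "surviving m J0" by auto
    have "\<exists>z\<in>mhom Env (KK m) Reg. \<forall>b\<in>Mi m. z (unit b) = (if b = b0 then emon J0 else \<zero>\<^bsub>\<Lambda>\<^esub>)"
      by (rule KZ.K_hom_exists[OF Ev.Reg.left_module_axioms]) (simp add: emon_closed[OF s(3)])
    then obtain z where z1: "z \<in> mhom Env (KK m) Reg"
      and z2: "\<forall>b\<in>Mi m. z (unit b) = (if b = b0 then emon J0 else \<zero>\<^bsub>\<Lambda>\<^esub>)"
      by (elim bexE) (rule that)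
    note z = z1 bspec[OF z2]
    have vz: "val m z b J = (if b = b0 \<and> J = J0 then \<one> else \<zero>)" for b J
    proof (cases "b \<in> Mi m")
      case True
      then show ?thesis using z(2)[OF True] s(3) by (simp add: val_def co_emon co_zero)
    next
      case False
      then have "b \<noteq> b0" using s(2) by auto
      then show ?thesis using False by (simp add: val_def)
    qed
    have vV: "val m z b \<in> V" for b by (rule val_V[OF z(1)])
    have "cocycle Env KK KZ.dK Reg m z"
      unfolding cocycle_iff[OF z(1)]
    proof (intro ballI allI impI)
      fix a I assume a: "a \<in> Mi (Suc m)" and I: "I \<subseteq> Ix"
      show "\<kappa> m I \<otimes> om (val m z) a I = \<zero>"
      proof (cases "om (val m z) a I = \<zero>")
        case False
        have "J0 \<subseteq> Ix \<and> J0 \<noteq> Ix \<and> card I = Suc (card J0)"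
          by (rule om_delta[OF False _ I]) (simp add: vz split: if_splits)
        \<comment> \<open>The top set is excluded by \<open>om_delta\<close>, so
          \<open>m + |J0|\<close> is even or \<open>2 = 0\<close>. As \<open>I\<close> has one
          element more than \<open>J0\<close>, the scalar at \<open>I\<close> is zero.\<close>
        then have "\<kappa> m I = \<zero>" using s(4) by (auto simp: \<kappa>_def surviving_def)
        then show ?thesis using om_closed[where v = "val m z", OF vV] by simp
      qed simp
    qed
    moreover have "\<forall>r\<in>?T. \<Theta> z r = (if r = s then \<one> else \<zero>)"
      using z(2) s by (auto simp: \<Theta>_def co_emon co_zero)
    ultimately show "\<exists>z. cocycle Env KK KZ.dK Reg m z \<and> (\<forall>r\<in>?T. \<Theta> z r = (if r = s then \<one> else \<zero>))" by blast
  qed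
  then show ?thesis unfolding HH by (simp add: card_cartesian_product)
qed

end

theorem theorem3:
  fixes k :: "('k, 'z) ring_scheme" and n m :: nat
  assumes "field k" and "n \<ge> 2"
  shows "vectorspace k (HH k (exterior_algebra k n) m) \<and>
    vectorspace.fin_dim k (HH k (exterior_algebra k n) m) \<and>
    vectorspace.dim k (HH k (exterior_algebra k n) m) =
      (if characteristic k = 2 then 2 ^ n * ((n + m - 1) choose (n - 1))
       else if m = 0 \<and> odd n then 2 ^ (n - 1) + 1
       else 2 ^ (n - 1) * ((n + m - 1) choose (n - 1)))"
proof -
  interpret field k by fact
  interpret E: exterior_loc k n by (rule exterior_loc.intro) fact
  have cI: "card E.Ix = n" and fI: "finite E.Ix" by (simp_all add: E.Ix_def)
  have x: "1 \<in> E.Ix" using assms(2) by (simp add: E.Ix_def)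
  \<comment> \<open>The count comes as \<open>(n + m - 1) choose m\<close>; passing to the
    complementary lower index \<open>n - 1\<close> requires \<open>m \<le> n + m - 1\<close>, that
    is, \<open>n\<close> positive.\<close>
  have cM: "card (mindex E.Ix m) = (n + m - 1) choose (n - 1)"
    using card_mindex[OF fI, of m] binomial_symmetric[of m "n + m - 1"] assms(2) by (simp add: cI)
  have E: "card {I. I \<subseteq> E.Ix \<and> even (m + card I)} = 2 ^ (n - 1)"
    using card_subsets_parity[OF fI x, of m] by (simp add: cI)
  have S: "card {I. I \<subseteq> E.Ix \<and> E.surviving m I} =
    (if characteristic k = 2 then 2 ^ n else if m = 0 \<and> odd n then 2 ^ (n - 1) + 1 else 2 ^ (n - 1))"
  proof (cases "characteristic k = 2")
    case True
    then have "{I. I \<subseteq> E.Ix \<and> E.surviving m I} = Pow E.Ix"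
      by (auto simp: E.surviving_def characteristic_eq_2_iff)
    then show ?thesis using True card_Pow[OF fI] by (simp add: cI)
  next
    case False
    then have two: "\<one>\<^bsub>k\<^esub> \<oplus>\<^bsub>k\<^esub> \<one>\<^bsub>k\<^esub> \<noteq> \<zero>\<^bsub>k\<^esub>" by (simp add: characteristic_eq_2_iff)
    show ?thesis
    proof (cases "m = 0 \<and> odd n")
      case True
      \<comment> \<open>The additional 1: for odd \<open>n\<close> the top set is not among the sets
        of even size.\<close>
      then have "{I. I \<subseteq> E.Ix \<and> E.surviving m I} = insert E.Ix {I. I \<subseteq> E.Ix \<and> even (m + card I)}"
        using two by (auto simp: E.surviving_def)
      moreover have "E.Ix \<notin> {I. I \<subseteq> E.Ix \<and> even (m + card I)}" using True by (simp add: cI)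
      moreover have "finite {I. I \<subseteq> E.Ix \<and> even (m + card I)}" using fI by simp
      ultimately show ?thesis using True False E by simp
    next
      case ne: False
      then have "{I. I \<subseteq> E.Ix \<and> E.surviving m I} = {I. I \<subseteq> E.Ix \<and> even (m + card I)}"
        using two by (auto simp: E.surviving_def cI)
      then show ?thesis using ne False E by simp
    qed
  qed
  \<comment> \<open>In the exceptional case \<open>m = 0\<close> the binomial factor is 1, so the
    product is just the number of surviving sets.\<close>
  show ?thesis using E.HH_dim[of m] unfolding cM S by auto
qed

end
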